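(* Let $((G,* ),\phi)$ be a (finite) equipped graph, let $\alpha\in\mathbb{N}^{G_0}$, let $q$ be a prime power, and let $Q$ be any quiver with underlying graph $(G,* )$. Then the number of isomorphism classes of absolutely indecomposable representations of $((G,* ),\phi)$ of dimension vector $\alpha$ over the finite field with $q$ elements is equal to $A_{Q,\alpha}(q)$, the number of isomorphism classes of absolutely indecomposable representations of the quiver $Q$ of dimension vector $\alpha$ over the finite field with $q$ elements.
   Context: Quivers are finite, and loops and multiple arrows are allowed; a quiver $Q=(Q_0,Q_1,h,t)$ has vertex set $Q_0$, arrow set $Q_1$, and $a\in Q_1$ goes from tail $t(a)$ to head $h(a)$. $\mathbb{N}=\{0,1,2,\dots\}$. All vector spaces are finite-dimensional. A representation of a quiver is a vector space at each vertex and a linear map for each arrow. A graph is a pair $(G,* )$ consisting of a quiver $G=(G_0,G_1,h,t)$ together with a fixed-point free involution $*$ of $G_1$ which exchanges heads and tails, so $h(a)=t(a^* )$ for all $a\in G_1$. An equipped graph $((G,* ),\phi)$ is a graph $(G,* )$ together with a mapping $\phi:G_1\to\{0,1\}$. A quiver $Q$ has underlying graph $(G,* )$ if $Q_0=G_0$ and $G_1$ is identified with the disjoint union $Q_1\cup Q_1^*$, where $Q_1^*=\{a^*:a\in Q_1\}$; that is, $Q_1$ consists of exactly one arrow from each $*$-orbit in $G_1$, with its head and tail. A linear relation between vector spaces $V$ and $W$ is a subspace $R\subseteq V\oplus W$; the opposite relation is $R^{op}=\{(w,v):(v,w)\in R\}\subseteq W\oplus V$. Define $\operatorname{Ker}R=\{v\in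 V:(v,0)\in R\}$, $\operatorname{Def}R=\{v\in V:(v,w)\in R\text{ for some }w\in W\}$, $\operatorname{Ind}R=\{w\in W:(0,w)\in R\}$, $\operatorname{Im}R=\{w\in W:(v,w)\in R\text{ for some }v\in V\}$. For $r,s\in\{0,1\}$, $R$ is an equipped relation of type $(r,s)$ if: $\operatorname{Ker}R=0$ in case $r=0$, respectively $\operatorname{Def}R=V$ in case $r=1$; and $\operatorname{Ind}R=0$ in case $s=0$, respectively $\operatorname{Im}R=W$ in case $s=1$. A representation $X$ of $((G,* ),\phi)$ over a field consists of a vector space $X_i$ for each $i\in G_0$ and an equipped relation $X_a\subseteq X_{t(a)}\oplus X_{h(a)}$ of type $(\phi(a),\phi(a^* ))$ for each $a\in G_1$, such that $X_{a^*}=X_a^{op}$ for all $a\in G_1$. Its dimension vector is $(\dim X_i)_{i\in G_0}$. A morphism $\theta:X\to X'$ is a collection of linear maps $\theta_i:X_i\to X'_i$ ($i\in G_0$) such that $(\theta_{t(a)}(x),\theta_{h(a)}(y))\in X'_a$ for all $a\in G_1$ and $(x,y)\in X_a$. This gives an additive category (direct sums taken componentwise on vector spaces and relations). In either setting, a representation is indecomposable if it is non-zero and not isomorphic to a direct sum of two non-zero representations, and absolutely indecomposable if it remains indecomposable after extending scalars (of all vector spaces and all maps or relations) to an algebraic closure of the base field. *)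

theory Defs
  imports
    "HOL-Algebra.Algebraic_Closure_Type"
    "HOL-Analysis.Product_Vector"
    "HOL-Library.Function_Algebras"
    "HOL-Library.FuncSet"
    "HOL-Number_Theory.Prime_Powers"
    "Graph_Theory.Digraph"
begin

text \<open>
  All vector spaces are finite-dimensional subspaces of a space \<open>'i \<Rightarrow> 'k\<close> of functions.
  For \<open>'i = nat\<close> every finite-dimensional space over \<open>'k\<close> is isomorphic to one of these.
  The coordinates are used only to describe external direct sums
  (\<open>'i + 'j \<Rightarrow> 'k\<close> is the product of \<open>'i \<Rightarrow> 'k\<close> and \<open>'j \<Rightarrow> 'k\<close>) and the extension of scalars.
\<close>

definition fscale :: "'k::field \<Rightarrow> ('i \<Rightarrow> 'k) \<Rightarrow> 'i \<Rightarrow> 'k" where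
  "fscale c v = (\<lambda>i. c * v i)"

interpretation fv: vector_space "fscale :: 'k::field \<Rightarrow> ('i \<Rightarrow> 'k) \<Rightarrow> 'i \<Rightarrow> 'k"
  by unfold_locales (auto simp: fscale_def algebra_simps)

interpretation fv2: vector_space_prod
  "fscale :: 'k::field \<Rightarrow> ('i \<Rightarrow> 'k) \<Rightarrow> 'i \<Rightarrow> 'k"
  "fscale :: 'k::field \<Rightarrow> ('j \<Rightarrow> 'k) \<Rightarrow> 'j \<Rightarrow> 'k"
  by unfold_locales

definition fin_dim_space :: "('i \<Rightarrow> 'k::field) set \<Rightarrow> bool" where
  "fin_dim_space V \<longleftrightarrow> (\<exists>B. finite B \<and> V = fv.span B)"

definition linear_map_on ::
    "('i \<Rightarrow> 'k::field) set \<Rightarrow> ('j \<Rightarrow> 'k) set \<Rightarrow> (('i \<Rightarrow> 'k) \<Rightarrow> ('j \<Rightarrow> 'k)) \<Rightarrow> bool" where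
  "linear_map_on V W f \<longleftrightarrow>
     f \<in> V \<rightarrow> W \<and>
     (\<forall>x\<in>V. \<forall>y\<in>V. f (x + y) = f x + f y) \<and>
     (\<forall>c. \<forall>x\<in>V. f (fscale c x) = fscale c (f x))"

definition sum_space ::
    "('i \<Rightarrow> 'k) set \<Rightarrow> ('j \<Rightarrow> 'k) set \<Rightarrow> ('i + 'j \<Rightarrow> 'k) set" where
  "sum_space V W = {case_sum v w |v w. v \<in> V \<and> w \<in> W}"

type_synonym ('i, 'k) linrel = "(('i \<Rightarrow> 'k) \<times> ('i \<Rightarrow> 'k)) set"

definition linear_relation ::
    "('i \<Rightarrow> 'k::field) set \<Rightarrow> ('i \<Rightarrow> 'k) set \<Rightarrow> ('i, 'k) linrel \<Rightarrow> bool" where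
  "linear_relation V W R \<longleftrightarrow> R \<subseteq> V \<times> W \<and> fv2.p.subspace R"

definition Ker_rel :: "('i, 'k::field) linrel \<Rightarrow> ('i \<Rightarrow> 'k) set" where
  "Ker_rel R = {v. (v, 0) \<in> R}"

definition Def_rel :: "('i, 'k::field) linrel \<Rightarrow> ('i \<Rightarrow> 'k) set" where
  "Def_rel R = {v. \<exists>w. (v, w) \<in> R}"

definition Ind_rel :: "('i, 'k::field) linrel \<Rightarrow> ('i \<Rightarrow> 'k) set" where
  "Ind_rel R = {w. (0, w) \<in> R}"

definition Im_rel :: "('i, 'k::field) linrel \<Rightarrow> ('i \<Rightarrow> 'k) set" where
  "Im_rel R = {w. \<exists>v. (v, w) \<in> R}"

definition equipped_relation ::
    "nat \<Rightarrow> nat \<Rightarrow> ('i \<Rightarrow> 'k::field) set \<Rightarrow> ('i \<Rightarrow> 'k) set \<Rightarrow> ('i, 'k) linrel \<Rightarrow> bool" where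
  "equipped_relation r s V W R \<longleftrightarrow>
     linear_relation V W R \<and>
     (r = 0 \<longrightarrow> Ker_rel R = {0}) \<and> (r = 1 \<longrightarrow> Def_rel R = V) \<and>
     (s = 0 \<longrightarrow> Ind_rel R = {0}) \<and> (s = 1 \<longrightarrow> Im_rel R = W)"

definition sum_rel :: "('i, 'k) linrel \<Rightarrow> ('j, 'k) linrel \<Rightarrow> ('i + 'j, 'k) linrel" where
  "sum_rel R S = {(case_sum v v', case_sum w w') |v v' w w'. (v, w) \<in> R \<and> (v', w') \<in> S}"

definition ext_vec :: "('i \<Rightarrow> 'k::field) \<Rightarrow> 'i \<Rightarrow> 'k alg_closure" where
  "ext_vec v = (\<lambda>i. to_ac (v i))"

definition ext_space :: "('i \<Rightarrow> 'k::field) set \<Rightarrow> ('i \<Rightarrow> 'k alg_closure) set" where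
  "ext_space V = fv.span (ext_vec ` V)"

definition ext_rel :: "('i, 'k::field) linrel \<Rightarrow> ('i, 'k alg_closure) linrel" where
  "ext_rel R = fv2.p.span (map_prod ext_vec ext_vec ` R)"

text \<open>
  On \<^term>\<open>ext_space V\<close> the extension of a linear map is determined by the conditions below;
  its values elsewhere are irrelevant. Existence and uniqueness are
  \<open>ext_map_props\<close> and \<open>ext_map_unique\<close>.
\<close>

definition ext_map ::
    "('i \<Rightarrow> 'k::field) set \<Rightarrow> ('i \<Rightarrow> 'k) set \<Rightarrow> (('i \<Rightarrow> 'k) \<Rightarrow> ('i \<Rightarrow> 'k)) \<Rightarrow>
     ('i \<Rightarrow> 'k alg_closure) \<Rightarrow> ('i \<Rightarrow> 'k alg_closure)" where
  "ext_map V W f =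
     (SOME g. linear_map_on (ext_space V) (ext_space W) g \<and>
        (\<forall>v\<in>V. g (ext_vec v) = ext_vec (f v)))"

lemma ac_functional:
  fixes x :: "'k::field alg_closure"
  assumes "x \<noteq> 0"
  obtains l :: "'k alg_closure \<Rightarrow> 'k" where
    "\<And>y z. l (y + z) = l y + l z" "\<And>c y. l (to_ac c * y) = c * l y" "l x = 1"
proof -
  interpret vector_space_pair "\<lambda>(c::'k) (y::'k alg_closure). to_ac c * y" "(*) :: 'k \<Rightarrow> 'k \<Rightarrow> 'k"
    by unfold_locales (auto simp: algebra_simps)
  have "vs1.independent {x}"
    using assms by simp
  then obtain l where l: "Vector_Spaces.linear (\<lambda>(c::'k) (y::'k alg_closure). to_ac c * y) (*) l"
      "\<forall>y\<in>{x}. l y = 1"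
    using linear_independent_extend[of "{x}" "\<lambda>_. 1"] by auto
  interpret l: Vector_Spaces.linear "\<lambda>(c::'k) (y::'k alg_closure). to_ac c * y" "(*)" l by fact
  show thesis
    by (rule that[of l]) (use l(2) in \<open>auto simp: l.add l.scale\<close>)
qed

lemma ext_vec_add: "ext_vec (v + w) = ext_vec v + ext_vec w"
  and ext_vec_scale: "ext_vec (fscale c v) = fscale (to_ac c) (ext_vec v)"
  and ext_vec_zero: "ext_vec 0 = 0"
  by (auto simp: ext_vec_def fscale_def)

lemma ext_vec_sum: "ext_vec (\<Sum>b\<in>B. f b) = (\<Sum>b\<in>B. ext_vec (f b))"
  by (induction B rule: infinite_finite_induct)
    (simp_all only: sum.infinite sum.empty sum.insert ext_vec_add ext_vec_zero not_False_eq_True)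

lemma inj_ext_vec: "inj ext_vec"
  by (auto simp: inj_def ext_vec_def fun_eq_iff)

lemma sum_fun_at: "(\<Sum>b\<in>B. f b) i = (\<Sum>b\<in>B. f b i)"
  by (induction B rule: infinite_finite_induct) auto

lemma independent_ext:
  fixes B :: "('i \<Rightarrow> 'k::field) set"
  assumes "finite B" "fv.independent B"
  shows "fv.independent (ext_vec ` B)"
proof (rule fv.independent_if_scalars_zero)
  show "finite (ext_vec ` B)" using assms by simp
next
  fix u x
  assume eq: "(\<Sum>x\<in>ext_vec ` B. fscale (u x) x) = 0" and "x \<in> ext_vec ` B"
  then obtain b0 where b0: "b0 \<in> B" "x = ext_vec b0" by auto
  show "u x = 0"
  proof (rule ccontr)
    assume "u x \<noteq> 0"
    then obtain l :: "'k alg_closure \<Rightarrow> 'k" where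
      l: "\<And>y z. l (y + z) = l y + l z" "\<And>c y. l (to_ac c * y) = c * l y" "l (u x) = 1"
      using ac_functional by blast
    have l0: "l 0 = 0" using l(2)[of 0 0] by simp
    have lsum: "l (\<Sum>b\<in>B. g b) = (\<Sum>b\<in>B. l (g b))" for g
      by (induction B rule: infinite_finite_induct) (auto simp: l l0)
    have *: "(\<Sum>b\<in>B. fscale (u (ext_vec b)) (ext_vec b)) = 0"
      using eq by (subst (asm) sum.reindex) (auto intro: inj_on_subset[OF inj_ext_vec])
    have "(\<Sum>b\<in>B. fscale (l (u (ext_vec b))) b) = 0"
    proof
      fix i
      have "(\<Sum>b\<in>B. u (ext_vec b) * to_ac (b i)) = 0"
        using fun_cong[OF *, of i] by (simp add: sum_fun_at fscale_def ext_vec_def)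
      then have "l (\<Sum>b\<in>B. to_ac (b i) * u (ext_vec b)) = 0"
        by (simp add: l0 mult.commute)
      then show "(\<Sum>b\<in>B. fscale (l (u (ext_vec b))) b) i = 0 i"
        by (simp add: lsum l(2) sum_fun_at fscale_def mult.commute)
    qed
    then have "l (u (ext_vec b0)) = 0"
      using assms b0(1) fv.independentD[of B B "\<lambda>b. l (u (ext_vec b))" b0] by auto
    then show False using l(3) b0 by simp
  qed
qed

lemma linear_map_on_sum:
  assumes f: "linear_map_on V W f" and V: "fv.subspace V" and "finite B" "B \<subseteq> V"
  shows "f (\<Sum>b\<in>B. fscale (c b) b) = (\<Sum>b\<in>B. fscale (c b) (f b))"
  using assms(3,4)
proof (induction B rule: finite_induct)
  case empty
  have "f (fscale 0 0) = fscale 0 (f 0)"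
    using f V unfolding linear_map_on_def by (meson fv.subspace_0)
  then show ?case by (simp only: fv.scale_zero_left sum.empty)
next
  case (insert b B)
  have V': "(\<Sum>b\<in>B. fscale (c b) b) \<in> V" "b \<in> V"
    using insert.prems V by (auto intro!: fv.subspace_sum fv.subspace_scale)
  have add: "f (x + y) = f x + f y" if "x \<in> V" "y \<in> V" for x y
    using f that unfolding linear_map_on_def by blast
  have scale: "f (fscale d x) = fscale d (f x)" if "x \<in> V" for d x
    using f that unfolding linear_map_on_def by blast
  have IH: "f (\<Sum>b\<in>B. fscale (c b) b) = (\<Sum>b\<in>B. fscale (c b) (f b))"
    using insert.IH insert.prems by blast
  show ?case
    unfolding sum.insert[OF insert.hyps]
    by (simp only: add[OF fv.subspace_scale[OF V V'(2)] V'(1)] scale[OF V'(2)] IH)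
qed

lemma ext_map_exists:
  fixes V W :: "('i \<Rightarrow> 'k::field) set"
  assumes V: "fin_dim_space V" and f: "linear_map_on V W f"
  shows "\<exists>g. linear_map_on (ext_space V) (ext_space W) g \<and>
           (\<forall>v\<in>V. g (ext_vec v) = ext_vec (f v))"
proof -
  obtain B0 where B0: "finite B0" "V = fv.span B0"
    using V by (auto simp: fin_dim_space_def)
  obtain B where B: "B \<subseteq> B0" "fv.independent B" "fv.span B = V"
    using fv.maximal_independent_subset[of B0] B0
    by (metis fv.span_mono fv.span_span subset_antisym)
  have fB: "finite B" using B B0 finite_subset by blast
  have BV: "B \<subseteq> V" using B fv.span_superset by blast
  have sV: "fv.subspace V" using B0 by simp
  obtain g where g: "Vector_Spaces.linear fscale fscale g"
      "\<forall>x\<in>ext_vec ` B. g x = ext_vec (f (inv_into B ext_vec x))"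
    using fv2.linear_independent_extend[OF independent_ext[OF fB B(2)],
        of "\<lambda>x. ext_vec (f (inv_into B ext_vec x))"] by blast
  interpret g: Vector_Spaces.linear fscale fscale g by fact
  have gB: "g (ext_vec b) = ext_vec (f b)" if "b \<in> B" for b
    using g(2) that by (simp add: inv_into_f_f[OF inj_on_subset[OF inj_ext_vec]])
  have gV: "g (ext_vec v) = ext_vec (f v)" if "v \<in> V" for v
  proof -
    obtain c where c: "v = (\<Sum>b\<in>B. fscale (c b) b)"
      using \<open>v \<in> V\<close> unfolding B(3)[symmetric] fv.span_finite[OF fB] by blast
    have "g (ext_vec v) = (\<Sum>b\<in>B. fscale (to_ac (c b)) (ext_vec (f b)))"
      by (simp add: c ext_vec_sum ext_vec_scale g.sum g.scale gB)
    also have "\<dots> = ext_vec (f v)"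
      using linear_map_on_sum[OF f sV fB BV, of c] by (simp add: c ext_vec_sum ext_vec_scale)
    finally show ?thesis .
  qed
  have "g x \<in> ext_space W" if "x \<in> ext_space V" for x
  proof -
    have "g x \<in> g ` fv.span (ext_vec ` V)" using that by (auto simp: ext_space_def)
    also have "\<dots> = fv.span (g ` ext_vec ` V)" by (simp add: g.span_image)
    also have "\<dots> \<subseteq> fv.span (ext_vec ` W)"
      using f gV by (intro fv.span_mono) (auto simp: linear_map_on_def)
    finally show ?thesis by (simp add: ext_space_def)
  qed
  then have "linear_map_on (ext_space V) (ext_space W) g"
    by (auto simp: linear_map_on_def g.add g.scale)
  then show ?thesis using gV by blast
qed

lemma ext_map_props:
  assumes "fin_dim_space V" "linear_map_on V W f"
  shows "linear_map_on (ext_space V) (ext_space W) (ext_map V W f)"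
    and "v \<in> V \<Longrightarrow> ext_map V W f (ext_vec v) = ext_vec (f v)"
  using someI_ex[OF ext_map_exists[OF assms]] by (auto simp: ext_map_def)

lemma ext_map_unique:
  assumes "fin_dim_space V" "linear_map_on V W f"
    and g: "linear_map_on (ext_space V) (ext_space W) g"
    and gf: "\<And>v. v \<in> V \<Longrightarrow> g (ext_vec v) = ext_vec (f v)"
    and "x \<in> ext_space V"
  shows "g x = ext_map V W f x"
proof -
  let ?h = "ext_map V W f"
  have h: "linear_map_on (ext_space V) (ext_space W) ?h"
    using ext_map_props[OF assms(1,2)] by blast
  have "x \<in> fv.span (ext_vec ` V)" using assms by (simp add: ext_space_def)
  then obtain t c where t: "finite t" "t \<subseteq> ext_vec ` V" "x = (\<Sum>a\<in>t. fscale (c a) a)"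
    by (auto simp: fv.span_explicit)
  have tV: "t \<subseteq> ext_space V" using t fv.span_superset by (fastforce simp: ext_space_def)
  have s: "fv.subspace (ext_space V)" by (simp add: ext_space_def)
  show ?thesis
    unfolding t(3) linear_map_on_sum[OF g s t(1) tV] linear_map_on_sum[OF h s t(1) tV]
    using t(2) gf ext_map_props(2)[OF assms(1,2)] by (intro sum.cong) auto
qed

text \<open>
  A quiver is a finite directed multigraph with loops, i.e. a \<^locale>\<open>fin_digraph\<close>.
  The involution and \<open>\<phi>\<close> are only constrained on \<^term>\<open>arcs G\<close>.
\<close>

locale involutive_graph = fin_digraph G
  for G :: "('v, 'e) pre_digraph" +
  fixes star :: "'e \<Rightarrow> 'e"
  assumes star_closed: "a \<in> arcs G \<Longrightarrow> star a \<in> arcs G"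
    and star_star: "a \<in> arcs G \<Longrightarrow> star (star a) = a"
    and star_fixed_point_free: "a \<in> arcs G \<Longrightarrow> star a \<noteq> a"
    and head_eq_tail_star: "a \<in> arcs G \<Longrightarrow> head G a = tail G (star a)"

locale equipped_graph = involutive_graph G star
  for G :: "('v, 'e) pre_digraph" and star :: "'e \<Rightarrow> 'e" +
  fixes \<phi> :: "'e \<Rightarrow> nat"
  assumes phi_range: "\<phi> \<in> arcs G \<rightarrow> {0, 1}"

definition has_underlying_graph ::
    "('v, 'e) pre_digraph \<Rightarrow> ('v, 'e) pre_digraph \<Rightarrow> ('e \<Rightarrow> 'e) \<Rightarrow> bool" where
  "has_underlying_graph Q G star \<longleftrightarrow>
     verts Q = verts G \<and> arcs Q \<subseteq> arcs G \<and>
     (\<forall>a\<in>arcs G. \<exists>!b. b \<in> {a, star a} \<and> b \<in> arcs Q) \<and>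
     (\<forall>a\<in>arcs Q. tail Q a = tail G a \<and> head Q a = head G a)"

text \<open>
  The components of a representation are relevant only at vertices and arrows of the quiver,
  and the value of a map only on the space at the tail; everything else is disregarded by
  the notion of isomorphism.
\<close>

record ('v, 'e, 'i, 'k) qrep =
  qspace :: "'v \<Rightarrow> ('i \<Rightarrow> 'k) set"
  qmap :: "'e \<Rightarrow> ('i \<Rightarrow> 'k) \<Rightarrow> ('i \<Rightarrow> 'k)"

definition quiver_rep :: "('v, 'e) pre_digraph \<Rightarrow> ('v, 'e, 'i, 'k::field) qrep \<Rightarrow> bool" where
  "quiver_rep Q M \<longleftrightarrow>
     (\<forall>i\<in>verts Q. fin_dim_space (qspace M i)) \<and>
     (\<forall>a\<in>arcs Q. linear_map_on (qspace M (tail Q a)) (qspace M (head Q a)) (qmap M a))"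

definition quiver_hom ::
    "('v, 'e) pre_digraph \<Rightarrow> ('v, 'e, 'i, 'k::field) qrep \<Rightarrow> ('v, 'e, 'j, 'k) qrep \<Rightarrow>
     ('v \<Rightarrow> ('i \<Rightarrow> 'k) \<Rightarrow> ('j \<Rightarrow> 'k)) \<Rightarrow> bool" where
  "quiver_hom Q M N \<theta> \<longleftrightarrow>
     (\<forall>i\<in>verts Q. linear_map_on (qspace M i) (qspace N i) (\<theta> i)) \<and>
     (\<forall>a\<in>arcs Q. \<forall>x\<in>qspace M (tail Q a).
        \<theta> (head Q a) (qmap M a x) = qmap N a (\<theta> (tail Q a) x))"

definition quiver_iso ::
    "('v, 'e) pre_digraph \<Rightarrow> ('v, 'e, 'i, 'k::field) qrep \<Rightarrow> ('v, 'e, 'j, 'k) qrep \<Rightarrow> bool" where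
  "quiver_iso Q M N \<longleftrightarrow>
     (\<exists>\<theta> \<psi>. quiver_hom Q M N \<theta> \<and> quiver_hom Q N M \<psi> \<and>
        (\<forall>i\<in>verts Q. (\<forall>x\<in>qspace M i. \<psi> i (\<theta> i x) = x) \<and> (\<forall>y\<in>qspace N i. \<theta> i (\<psi> i y) = y)))"

definition quiver_nonzero :: "('v, 'e) pre_digraph \<Rightarrow> ('v, 'e, 'i, 'k::field) qrep \<Rightarrow> bool" where
  "quiver_nonzero Q M \<longleftrightarrow> (\<exists>i\<in>verts Q. qspace M i \<noteq> {0})"

definition quiver_sum ::
    "('v, 'e, 'i, 'k::field) qrep \<Rightarrow> ('v, 'e, 'j, 'k) qrep \<Rightarrow> ('v, 'e, 'i + 'j, 'k) qrep" where
  "quiver_sum M N =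
     \<lparr>qspace = \<lambda>i. sum_space (qspace M i) (qspace N i),
      qmap = \<lambda>a u. case_sum (qmap M a (u \<circ> Inl)) (qmap N a (u \<circ> Inr))\<rparr>"

definition quiver_indecomposable ::
    "('v, 'e) pre_digraph \<Rightarrow> ('v, 'e, nat, 'k::field) qrep \<Rightarrow> bool" where
  "quiver_indecomposable Q M \<longleftrightarrow>
     quiver_rep Q M \<and> quiver_nonzero Q M \<and>
     \<not> (\<exists>(N :: ('v, 'e, nat, 'k) qrep) (L :: ('v, 'e, nat, 'k) qrep).
          quiver_rep Q N \<and> quiver_nonzero Q N \<and> quiver_rep Q L \<and> quiver_nonzero Q L \<and>
          quiver_iso Q M (quiver_sum N L))"

definition quiver_ext ::
    "('v, 'e) pre_digraph \<Rightarrow> ('v, 'e, 'i, 'k::field) qrep \<Rightarrow> ('v, 'e, 'i, 'k alg_closure) qrep" where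
  "quiver_ext Q M =
     \<lparr>qspace = \<lambda>i. ext_space (qspace M i),
      qmap = \<lambda>a. ext_map (qspace M (tail Q a)) (qspace M (head Q a)) (qmap M a)\<rparr>"

definition quiver_abs_indecomposable ::
    "('v, 'e) pre_digraph \<Rightarrow> ('v, 'e, nat, 'k::field) qrep \<Rightarrow> bool" where
  "quiver_abs_indecomposable Q M \<longleftrightarrow>
     quiver_indecomposable Q M \<and> quiver_indecomposable Q (quiver_ext Q M)"

definition quiver_iso_classes ::
    "('v, 'e) pre_digraph \<Rightarrow> ('v \<Rightarrow> nat) \<Rightarrow> ('v, 'e, nat, 'k::field) qrep set set" where
  "quiver_iso_classes Q \<alpha> =
     {M. quiver_rep Q M \<and> (\<forall>i\<in>verts Q. fv.dim (qspace M i) = \<alpha> i) \<and>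
         quiver_abs_indecomposable Q M}
     // {(M, N). quiver_rep Q M \<and> quiver_rep Q N \<and> quiver_iso Q M N}"

text \<open>The number \<open>A\<^bsub>Q,\<alpha>\<^esub>(q)\<close>, where \<open>q\<close> is the cardinality of \<open>'k\<close>.\<close>

definition quiver_A ::
    "'k::field itself \<Rightarrow> ('v, 'e) pre_digraph \<Rightarrow> ('v \<Rightarrow> nat) \<Rightarrow> nat" where
  "quiver_A _ Q \<alpha> = card (quiver_iso_classes Q \<alpha> :: ('v, 'e, nat, 'k) qrep set set)"

record ('v, 'e, 'i, 'k) erep =
  espace :: "'v \<Rightarrow> ('i \<Rightarrow> 'k) set"
  erel :: "'e \<Rightarrow> (('i \<Rightarrow> 'k) \<times> ('i \<Rightarrow> 'k)) set"

definition equipped_rep ::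
    "('v, 'e) pre_digraph \<Rightarrow> ('e \<Rightarrow> 'e) \<Rightarrow> ('e \<Rightarrow> nat) \<Rightarrow> ('v, 'e, 'i, 'k::field) erep \<Rightarrow> bool" where
  "equipped_rep G star \<phi> M \<longleftrightarrow>
     (\<forall>i\<in>verts G. fin_dim_space (espace M i)) \<and>
     (\<forall>a\<in>arcs G. equipped_relation (\<phi> a) (\<phi> (star a))
        (espace M (tail G a)) (espace M (head G a)) (erel M a)) \<and>
     (\<forall>a\<in>arcs G. erel M (star a) = (erel M a)\<inverse>)"

definition equipped_hom ::
    "('v, 'e) pre_digraph \<Rightarrow> ('v, 'e, 'i, 'k::field) erep \<Rightarrow> ('v, 'e, 'j, 'k) erep \<Rightarrow>
     ('v \<Rightarrow> ('i \<Rightarrow> 'k) \<Rightarrow> ('j \<Rightarrow> 'k)) \<Rightarrow> bool" where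
  "equipped_hom G M N \<theta> \<longleftrightarrow>
     (\<forall>i\<in>verts G. linear_map_on (espace M i) (espace N i) (\<theta> i)) \<and>
     (\<forall>a\<in>arcs G. \<forall>(x, y)\<in>erel M a. (\<theta> (tail G a) x, \<theta> (head G a) y) \<in> erel N a)"

definition equipped_iso ::
    "('v, 'e) pre_digraph \<Rightarrow> ('v, 'e, 'i, 'k::field) erep \<Rightarrow> ('v, 'e, 'j, 'k) erep \<Rightarrow> bool" where
  "equipped_iso G M N \<longleftrightarrow>
     (\<exists>\<theta> \<psi>. equipped_hom G M N \<theta> \<and> equipped_hom G N M \<psi> \<and>
        (\<forall>i\<in>verts G. (\<forall>x\<in>espace M i. \<psi> i (\<theta> i x) = x) \<and> (\<forall>y\<in>espace N i. \<theta> i (\<psi> i y) = y)))"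

definition equipped_nonzero :: "('v, 'e) pre_digraph \<Rightarrow> ('v, 'e, 'i, 'k::field) erep \<Rightarrow> bool" where
  "equipped_nonzero G M \<longleftrightarrow> (\<exists>i\<in>verts G. espace M i \<noteq> {0})"

definition equipped_sum ::
    "('v, 'e, 'i, 'k::field) erep \<Rightarrow> ('v, 'e, 'j, 'k) erep \<Rightarrow> ('v, 'e, 'i + 'j, 'k) erep" where
  "equipped_sum M N =
     \<lparr>espace = \<lambda>i. sum_space (espace M i) (espace N i),
      erel = \<lambda>a. sum_rel (erel M a) (erel N a)\<rparr>"

definition equipped_indecomposable ::
    "('v, 'e) pre_digraph \<Rightarrow> ('e \<Rightarrow> 'e) \<Rightarrow> ('e \<Rightarrow> nat) \<Rightarrow> ('v, 'e, nat, 'k::field) erep \<Rightarrow> bool" where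
  "equipped_indecomposable G star \<phi> M \<longleftrightarrow>
     equipped_rep G star \<phi> M \<and> equipped_nonzero G M \<and>
     \<not> (\<exists>(N :: ('v, 'e, nat, 'k) erep) (L :: ('v, 'e, nat, 'k) erep).
          equipped_rep G star \<phi> N \<and> equipped_nonzero G N \<and>
          equipped_rep G star \<phi> L \<and> equipped_nonzero G L \<and>
          equipped_iso G M (equipped_sum N L))"

definition equipped_ext ::
    "('v, 'e, 'i, 'k::field) erep \<Rightarrow> ('v, 'e, 'i, 'k alg_closure) erep" where
  "equipped_ext M =
     \<lparr>espace = \<lambda>i. ext_space (espace M i), erel = \<lambda>a. ext_rel (erel M a)\<rparr>"

definition equipped_abs_indecomposable ::
    "('v, 'e) pre_digraph \<Rightarrow> ('e \<Rightarrow> 'e) \<Rightarrow> ('e \<Rightarrow> nat) \<Rightarrow> ('v, 'e, nat, 'k::field) erep \<Rightarrow> bool" where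
  "equipped_abs_indecomposable G star \<phi> M \<longleftrightarrow>
     equipped_indecomposable G star \<phi> M \<and> equipped_indecomposable G star \<phi> (equipped_ext M)"

definition equipped_iso_classes ::
    "('v, 'e) pre_digraph \<Rightarrow> ('e \<Rightarrow> 'e) \<Rightarrow> ('e \<Rightarrow> nat) \<Rightarrow> ('v \<Rightarrow> nat) \<Rightarrow>
     ('v, 'e, nat, 'k::field) erep set set" where
  "equipped_iso_classes G star \<phi> \<alpha> =
     {M. equipped_rep G star \<phi> M \<and> (\<forall>i\<in>verts G. fv.dim (espace M i) = \<alpha> i) \<and>
         equipped_abs_indecomposable G star \<phi> M}
     // {(M, N). equipped_rep G star \<phi> M \<and> equipped_rep G star \<phi> N \<and> equipped_iso G M N}"

definition equipped_A ::
    "'k::field itself \<Rightarrow> ('v, 'e) pre_digraph \<Rightarrow> ('e \<Rightarrow> 'e) \<Rightarrow> ('e \<Rightarrow> nat) \<Rightarrow> ('v \<Rightarrow> nat) \<Rightarrow> nat" where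
  "equipped_A _ G star \<phi> \<alpha> =
     card (equipped_iso_classes G star \<phi> \<alpha> :: ('v, 'e, nat, 'k) erep set set)"

end

theory Submission
 imports Defs "HOL-Number_Theory.Residues" "HOL-Library.Multiset"
begin

text \<open>
Orienting the graph along \<open>Q\<close>, a representation becomes one linear relation per arrow of \<open>Q\<close>, and a type in
\<open>{0, 1} \<times> {0, 1}\<close> for each arrow; linear maps are the relations of type \<open>(1, 0)\<close>. It therefore suffices to show
that counts are independent of the type. For two operators on finite spaces the number of invariant
relations of each type between them equals the number of homomorphisms, so Burnside's lemma gives
equally many isomorphism classes of each type over every finite field. By Lang's theorem and the
Noether-Deuring theorem these are the Frobenius-fixed classes over the algebraic closure. By
Krull-Schmidt a fixed class is a fixed multiset of classes of indecomposables; since the counts agree for all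
powers of Frobenius, induction on the dimension vector yields equivariant bijections between the smaller
indecomposables, hence equally many fixed indecomposable classes in each dimension vector.
Finally the absolutely indecomposable representations over the finite field are the descents of these.
\<close>

text \<open>The types are compared through numbers alone, one pair of operators at a time;
  Burnside's lemma then turns equal numbers of invariant relations into equal numbers of isomorphism
  classes. The obstacle is the passage to indecomposables. A class fixed by Frobenius can be a sum
  of indecomposables that Frobenius permutes, so counting fixed multisets requires the cycle
  structure of Frobenius on the smaller indecomposables, not just the number of its fixed points.
  The fixed-point counts of all powers of Frobenius determine that structure, because points of
  exact period k can be separated from those whose period properly divides k. Hence the counting is
  done over every finite extension of the base field, and the locale \<open>frob\<close> axiomatises
  the power map by properties that every power \<open>s ^ e\<close> inherits. Every element of the
  closure lies in a finite subfield; this finiteness makes some power of each endomorphism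
  idempotent, gives Lang's theorem by counting roots, and makes every class periodic under
  Frobenius.\<close>

section \<open>Iterates of self-maps of finite sets\<close>

lemma finite_inj_periodic:
 assumes "finite S" "f ` S \<subseteq> S" "inj_on f S" "x : S"
 shows "EX m>0. (f ^^ m) x = x"
proof -
 have mem: "(f ^^ n) x : S" for n
  using assms by (induction n) auto
 have "~ inj (%n. (f ^^ n) x)"
  by (meson assms(1) finite_subset image_subset_iff infinite_UNIV_nat inj_on_finite mem)
 then obtain i j where ij: "i < j" "(f ^^ i) x = (f ^^ j) x"
  unfolding inj_def by (metis linorder_neqE_nat)
 have "(f ^^ k) x = (f ^^ (k + d)) x ==> x = (f ^^ d) x" for k d
 proof (induction k)
  case (Suc k)
  then have "f ((f ^^ k) x) = f ((f ^^ (k + d)) x)" by simp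
  then have "(f ^^ k) x = (f ^^ (k + d)) x"
  using assms(3) mem by (meson inj_onD)
  then show ?case using Suc by simp
 qed simp
 from this[of i "j - i"] ij show ?thesis
  by (intro exI[of _ "j - i"]) auto
qed

text \<open>The restrictions of the iterates of \<open>f\<close> to \<open>S\<close> form a finite
  cyclic semigroup, and such a semigroup contains an idempotent. Working with restrictions gives one
  exponent for all points at once.\<close>

lemma finite_idempotent_power:
 assumes "finite S" "f ` S \<subseteq> S"
 shows "EX m>0. ALL x:S. (f ^^ (m + m)) x = (f ^^ m) x"
proof -
 have mem: "(f ^^ n) x : S" if "x : S" for n x
  using assms that by (induction n) auto
 define P where "P n = restrict (f ^^ n) S" for n
 have "range P \<subseteq> S \<rightarrow>\<^sub>E S" using mem by (auto simp: P_def)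
 then have "finite (range P)"
  using assms(1) by (meson finite_PiE finite_subset)
 then have "~ inj P" using range_inj_infinite by blast
 then obtain i j where ij: "i < j" "P i = P j"
  unfolding inj_def by (metis linorder_neqE_nat)
 define d where "d = j - i"
 have eq: "(f ^^ (i + d)) x = (f ^^ i) x" if "x : S" for x
  using ij that by (auto simp: P_def d_def fun_eq_iff restrict_def) metis
 have step: "(f ^^ (n + d)) x = (f ^^ n) x" if "x : S" "n \<ge> i" for x n
 proof -
  have "(f ^^ (n + d)) x = (f ^^ (n - i)) ((f ^^ (i + d)) x)"
  using that by (metis add.assoc comp_apply funpow_add le_add_diff_inverse2)
  also have "... = (f ^^ n) x"
  using that by (metis eq comp_apply funpow_add le_add_diff_inverse2)
  finally show ?thesis .
 qed
 have steps: "(f ^^ (n + k * d)) x = (f ^^ n) x" if "x : S" "n \<ge> i" for x n k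
 proof (induction k)
  case (Suc k)
  have "(f ^^ (n + Suc k * d)) x = (f ^^ ((n + k * d) + d)) x" by (simp add: algebra_simps)
  then show ?case using Suc step[of x "n + k * d"] that by simp
 qed simp
 have "d > 0" using ij by (simp add: d_def)
 show ?thesis
 proof (intro exI conjI ballI)
  \<comment> \<open>A multiple of the period \<open>d\<close> that is at least the preperiod
    \<open>i\<close>: beyond \<open>i\<close>, adding any multiple of \<open>d\<close> changes
    nothing. \<open>Suc i\<close> instead of \<open>i\<close> keeps the exponent positive.\<close>
  show "Suc i * d > 0" using \<open>d > 0\<close> by simp
  fix x assume "x : S"
  have "i <= Suc i * d" using \<open>d > 0\<close>
  by (metis le_add2 le_trans mult.commute mult_le_mono nat_mult_1_right Suc_leI One_nat_def le_SucI order_refl)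
  then show "(f ^^ (Suc i * d + Suc i * d)) x = (f ^^ (Suc i * d)) x"
  using steps[OF \<open>x : S\<close>] by blast
 qed
qed

section \<open>The Frobenius map on a field and on coordinate vectors\<close>

definition fr :: "nat => ('i => 'a::field) => 'i => 'a" where
 "fr s v = (%i. v i ^ s)"

text \<open>The properties of the \<open>s\<close>-power map on an algebraic closure of a field with
  \<open>s\<close> elements. The last two say that each element lies in the fixed field of some
  power of the map, and that the fixed field of the \<open>N\<close>-th power is finite of the
  expected order.\<close>

locale frob =
 fixes ty :: "'a::field itself" and s :: nat
 assumes s_gt1: "s > 1"
  and frob_add: "!!x y::'a. (x + y) ^ s = x ^ s + y ^ s"
  and frob_periodic: "!!x::'a. EX N>0. x ^ (s ^ N) = x"
  and card_fixed: "!!N. N > 0 ==> card {x::'a. x ^ (s ^ N) = x} = s ^ N"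
begin

lemma frob_zero [simp]: "(0::'a) ^ s = 0"
 using s_gt1 by simp

lemma frob_add_pow: "(x + y :: 'a) ^ (s ^ n) = x ^ (s ^ n) + y ^ (s ^ n)"
proof (induction n)
 case (Suc n)
 have "(x + y) ^ (s ^ Suc n) = ((x + y) ^ (s ^ n)) ^ s"
  by (metis power_Suc2 power_mult)
 also have "... = (x ^ (s ^ n)) ^ s + (y ^ (s ^ n)) ^ s" by (simp only: Suc frob_add)
 finally show ?case by (metis power_Suc2 power_mult)
qed simp

text \<open>Makes every result of the locale available for all powers of Frobenius, that is, for all
  finite extensions of the base field.\<close>

lemma frob_power:
 assumes e: "e > 0"
 shows "frob TYPE('a) (s ^ e)"
proof (rule frob.intro)
 show "1 < s ^ e" by (rule one_less_power[OF s_gt1 e])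
 show "(x + y :: 'a) ^ (s ^ e) = x ^ (s ^ e) + y ^ (s ^ e)" for x y by (rule frob_add_pow)
 show "EX N>0. (x::'a) ^ ((s ^ e) ^ N) = x" for x
 proof -
  obtain N where N: "N > 0" "x ^ (s ^ N) = x" using frob_periodic by blast
  have "x ^ (s ^ (N * k)) = x" for k
  by (induction k) (simp_all add: power_add power_mult N(2))
  then have "x ^ ((s ^ e) ^ N) = x" by (metis mult.commute power_mult)
  then show ?thesis using N by blast
 qed
 show "card {x::'a. x ^ ((s ^ e) ^ N) = x} = (s ^ e) ^ N" if "N > 0" for N
  using card_fixed[of "e * N"] that e by (simp add: power_mult)
qed

lemma finite_fixed: "N > 0 ==> finite {x::'a. x ^ (s ^ N) = x}"
 using card_fixed[of N] s_gt1 by (intro card_ge_0_finite) simp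

text \<open>Finitely many elements lie in a common finite subfield: the product of their periods is
  a period of each. Applied to matrix entries, it reduces questions over the closure to finite
  sets.\<close>

lemma common_period:
 assumes "finite C"
 shows "EX N>0. ALL x:C. (x::'a) ^ (s ^ N) = x"
 using assms
proof (induction C)
 case (insert x C)
 obtain N where N: "N > 0" "ALL y:C. y ^ (s ^ N) = y" using insert by blast
 obtain M where M: "M > 0" "x ^ (s ^ M) = x" using frob_periodic by blast
 have mult: "y ^ (s ^ (A * k)) = y" if "y ^ (s ^ A) = y" for y :: 'a and A k
  by (induction k) (simp_all add: power_add power_mult that)
 have "ALL y:insert x C. y ^ (s ^ (N * M)) = y"
  using N(2) mult[of _ N M] mult[OF M(2), of N] by (auto simp: mult.commute)
 then show ?case using N M by (intro exI[of _ "N * M"]) auto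
qed auto

text \<open>On elements of period \<open>N = Suc M\<close> the power \<open>s ^ M\<close> inverts
  the power \<open>s\<close>. The same inverse proves \<open>frob_surj\<close>.\<close>

lemma frob_inj: "(x::'a) ^ s = y ^ s ==> x = y"
proof -
 assume eq: "x ^ s = y ^ s"
 obtain N where N: "N > 0" "ALL z:{x,y}. z ^ (s ^ N) = z" using common_period[of "{x,y}"] by auto
 then obtain M where "N = Suc M" by (metis gr0_implies_Suc)
 then have "x = (x ^ s) ^ (s ^ M)" "y = (y ^ s) ^ (s ^ M)"
  using N by (metis insertI1 power_Suc power_mult, metis insertI1 insertI2 power_Suc power_mult)
 then show ?thesis using eq by simp
qed

lemma frob_surj: "EX y. y ^ s = (x::'a)"
proof -
 obtain N where N: "N > 0" "x ^ (s ^ N) = x" using frob_periodic by blast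
 then obtain M where "N = Suc M" by (metis gr0_implies_Suc)
 then have "(x ^ (s ^ M)) ^ s = x" using N by (metis power_Suc2 power_mult)
 then show ?thesis by blast
qed

lemma fr_add: "fr s (v + w) = fr s v + fr s (w :: 'i => 'a)"
 by (auto simp: fr_def frob_add)

lemma fr_scale: "fr s (fscale c v) = fscale (c ^ s) (fr s (v :: 'i => 'a))"
 by (auto simp: fr_def fscale_def power_mult_distrib)

lemma fr_zero [simp]: "fr s (0 :: 'i => 'a) = 0"
 by (auto simp: fr_def)

lemma inj_fr: "inj (fr s :: ('i => 'a) => _)"
 unfolding inj_def fr_def fun_eq_iff using frob_inj by blast

lemma surj_fr: "surj (fr s :: ('i => 'a) => _)"
proof (rule surjI)
 fix v :: "'i => 'a"
 show "fr s (%i. SOME y. y ^ s = v i) = v"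
  unfolding fr_def fun_eq_iff using frob_surj by (auto intro: someI_ex)
qed

lemma bij_fr: "bij (fr s :: ('i => 'a) => _)"
 using inj_fr surj_fr by (simp add: bij_def)

lemma fr_eq_0_iff [simp]: "fr s (v :: 'i => 'a) = 0 \<longleftrightarrow> v = 0"
 using inj_fr by (metis fr_zero injD)

end

section \<open>Semilinear maps: Lang's theorem and the number of fixed vectors\<close>

locale frob_space = frob ty s + vector_space scale
 for ty :: "'a::field itself" and s :: nat and scale :: "'a => 'b::ab_group_add => 'b"
begin

text \<open>Lang's theorem in linear form. If a linear functional kills all fixed vectors, it kills
 every averaged vector; as a function of \<open>c\<close> this is a polynomial with too many roots.\<close>

lemma lang:
 assumes B: "finite B" "V = span B"
  and tauV: "!!v. v : V ==> tau v : V"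
  and tauadd: "!!v w. v : V ==> w : V ==> tau (v + w) = tau v + tau w"
  and tauscale: "!!c v. v : V ==> tau (scale c v) = scale (c ^ s) (tau v)"
  and tauinj: "!!v. v : V ==> tau v = 0 ==> v = 0"
 shows "span {v : V. tau v = v} = V"
proof
 let ?W = "{v : V. tau v = v}"
 have sub: "subspace V" by (simp add: B)
 show "span ?W \<subseteq> V" using sub by (intro span_minimal) auto
 have t0: "tau 0 = 0" using tauscale[of 0 0] subspace_0[OF sub] s_gt1 by simp
 have tsum: "tau (\<Sum>x\<in>Y. f x) = (\<Sum>x\<in>Y. tau (f x))" if "!!x. x : Y ==> f x : V" for Y :: "'c set" and f
  using that
  by (induction Y rule: infinite_finite_induct) (auto simp: t0 tauadd subspace_sum sub)
 have tpow: "(tau ^^ n) v : V" if "v : V" for n v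
  using that by (induction n) (auto intro: tauV)
 have BV: "B \<subseteq> V" using B span_superset by auto
 have "b : span ?W" if b: "b : B" for b
 proof (rule ccontr)
  assume nb: "b \<notin> span ?W"
  have "ALL x:B. EX g. tau x = (\<Sum>y\<in>B. scale (g y) y)"
  proof
  fix x assume "x : B"
  then have "tau x : span B" using tauV BV B by blast
  then show "EX g. tau x = (\<Sum>y\<in>B. scale (g y) y)" using span_finite[OF B(1)] by auto
  qed
  then obtain g where g: "!!x. x : B ==> tau x = (\<Sum>y\<in>B. scale (g x y) y)" by metis
  \<comment> \<open>The fixed field \<open>K\<close> of the \<open>N\<close>-th power contains all
    matrix entries of \<open>tau\<close> on \<open>B\<close>. So the \<open>K\<close>-combinations
    of \<open>B\<close> form a finite set \<open>S\<close> stable under the injective map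
    \<open>tau\<close>, and \<open>b\<close>, being in \<open>S\<close>, has a period
    \<open>m\<close>.\<close>
  obtain N where N: "N > 0" "ALL c:case_prod g ` (B \<times> B). c ^ (s ^ N) = c"
  using common_period[of "case_prod g ` (B \<times> B)"] B by auto
  define K where "K = {c::'a. c ^ (s ^ N) = c}"
  have K: "0 : K" "1 : K" "!!x y. x : K ==> y : K ==> x + y : K"
  "!!x y. x : K ==> y : K ==> x * y : K" "!!x. x : K ==> x ^ s : K"
  using s_gt1 by (auto simp: K_def frob_add_pow power_mult_distrib) (metis mult.commute power_mult)
  have Ksum: "(\<Sum>x\<in>Y. f x) : K" if "!!x. x : Y ==> f x : K" for Y :: "'b set" and f
  using that by (induction Y rule: infinite_finite_induct) (auto intro: K)
  have gK: "g x y : K" if "x : B" "y : B" for x y using N that by (auto simp: K_def)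
  define S where "S = (%c. \<Sum>x\<in>B. scale (c x) x) ` (B \<rightarrow>\<^sub>E K)"
  have finS: "finite S" unfolding S_def
  using B finite_fixed[OF N(1)] by (intro finite_imageI finite_PiE) (auto simp: K_def)
  have SI: "(\<Sum>x\<in>B. scale (c x) x) : S" if "!!x. x : B ==> c x : K" for c
  proof -
  have "(\<Sum>x\<in>B. scale (c x) x) = (\<Sum>x\<in>B. scale (restrict c B x) x)" by (intro sum.cong) auto
  then show ?thesis unfolding S_def
  by (rule image_eqI[where x = "restrict c B"]) (use that in auto)
  qed
  have SV: "S \<subseteq> V" unfolding S_def using BV sub by (auto intro!: subspace_sum subspace_scale)
  have tauS: "tau ` S \<subseteq> S"
  proof
  fix z assume "z : tau ` S"
  then obtain c where c: "!!x. x : B ==> c x : K" "z = tau (\<Sum>x\<in>B. scale (c x) x)"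
  by (auto simp: S_def)
  have "z = (\<Sum>x\<in>B. scale (c x ^ s) (tau x))"
  unfolding c(2) using BV sub by (subst tsum) (auto simp: tauscale subspace_scale intro!: sum.cong)
  also have "... = (\<Sum>x\<in>B. \<Sum>y\<in>B. scale (c x ^ s * g x y) y)"
  by (intro sum.cong) (auto simp: g scale_sum_right)
  also have "... = (\<Sum>y\<in>B. scale (\<Sum>x\<in>B. c x ^ s * g x y) y)"
  by (subst sum.swap) (simp add: scale_sum_left)
  also have "... : S" by (intro SI Ksum K(4) K(5) c gK)
  finally show "z : S" .
  qed
  have bS: "b : S"
  proof -
  have "b = (\<Sum>x\<in>B. scale (if x = b then 1 else 0) x)"
  using b B(1) by (subst sum.cong[OF refl, of _ _ "%x. if x = b then x else 0"]) (auto simp: sum.delta)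
  then show ?thesis using SI[of "%x. if x = b then 1 else 0"] K by auto
  qed
  have "inj_on tau S"
  proof (rule inj_onI)
  fix x y assume xy: "x : S" "y : S" "tau x = tau y"
  have V: "y : V" "x - y : V" using xy SV by (auto intro: subspace_diff[OF sub])
  have "tau x = tau ((x - y) + y)" by simp
  also have "... = tau (x - y) + tau y" using V by (intro tauadd)
  finally have "tau (x - y) = 0" using xy by simp
  then show "x = y" using tauinj[of "x - y"] V by simp
  qed
  then obtain m where m: "m > 0" "(tau ^^ m) b = b"
  using finite_inj_periodic[OF finS tauS _ bS] by blast
  interpret vp: vector_space_pair scale "(*) :: 'a => 'a => 'a"
  by unfold_locales (auto simp: algebra_simps)
  obtain C where C: "C \<subseteq> ?W" "independent C" "?W \<subseteq> span C"
  using maximal_independent_subset by blast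
  have spC: "span C = span ?W" using C by (metis span_mono span_span subset_antisym)
  have "independent (insert b C)" using C nb spC by (intro independent_insertI) auto
  then obtain lf where lf: "Vector_Spaces.linear scale (*) lf" "ALL x:insert b C. lf x = (if x = b then 1 else 0)"
  using vp.linear_independent_extend[of "insert b C" "%x. if x = b then 1 else 0"] by blast
  interpret l: Vector_Spaces.linear scale "(*)" lf by fact
  have bC: "b \<notin> C" using nb spC span_base by blast
  have lC: "lf x = 0" if "x : span C" for x
  using l.eq_0_on_span[of C x] lf(2) bC that by fastforce
  define p where "p = (\<Sum>i<m. monom (lf ((tau ^^ i) b)) (s ^ i))"
  have root: "poly p c = 0" if c: "c ^ (s ^ m) = c" for c
  proof -
  \<comment> \<open>\<open>tau\<close> sends each summand to the next one; the last wraps around to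
    the first because both \<open>b\<close> and \<open>c\<close> have period \<open>m\<close>. Hence
    \<open>t\<close> is a fixed vector, is killed by \<open>lf\<close>, and \<open>lf t\<close> is
    the value of \<open>p\<close> at \<open>c\<close>.\<close>
  define t where "t = (\<Sum>i<m. scale (c ^ (s ^ i)) ((tau ^^ i) b))"
  have bV: "b : V" using b BV by blast
  have "tau t = (\<Sum>i<m. scale (c ^ (s ^ Suc i)) ((tau ^^ Suc i) b))"
  unfolding t_def using tpow[OF bV] sub
  by (subst tsum) (auto simp: tauscale subspace_scale mult.commute simp flip: power_mult intro!: sum.cong)
  also have "... = (\<Sum>i<Suc m. scale (c ^ (s ^ i)) ((tau ^^ i) b)) - scale (c ^ (s ^ 0)) ((tau ^^ 0) b)"
  by (subst sum.lessThan_Suc_shift) simp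
  also have "... = t" using c m by (simp add: t_def)
  finally have "tau t = t" .
  moreover have "t : V" unfolding t_def using tpow[OF bV] sub by (intro subspace_sum subspace_scale) auto
  ultimately have "t : span C" using C(3) by blast
  then have "lf t = 0" by (rule lC)
  then show ?thesis
  by (simp add: p_def t_def poly_sum poly_monom l.sum l.scale mult.commute)
  qed
  have "degree p <= s ^ (m - 1)"
  unfolding p_def using s_gt1
  by (intro degree_sum_le) (auto intro!: order_trans[OF degree_monom_le] power_increasing)
  also have "... < s ^ m" using s_gt1 m by (intro power_strict_increasing) auto
  also have "... = card {c::'a. c ^ (s ^ m) = c}" using card_fixed[OF m(1)] by simp
  finally have deg: "degree p < card {c::'a. c ^ (s ^ m) = c}" .
  have "p = 0"
  proof (rule ccontr)
  assume "p ~= 0"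
  then have "card {c. poly p c = 0} <= degree p" "finite {c. poly p c = 0}"
  by (auto simp: card_poly_roots_bound poly_roots_finite)
  moreover have "card {c::'a. c ^ (s ^ m) = c} <= card {c. poly p c = 0}"
  using root calculation by (intro card_mono) auto
  ultimately show False using deg by linarith
  qed
  \<comment> \<open>Only the index 0 contributes to degree 1, with coefficient
    \<open>lf b = 1\<close>; so \<open>p\<close> is not the zero polynomial.\<close>
  moreover have "coeff p 1 = 1"
  proof -
  have "coeff p 1 = (\<Sum>i<m. if i = 0 then lf b else 0)"
  unfolding p_def coeff_sum using s_gt1 by (intro sum.cong) (auto simp: power_eq_1_iff)
  also have "... = 1" using m lf(2) by (simp add: sum.delta)
  finally show ?thesis .
  qed
  ultimately show False by simp
 qed
 then show "V \<subseteq> span ?W" using B span_minimal[of B "span ?W"] by auto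
qed

text \<open>The fixed vectors span by \<open>lang\<close>, so a maximal independent set of fixed
  vectors is already a basis of the whole space.\<close>

lemma fixed_basis:
 assumes B: "finite B" "V = span B"
  and tauV: "!!v. v : V ==> tau v : V"
  and tauadd: "!!v w. v : V ==> w : V ==> tau (v + w) = tau v + tau w"
  and tauscale: "!!c v. v : V ==> tau (scale c v) = scale (c ^ s) (tau v)"
  and tauinj: "!!v. v : V ==> tau v = 0 ==> v = 0"
 obtains C where "finite C" "independent C" "span C = V" "!!x. x : C ==> tau x = x" "card C = dim V"
proof -
 let ?W = "{v : V. tau v = v}"
 have sp: "span ?W = V" by (rule lang[OF assms])
 obtain C where C: "C \<subseteq> ?W" "independent C" "?W \<subseteq> span C"
  using maximal_independent_subset by blast
 have spC: "span C = V" using C sp by (metis span_mono span_span subset_antisym)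
 have fin: "finite C"
  using C spC B independent_span_bound[OF B(1) C(2)] span_superset by auto
 show thesis
  by (rule that[of C]) (use C spC fin in \<open>auto simp: dim_span_eq_card_independent[symmetric]\<close>)
qed

text \<open>In a basis of fixed vectors a vector is fixed exactly when its coefficients satisfy
  \<open>c ^ s = c\<close>, and there are \<open>s\<close> such scalars. The count thus depends on
  the dimension over the large field only.\<close>

lemma card_fixed_vectors:
 assumes B: "finite B" "V = span B"
  and tauV: "!!v. v : V ==> tau v : V"
  and tauadd: "!!v w. v : V ==> w : V ==> tau (v + w) = tau v + tau w"
  and tauscale: "!!c v. v : V ==> tau (scale c v) = scale (c ^ s) (tau v)"
  and tauinj: "!!v. v : V ==> tau v = 0 ==> v = 0"
 shows "card {v : V. tau v = v} = s ^ dim V" "finite {v : V. tau v = v}"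
proof -
 obtain C where C: "finite C" "independent C" "span C = V" "!!x. x : C ==> tau x = x" "card C = dim V"
  using fixed_basis[OF assms] by blast
 let ?K = "{c::'a. c ^ s = c}"
 let ?f = "%c. \<Sum>x\<in>C. scale (c x) x"
 have sub: "subspace V" by (simp add: B)
 have CV: "C \<subseteq> V" using C span_superset by auto
 have t0: "tau 0 = 0" using tauscale[of 0 0] subspace_0[OF sub] s_gt1 by simp
 have tauf: "tau (?f c) = (\<Sum>x\<in>C. scale (c x ^ s) x)" for c
 proof -
  have "tau (\<Sum>x\<in>Y. scale (c x) x) = (\<Sum>x\<in>Y. scale (c x ^ s) x)" if "Y \<subseteq> C" for Y
  using that
  proof (induction Y rule: infinite_finite_induct)
  case (insert x Y)
  then have "scale (c x) x : V" "(\<Sum>x\<in>Y. scale (c x) x) : V"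
  using CV sub by (auto intro!: subspace_sum subspace_scale)
  then show ?case using insert C(4)[of x] CV by (auto simp: tauadd tauscale)
  qed (auto simp: t0)
  then show ?thesis by blast
 qed
 have inj: "inj_on ?f (C \<rightarrow>\<^sub>E ?K)"
 proof (rule inj_onI)
  fix c d assume cd: "c : C \<rightarrow>\<^sub>E ?K" "d : C \<rightarrow>\<^sub>E ?K" "?f c = ?f d"
  then have "(\<Sum>x\<in>C. scale (c x - d x) x) = 0"
  by (simp add: scale_left_diff_distrib sum_subtractf)
  then have "c x - d x = 0" if "x : C" for x
  using independentD[OF C(2) C(1) order_refl _ that, of "%x. c x - d x"] by simp
  then show "c = d" using cd by (intro PiE_ext[OF cd(1,2)]) auto
 qed
 have img: "?f ` (C \<rightarrow>\<^sub>E ?K) = {v : V. tau v = v}"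
 proof (intro equalityI subsetI)
  fix v assume "v : ?f ` (C \<rightarrow>\<^sub>E ?K)"
  then obtain c where c: "c : C \<rightarrow>\<^sub>E ?K" "v = ?f c" by blast
  have "tau v = v" using c(1) unfolding c(2) tauf by (intro sum.cong) (auto simp: PiE_iff)
  moreover have "v : V" using c CV sub by (auto intro!: subspace_sum subspace_scale)
  ultimately show "v : {v : V. tau v = v}" by simp
 next
  fix v assume "v : {v : V. tau v = v}"
  then have v: "v : V" "tau v = v" by auto
  then obtain c where c: "v = ?f c" using C(3) span_finite[OF C(1)] by auto
  have "(\<Sum>x\<in>C. scale (c x ^ s - c x) x) = 0"
  using v(2) unfolding c tauf by (simp add: scale_left_diff_distrib sum_subtractf)
  then have "c x ^ s - c x = 0" if "x : C" for x
  using independentD[OF C(2) C(1) order_refl _ that, of "%x. c x ^ s - c x"] by simp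
  then have "restrict c C : C \<rightarrow>\<^sub>E ?K" by (auto simp: PiE_iff)
  then show "v : ?f ` (C \<rightarrow>\<^sub>E ?K)"
  by (rule rev_image_eqI) (auto simp: c intro!: sum.cong)
 qed
 have "card {v : V. tau v = v} = card (C \<rightarrow>\<^sub>E ?K)" unfolding img[symmetric] by (rule card_image[OF inj])
 also have "... = s ^ dim V" using card_fixed[of 1] C by (simp add: card_PiE)
 finally show "card {v : V. tau v = v} = s ^ dim V" .
 show "finite {v : V. tau v = v}"
  unfolding img[symmetric] using C finite_fixed[of 1] by (intro finite_imageI finite_PiE) auto
qed

end

sublocale frob \<subseteq> fvf: frob_space ty s "fscale :: 'a => ('i => 'a) => _"
 by unfold_locales

section \<open>Finite fields and their algebraic closures\<close>

text \<open>Multiplication by a nonzero \<open>x\<close> permutes the nonzero elements; comparing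
  the two products gives Fermat's little theorem.\<close>

lemma finite_field_power_card:
 fixes x :: "'k::field"
 assumes "finite (UNIV :: 'k set)"
 shows "x ^ card (UNIV :: 'k set) = x"
proof (cases "x = 0")
 case False
 have pos: "card (UNIV :: 'k set) > 0" using assms by (simp add: card_gt_0_iff)
 have "x * (\<Prod>y\<in>UNIV-{0}. x * y) = x * x ^ (card (UNIV :: 'k set) - 1) * \<Prod>(UNIV-{0})"
  using assms by (simp add: prod.distrib mult_ac)
 also have "x * x ^ (card (UNIV :: 'k set) - 1) = x ^ card (UNIV :: 'k set)"
  using pos by (metis Suc_diff_1 power_Suc)
 also have "(\<Prod>y\<in>UNIV-{0}. x * y) = (\<Prod>y\<in>UNIV-{0}. y)"
  by (rule prod.reindex_bij_witness[of _ "%y. y / x" "%y. x * y"]) (use False in auto)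
 finally show ?thesis using assms by simp
qed (use assms in \<open>auto simp: card_gt_0_iff\<close>)

text \<open>The polynomial splits into linear factors, and a repeated factor would make the
  derivative vanish at its root.\<close>

lemma card_roots_separable:
 fixes p :: "'a::alg_closed_field poly"
 assumes "p ~= 0" "!!x. poly (pderiv p) x ~= 0"
 shows "card {x. poly p x = 0} = degree p"
proof -
 obtain A where A: "size A = degree p" "p = smult (lead_coeff p) (\<Prod>x\<in>#A. [:-x, 1:])"
  using alg_closed_imp_factorization[OF assms(1)] by blast
 have c1: "count A a <= 1" for a
 proof (rule ccontr)
  assume "~ count A a <= 1"
  then have "replicate_mset 2 a \<subseteq># A" by (simp flip: count_le_replicate_mset_subset_eq)
  then obtain B where "A = replicate_mset 2 a + B" using subset_mset.le_iff_add by blast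
  then have "A = add_mset a (add_mset a B)" by (simp add: numeral_2_eq_2)
  then have "p = [:-a, 1:] * ([:-a, 1:] * smult (lead_coeff p) (\<Prod>x\<in>#B. [:-x, 1:]))"
  using A(2) by (simp add: mult_ac)
  then obtain r where pr: "p = [:-a, 1:] * ([:-a, 1:] * r)" by blast
  have "poly (pderiv p) a = 0" unfolding pr pderiv_mult poly_add poly_mult by simp
  then show False using assms(2) by blast
 qed
 have "poly p x = 0 \<longleftrightarrow> x \<in># A" for x
 proof -
  have "poly p x = lead_coeff p * (\<Prod>y\<in>#A. x - y)"
  by (subst A(2)) (simp add: poly_prod_mset)
  then show ?thesis using assms(1) by (auto simp: prod_mset_zero_iff)
 qed
 then have "{x. poly p x = 0} = set_mset A" by auto
 also have "card (set_mset A) = size A"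
 proof -
  have "size A = (\<Sum>x\<in>set_mset A. count A x)" by (simp add: size_multiset_overloaded_eq)
  also have "... = (\<Sum>x\<in>set_mset A. 1)"
  using c1 by (intro sum.cong refl) (metis count_greater_zero_iff le_antisym Suc_leI One_nat_def)
  finally show ?thesis by simp
 qed
 finally show ?thesis using A(1) by simp
qed

lemma primepow_card_eq_CHAR_power:
 assumes "primepow q" "card (UNIV :: 'k::field set) = q"
 obtains n where "q = CHAR('k) ^ n" "prime CHAR('k)" "n > 0"
proof -
 have fin: "finite (UNIV :: 'k set)"
  using assms primepow_gt_Suc_0[of q] by (intro card_ge_0_finite) simp
 have pr: "prime CHAR('k)"
  using prime_CHAR_semidom[where ?'a = 'k] finite_imp_CHAR_pos[OF fin] by simp
 have "CHAR('k) dvd q" using CHAR_dvd_CARD[where ?'a = 'k] assms by simp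
 moreover obtain r n where r: "prime r" "n > 0" "q = r ^ n"
  using assms(1) by (auto simp: primepow_def)
 ultimately have "CHAR('k) = r" using pr
  by (metis prime_dvd_power primes_dvd_imp_eq)
 then show thesis using that[of n] r by simp
qed

text \<open>Additivity is the freshman's dream. For periodicity, all powers of an algebraic
  \<open>x\<close> lie in the finite set of combinations of \<open>1, x, ..., x ^ (d - 1)\<close>
  over the base field, so two Frobenius iterates of \<open>x\<close> coincide, and injectivity
  cancels the smaller exponent. The fixed points of the \<open>N\<close>-th iterate are the roots of
  X^(q^N) - X, which is separable because its derivative is -1.\<close>

lemma frob_alg_closure:
 assumes q: "primepow q" "card (UNIV :: 'k::field set) = q"
 shows "frob TYPE('k alg_closure) q"
proof (rule frob.intro)
 obtain n where n: "q = CHAR('k) ^ n" "prime CHAR('k)" "n > 0"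
  using primepow_card_eq_CHAR_power[OF q] by blast
 have fin: "finite (UNIV :: 'k set)"
  using q primepow_gt_Suc_0[of q] by (intro card_ge_0_finite) simp
 show q1: "1 < q" using primepow_gt_Suc_0[OF q(1)] by simp
 show add: "(x + y) ^ q = x ^ q + y ^ q" for x y :: "'k alg_closure"
  by (rule freshmans_dream'[where n = n]) (simp_all add: n)
 have diff: "(x - y) ^ q = x ^ q - y ^ q" for x y :: "'k alg_closure"
  using add[of "x - y" y] by (simp add: algebra_simps)
 have inj: "x = y" if "x ^ q = y ^ q" for x y :: "'k alg_closure"
  using diff[of x y] that q1 by simp
 have comm: "x ^ (q ^ N) = y ^ (q ^ N) ==> x = y" for x y :: "'k alg_closure" and N
 proof (induction N)
  case (Suc N)
  then show ?case using inj[of "x ^ (q ^ N)" "y ^ (q ^ N)"]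
  by (metis power_Suc2 power_mult)
 qed simp
 show "EX N>0. x ^ (q ^ N) = x" for x :: "'k alg_closure"
 proof -
  obtain p :: "'k poly" where p: "p ~= 0" "poly (map_poly to_ac p) x = 0"
  using alg_closure_algebraic by blast
  define d where "d = degree p"
  define c where "c i = - coeff p i / lead_coeff p" for i
  have lc: "lead_coeff p ~= 0" using p by simp
  have "(\<Sum>i\<le>d. to_ac (coeff p i) * x ^ i) = 0"
  using p(2) by (simp add: poly_altdef coeff_map_poly degree_map_poly d_def)
  then have "(\<Sum>i<d. to_ac (coeff p i) * x ^ i) + to_ac (lead_coeff p) * x ^ d = 0"
  by (simp add: lessThan_Suc_atMost[symmetric] d_def)
  then have "to_ac (lead_coeff p) * x ^ d = - (\<Sum>i<d. to_ac (coeff p i) * x ^ i)"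
  by (simp add: eq_neg_iff_add_eq_0 add.commute)
  then have "x ^ d = - (\<Sum>i<d. to_ac (coeff p i) * x ^ i) / to_ac (lead_coeff p)"
  using lc by (simp add: field_simps)
  then have xd: "x ^ d = (\<Sum>i<d. to_ac (c i) * x ^ i)"
  by (simp add: c_def sum_negf sum_divide_distrib)
  define S where "S = (%a. \<Sum>i<d. to_ac (a i) * x ^ i) ` ({..<d} \<rightarrow>\<^sub>E (UNIV :: 'k set))"
  have finS: "finite S" unfolding S_def using fin by (intro finite_imageI finite_PiE) auto
  have SI: "(\<Sum>i<d. to_ac (a i) * x ^ i) : S" for a
  unfolding S_def by (rule image_eqI[where x = "restrict a {..<d}"]) (auto intro!: sum.cong)
  have d0: "d > 0"
  proof (rule ccontr)
  assume "~ d > 0"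
  then show False using xd by simp
  qed
  have S1: "1 : S"
  proof -
  have "(\<Sum>i<d. to_ac (if i = 0 then 1 else 0 :: 'k) * x ^ i) = (\<Sum>i<d. if i = 0 then 1 else 0)"
  by (intro sum.cong) auto
  then show ?thesis using SI[of "%i. if i = 0 then 1 else 0"] d0 by (simp add: sum.delta)
  qed
  \<comment> \<open>The shift by \<open>x\<close> produces one term with \<open>x ^ d\<close>, which
    the monic relation \<open>xd\<close> rewrites in lower powers.\<close>
  have Sx: "y * x : S" if "y : S" for y
  proof -
  obtain a where a: "y = (\<Sum>i<d. to_ac (a i) * x ^ i)" using \<open>y : S\<close> by (auto simp: S_def)
  obtain d' where d': "d = Suc d'" using d0 gr0_implies_Suc by blast
  have "y * x = (\<Sum>i<d. to_ac (a i) * x ^ Suc i)"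
  unfolding a by (simp add: sum_distrib_right sum_distrib_left mult_ac)
  also have "... = (\<Sum>i<d'. to_ac (a i) * x ^ Suc i) + to_ac (a d') * x ^ d" by (simp add: d')
  also have "(\<Sum>i<d'. to_ac (a i) * x ^ Suc i) = (\<Sum>i<d. to_ac (if i = 0 then 0 else a (i - 1)) * x ^ i)"
  unfolding d' by (subst sum.lessThan_Suc_shift) simp
  also have "to_ac (a d') * x ^ d = (\<Sum>i<d. to_ac (a d' * c i) * x ^ i)"
  unfolding xd by (simp add: sum_distrib_left mult_ac)
  finally have "y * x = (\<Sum>i<d. to_ac ((if i = 0 then 0 else a (i - 1)) + a d' * c i) * x ^ i)"
  by (simp add: sum.distrib distrib_right del: to_ac_mult)
  then show ?thesis using SI by metis
  qed
  have "x ^ k : S" for k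
  by (induction k) (auto simp: S1 mult.commute dest: Sx)
  then have "range (%i. x ^ (q ^ i)) \<subseteq> S" by auto
  then have "~ inj (%i. x ^ (q ^ i))" using finS finite_subset range_inj_infinite by blast
  then obtain i j where ij: "i < j" "x ^ (q ^ i) = x ^ (q ^ j)"
  unfolding inj_def by (metis linorder_neqE_nat)
  then have "x ^ (q ^ i) = (x ^ (q ^ (j - i))) ^ (q ^ i)"
  by (metis le_add_diff_inverse2 less_imp_le power_add power_mult)
  then have "x = x ^ (q ^ (j - i))" using comm by blast
  then show ?thesis using ij by (intro exI[of _ "j - i"]) auto
 qed
 show "card {x::'k alg_closure. x ^ (q ^ N) = x} = q ^ N" if "N > 0" for N
 proof -
  define m where "m = q ^ N"
  have m: "m > 1" unfolding m_def by (rule one_less_power[OF q1 that])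
  have m0: "(of_nat m :: 'k alg_closure) = 0"
  proof -
  have "CHAR('k) dvd m" using n that unfolding m_def n(1) power_mult[symmetric] by (intro dvd_power) simp
  then show ?thesis by (simp add: of_nat_eq_0_iff_char_dvd)
  qed
  define P :: "'k alg_closure poly" where "P = monom 1 m - monom 1 1"
  have deg: "degree P = m"
  proof -
  have "degree P = degree (monom (1 :: 'k alg_closure) m)"
  unfolding P_def using m degree_add_eq_left[of "- monom (1 :: 'k alg_closure) 1" "monom 1 m"] by (simp add: degree_monom_eq)
  then show ?thesis by (simp add: degree_monom_eq)
  qed
  have "P ~= 0" using deg m by auto
  moreover have "poly (pderiv P) x ~= 0" for x
  using m0 by (simp add: P_def pderiv_diff pderiv_monom)
  ultimately have "card {x. poly P x = 0} = m" using card_roots_separable deg by blast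
  then show ?thesis by (simp add: P_def poly_monom m_def)
 qed
qed

text \<open>The base field consists of fixed elements, and both sets have \<open>q\<close> elements.
  This is the entry point for descent: fixed coordinates come from the base field.\<close>

lemma fixed_eq_range_to_ac:
 assumes q: "primepow q" "card (UNIV :: 'k::field set) = q"
 shows "{x :: 'k alg_closure. x ^ q = x} = range to_ac"
proof -
 interpret frob "TYPE('k alg_closure)" q by (rule frob_alg_closure[OF q])
 have fin: "finite (UNIV :: 'k set)"
  using q primepow_gt_Suc_0[of q] by (intro card_ge_0_finite) simp
 have "range to_ac \<subseteq> {x :: 'k alg_closure. x ^ q = x}"
  using finite_field_power_card[OF fin] q by (auto simp flip: to_ac_power)
 moreover have "card (range (to_ac :: 'k => _)) = q" using q by (simp add: card_image inj_to_ac)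
 ultimately show ?thesis using card_fixed[of 1] finite_fixed[of 1]
  by (intro card_subset_eq[symmetric]) auto
qed

section \<open>Counting fibres; orthogonal complements over a finite subfield\<close>

lemma card_eq_sum_fibers:
 assumes "finite A"
 shows "card A = (\<Sum>y\<in>f ` A. card {x : A. f x = y})"
proof -
 have "card A = card (\<Union>y\<in>f ` A. {x : A. f x = y})" by (rule arg_cong[where f = card]) auto
 also have "... = (\<Sum>y\<in>f ` A. card {x : A. f x = y})"
  using assms by (intro card_UN_disjoint) auto
 finally show ?thesis .
qed

text \<open>All fibres over the image are translates of the kernel.\<close>

lemma card_image_mult_card_kernel:
 fixes f :: "'b::ab_group_add => 'c::ab_group_add"
 assumes fin: "finite A" and diff: "!!x y. x : A ==> y : A ==> x - y : A"
  and add: "!!x y. x : A ==> y : A ==> x + y : A"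
  and f: "!!x y. x : A ==> y : A ==> f (x + y) = f x + f y"
 shows "card A = card (f ` A) * card {x : A. f x = 0}"
proof -
 have fd: "f (x - y) = f x - f y" if "x : A" "y : A" for x y
  using f[OF diff[OF that] that(2)] by (simp add: eq_diff_eq)
 have "card {x : A. f x = y} = card {x : A. f x = 0}" if y: "y : f ` A" for y
 proof -
  obtain a where a: "a : A" "y = f a" using y by auto
  have "bij_betw (%x. x - a) {x : A. f x = y} {x : A. f x = 0}"
  by (rule bij_betw_byWitness[where f' = "%x. x + a"]) (auto simp: a diff add fd f)
  then show ?thesis by (rule bij_betw_same_card)
 qed
 then show ?thesis by (subst card_eq_sum_fibers[OF fin, of f]) simp
qed

lemma fscale_one [simp]: "fscale 1 v = v"
 by (simp add: fscale_def)

lemma fscale_apply: "fscale c v i = c * v i"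
 by (simp add: fscale_def)

text \<open>The finite field is a set inside a larger field rather than a type, because it will be
  the fixed field of a varying power of Frobenius in one algebraic closure.\<close>

locale finite_subfield =
 fixes kk :: "'a::field set"
 assumes finite_kk: "finite kk" and zero_kk [simp]: "0 : kk" and one_kk [simp]: "1 : kk"
  and add_kk: "!!x y. x : kk ==> y : kk ==> x + y : kk"
  and mult_kk: "!!x y. x : kk ==> y : kk ==> x * y : kk"
  and minus_kk: "!!x. x : kk ==> - x : kk"
  and inverse_kk: "!!x. x : kk ==> inverse x : kk"
begin

lemma sum_kk: "(!!x. x : A ==> f x : kk) ==> sum f A : kk"
 by (induction A rule: infinite_finite_induct) (auto intro: add_kk)

lemma diff_kk: "x : kk ==> y : kk ==> x - y : kk"
 using add_kk[of x "-y"] minus_kk by simp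

text \<open>The coordinate space \<open>kk\<close>^J, extended by zero so that spaces of different
  dimensions share a type.\<close>

definition spk :: "'j set => ('j => 'a) set" where
 "spk J = {v. (ALL j:J. v j : kk) & (ALL j. j \<notin> J --> v j = 0)}"

definition ksub :: "('j => 'a) set => bool" where
 "ksub S \<longleftrightarrow> 0 : S & (ALL x:S. ALL y:S. x + y : S) & (ALL c:kk. ALL x:S. fscale c x : S)"

lemma ksubD:
 assumes "ksub S"
 shows "0 : S" "x : S ==> y : S ==> x + y : S" "c : kk ==> x : S ==> fscale c x : S"
  "x : S ==> - x : S" "x : S ==> y : S ==> x - y : S"
proof -
 show 1: "0 : S" "x : S ==> y : S ==> x + y : S" "c : kk ==> x : S ==> fscale c x : S" for x y c
  using assms by (auto simp: ksub_def)
 have "- x = fscale (-1) x" for x :: "'b => 'a" by (auto simp: fscale_def)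
 then show 2: "x : S ==> - x : S" for x using 1(3)[of "-1" x] minus_kk by simp
 show "x : S ==> y : S ==> x - y : S" using 1(2)[of x "-y"] 2[of y] by simp
qed

lemma ksub_sum: "ksub S ==> (!!x. x : A ==> f x : S) ==> sum f A : S"
 by (induction A rule: infinite_finite_induct) (auto intro: ksubD)

lemma ksub_spk: "ksub (spk J)"
 by (auto simp: ksub_def spk_def fscale_def intro: add_kk mult_kk)

lemma spk_iff: "v : spk J \<longleftrightarrow> (ALL j. v j : kk) & (ALL j. j \<notin> J --> v j = 0)"
 by (auto simp: spk_def)

lemma card_spk:
 assumes "finite J"
 shows "finite (spk J)" "card (spk J) = card kk ^ card J"
proof -
 have "bij_betw (%v. restrict v J) (spk J) (J \<rightarrow>\<^sub>E kk)"
  by (rule bij_betw_byWitness[where f' = "%v j. if j : J then v j else 0"])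
  (auto simp: spk_def fun_eq_iff PiE_iff extensional_def)
 then show "finite (spk J)" "card (spk J) = card kk ^ card J"
  using assms finite_kk finite_PiE[of J "%_. kk"]
  by (auto simp: bij_betw_finite bij_betw_same_card[of _ "spk J"] card_PiE)
qed

definition dot :: "'j set => ('j => 'a) => ('j => 'a) => 'a" where
 "dot J v w = (\<Sum>j\<in>J. v j * w j)"

lemma dot_add: "dot J (u + v) w = dot J u w + dot J v w" "dot J w (u + v) = dot J w u + dot J w v"
 and dot_scale: "dot J (fscale c v) w = c * dot J v w" "dot J v (fscale c w) = c * dot J v w"
 and dot_zero [simp]: "dot J 0 w = 0" "dot J w 0 = 0"
 and dot_commute: "dot J v w = dot J w v"
 by (simp_all add: dot_def sum.distrib sum_distrib_left fscale_def algebra_simps)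

lemma dot_unit:
 assumes "finite J" "i : J"
 shows "dot J (%j. if j = i then 1 else 0) w = w i"
proof -
 have "dot J (%j. if j = i then 1 else 0) w = (\<Sum>j\<in>J. if j = i then w j else 0)"
  unfolding dot_def by (intro sum.cong) auto
 then show ?thesis using assms by simp
qed

lemma unit_spk: "i : J ==> (%j. if j = i then 1 else 0) : spk J"
 by (auto simp: spk_def)

lemma dot_nondegenerate:
 assumes "finite J" "w : spk J" "!!v. v : spk J ==> dot J v w = 0"
 shows "w = 0"
proof
 fix i show "w i = 0 i"
  using assms dot_unit[of J i w] unit_spk[of i J] by (cases "i : J") (auto simp: spk_def)
qed

definition perp :: "'j set => ('j => 'a) set => ('j => 'a) set" where
 "perp J S = {w : spk J. ALL v:S. dot J v w = 0}"

text \<open>Induction on the coordinates. If all vectors of \<open>S\<close> vanish at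
  \<open>i\<close>, the coordinate \<open>i\<close> of an annihilating vector is free. Otherwise a
  vector \<open>u\<close> of \<open>S\<close> with \<open>u i = 1\<close> splits off, leaving
  \<open>S0\<close>, and determines the coordinate \<open>i\<close> of every annihilating vector. In
  both cases the product gains one factor \<open>card kk\<close>.\<close>

lemma card_perp:
 assumes "finite J" "ksub S" "S \<subseteq> spk J"
 shows "card S * card (perp J S) = card kk ^ card J"
 using assms
proof (induction J arbitrary: S rule: finite_induct)
 case empty
 then have "S = {0}" "perp {} S = {0}"
  by (auto simp: spk_def ksub_def perp_def dot_def fun_eq_iff)
 then show ?case by simp
next
 case (insert i J)
 note sub = ksubD[OF insert.prems(1)]
 have finS: "finite S" using insert card_spk(1)[of "insert i J"] finite_subset by blast
 define S0 where "S0 = {v : S. v i = 0}"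
 have "ksub S0" using sub by (auto simp: S0_def ksub_def fscale_apply)
 moreover have "v : spk J" if "v : S0" for v
  using that subsetD[OF insert.prems(2), of v] by (auto simp: S0_def spk_def)
 ultimately have S0: "ksub S0" "S0 \<subseteq> spk J" by auto
 note IH = insert.IH[OF S0]
 have dot_ins: "dot (insert i J) v w = v i * w i + dot J v w" for v w
  using insert.hyps by (simp add: dot_def)
 have dot_upd: "dot J v (w(i := c)) = dot J v w" for v w c
  unfolding dot_def using insert.hyps by (intro sum.cong) auto
 show ?case
 proof (cases "ALL v:S. v i = 0")
  case True
  then have SS: "S0 = S" by (auto simp: S0_def)
  have d0: "dot (insert i J) v w = dot J v w" if "v : S" for v w
  using True that by (simp add: dot_ins)
  have "bij_betw (%(w, c). w(i := c)) (perp J S0 \<times> kk) (perp (insert i J) S)"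
  using insert.hyps
  by (intro bij_betw_byWitness[where f' = "%w. (w(i := 0), w i)"])
  (auto simp: perp_def spk_def SS d0 dot_upd fun_eq_iff)
  then have "card (perp (insert i J) S) = card (perp J S0) * card kk"
  by (metis bij_betw_same_card card_cartesian_product)
  then show ?thesis using IH SS insert.hyps by (simp add: mult_ac)
 next
  case False
  then obtain u0 where u0: "u0 : S" "u0 i ~= 0" by auto
  define u where "u = fscale (inverse (u0 i)) u0"
  have "u0 i : kk" using u0 insert.prems by (auto simp: spk_def)
  then have u: "u : S" "u i = 1"
  using u0 sub inverse_kk by (auto simp: u_def fscale_def)
  have ukk: "u j : kk" for j using u insert.prems by (auto simp: spk_iff)
  have Skk: "v j : kk" if "v : S" for v j using that insert.prems by (auto simp: spk_iff)
  have "bij_betw (%(c, v). fscale c u + v) (kk \<times> S0) S"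
  proof (rule bij_betw_byWitness[where f' = "%v. (v i, v - fscale (v i) u)"])
  show "(%(c, v). fscale c u + v) ` (kk \<times> S0) \<subseteq> S" using u sub by (auto simp: S0_def)
  show "(%v. (v i, v - fscale (v i) u)) ` S \<subseteq> kk \<times> S0"
  using u sub Skk by (auto simp: S0_def fscale_apply)
  qed (use u in \<open>auto simp: S0_def fscale_apply\<close>)
  then have cS: "card S = card kk * card S0"
  by (metis bij_betw_same_card card_cartesian_product)
  have dkk: "dot J v w : kk" if "w : spk J" "v : S" for v w
  unfolding dot_def using that Skk by (intro sum_kk mult_kk) (auto simp: spk_iff)
  \<comment> \<open>The value at \<open>i\<close> is what orthogonality to \<open>u\<close> forces;
    since every \<open>v\<close> in \<open>S\<close> differs from a multiple of \<open>u\<close> by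
    an element of \<open>S0\<close>, orthogonality to \<open>S0\<close> in the other coordinates is
    the remaining condition.\<close>
  have "bij_betw (%w. w(i := - dot J u w)) (perp J S0) (perp (insert i J) S)"
  proof (rule bij_betw_byWitness[where f' = "%w. w(i := 0)"])
  show "ALL w:perp J S0. (w(i := - dot J u w))(i := 0) = w"
  using insert.hyps by (auto simp: perp_def spk_def fun_eq_iff)
  have "dot (insert i J) u w = w i + dot J u w" for w using u by (simp add: dot_ins)
  then have eq: "w i = - dot J u w" if "w : perp (insert i J) S" for w
  using that u(1) by (auto simp: perp_def eq_neg_iff_add_eq_0)
  show "ALL w:perp (insert i J) S. (w(i := 0))(i := - dot J u (w(i := 0))) = w"
  using eq by (auto simp: dot_upd fun_eq_iff)
  show "(%w. w(i := 0)) ` perp (insert i J) S \<subseteq> perp J S0"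
  by (auto simp: perp_def spk_def S0_def dot_ins dot_upd)
  show "(%w. w(i := - dot J u w)) ` perp J S0 \<subseteq> perp (insert i J) S"
  proof safe
  fix w assume w: "w : perp J S0"
  have "dot (insert i J) v (w(i := - dot J u w)) = 0" if v: "v : S" for v
  proof -
  have "v - fscale (v i) u : S0" using v u sub Skk by (auto simp: S0_def fscale_apply)
  then have "dot J (v - fscale (v i) u) w = 0" using w by (auto simp: perp_def)
  then have "dot J ((v - fscale (v i) u) + fscale (v i) u) w = v i * dot J u w"
  by (simp only: dot_add dot_scale add_0)
  then show ?thesis by (simp add: dot_ins dot_upd)
  qed
  moreover have "w(i := - dot J u w) : spk (insert i J)"
  using w dkk[OF _ u(1), of w] minus_kk by (auto simp: perp_def spk_def)
  ultimately show "w(i := - dot J u w) : perp (insert i J) S" by (auto simp: perp_def)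
  qed
  qed
  then have "card (perp (insert i J) S) = card (perp J S0)" by (simp add: bij_betw_same_card)
  then show ?thesis using IH cS insert.hyps by (simp add: mult_ac)
 qed
qed

text \<open>A matrix and its transpose have equal nullity: the annihilator of the image of
  \<open>L\<close> is the kernel of \<open>L'\<close>, and its size is compared with that of the
  kernel of \<open>L\<close> by \<open>card_perp\<close> and the fibre count.\<close>

lemma card_kernel_adjoint:
 assumes J: "finite J"
  and L: "!!v. v : spk J ==> L v : spk J" "!!v w. L (v + w) = L v + L w"
  "!!c v. L (fscale c v) = fscale c (L v)"
  and L': "!!v. v : spk J ==> L' v : spk J"
  and adj: "!!v w. v : spk J ==> w : spk J ==> dot J (L v) w = dot J v (L' w)"
 shows "card {v : spk J. L v = 0} = card {w : spk J. L' w = 0}"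
proof -
 note sub = ksubD[OF ksub_spk[of J]]
 note fin = card_spk[OF J]
 have "ksub (L ` spk J)"
  using sub L(2,3) unfolding ksub_def
  by (auto simp: image_iff) (metis fv.scale_zero_left, metis, metis)
 then have 1: "card (L ` spk J) * card (perp J (L ` spk J)) = card (spk J)"
  using card_perp[OF J, of "L ` spk J"] L(1) fin by auto
 have 2: "card (spk J) = card (L ` spk J) * card {v : spk J. L v = 0}"
  by (rule card_image_mult_card_kernel) (auto simp: fin sub L)
 have 3: "perp J (L ` spk J) = {w : spk J. L' w = 0}"
  using dot_nondegenerate[OF J L'] adj by (auto simp: perp_def)
 have "card (spk J) > 0" unfolding card_gt_0_iff using fin(1) sub(1) by blast
 then have "card (L ` spk J) > 0" using 2 by (metis gr0I mult_0)
 then show ?thesis using 1 2 3 by simp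
qed

section \<open>Modules with one operator and the invariant relations between them\<close>

definition krel :: "(('i => 'a) \<times> ('j => 'a)) set => bool" where
 "krel R \<longleftrightarrow> (0, 0) : R & (ALL x y x' y'. (x, y) : R --> (x', y') : R --> (x + x', y + y') : R) \<and>
  (ALL c:kk. ALL x y. (x, y) : R --> (fscale c x, fscale c y) : R)"

lemma krelD:
 assumes "krel R"
 shows "(0, 0) : R" "(x, y) : R ==> (x', y') : R ==> (x + x', y + y') : R"
  "c : kk ==> (x, y) : R ==> (fscale c x, fscale c y) : R"
  "(x, y) : R ==> (x', y') : R ==> (x - x', y - y') : R"
proof -
 show 1: "(0, 0) : R" "(x, y) : R ==> (x', y') : R ==> (x + x', y + y') : R"
  "c : kk ==> (x, y) : R ==> (fscale c x, fscale c y) : R" for x y x' y' c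
  using assms by (auto simp: krel_def)
 have "- x = fscale (-1) x" for x :: "'k => 'a" by (auto simp: fscale_def)
 then show "(x, y) : R ==> (x', y') : R ==> (x - x', y - y') : R"
  using 1(2)[of x y "- x'" "- y'"] 1(3)[of "-1" x' y'] minus_kk
  by (metis add_uminus_conv_diff one_kk)
qed

lemma krel_sum: "krel R ==> (!!x. x : A ==> (f x, g x) : R) ==> (sum f A, sum g A) : R"
 by (induction A rule: infinite_finite_induct) (auto intro: krelD)

lemma krel_converse: "krel R ==> krel (R\<inverse>)"
 by (auto simp: krel_def)

text \<open>A finite module over the polynomial ring in one variable with coefficients in
  \<open>kk\<close>, the variable acting by \<open>g\<close>. \<open>Subs\<close> are its
  submodules, and \<open>Rl\<close> are the submodules of the direct sum of two such
  modules.\<close>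

definition kmod :: "('i => 'a) set => (('i => 'a) => ('i => 'a)) => bool" where
 "kmod S g \<longleftrightarrow> finite S & ksub S & g ` S \<subseteq> S & (ALL x:S. ALL y:S. g (x + y) = g x + g y) \<and>
  (ALL c:kk. ALL x:S. g (fscale c x) = fscale c (g x))"

lemma kmodD:
 assumes "kmod S g"
 shows "finite S" "ksub S" "x : S ==> g x : S" "x : S ==> y : S ==> g (x + y) = g x + g y"
  "c : kk ==> x : S ==> g (fscale c x) = fscale c (g x)"
 using assms by (auto simp: kmod_def)

lemma kmod_zero: "kmod S g ==> g 0 = 0"
 using kmodD(5)[of S g 0 0] ksubD(1)[of S] by (simp add: kmodD)

lemma kmod_sum: "kmod S g ==> (!!x. x : A ==> f x : S) ==> g (sum f A) = (\<Sum>x\<in>A. g (f x))"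
 by (induction A rule: infinite_finite_induct) (auto simp: kmod_zero kmodD(2,4) ksub_sum)

definition Rl where
 "Rl S g T h = {R. R \<subseteq> S \<times> T & krel R & (ALL x y. (x, y) : R --> (g x, h y) : R)}"

text \<open>Homomorphisms are encoded as graphs, which makes them special relations: full domain
  says total, zero indeterminacy says single-valued. In this encoding \<open>Pars\<close> are the
  isomorphisms between a submodule of \<open>S\<close> and a submodule of \<open>T\<close>.\<close>

definition Hm where
 "Hm S g T h = {R : Rl S g T h. Def_rel R = S & Ind_rel R = {0}}"
definition Injs where
 "Injs S g T h = {R : Rl S g T h. Def_rel R = S & Ind_rel R = {0} & Ker_rel R = {0}}"
definition Surs where
 "Surs S g T h = {R : Rl S g T h. Def_rel R = S & Ind_rel R = {0} & Im_rel R = T}"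
definition Pars where
 "Pars S g T h = {R : Rl S g T h. Ker_rel R = {0} & Ind_rel R = {0}}"
definition Subs where
 "Subs S g = {U. U \<subseteq> S & ksub U & g ` U \<subseteq> U}"

lemma finite_Rl: "kmod S g ==> kmod T h ==> finite (Rl S g T h)"
 by (rule finite_subset[of _ "Pow (S \<times> T)"]) (auto simp: Rl_def kmod_def)

lemma finite_Subs: "kmod S g ==> finite (Subs S g)"
 by (rule finite_subset[of _ "Pow S"]) (auto simp: Subs_def kmod_def)

lemma kmod_Subs:
 assumes "kmod S g" "U : Subs S g"
 shows "kmod U g"
proof -
 have U: "U \<subseteq> S" "ksub U" "g ` U \<subseteq> U" using assms(2) by (auto simp: Subs_def)
 note S = kmodD[OF assms(1)]
 show ?thesis unfolding kmod_def
  using U S(1,2) by (intro conjI ballI S(4,5)) (auto intro: finite_subset)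
qed

lemma finite_Hm:
 "kmod S g ==> kmod T h ==> finite (Hm S g T h)"
 "kmod S g ==> kmod T h ==> finite (Injs S g T h)"
 "kmod S g ==> kmod T h ==> finite (Surs S g T h)"
 "kmod S g ==> kmod T h ==> finite (Pars S g T h)"
 unfolding Hm_def Injs_def Surs_def Pars_def by (auto intro: finite_subset[OF _ finite_Rl[of S g T h]])

lemma converse_simps:
 "Ker_rel (R\<inverse>) = Ind_rel R" "Ind_rel (R\<inverse>) = Ker_rel R"
 "Def_rel (R\<inverse>) = Im_rel R" "Im_rel (R\<inverse>) = Def_rel R"
 by (auto simp: Ker_rel_def Ind_rel_def Def_rel_def Im_rel_def)

lemma Rl_converse: "R : Rl S g T h ==> R\<inverse> : Rl T h S g"
 by (auto simp: Rl_def krel_converse)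

lemma Im_Subs:
 assumes "R : Rl S g T h"
 shows "Im_rel R : Subs T h"
proof -
 have R: "R \<subseteq> S \<times> T" "krel R" "!!x y. (x, y) : R ==> (g x, h y) : R"
  using assms by (auto simp: Rl_def)
 show ?thesis unfolding Subs_def Im_rel_def ksub_def
  using R(1) krelD(1-3)[OF R(2)] R(3) by fast
qed

lemma Def_Subs: "R : Rl S g T h ==> Def_rel R : Subs S g"
 using Im_Subs[OF Rl_converse] by (simp add: converse_simps)

lemma inj_fst:
 assumes "R : Rl S g T h" "Ind_rel R = {0}"
 shows "inj_on fst R"
proof (rule inj_onI, clarify)
 fix x y x' y' assume xy: "(x, y) : R" "(x', y') : R" "fst (x, y) = fst (x', y')"
 have "(x - x', y - y') : R" using assms(1) xy krelD(4)[of R x y x' y'] by (simp add: Rl_def)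
 then have "y - y' : Ind_rel R" using xy by (simp add: Ind_rel_def)
 then show "x = x' & y = y'" using xy assms by simp
qed

lemma card_Ind:
 assumes "R : Rl S g T h" "Ind_rel R = {0}"
 shows "card R = card (Def_rel R)"
proof -
 have "Def_rel R = fst ` R" by (force simp: Def_rel_def)
 then show ?thesis using card_image[OF inj_fst[OF assms]] by simp
qed

lemma card_Ker: "R : Rl S g T h ==> Ker_rel R = {0} ==> card R = card (Im_rel R)"
 using card_Ind[OF Rl_converse, of R S g T h] by (simp add: converse_simps card_inverse)

lemma Rl_functional: "R : Rl S g T h ==> Ind_rel R = {0} ==> (x, y) : R ==> (x, y') : R ==> y = y'"
 using inj_fst[of R S g T h] unfolding inj_on_def by force

text \<open>The graph has exactly \<open>card S\<close> elements, and the homomorphism is injective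
  when the second projection loses none of them.\<close>

lemma Hm_inj_iff:
 assumes R: "R : Hm S g T h" and fin: "finite S" "finite T"
 shows "card (Im_rel R) <= card S" "Ker_rel R = {0} \<longleftrightarrow> card (Im_rel R) = card S"
proof -
 have R': "R : Rl S g T h" "Def_rel R = S" "Ind_rel R = {0}" using R by (auto simp: Hm_def)
 have finR: "finite R" using R' fin by (auto simp: Rl_def intro: finite_subset)
 have cR: "card R = card S" using card_Ind R' by metis
 have im: "Im_rel R = snd ` R" by (force simp: Im_rel_def)
 show "card (Im_rel R) <= card S" using card_image_le[OF finR, of snd] cR im by simp
 show "Ker_rel R = {0} \<longleftrightarrow> card (Im_rel R) = card S"
 proof
  assume "Ker_rel R = {0}"
  then show "card (Im_rel R) = card S" using card_Ker R' cR by metis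
 next
  assume "card (Im_rel R) = card S"
  then have "inj_on snd R" using finR cR im by (simp add: eq_card_imp_inj_on)
  moreover have "(0, 0) : R" using R' by (auto simp: Rl_def krel_def)
  ultimately show "Ker_rel R = {0}" unfolding Ker_rel_def inj_on_def by force
 qed
qed

text \<open>Homomorphisms are sorted by their image; dually, \<open>Pars_eq_UN_Injs\<close> sorts
  partial isomorphisms by their domain. Both unions are disjoint, and the two sortings drive the
  recursion in \<open>card_Injs_eq_card_Surs\<close>.\<close>

lemma Hm_eq_UN_Surs: "Hm S g T h = (\<Union>U\<in>Subs T h. Surs S g U h)"
proof -
 have "R : Surs S g (Im_rel R) h" "Im_rel R : Subs T h" if "R : Hm S g T h" for R
  using that Im_Subs[of R S g T h] by (auto simp: Hm_def Surs_def Rl_def Im_rel_def)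
 moreover have "R : Hm S g T h" if "R : Surs S g U h" "U : Subs T h" for R U
  using that by (auto simp: Hm_def Surs_def Rl_def Subs_def)
 ultimately show ?thesis by blast
qed

lemma Pars_eq_UN_Injs: "Pars S g T h = (\<Union>U\<in>Subs S g. Injs U g T h)"
proof -
 have "R : Injs (Def_rel R) g T h" "Def_rel R : Subs S g" if "R : Pars S g T h" for R
  using that Def_Subs[of R S g T h] by (auto simp: Pars_def Injs_def Rl_def Def_rel_def)
 moreover have "R : Pars S g T h" if "R : Injs U g T h" "U : Subs S g" for R U
  using that by (auto simp: Pars_def Injs_def Rl_def Subs_def)
 ultimately show ?thesis by blast
qed

lemma card_UN_Surs:
 assumes "kmod S g" "kmod T h" "A \<subseteq> Subs T h"
 shows "card (\<Union>U\<in>A. Surs S g U h) = (\<Sum>U\<in>A. card (Surs S g U h))"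
 using assms finite_Subs[OF assms(2)]
 by (intro card_UN_disjoint) (auto simp: Surs_def intro!: finite_Hm(3)[unfolded Surs_def] intro: kmod_Subs finite_subset)

lemma card_UN_Injs:
 assumes "kmod S g" "kmod T h" "A \<subseteq> Subs S g"
 shows "card (\<Union>U\<in>A. Injs U g T h) = (\<Sum>U\<in>A. card (Injs U g T h))"
 using assms finite_Subs[OF assms(1)]
 by (intro card_UN_disjoint) (auto simp: Injs_def intro!: finite_Hm(2)[unfolded Injs_def] intro: kmod_Subs finite_subset)

end

section \<open>Matrices, and as many homomorphisms in one direction as in the other\<close>

context finite_subfield begin

lemma card_kk: "card kk \<ge> 2"
proof -
 have "card {0, 1 :: 'a} <= card kk" using finite_kk by (intro card_mono) auto
 then show ?thesis by simp
qed

definition comb :: "nat => (nat => 'j => 'a) => (nat => 'a) => 'j => 'a" where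
 "comb n b c = (\<Sum>j<n. fscale (c j) (b j))"

lemma comb_add: "comb n b (c + d) = comb n b c + comb n b d"
 by (simp add: comb_def fv.scale_left_distrib sum.distrib)

lemma comb_scale: "comb n b (fscale k c) = fscale k (comb n b c)"
 by (simp add: comb_def fv.scale_sum_right fscale_apply)

lemma comb_diff: "comb n b (c - d) = comb n b c - comb n b d"
 by (simp add: comb_def fv.scale_left_diff_distrib sum_subtractf)

lemma comb_zero: "comb n b 0 = 0"
 by (simp add: comb_def)

lemma comb_minus: "comb n b (- c) = - comb n b c"
 using comb_diff[of n b 0 c] by (simp add: comb_zero)

lemma comb_sum: "comb n b (\<Sum>i\<in>A. f i) = (\<Sum>i\<in>A. comb n b (f i))"
 by (induction A rule: infinite_finite_induct)
  (simp_all only: sum.infinite sum.empty sum.insert comb_zero comb_add not_False_eq_True)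

lemma comb_in: "ksub S ==> (!!j. j < n ==> b j : S) ==> c : spk {..<n} ==> comb n b c : S"
 unfolding comb_def by (intro ksub_sum ksubD(3)) (auto simp: spk_iff)

text \<open>Coefficients range over \<open>kk\<close> only. A longest list with injective
  combination map exists because its length \<open>n\<close> satisfies
  \<open>card kk ^ n <= card S\<close> and \<open>n < 2 ^ n\<close>. If it missed a vector
  \<open>u\<close>, appending \<open>u\<close> would keep the map injective: a relation involving
  \<open>u\<close> could be solved for \<open>u\<close>.\<close>

lemma basis_exists_finite:
 assumes S: "ksub S" "finite S"
 shows "EX n b. (ALL j<n. b j : S) & bij_betw (comb n b) (spk {..<n}) S"
proof -
 define P where "P n \<longleftrightarrow> (EX b. (ALL j<n. b j : S) & inj_on (comb n b) (spk {..<n}))" for n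
 have bound: "n <= card S" if "P n" for n
 proof -
  obtain b where b: "ALL j<n. b j : S" "inj_on (comb n b) (spk {..<n})" using \<open>P n\<close> by (auto simp: P_def)
  have "card (comb n b ` spk {..<n}) <= card S" using b S by (intro card_mono) (auto intro: comb_in)
  then have "card kk ^ n <= card S" using card_image[OF b(2)] by (simp add: card_spk)
  moreover have "n < 2 ^ n" by (rule less_exp)
  moreover have "(2::nat) ^ n <= card kk ^ n" using card_kk by (intro power_mono) auto
  ultimately show ?thesis by linarith
 qed
 have "P 0" unfolding P_def by (auto simp: inj_on_def spk_def fun_eq_iff)
 then obtain n where n: "P n" "!!m. P m ==> m <= n"
  using bound by (metis GreatestI_nat Greatest_le_nat)
 then obtain b where b: "ALL j<n. b j : S" "inj_on (comb n b) (spk {..<n})" by (auto simp: P_def)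
 have "comb n b ` spk {..<n} = S"
 proof (rule ccontr)
  assume "comb n b ` spk {..<n} ~= S"
  then obtain u where u: "u : S" "u \<notin> comb n b ` spk {..<n}" using b S by (auto intro: comb_in)
  define b' where "b' = b(n := u)"
  have comb': "comb (Suc n) b' c = comb n b (c(n := 0)) + fscale (c n) u" for c
  proof -
  have "(\<Sum>j<n. fscale (c j) (b' j)) = (\<Sum>j<n. fscale ((c(n := 0)) j) (b j))"
  by (intro sum.cong) (auto simp: b'_def)
  then show ?thesis by (simp add: comb_def b'_def)
  qed
  have upd: "c(n := 0) : spk {..<n}" if "c : spk {..<Suc n}" for c
  using that by (auto simp: spk_iff)
  have "c = 0" if c: "c : spk {..<Suc n}" "comb (Suc n) b' c = 0" for c
  proof -
  have "c n = 0"
  proof (rule ccontr)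
  assume nz: "c n ~= 0"
  have "fscale (c n) u = - comb n b (c(n := 0))" using c(2) unfolding comb' by (simp add: add_eq_0_iff)
  then have "u = fscale (inverse (c n)) (- comb n b (c(n := 0)))"
  using nz by (metis fv.scale_scale fscale_one left_inverse)
  also have "... = comb n b (fscale (- inverse (c n)) (c(n := 0)))"
  by (simp add: comb_scale comb_minus)
  finally have "u = comb n b (fscale (- inverse (c n)) (c(n := 0)))" .
  moreover have "fscale (- inverse (c n)) (c(n := 0)) : spk {..<n}"
  using upd[OF c(1)] c(1) by (intro ksubD(3)[OF ksub_spk] minus_kk inverse_kk) (auto simp: spk_iff)
  ultimately show False using u(2) by blast
  qed
  then have "comb n b (c(n := 0)) = comb n b 0" using c(2) unfolding comb' by (simp add: comb_def)
  then have "c(n := 0) = 0" using b(2) upd[OF c(1)] ksubD(1)[OF ksub_spk] by (meson inj_onD)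
  then show "c = 0" using \<open>c n = 0\<close> by (simp add: fun_eq_iff) metis
  qed
  then have "inj_on (comb (Suc n) b') (spk {..<Suc n})"
  by (intro inj_onI) (metis comb_diff ksubD(5)[OF ksub_spk] right_minus_eq)
  then have "P (Suc n)" unfolding P_def
  by (intro exI[of _ b'] conjI) (use b(1) u(1) in \<open>auto simp: b'_def less_Suc_eq\<close>)
  then show False using n(2) by force
 qed
 then show ?thesis using b by (auto simp: bij_betw_def)
qed

lemma unit_comb: "j < n ==> comb n b (%i. if i = j then 1 else 0) = b j"
proof -
 assume j: "j < n"
 have "comb n b (%i. if i = j then 1 else 0) = (\<Sum>i<n. if i = j then b j else 0)"
  unfolding comb_def by (intro sum.cong) auto
 then show ?thesis using j by simp
qed

text \<open>Row vector times matrix. Matrices are functions on index pairs, hence themselves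
  elements of a space \<open>spk\<close>, so that \<open>card_kernel_adjoint\<close> applies to
  linear maps between matrices.\<close>

definition vm :: "nat => (nat => 'a) => (nat \<times> nat => 'a) => nat => 'a" where
 "vm n c M = comb n (%j l. M (j, l)) c"

lemma vm_apply: "vm n c M l = (\<Sum>j<n. c j * M (j, l))"
 by (simp add: vm_def comb_def sum_fun_at fscale_apply)

lemma vm_spk: "c : spk {..<n} ==> M : spk ({..<n} \<times> {..<m}) ==> vm n c M : spk {..<m}"
 by (auto simp: spk_iff vm_apply intro!: sum_kk mult_kk)

text \<open>A module is represented by the matrix of its operator with respect to a basis.\<close>

lemma matrix_exists:
 assumes S: "kmod S g" and b: "ALL j<n. b j : S" "bij_betw (comb n b) (spk {..<n}) S"
 obtains G where "G : spk ({..<n} \<times> {..<n})"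
  "!!c. c : spk {..<n} ==> g (comb n b c) = comb n b (vm n c G)"
proof -
 note S' = kmodD[OF S]
 have "EX r. r : spk {..<n} & g (b j) = comb n b r" if "j < n" for j
 proof -
  have "g (b j) : S" using S'(3) b that by simp
  then show ?thesis using b(2) unfolding bij_betw_def by blast
 qed
 then obtain r where r: "!!j. j < n ==> r j : spk {..<n}" "!!j. j < n ==> g (b j) = comb n b (r j)"
  by metis
 define G where "G = (%(j, l). if j < n then r j l else 0)"
 show thesis
 proof (rule that[of G])
  show "G : spk ({..<n} \<times> {..<n})" using r(1) by (auto simp: G_def spk_iff)
  fix c assume c: "c : spk {..<n}"
  have "g (comb n b c) = (\<Sum>j<n. fscale (c j) (comb n b (r j)))"
  unfolding comb_def[of n b c] using b(1) c r(2) S'(2)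
  by (subst kmod_sum[OF S]) (auto simp: S'(5) spk_iff intro!: ksubD(3) sum.cong)
  also have "... = comb n b (\<Sum>j<n. fscale (c j) (r j))"
  by (simp add: comb_sum comb_scale)
  also have "(\<Sum>j<n. fscale (c j) (r j)) = vm n c G"
  by (auto simp: fun_eq_iff vm_apply sum_fun_at fscale_apply G_def intro!: sum.cong)
  finally show "g (comb n b c) = comb n b (vm n c G)" .
 qed
qed

text \<open>A homomorphism is determined by the images of the basis vectors, the rows of
  \<open>M\<close>. With row vectors, invariance of its graph reads M H = G M.\<close>

lemma card_Hm_eq_matrices:
 assumes S: "kmod S g" and T: "kmod T h"
  and b: "ALL j<n. b j : S" "bij_betw (comb n b) (spk {..<n}) S"
  and b': "ALL j<m. b' j : T" "bij_betw (comb m b') (spk {..<m}) T"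
  and G: "!!c. c : spk {..<n} ==> g (comb n b c) = comb n b (vm n c G)" "G : spk ({..<n} \<times> {..<n})"
  and H: "!!c. c : spk {..<m} ==> h (comb m b' c) = comb m b' (vm m c H)" "H : spk ({..<m} \<times> {..<m})"
 shows "card (Hm S g T h) = card {M : spk ({..<n} \<times> {..<m}).
  ALL j<n. ALL l<m. (\<Sum>k<m. M (j, k) * H (k, l)) = (\<Sum>k<n. G (j, k) * M (k, l))}"
  (is "_ = card ?Ms")
proof -
 note S' = kmodD[OF S] and T' = kmodD[OF T]
 have injS: "inj_on (comb n b) (spk {..<n})" and imS: "comb n b ` spk {..<n} = S"
  and injT: "inj_on (comb m b') (spk {..<m})" and imT: "comb m b' ` spk {..<m} = T"
  using b b' by (auto simp: bij_betw_def)
 define R where "R M = (%c. (comb n b c, comb m b' (vm n c M))) ` spk {..<n}" for M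
 have vm_add: "vm n (c + d) M = vm n c M + vm n d M" for n c d M
  by (simp add: vm_def comb_add)
 have vm_scale: "vm n (fscale k c) M = fscale k (vm n c M)" for n c k M
  by (simp add: vm_def comb_scale)
 have z: "0 : spk {..<n}" for n using ksubD(1)[OF ksub_spk] .
 have comb0: "comb n b 0 = 0" for n and b :: "nat => 'z => 'a" by (simp add: comb_def)
 have krelR: "krel (R M)" for M
  unfolding krel_def
 proof (intro conjI allI impI ballI)
  show "(0, 0) : R M" unfolding R_def by (rule image_eqI[of _ _ 0]) (auto simp: z comb0 vm_def)
 next
  fix x y x' y' assume "(x, y) : R M" "(x', y') : R M"
  then obtain c d where cd: "c : spk {..<n}" "d : spk {..<n}" "x = comb n b c" "x' = comb n b d"
  "y = comb m b' (vm n c M)" "y' = comb m b' (vm n d M)" by (auto simp: R_def)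
  show "(x + x', y + y') : R M" unfolding R_def
  by (rule image_eqI[of _ _ "c + d"]) (auto simp: cd comb_add vm_add ksubD(2)[OF ksub_spk])
 next
  fix k x y assume "k : kk" "(x, y) : R M"
  then obtain c where c: "c : spk {..<n}" "x = comb n b c" "y = comb m b' (vm n c M)" by (auto simp: R_def)
  show "(fscale k x, fscale k y) : R M" unfolding R_def
  by (rule image_eqI[of _ _ "fscale k c"])
  (auto simp: c comb_scale vm_scale ksubD(3)[OF ksub_spk] \<open>k : kk\<close>)
 qed
 \<comment> \<open>Injectivity of the coordinate maps turns invariance of the graph into an equation
   between row vectors; testing it on unit vectors gives the matrix equation entry by entry.\<close>
 have inv: "(ALL x y. (x, y) : R M --> (g x, h y) : R M) \<longleftrightarrow>
  (ALL j<n. ALL l<m. (\<Sum>k<m. M (j, k) * H (k, l)) = (\<Sum>k<n. G (j, k) * M (k, l)))"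
  if M: "M : spk ({..<n} \<times> {..<m})" for M
 proof -
  have vmG: "vm n c G : spk {..<n}" if "c : spk {..<n}" for c using vm_spk G that by blast
  have vmH: "vm m c H : spk {..<m}" if "c : spk {..<m}" for c using vm_spk H that by blast
  have "(ALL x y. (x, y) : R M --> (g x, h y) : R M) \<longleftrightarrow>
  (ALL c:spk {..<n}. (g (comb n b c), h (comb m b' (vm n c M))) : R M)"
  proof -
  have "(ALL x y. (x, y) : R M --> (g x, h y) : Z) \<longleftrightarrow>
  (ALL c:spk {..<n}. (g (comb n b c), h (comb m b' (vm n c M))) : Z)" for Z by (auto simp: R_def)
  then show ?thesis by blast
  qed
  also have "... \<longleftrightarrow>
  (ALL c:spk {..<n}. (comb n b (vm n c G), comb m b' (vm m (vm n c M) H)) : R M)"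
  using G(1) H(1) vm_spk[OF _ M] by simp
  also have "... \<longleftrightarrow> (ALL c:spk {..<n}. vm m (vm n c M) H = vm n (vm n c G) M)"
  proof (intro ball_cong refl iffI)
  fix c assume c: "c : spk {..<n}"
  show "(comb n b (vm n c G), comb m b' (vm m (vm n c M) H)) : R M"
  if "vm m (vm n c M) H = vm n (vm n c G) M"
  unfolding R_def by (rule image_eqI[of _ _ "vm n c G"]) (auto simp: that vmG c)
  assume "(comb n b (vm n c G), comb m b' (vm m (vm n c M) H)) : R M"
  then obtain d where d: "d : spk {..<n}" "comb n b (vm n c G) = comb n b d"
  "comb m b' (vm m (vm n c M) H) = comb m b' (vm n d M)" by (auto simp: R_def)
  have "d = vm n c G" using d injS vmG[OF c] by (metis inj_onD)
  then show "vm m (vm n c M) H = vm n (vm n c G) M"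
  using d(3) injT vmH[OF vm_spk[OF c M]] vm_spk[OF d(1) M] by (metis inj_onD)
  qed
  also have "... \<longleftrightarrow> (ALL j<n. ALL l<m. (\<Sum>k<m. M (j, k) * H (k, l)) = (\<Sum>k<n. G (j, k) * M (k, l)))"
  proof
  assume eq: "ALL c:spk {..<n}. vm m (vm n c M) H = vm n (vm n c G) M"
  show "ALL j<n. ALL l<m. (\<Sum>k<m. M (j, k) * H (k, l)) = (\<Sum>k<n. G (j, k) * M (k, l))"
  proof (intro allI impI)
  fix j l assume jl: "j < n" "l < m"
  have u: "vm n (%i. if i = j then 1 else 0) N = (%l. N (j, l))" for N
  unfolding vm_def by (rule unit_comb[OF jl(1), of "%j l. N (j, l)"])
  have "vm m (%l. M (j, l)) H l = vm n (%l. G (j, l)) M l"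
  using bspec[OF eq unit_spk[of j "{..<n}"]] jl by (simp add: u)
  then show "(\<Sum>k<m. M (j, k) * H (k, l)) = (\<Sum>k<n. G (j, k) * M (k, l))" by (simp add: vm_apply)
  qed
  next
  assume eq: "ALL j<n. ALL l<m. (\<Sum>k<m. M (j, k) * H (k, l)) = (\<Sum>k<n. G (j, k) * M (k, l))"
  show "ALL c:spk {..<n}. vm m (vm n c M) H = vm n (vm n c G) M"
  proof (intro ballI ext)
  fix c l assume c: "c : spk {..<n}"
  show "vm m (vm n c M) H l = vm n (vm n c G) M l"
  proof (cases "l < m")
  case True
  have "vm m (vm n c M) H l = (\<Sum>k<m. \<Sum>j<n. c j * M (j, k) * H (k, l))"
  by (simp add: vm_apply sum_distrib_right)
  also have "... = (\<Sum>j<n. c j * (\<Sum>k<m. M (j, k) * H (k, l)))"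
  by (subst sum.swap) (simp add: sum_distrib_left mult_ac)
  also have "... = (\<Sum>j<n. c j * (\<Sum>k<n. G (j, k) * M (k, l)))"
  using eq True by (intro sum.cong) auto
  also have "... = (\<Sum>j<n. \<Sum>k<n. c j * G (j, k) * M (k, l))"
  by (simp add: sum_distrib_left mult_ac)
  also have "... = vm n (vm n c G) M l"
  by (subst sum.swap) (simp add: vm_apply sum_distrib_right)
  finally show ?thesis .
  next
  case False
  then show ?thesis using vm_spk[OF vm_spk[OF c M] H(2)] vm_spk[OF vm_spk[OF c G(2)] M]
  by (auto simp: spk_iff)
  qed
  qed
  qed
  finally show ?thesis .
 qed
 have RT: "R M \<subseteq> S \<times> T" "Def_rel (R M) = S" "Ind_rel (R M) = {0}" if M: "M : spk ({..<n} \<times> {..<m})" for M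
 proof -
  show "R M \<subseteq> S \<times> T" using imS imT vm_spk[OF _ M] by (auto simp: R_def)
  show "Def_rel (R M) = S" using imS by (auto simp: R_def Def_rel_def image_iff)
  show "Ind_rel (R M) = {0}"
  proof
  show "{0} \<subseteq> Ind_rel (R M)" using krelD(1)[OF krelR[of M]] by (auto simp: Ind_rel_def)
  show "Ind_rel (R M) \<subseteq> {0}"
  proof
  fix y assume "y : Ind_rel (R M)"
  then obtain c where c: "c : spk {..<n}" "comb n b c = 0" "y = comb m b' (vm n c M)"
  by (auto simp: Ind_rel_def R_def)
  have "c = 0" using injS c(1,2) z[of n] comb0[of n b] by (metis inj_onD)
  then show "y : {0}" using c by (simp add: vm_def comb0)
  qed
  qed
 qed
 have "bij_betw R ?Ms (Hm S g T h)"
 proof (rule bij_betw_imageI)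
  show "inj_on R ?Ms"
  proof (rule inj_onI)
  fix M N assume MN: "M : ?Ms" "N : ?Ms" "R M = R N"
  show "M = N"
  proof
  fix p :: "nat \<times> nat"
  obtain j l where p: "p = (j, l)" by fastforce
  show "M p = N p"
  proof (cases "j < n")
  case True
  define u where "u = (%i. if i = j then 1 else 0 :: 'a)"
  have us: "u : spk {..<n}" using True unit_spk[of j "{..<n}"] by (simp add: u_def)
  have u: "vm n u N' = (%l. N' (j, l))" for N'
  unfolding vm_def u_def by (rule unit_comb[OF True, of "%j l. N' (j, l)"])
  have "(comb n b u, comb m b' (vm n u M)) : R N"
  unfolding MN(3)[symmetric] using us by (auto simp: R_def)
  then obtain d where d: "d : spk {..<n}" "comb n b u = comb n b d"
  "comb m b' (vm n u M) = comb m b' (vm n d N)" by (auto simp: R_def)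
  have "u = d" using injS d us by (metis inj_onD)
  then have "vm n u M = vm n u N" using d(3) injT MN vm_spk[OF us, of _ m] by (auto dest: inj_onD)
  then show ?thesis by (simp add: u p fun_eq_iff)
  qed (use MN p in \<open>auto simp: spk_iff\<close>)
  qed
  qed
  show "R ` ?Ms = Hm S g T h"
  proof (intro equalityI subsetI)
  fix X' assume "X' : R ` ?Ms"
  then obtain M where XM: "X' = R M" and M: "M : spk ({..<n} \<times> {..<m})"
  and eq: "ALL j<n. ALL l<m. (\<Sum>k<m. M (j, k) * H (k, l)) = (\<Sum>k<n. G (j, k) * M (k, l))" by auto
  show "X' : Hm S g T h"
  unfolding XM Hm_def Rl_def using iffD2[OF inv[OF M] eq] RT[OF M] krelR[of M] by simp
  next
  fix X' assume X': "X' : Hm S g T h"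
  then have X: "X' : Rl S g T h" "Def_rel X' = S" "Ind_rel X' = {0}" "krel X'" "X' \<subseteq> S \<times> T"
  by (auto simp: Hm_def Rl_def)
  have "EX r. r : spk {..<m} & (b j, comb m b' r) : X'" if "j < n" for j
  proof -
  have "b j : Def_rel X'" using X b that by simp
  then obtain y where "(b j, y) : X'" by (auto simp: Def_rel_def)
  moreover from this have "y : T" using X by auto
  ultimately show ?thesis using imT by blast
  qed
  then obtain r where r: "!!j. j < n ==> r j : spk {..<m}" "!!j. j < n ==> (b j, comb m b' (r j)) : X'"
  by metis
  define M where "M = (%(j, l). if j < n then r j l else 0)"
  have M: "M : spk ({..<n} \<times> {..<m})" using r(1) by (auto simp: M_def spk_iff)
  have "R M \<subseteq> X'"
  proof
  fix p assume "p : R M"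
  then obtain c where c: "c : spk {..<n}" "p = (comb n b c, comb m b' (vm n c M))" by (auto simp: R_def)
  have "vm n c M = (\<Sum>j<n. fscale (c j) (r j))"
  by (auto simp: fun_eq_iff vm_apply sum_fun_at fscale_apply M_def intro!: sum.cong)
  then have "comb m b' (vm n c M) = (\<Sum>j<n. fscale (c j) (comb m b' (r j)))"
  by (simp add: comb_sum comb_scale)
  then show "p : X'" unfolding c(2) comb_def[of n b c] using r(2) c(1)
  by (auto intro!: krel_sum[OF X(4)] krelD(3)[OF X(4)] simp: spk_iff)
  qed
  have XR: "X' = R M"
  proof (intro equalityI \<open>R M \<subseteq> X'\<close> subrelI)
  fix x y assume xy: "(x, y) : X'"
  then have "x : Def_rel (R M)" using X RT(2)[OF M] by (auto simp: Def_rel_def)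
  then obtain y' where "(x, y') : R M" by (auto simp: Def_rel_def)
  then show "(x, y) : R M" using Rl_functional[OF X(1,3) xy] \<open>R M \<subseteq> X'\<close> by blast
  qed
  have "M : ?Ms" using iffD1[OF inv[OF M]] M X(1) unfolding XR Rl_def by blast
  then show "X' : R ` ?Ms" unfolding XR by (rule imageI)
  qed
 qed
 then show ?thesis by (simp add: bij_betw_same_card)
qed

text \<open>\<open>M H - G M\<close> and \<open>M H\<^sup>T - G\<^sup>T M\<close> are adjoint linear functions of \<open>M\<close>.\<close>

lemma card_Hm_commute:
 assumes S: "kmod S g" and T: "kmod T h"
 shows "card (Hm S g T h) = card (Hm T h S g)"
proof -
 obtain n b where b: "ALL j<n. b j : S" "bij_betw (comb n b) (spk {..<n}) S"
  using basis_exists_finite[of S] kmodD(1,2)[OF S] by blast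
 obtain m b' where b': "ALL j<m. b' j : T" "bij_betw (comb m b') (spk {..<m}) T"
  using basis_exists_finite[of T] kmodD(1,2)[OF T] by blast
 obtain G where G: "G : spk ({..<n} \<times> {..<n})"
  "!!c. c : spk {..<n} ==> g (comb n b c) = comb n b (vm n c G)" using matrix_exists[OF S b] by blast
 obtain H where H: "H : spk ({..<m} \<times> {..<m})"
  "!!c. c : spk {..<m} ==> h (comb m b' c) = comb m b' (vm m c H)" using matrix_exists[OF T b'] by blast
 let ?J = "{..<n} \<times> {..<m}"
 define L where "L M = (%(j, l). if (j, l) : ?J then (\<Sum>k<m. M (j, k) * H (k, l)) - (\<Sum>k<n. G (j, k) * M (k, l)) else 0)" for M
 define L' where "L' M = (%(j, l). if (j, l) : ?J then (\<Sum>k<m. M (j, k) * H (l, k)) - (\<Sum>k<n. G (k, j) * M (k, l)) else 0)" for M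
 have spkL: "L M : spk ?J" "L' M : spk ?J" if "M : spk ?J" for M
  using that G(1) H(1) unfolding L_def L'_def
  by (auto simp: spk_iff intro!: diff_kk sum_kk mult_kk)
 have dot2: "dot ?J M N = (\<Sum>j<n. \<Sum>l<m. M (j, l) * N (j, l))" for M N
  unfolding dot_def by (simp add: sum.cartesian_product)
 have adj: "dot ?J (L M) N = dot ?J M (L' N)" for M N
 proof -
  have eqA: "(\<Sum>j<n. \<Sum>l<m. \<Sum>k<m. M (j, k) * H (k, l) * N (j, l)) = (\<Sum>j<n. \<Sum>k<m. \<Sum>l<m. M (j, k) * H (k, l) * N (j, l))"
  by (rule sum.cong[OF refl], rule sum.swap)
  have eqB: "(\<Sum>j<n. \<Sum>l<m. \<Sum>k<n. G (j, k) * M (k, l) * N (j, l)) = (\<Sum>k<n. \<Sum>l<m. \<Sum>j<n. G (j, k) * M (k, l) * N (j, l))"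
  (is "?A = ?B")
  proof -
  have "?A = (\<Sum>l<m. \<Sum>j<n. \<Sum>k<n. G (j, k) * M (k, l) * N (j, l))" by (rule sum.swap)
  also have "... = (\<Sum>l<m. \<Sum>k<n. \<Sum>j<n. G (j, k) * M (k, l) * N (j, l))"
  by (rule sum.cong[OF refl], rule sum.swap)
  also have "... = ?B" by (rule sum.swap)
  finally show ?thesis .
  qed
  have "dot ?J (L M) N = (\<Sum>j<n. \<Sum>l<m. (\<Sum>k<m. M (j, k) * H (k, l) * N (j, l)) - (\<Sum>k<n. G (j, k) * M (k, l) * N (j, l)))"
  unfolding dot2 L_def by (intro sum.cong refl) (simp add: left_diff_distrib sum_distrib_right)
  also have "... = (\<Sum>j<n. \<Sum>k<m. \<Sum>l<m. M (j, k) * H (k, l) * N (j, l)) - ?B"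
  unfolding sum_subtractf eqA eqB ..
  also have "... = (\<Sum>j<n. \<Sum>l<m. (\<Sum>k<m. M (j, l) * H (l, k) * N (j, k)) - (\<Sum>k<n. G (k, j) * M (j, l) * N (k, l)))"
  unfolding sum_subtractf ..
  also have "... = dot ?J M (L' N)"
  unfolding dot2 L'_def
  by (intro sum.cong refl) (simp add: right_diff_distrib sum_distrib_left mult_ac)
  finally show ?thesis .
 qed
 have "card {M : spk ?J. L M = 0} = card {M : spk ?J. L' M = 0}"
 proof (rule card_kernel_adjoint)
  show "L (M + N) = L M + L N" for M N
  by (auto simp: L_def fun_eq_iff sum.distrib algebra_simps)
  show "L (fscale c M) = fscale c (L M)" for c M
  by (auto simp: L_def fun_eq_iff fscale_apply sum_distrib_left algebra_simps)
 qed (auto simp: spkL adj)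
 moreover have "{M : spk ?J. L M = 0} = {M : spk ?J. ALL j<n. ALL l<m. (\<Sum>k<m. M (j, k) * H (k, l)) = (\<Sum>k<n. G (j, k) * M (k, l))}"
  by (auto simp: L_def fun_eq_iff)
 moreover have "{M : spk ?J. L' M = 0} = {M : spk ?J. ALL j<n. ALL l<m. (\<Sum>k<m. M (j, k) * H (l, k)) = (\<Sum>k<n. G (k, j) * M (k, l))}"
  by (auto simp: L'_def fun_eq_iff)
 \<comment> \<open>Transposition turns the solutions for the transposed matrices into the
   intertwiners in the opposite direction.\<close>
 moreover have "card ... = card {M : spk ({..<m} \<times> {..<n}). ALL j<m. ALL l<n. (\<Sum>k<n. M (j, k) * G (k, l)) = (\<Sum>k<m. H (j, k) * M (k, l))}"
  (is "card ?A = card ?B")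
 proof -
  let ?t = "%M p. M (snd p, fst p)"
  have tt: "?t (?t M) = M" for M :: "nat \<times> nat => 'a" by auto
  have "?t ` ?A \<subseteq> ?B" "?t ` ?B \<subseteq> ?A" by (auto simp: spk_iff mult.commute)
  then have "bij_betw ?t ?A ?B" by (intro bij_betw_byWitness[of _ ?t]) (auto simp: tt)
  then show ?thesis by (rule bij_betw_same_card)
 qed
 ultimately show ?thesis
  using card_Hm_eq_matrices[OF S T b b' G(2,1) H(2,1)] card_Hm_eq_matrices[OF T S b' b H(2,1) G(2,1)]
  by simp
qed

end

section \<open>Equal numbers of invariant relations of the four types\<close>

context finite_subfield begin

lemma Injs_subset: "Injs S g T h \<subseteq> Hm S g T h" and Surs_subset: "Surs S g T h \<subseteq> Hm S g T h"
 by (auto simp: Hm_def Injs_def Surs_def)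

lemma Pars_converse: "R : Pars S g T h ==> R\<inverse> : Pars T h S g"
 using Rl_converse[of R S g T h] by (simp add: Pars_def converse_simps)

text \<open>By induction both sides are the total number of homomorphisms in the respective
 direction minus the number of isomorphisms between submodules of size less than \<open>card S\<close>.\<close>

lemma card_Injs_eq_card_Surs:
 fixes S T :: "('i => 'a) set"
 assumes "kmod S g" "kmod T h"
 shows "card (Injs S g T h) = card (Surs T h S g)"
 using assms
proof (induction "card S" arbitrary: S g T h rule: less_induct)
 case less
 note S = less.prems(1) and T = less.prems(2)
 note fS = kmodD(1)[OF S] and fT = kmodD(1)[OF T]
 let ?A = "{U : Subs T h. card U < card S}" and ?B = "{U : Subs S g. card U < card S}"
 \<comment> \<open>A homomorphism fails to be injective exactly when its image is smaller than
   \<open>S\<close>, so these homomorphisms are sorted by such images.\<close>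
 have NI: "Hm S g T h - Injs S g T h = (\<Union>U\<in>?A. Surs S g U h)"
 proof (intro equalityI subsetI)
  fix R assume R: "R : Hm S g T h - Injs S g T h"
  then obtain U where U: "U : Subs T h" "R : Surs S g U h" unfolding Hm_eq_UN_Surs by blast
  have "Im_rel R = U" using U by (simp add: Surs_def)
  moreover have "Ker_rel R ~= {0}" using R by (auto simp: Hm_def Injs_def)
  ultimately have "card U < card S" using Hm_inj_iff[of R S g T h] R fS fT by auto
  then show "R : (\<Union>U\<in>?A. Surs S g U h)" using U by blast
 next
  fix R assume "R : (\<Union>U\<in>?A. Surs S g U h)"
  then obtain U where U: "U : Subs T h" "card U < card S" "R : Surs S g U h" by blast
  then have "R : Hm S g T h" unfolding Hm_eq_UN_Surs by blast
  moreover have "Im_rel R = U" using U by (simp add: Surs_def)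
  ultimately show "R : Hm S g T h - Injs S g T h"
  using Hm_inj_iff(2)[of R S g T h] U(2) fS fT by (auto simp: Injs_def)
 qed
 have NS: "Hm T h S g - Surs T h S g = (\<Union>U\<in>?B. Surs T h U g)"
 proof (intro equalityI subsetI)
  fix R assume R: "R : Hm T h S g - Surs T h S g"
  then obtain U where U: "U : Subs S g" "R : Surs T h U g" unfolding Hm_eq_UN_Surs by blast
  have "U ~= S" using R U by auto
  then have "card U < card S" using U fS by (auto simp: Subs_def intro: psubset_card_mono)
  then show "R : (\<Union>U\<in>?B. Surs T h U g)" using U by blast
 next
  fix R assume "R : (\<Union>U\<in>?B. Surs T h U g)"
  then obtain U where U: "U : Subs S g" "card U < card S" "R : Surs T h U g" by blast
  then have "R : Hm T h S g" unfolding Hm_eq_UN_Surs by blast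
  moreover have "Im_rel R = U" using U by (simp add: Surs_def)
  ultimately show "R : Hm T h S g - Surs T h S g" using U(2) by (auto simp: Surs_def)
 qed
 have P1: "{R : Pars T h S g. card R < card S} = (\<Union>U\<in>?A. Injs U h S g)"
 proof (intro equalityI subsetI)
  fix R assume R: "R : {R : Pars T h S g. card R < card S}"
  then obtain U where U: "U : Subs T h" "R : Injs U h S g" unfolding Pars_eq_UN_Injs by blast
  then have "card R = card U" using card_Ind[of R U h S g] by (auto simp: Injs_def)
  then show "R : (\<Union>U\<in>?A. Injs U h S g)" using U R by auto
 next
  fix R assume "R : (\<Union>U\<in>?A. Injs U h S g)"
  then obtain U where U: "U : Subs T h" "card U < card S" "R : Injs U h S g" by blast
  then have "card R = card U" using card_Ind[of R U h S g] by (auto simp: Injs_def)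
  then show "R : {R : Pars T h S g. card R < card S}" using U unfolding Pars_eq_UN_Injs by auto
 qed
 have P2: "{R : Pars S g T h. card R < card S} = (\<Union>U\<in>?B. Injs U g T h)"
 proof (intro equalityI subsetI)
  fix R assume R: "R : {R : Pars S g T h. card R < card S}"
  then obtain U where U: "U : Subs S g" "R : Injs U g T h" unfolding Pars_eq_UN_Injs by blast
  then have "card R = card U" using card_Ind[of R U g T h] by (auto simp: Injs_def)
  then show "R : (\<Union>U\<in>?B. Injs U g T h)" using U R by auto
 next
  fix R assume "R : (\<Union>U\<in>?B. Injs U g T h)"
  then obtain U where U: "U : Subs S g" "card U < card S" "R : Injs U g T h" by blast
  then have "card R = card U" using card_Ind[of R U g T h] by (auto simp: Injs_def)
  then show "R : {R : Pars S g T h. card R < card S}" using U unfolding Pars_eq_UN_Injs by auto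
 qed
 have "card (Hm S g T h - Injs S g T h) = (\<Sum>U\<in>?A. card (Surs S g U h))"
  unfolding NI by (rule card_UN_Surs[OF S T]) auto
 \<comment> \<open>The induction hypothesis has the smaller module \<open>U\<close> as source and
   \<open>S\<close> as target: surjections of \<open>S\<close> onto \<open>U\<close> become
   injections of \<open>U\<close> into \<open>S\<close>.\<close>
 also have "... = (\<Sum>U\<in>?A. card (Injs U h S g))"
  using less.hyps kmod_Subs[OF T] S by (intro sum.cong) auto
 also have "... = card {R : Pars T h S g. card R < card S}"
  unfolding P1 by (rule card_UN_Injs[OF T S, symmetric]) auto
 also have "... = card {R : Pars S g T h. card R < card S}"
  by (rule bij_betw_same_card[of converse], rule bij_betw_byWitness[of _ converse])
  (auto dest: Pars_converse)
 also have "... = (\<Sum>U\<in>?B. card (Injs U g T h))"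
  unfolding P2 by (rule card_UN_Injs[OF S T]) auto
 also have "... = (\<Sum>U\<in>?B. card (Surs T h U g))"
  using less.hyps kmod_Subs[OF S] T by (intro sum.cong) auto
 also have "... = card (Hm T h S g - Surs T h S g)"
  unfolding NS by (rule card_UN_Surs[OF T S, symmetric]) auto
 finally have eq: "card (Hm S g T h - Injs S g T h) = card (Hm T h S g - Surs T h S g)" .
 have "card (Hm S g T h) = card (Injs S g T h) + card (Hm S g T h - Injs S g T h)"
  using card_Diff_subset[OF _ Injs_subset, of S g T h] card_mono[OF _ Injs_subset, of S g T h]
  finite_Hm(1,2)[OF S T] by simp
 moreover have "card (Hm T h S g) = card (Surs T h S g) + card (Hm T h S g - Surs T h S g)"
  using card_Diff_subset[OF _ Surs_subset, of T h S g] card_mono[OF _ Surs_subset, of T h S g]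
  finite_Hm(1,3)[OF T S] by simp
 ultimately show ?case using eq card_Hm_commute[OF S T] by simp
qed

text \<open>Sort by domain, exchange injections of \<open>U\<close> into \<open>T\<close> for
  surjections of \<open>T\<close> onto \<open>U\<close>, and reassemble: the latter, over all
  \<open>U\<close>, are all homomorphisms from \<open>T\<close> to \<open>S\<close>.\<close>

lemma card_Pars:
 fixes S T :: "('i => 'a) set"
 assumes S: "kmod S g" and T: "kmod T h"
 shows "card (Pars S g T h) = card (Hm S g T h)"
proof -
 have "card (Pars S g T h) = (\<Sum>U\<in>Subs S g. card (Injs U g T h))"
  unfolding Pars_eq_UN_Injs by (rule card_UN_Injs[OF S T]) auto
 also have "... = (\<Sum>U\<in>Subs S g. card (Surs T h U g))"
  using kmod_Subs[OF S] T by (intro sum.cong refl card_Injs_eq_card_Surs)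
 also have "... = card (Hm T h S g)"
  unfolding Hm_eq_UN_Surs by (rule card_UN_Surs[OF T S, symmetric]) auto
 finally show ?thesis using card_Hm_commute[OF S T] by simp
qed

text \<open>The annihilator of \<open>R\<close> under the sum of the two dot products. It exchanges
  kernel with domain and indeterminacy with image, hence the vanishing conditions with the fullness
  conditions of a type.\<close>

definition rperp where
 "rperp J J' R = {(v', w'). v' : spk J & w' : spk J' & (ALL (v, w):R. dot J v v' + dot J' w w' = 0)}"

text \<open>The witness is the transpose: coordinate \<open>j\<close> of the image of
  \<open>w\<close> is the product of \<open>w\<close> with the image of the \<open>j\<close>-th unit
  vector.\<close>

lemma adjoint_exists:
 assumes J: "finite J" and g: "kmod (spk J) g"
 obtains g' where "kmod (spk J) g'"
  "!!v w. v : spk J ==> w : spk J ==> dot J (g v) w = dot J v (g' w)"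
proof -
 note g' = kmodD[OF g]
 let ?e = "%j i. if i = j then 1 else (0::'a)"
 define t where "t w = (%j. if j : J then dot J (g (?e j)) w else 0)" for w
 have dotkk: "dot J v w : kk" if "v : spk J" "w : spk J" for v w
  unfolding dot_def using that by (intro sum_kk mult_kk) (auto simp: spk_iff)
 have "kmod (spk J) t"
  using card_spk[OF J] ksub_spk[of J] g'(3)[OF unit_spk] dotkk unfolding kmod_def
  by (auto simp: t_def spk_def fun_eq_iff dot_add dot_scale fscale_apply)
 moreover have "dot J (g v) w = dot J v (t w)" if v: "v : spk J" and w: "w : spk J" for v w
 proof -
  have v': "v = (\<Sum>j\<in>J. fscale (v j) (?e j))"
  proof
  fix i
  have "(\<Sum>j\<in>J. fscale (v j) (?e j)) i = (\<Sum>j\<in>J. if i = j then v j else 0)"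
  unfolding sum_fun_at by (intro sum.cong) (auto simp: fscale_apply)
  then show "v i = (\<Sum>j\<in>J. fscale (v j) (?e j)) i" using v J by (auto simp: spk_iff)
  qed
  have mem: "fscale (v j) (?e j) : spk J" if "j : J" for j
  using v that by (intro ksubD(3)[OF ksub_spk] unit_spk) (auto simp: spk_iff)
  have "g v = (\<Sum>j\<in>J. g (fscale (v j) (?e j)))"
  by (subst v', rule kmod_sum[OF g]) (rule mem)
  also have "... = (\<Sum>j\<in>J. fscale (v j) (g (?e j)))"
  using v by (intro sum.cong refl g'(5) unit_spk) (auto simp: spk_iff)
  finally have gv: "g v = (\<Sum>j\<in>J. fscale (v j) (g (?e j)))" .
  have dsum: "dot J (\<Sum>j\<in>A. f j) w = (\<Sum>j\<in>A. dot J (f j) w)" for A f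
  by (induction A rule: infinite_finite_induct)
  (simp_all only: sum.infinite sum.empty sum.insert dot_zero dot_add not_False_eq_True)
  have "dot J (g v) w = (\<Sum>j\<in>J. v j * dot J (g (?e j)) w)" unfolding gv dsum by (simp only: dot_scale)
  also have "... = dot J v (t w)" unfolding dot_def[of J v] by (intro sum.cong) (auto simp: t_def)
  finally show ?thesis .
 qed
 ultimately show thesis using that by blast
qed

text \<open>Rewrites annihilators of pairs as annihilators of vectors indexed by the disjoint union,
  where \<open>card_perp\<close> applies.\<close>

lemma rperp_mono: "rperp J J' R = {(v', w'). v' : spk J & w' : spk J' & case_sum v' w' : perp (J <+> J') ((%(v, w). case_sum v w) ` R)}"
 if "finite J" "finite J'"
proof -
 have "dot (J <+> J') (case_sum v w) (case_sum v' w') = dot J v v' + dot J' w w'" for v w v' w'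
  unfolding dot_def by (simp add: sum.Plus[OF that])
 moreover have "v' : spk J ==> w' : spk J' ==> case_sum v' w' : spk (J <+> J')" for v' w'
  by (auto simp: spk_def Plus_def image_iff split: sum.splits)
 ultimately show ?thesis by (auto simp: rperp_def perp_def)
qed

lemma card_rperp:
 assumes J: "finite J" "finite J'" and R: "R \<subseteq> spk J \<times> spk J'" "krel R"
 shows "card R * card (rperp J J' R) = card kk ^ (card J + card J')"
proof -
 let ?c = "%(v, w). case_sum v w :: 'b + 'c => 'a"
 have inj: "inj_on ?c A" for A
 proof (rule inj_onI, clarify)
  fix v w v' w' assume eq: "case_sum v w = (case_sum v' w' :: _ => 'a)"
  show "v = v' & w = w'"
  using fun_cong[OF eq, of "Inl _"] fun_cong[OF eq, of "Inr _"] by auto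
 qed
 have spkc: "v' : spk J ==> w' : spk J' ==> case_sum v' w' : spk (J <+> J')" for v' w'
  by (auto simp: spk_def Plus_def image_iff split: sum.splits)
 have addc: "case_sum v w + case_sum v' w' = (case_sum (v + v') (w + w') :: _ => 'a)"
  and scalec: "fscale k (case_sum v w) = (case_sum (fscale k v) (fscale k w) :: _ => 'a)"
  and zeroc: "(0 :: _ => 'a) = case_sum 0 0" for v v' :: "'b => 'a" and w w' :: "'c => 'a" and k
  by (auto simp: fun_eq_iff fscale_apply split: sum.splits)
 have "?c ` R \<subseteq> spk (J <+> J')" using R(1) spkc by auto
 moreover have "ksub (?c ` R)" unfolding ksub_def
 proof (intro conjI ballI)
  show "0 : ?c ` R" unfolding zeroc using krelD(1)[OF R(2)] by force
 next
  fix x y assume "x : ?c ` R" "y : ?c ` R"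
  then obtain v w v' w' where "(v, w) : R" "(v', w') : R" "x = case_sum v w" "y = case_sum v' w'" by auto
  then show "x + y : ?c ` R" using krelD(2)[OF R(2), of v w v' w'] addc
  by (intro image_eqI[of _ _ "(v + v', w + w')"]) auto
 next
  fix k x assume k: "k : kk" and "x : ?c ` R"
  then obtain v w where "(v, w) : R" "x = case_sum v w" by auto
  then show "fscale k x : ?c ` R" using krelD(3)[OF R(2) k, of v w] scalec
  by (intro image_eqI[of _ _ "(fscale k v, fscale k w)"]) auto
 qed
 ultimately have "card (?c ` R) * card (perp (J <+> J') (?c ` R)) = card kk ^ (card J + card J')"
  using card_perp[of "J <+> J'" "?c ` R"] J by (simp add: card_Plus)
 moreover have "card (?c ` R) = card R" by (rule card_image[OF inj])
 moreover have "perp (J <+> J') (?c ` R) = ?c ` rperp J J' R"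
 proof (intro equalityI subsetI)
  fix x assume x: "x : perp (J <+> J') (?c ` R)"
  have "x = case_sum (x \<circ> Inl) (x \<circ> Inr)" by (auto simp: fun_eq_iff split: sum.splits)
  moreover have "x \<circ> Inl : spk J" "x \<circ> Inr : spk J'"
  using x by (auto simp: perp_def spk_def Plus_def image_iff)
  ultimately show "x : ?c ` rperp J J' R" using x unfolding rperp_mono[OF J]
  by (intro image_eqI[of _ _ "(x \<circ> Inl, x \<circ> Inr)"]) auto
 qed (auto simp: rperp_mono[OF J])
 moreover have "card (?c ` rperp J J' R) = card (rperp J J' R)" by (rule card_image[OF inj])
 ultimately show ?thesis by simp
qed

lemma krel_rperp: "krel (rperp J J' R)"
 unfolding krel_def
proof (intro conjI allI impI ballI)
 show "(0, 0) : rperp J J' R" by (auto simp: rperp_def ksubD(1)[OF ksub_spk])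
next
 fix x y x' y' assume a: "(x, y) : rperp J J' R" "(x', y') : rperp J J' R"
 have "dot J v (x + x') + dot J' w (y + y') = 0" if "(v, w) : R" for v w
 proof -
  have "dot J v (x + x') + dot J' w (y + y') = (dot J v x + dot J' w y) + (dot J v x' + dot J' w y')"
  by (simp add: dot_add algebra_simps)
  moreover have "dot J v x + dot J' w y = 0" "dot J v x' + dot J' w y' = 0"
  using a that by (auto simp: rperp_def)
  ultimately show ?thesis by simp
 qed
 then show "(x + x', y + y') : rperp J J' R"
  using a by (auto simp: rperp_def ksubD(2)[OF ksub_spk])
next
 fix c x y assume c: "c : kk" and a: "(x, y) : rperp J J' R"
 have "dot J v (fscale c x) + dot J' w (fscale c y) = 0" if "(v, w) : R" for v w
 proof -
  have "dot J v (fscale c x) + dot J' w (fscale c y) = c * (dot J v x + dot J' w y)"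
  by (simp add: dot_scale algebra_simps)
  then show ?thesis using a that by (auto simp: rperp_def)
 qed
 then show "(fscale c x, fscale c y) : rperp J J' R"
  using a c by (auto simp: rperp_def ksubD(3)[OF ksub_spk])
qed

text \<open>A relation lies in its double annihilator, and \<open>card_rperp\<close>, used twice,
  shows that both have the same size.\<close>

lemma rperp_rperp:
 assumes J: "finite J" "finite J'" and R: "R \<subseteq> spk J \<times> spk J'" "krel R"
 shows "rperp J J' (rperp J J' R) = R"
proof (rule sym, rule card_subset_eq)
 have sub: "rperp J J' A \<subseteq> spk J \<times> spk J'" for A by (auto simp: rperp_def)
 have fin: "finite (spk J \<times> spk J')" using J by (simp add: card_spk)
 show "finite (rperp J J' (rperp J J' R))" using sub fin by (rule finite_subset)
 show "R \<subseteq> rperp J J' (rperp J J' R)"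
  using R(1) unfolding rperp_def by (auto simp: dot_commute) 
 have "card (rperp J J' R) > 0"
  using krelD(1)[OF krel_rperp[of J J' R]] finite_subset[OF sub fin] by (auto simp: card_gt_0_iff)
 then show "card R = card (rperp J J' (rperp J J' R))"
  using card_rperp[OF J R] card_rperp[OF J sub krel_rperp, of R] by (metis mult.commute mult_cancel1 less_irrefl)
qed

lemma perp_eq_0_iff:
 assumes J: "finite J" and S: "ksub S" "S \<subseteq> spk J"
 shows "perp J S = {0} \<longleftrightarrow> S = spk J"
proof
 have fin: "finite (spk J)" using card_spk[OF J] by simp
 assume "perp J S = {0}"
 then have "card S = card (spk J)" using card_perp[OF J S] card_spk[OF J] by simp
 then show "S = spk J" using S fin by (simp add: card_subset_eq)
next
 assume "S = spk J"
 then show "perp J S = {0}" using dot_nondegenerate[OF J] ksubD(1)[OF ksub_spk] by (auto simp: perp_def)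
qed

text \<open>The kernel of the annihilator is the annihilator of the domain, which is zero exactly
  when the domain is everything; likewise for indeterminacy and image.\<close>

lemma Ker_rperp:
 assumes J: "finite J" "finite J'" and R: "R \<subseteq> spk J \<times> spk J'" "krel R"
 shows "Ker_rel (rperp J J' R) = {0} \<longleftrightarrow> Def_rel R = spk J"
  "Ind_rel (rperp J J' R) = {0} \<longleftrightarrow> Im_rel R = spk J'"
proof -
 have "Ker_rel (rperp J J' R) = perp J (Def_rel R)"
  using ksubD(1)[OF ksub_spk, of J'] by (auto simp: Ker_rel_def rperp_def perp_def Def_rel_def)
 moreover have "ksub (Def_rel R)" "Def_rel R \<subseteq> spk J"
  using R krelD(1-3)[OF R(2)] unfolding ksub_def Def_rel_def by blast+
 ultimately show "Ker_rel (rperp J J' R) = {0} \<longleftrightarrow> Def_rel R = spk J" using perp_eq_0_iff[OF J(1)] by simp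
 have "Ind_rel (rperp J J' R) = perp J' (Im_rel R)"
  using ksubD(1)[OF ksub_spk, of J] by (auto simp: Ind_rel_def rperp_def perp_def Im_rel_def)
 moreover have "ksub (Im_rel R)" "Im_rel R \<subseteq> spk J'"
  using R krelD(1-3)[OF R(2)] unfolding ksub_def Im_rel_def by blast+
 ultimately show "Ind_rel (rperp J J' R) = {0} \<longleftrightarrow> Im_rel R = spk J'" using perp_eq_0_iff[OF J(2)] by simp
qed

text \<open>Types \<open>(1,1)\<close> and \<open>(0,0)\<close>, and types \<open>(1,0)\<close> and \<open>(0,1)\<close>, are exchanged by passing to
 annihilators and adjoint operators.\<close>

theorem card_invariant_relations:
 fixes J J' :: "'i set"
 assumes J: "finite J" "finite J'" and g: "kmod (spk J) g" and h: "kmod (spk J') h"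
  and rs: "r : {0, 1 :: nat}" "s : {0, 1 :: nat}"
 shows "card {R : Rl (spk J) g (spk J') h. (r = 0 --> Ker_rel R = {0}) & (r = 1 --> Def_rel R = spk J) \<and>
  (s = 0 --> Ind_rel R = {0}) & (s = 1 --> Im_rel R = spk J')} = card (Hm (spk J) g (spk J') h)"
  (is "card (?N r s) = _")
proof -
 obtain g' where g': "kmod (spk J) g'"
  "!!v w. v : spk J ==> w : spk J ==> dot J (g v) w = dot J v (g' w)" using adjoint_exists[OF J(1) g] by blast
 obtain h' where h': "kmod (spk J') h'"
  "!!v w. v : spk J' ==> w : spk J' ==> dot J' (h v) w = dot J' v (h' w)" using adjoint_exists[OF J(2) h] by blast
 let ?P = "rperp J J'"
 have Rl1: "?P R : Rl (spk J) g' (spk J') h'" if "R : Rl (spk J) g (spk J') h" for R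
  unfolding Rl_def
 proof (safe)
  fix v' w' assume vw': "(v', w') : ?P R"
  have "dot J v (g' v') + dot J' w (h' w') = 0" if vw: "(v, w) : R" for v w
  proof -
  have "v : spk J" "w : spk J'" "(g v, h w) : R" "v' : spk J" "w' : spk J'"
  using vw vw' \<open>R : Rl (spk J) g (spk J') h\<close> by (auto simp: Rl_def rperp_def)
  then show ?thesis using g'(2)[of v v'] h'(2)[of w w'] vw' by (auto simp: rperp_def)
  qed
  then show "(g' v', h' w') : ?P R"
  using vw' kmodD(3)[OF g'(1)] kmodD(3)[OF h'(1)] by (auto simp: rperp_def)
 qed (auto simp: krel_rperp, auto simp: rperp_def)
 have Rl2: "?P R : Rl (spk J) g (spk J') h" if "R : Rl (spk J) g' (spk J') h'" for R
  unfolding Rl_def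
 proof (safe)
  fix v' w' assume vw': "(v', w') : ?P R"
  have "dot J v (g v') + dot J' w (h w') = 0" if vw: "(v, w) : R" for v w
  proof -
  have "v : spk J" "w : spk J'" "(g' v, h' w) : R" "v' : spk J" "w' : spk J'"
  using vw vw' \<open>R : Rl (spk J) g' (spk J') h'\<close> by (auto simp: Rl_def rperp_def)
  then show ?thesis using g'(2)[of v' v] h'(2)[of w' w] vw'
  by (auto simp: rperp_def dot_commute)
  qed
  then show "(g v', h w') : ?P R"
  using vw' kmodD(3)[OF g] kmodD(3)[OF h] by (auto simp: rperp_def)
 qed (auto simp: krel_rperp, auto simp: rperp_def)
 have PP: "?P (?P R) = R" if "R : Rl (spk J) g0 (spk J') h0" for R g0 h0
  using that J by (intro rperp_rperp) (auto simp: Rl_def)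
 have KI: "Ker_rel (?P R) = {0} \<longleftrightarrow> Def_rel R = spk J" "Ind_rel (?P R) = {0} \<longleftrightarrow> Im_rel R = spk J'"
  if "R : Rl (spk J) g0 (spk J') h0" for R g0 h0
  using that Ker_rperp[OF J, of R] by (auto simp: Rl_def)
 have DI: "Def_rel (?P R) = spk J \<longleftrightarrow> Ker_rel R = {0}" "Im_rel (?P R) = spk J' \<longleftrightarrow> Ind_rel R = {0}"
  if "R : Rl (spk J) g (spk J') h" for R
  using KI[OF Rl1[OF that]] PP[OF that] by auto
 have N10: "card (?N 1 0) = card (Hm (spk J) g (spk J') h)"
  unfolding Hm_def by (simp only: one_neq_zero zero_neq_one simp_thms)
 have N00: "card (?N 0 0) = card (Hm (spk J) g (spk J') h)"
  using card_Pars[OF g h] unfolding Pars_def by (simp only: zero_neq_one simp_thms)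
 have "converse ` ?N 0 1 \<subseteq> Hm (spk J') h (spk J) g" "converse ` Hm (spk J') h (spk J) g \<subseteq> ?N 0 1"
  using Rl_converse by (fastforce simp: Hm_def converse_simps)+
 then have "bij_betw converse (?N 0 1) (Hm (spk J') h (spk J) g)"
  by (intro bij_betw_byWitness[of _ converse]) auto
 then have "card (?N 0 1) = card (Hm (spk J') h (spk J) g)" by (rule bij_betw_same_card)
 then have N01: "card (?N 0 1) = card (Hm (spk J) g (spk J') h)" using card_Hm_commute[OF g h] by simp
 \<comment> \<open>The annihilator of a relation of type (1,1) has type (0,0), but for the adjoint
   operators \<open>g'\<close> and \<open>h'\<close>; the last block of the chain returns to
   \<open>g\<close> and \<open>h\<close>.\<close>
 have P1: "?P R : Pars (spk J) g' (spk J') h'" if R: "R : ?N 1 1" for R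
 proof -
  have R': "R : Rl (spk J) g (spk J') h" "Def_rel R = spk J" "Im_rel R = spk J'" using R by auto
  show ?thesis using R' Rl1[OF R'(1)] KI[OF R'(1)] unfolding Pars_def by blast
 qed
 have P2: "?P R : ?N 1 1" if R: "R : Pars (spk J) g' (spk J') h'" for R
 proof -
  have R1: "R : Rl (spk J) g' (spk J') h'" and R2: "Ker_rel R = {0}" "Ind_rel R = {0}"
  using R unfolding Pars_def by blast+
  have "Def_rel (?P R) = spk J" using KI(1)[OF Rl2[OF R1]] R2(1) unfolding PP[OF R1] by (rule iffD1)
  moreover have "Im_rel (?P R) = spk J'" using KI(2)[OF Rl2[OF R1]] R2(2) unfolding PP[OF R1] by (rule iffD1)
  ultimately show ?thesis using Rl2[OF R1]
  by (simp only: mem_Collect_eq simp_thms one_neq_zero zero_neq_one)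
 qed
 have "bij_betw ?P (?N 1 1) (Pars (spk J) g' (spk J') h')"
 proof (rule bij_betw_byWitness[of _ ?P])
  show "ALL R:?N 1 1. ?P (?P R) = R" by (rule ballI, rule PP, drule CollectD, erule conjunct1)
  show "ALL R:Pars (spk J) g' (spk J') h'. ?P (?P R) = R"
  by (rule ballI, rule PP, unfold Pars_def, drule CollectD, erule conjunct1)
  show "?P ` ?N 1 1 \<subseteq> Pars (spk J) g' (spk J') h'" by (rule image_subsetI, erule P1)
  show "?P ` Pars (spk J) g' (spk J') h' \<subseteq> ?N 1 1" by (rule image_subsetI, erule P2)
 qed
 then have "card (?N 1 1) = card (Pars (spk J) g' (spk J') h')" by (rule bij_betw_same_card)
 also have "... = card (Hm (spk J') h' (spk J) g')" using card_Pars[OF g'(1) h'(1)] card_Hm_commute[OF g'(1) h'(1)] by simp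
 \<comment> \<open>For a homomorphism from \<open>h'\<close> to \<open>g'\<close>, the annihilator
   of the converse of its graph is the graph of a homomorphism from \<open>g\<close> to
   \<open>h\<close>; this is the adjoint map up to sign.\<close>
 also have "... = card (?N 1 0)"
 proof -
  let ?f = "%R. ?P (R\<inverse>)" and ?f' = "%R. (?P R)\<inverse>"
  have 1: "?f R : ?N 1 0" if R: "R : Hm (spk J') h' (spk J) g'" for R
  proof -
  have R1: "R\<inverse> : Rl (spk J) g' (spk J') h'" and R2: "Im_rel (R\<inverse>) = spk J'" "Ker_rel (R\<inverse>) = {0}"
  using R Rl_converse unfolding Hm_def converse_simps by blast+
  have "Ind_rel (?f R) = {0}" using KI(2)[OF R1] R2(1) by (rule iffD2)
  moreover have "Def_rel (?f R) = spk J"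
  using KI(1)[OF Rl2[OF R1]] R2(2) unfolding PP[OF R1] by (rule iffD1)
  ultimately show ?thesis using Rl2[OF R1]
  by (simp only: mem_Collect_eq simp_thms one_neq_zero zero_neq_one)
  qed
  have 2: "?f' R : Hm (spk J') h' (spk J) g'" if R: "R : ?N 1 0" for R
  proof -
  have R1: "R : Rl (spk J) g (spk J') h" and R2: "Def_rel R = spk J" "Ind_rel R = {0}" using R by auto
  have "Ker_rel (?P R) = {0}" using KI(1)[OF R1] R2(1) by (rule iffD2)
  moreover have "Im_rel (?P R) = spk J'" using DI(2)[OF R1] R2(2) by (rule iffD2)
  ultimately show ?thesis using Rl_converse[OF Rl1[OF R1]]
  unfolding Hm_def mem_Collect_eq converse_simps by (intro conjI)
  qed
  have "bij_betw ?f (Hm (spk J') h' (spk J) g') (?N 1 0)"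
  proof (rule bij_betw_byWitness[of _ ?f'])
  show "ALL R:Hm (spk J') h' (spk J) g'. ?f' (?f R) = R"
  proof
  fix R assume "R : Hm (spk J') h' (spk J) g'"
  then have "?P (?P (R\<inverse>)) = R\<inverse>"
  by (intro PP Rl_converse) (unfold Hm_def, drule CollectD, erule conjunct1)
  then show "?f' (?f R) = R" by simp
  qed
  show "ALL R:?N 1 0. ?f (?f' R) = R"
  by (rule ballI, subst converse_converse, rule PP, drule CollectD, erule conjunct1)
  show "?f ` Hm (spk J') h' (spk J) g' \<subseteq> ?N 1 0" by (rule image_subsetI, erule 1)
  show "?f' ` ?N 1 0 \<subseteq> Hm (spk J') h' (spk J) g'" by (rule image_subsetI, erule 2)
  qed
  then show ?thesis by (rule bij_betw_same_card)
 qed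
 finally have N11: "card (?N 1 1) = card (Hm (spk J) g (spk J') h)" using N10 by (rule trans)
 consider "r = 0" "s = 0" | "r = 1" "s = 0" | "r = 0" "s = 1" | "r = 1" "s = 1" using rs by auto
 then show ?thesis using N00 N10 N01 N11 by cases (simp_all only:)
qed

end

section \<open>Standard coordinate spaces and linear maps between subspaces\<close>

text \<open>The model space of dimension \<open>n\<close>. Moving representations into these spaces
  makes equality of representations meaningful and sets of them finite over a finite field.\<close>

definition sp :: "nat => (nat => 'a::field) set" where
 "sp n = {v. ALL j>=n. v j = 0}"

definition unitv :: "nat => nat => 'a::field" where
 "unitv j = (%i. if i = j then 1 else 0)"

lemma subspace_sp: "fv.subspace (sp n)"
 by (auto simp: fv.subspace_def sp_def fscale_def)

lemma unitv_sp: "j < n ==> unitv j : sp n"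
 by (auto simp: sp_def unitv_def)

lemma sp_expand:
 assumes "v : sp n"
 shows "v = (\<Sum>j<n. fscale (v j) (unitv j))"
proof
 fix i
 have "(\<Sum>j<n. fscale (v j) (unitv j)) i = (\<Sum>j<n. if i = j then v j else 0)"
  unfolding sum_fun_at by (intro sum.cong) (auto simp: fscale_def unitv_def)
 then show "v i = (\<Sum>j<n. fscale (v j) (unitv j)) i" using assms by (auto simp: sp_def)
qed

lemma span_unitv: "fv.span (unitv ` {..<n}) = sp n"
proof (intro equalityI subsetI)
 fix v :: "nat => 'a" assume "v : sp n"
 then have "v = (\<Sum>j<n. fscale (v j) (unitv j))" by (rule sp_expand)
 also have "... : fv.span (unitv ` {..<n})"
  by (intro fv.span_sum fv.span_scale fv.span_base) auto
 finally show "v : fv.span (unitv ` {..<n})" .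
next
 fix v :: "nat => 'a" assume "v : fv.span (unitv ` {..<n})"
 then show "v : sp n"
  using fv.span_minimal[OF _ subspace_sp, of "unitv ` {..<n}" n] unitv_sp by blast
qed

lemma inj_unitv: "inj (unitv :: nat => nat => 'a::field)"
 unfolding inj_def unitv_def fun_eq_iff by (metis zero_neq_one)

lemma independent_unitv: "fv.independent (unitv ` {..<n} :: (nat => 'a::field) set)"
proof (rule fv.independent_if_scalars_zero)
 fix f :: "(nat => 'a) => 'a" and x :: "nat => 'a"
 assume eq: "(\<Sum>x\<in>unitv ` {..<n}. fscale (f x) x) = 0" and "x : unitv ` {..<n}"
 then obtain j where j: "j < n" "x = unitv j" by auto
 have "(\<Sum>i<n. fscale (f (unitv i)) (unitv i)) = 0"
  using eq by (subst (asm) sum.reindex) (auto intro: inj_on_subset[OF inj_unitv])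
 then have "(\<Sum>i<n. f (unitv i) * unitv i j) = 0"
  by (metis (no_types, lifting) fscale_def sum.cong sum_fun_at zero_fun_apply)
 moreover have "(\<Sum>i<n. f (unitv i) * unitv i j) = (\<Sum>i<n. if i = j then f x else 0)"
  by (intro sum.cong) (auto simp: unitv_def j)
 ultimately show "f x = 0" using j by simp
qed simp

lemma dim_sp: "fv.dim (sp n :: (nat => 'a::field) set) = n"
 using fv.dim_span_eq_card_independent[OF independent_unitv[where ?'a = 'a, of n]]
 by (simp add: span_unitv card_image[OF inj_on_subset[OF inj_unitv subset_UNIV]])

lemma fin_dim_sp: "fin_dim_space (sp n)"
 unfolding fin_dim_space_def using span_unitv by (metis finite_imageI finite_lessThan)

lemma fin_dim_subspace: "fin_dim_space V ==> fv.subspace V"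
 by (auto simp: fin_dim_space_def)

lemma fin_dim_basis:
 assumes "fin_dim_space V"
 obtains B where "finite B" "fv.independent B" "fv.span B = V" "card B = fv.dim V"
proof -
 obtain B0 where B0: "finite B0" "V = fv.span B0" using assms by (auto simp: fin_dim_space_def)
 obtain B where B: "B \<subseteq> V" "fv.independent B" "V \<subseteq> fv.span B" "card B = fv.dim V"
  by (rule fv.basis_exists[of V])
 have "finite B" using B B0 fv.independent_span_bound by blast
 moreover have "fv.span B = V" using B B0 by (metis fv.span_minimal fv.subspace_span subset_antisym)
 ultimately show thesis using that B by blast
qed

lemma fin_dim_subset:
 assumes "fin_dim_space V" "fv.subspace U" "U \<subseteq> V"
 shows "fin_dim_space U"
proof -
 obtain B0 where B0: "finite B0" "V = fv.span B0" using assms by (auto simp: fin_dim_space_def)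
 obtain B where B: "B \<subseteq> U" "fv.independent B" "U \<subseteq> fv.span B"
  by (rule fv.basis_exists[of U])
 have "finite B" using B B0 assms(3) fv.independent_span_bound[of B0 B] by blast
 moreover have "U = fv.span B" using B assms(2) by (metis fv.span_minimal subset_antisym)
 ultimately show ?thesis by (auto simp: fin_dim_space_def)
qed

lemma fin_dim_zero: "fin_dim_space {0}"
 unfolding fin_dim_space_def by (rule exI[of _ "{}"]) simp

lemma linear_map_onD:
 assumes "linear_map_on V W f"
 shows "x : V ==> f x : W" "x : V ==> y : V ==> f (x + y) = f x + f y"
  "x : V ==> f (fscale c x) = fscale c (f x)"
 using assms by (auto simp: linear_map_on_def)

lemma linear_map_on_zero: "linear_map_on V W f ==> fv.subspace V ==> f 0 = 0"
 using linear_map_onD(3)[of V W f 0 0] fv.subspace_0[of V] by (simp only: fv.scale_zero_left)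

lemma linear_map_on_diff:
 assumes "linear_map_on V W f" "fv.subspace V" "x : V" "y : V"
 shows "f (x - y) = f x - f y"
 using linear_map_onD(2)[OF assms(1) fv.subspace_diff[OF assms(2,3,4)] assms(4)] by (simp add: eq_diff_eq)

lemma linear_map_on_comp: "linear_map_on V W f ==> linear_map_on W U g ==> linear_map_on V U (g \<circ> f)"
 by (auto simp: linear_map_on_def Pi_iff)

lemma linear_map_on_id: "linear_map_on V V (%x. x)"
 by (auto simp: linear_map_on_def)

lemma linear_map_on_cong: "(!!x. x : V ==> f x = g x) ==> fv.subspace V ==> linear_map_on V W f ==> linear_map_on V W g"
 unfolding linear_map_on_def by (auto simp: fv.subspace_add fv.subspace_scale Pi_iff)

lemma linear_map_on_addf:
 assumes "linear_map_on V W f" "linear_map_on V W g" "fv.subspace W"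
 shows "linear_map_on V W (%x. f x + g x)"
 using assms(1,2) fv.subspace_add[OF assms(3)]
 unfolding linear_map_on_def by (auto simp: Pi_iff fv.scale_right_distrib algebra_simps)

lemma linear_map_on_subf:
 assumes "linear_map_on V W f" "linear_map_on V W g" "fv.subspace W"
 shows "linear_map_on V W (%x. f x - g x)"
 using assms(1,2) fv.subspace_diff[OF assms(3)]
 unfolding linear_map_on_def by (auto simp: Pi_iff fv.scale_right_diff_distrib algebra_simps)

lemma linear_map_on_0: "fv.subspace W ==> linear_map_on V W (%x. 0)"
 unfolding linear_map_on_def by (auto simp: fv.subspace_0)

lemma linear_map_on_inv_into:
 assumes f: "linear_map_on V W f" "bij_betw f V W" and V: "fv.subspace V"
 shows "linear_map_on W V (inv_into V f)"
proof -
 have im: "f ` V = W" and inj: "inj_on f V" using f(2) by (auto simp: bij_betw_def)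
 have eq: "inv_into V f (f x) = x" if "x : V" for x using inj that by simp
 have "inv_into V f (f x + f y) = x + y" if "x : V" "y : V" for x y
  using eq[OF fv.subspace_add[OF V that]] linear_map_onD(2)[OF f(1) that] by simp
 moreover have "inv_into V f (fscale c (f x)) = fscale c x" if "x : V" for x c
  using eq[OF fv.subspace_scale[OF V that]] linear_map_onD(3)[OF f(1) that] by simp
 ultimately show ?thesis unfolding linear_map_on_def im[symmetric] using eq by auto
qed

lemma linear_map_on_extend:
 fixes f :: "('i => 'a::field) => ('j => 'a)"
 assumes f: "linear_map_on V W f" and V: "fin_dim_space V"
 obtains g where "Vector_Spaces.linear fscale fscale g" "!!x. x : V ==> g x = f x"
proof -
 obtain B where B: "finite B" "fv.independent B" "fv.span B = V" using fin_dim_basis[OF V] by blast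
 obtain g where g: "Vector_Spaces.linear fscale fscale g" "ALL x:B. g x = f x"
  using fv2.linear_independent_extend[OF B(2), of f] by blast
 interpret g: Vector_Spaces.linear fscale fscale g by fact
 have BV: "B \<subseteq> V" using B(3) fv.span_superset by blast
 have "g x = f x" if "x : V" for x
 proof -
  obtain c where c: "x = (\<Sum>b\<in>B. fscale (c b) b)" using \<open>x : V\<close> B fv.span_finite by auto
  show ?thesis using linear_map_on_sum[OF f fin_dim_subspace[OF V] B(1) BV, of c] g(2)
  by (simp add: c g.sum g.scale)
 qed
 then show thesis using that g by blast
qed

lemma linear_map_on_image_subspace:
 assumes f: "linear_map_on V W f" and U: "fv.subspace U" "U \<subseteq> V"
 shows "fv.subspace (f ` U)"
 unfolding fv.subspace_def
proof (intro conjI ballI allI)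
 have "0 : V" using U fv.subspace_0 by blast
 from linear_map_onD(3)[OF f this, of 0] have "f 0 = 0" by (simp only: fv.scale_zero_left)
 then show "0 : f ` U" using fv.subspace_0[OF U(1)] by (metis imageI)
next
 fix x y assume "x : f ` U" "y : f ` U"
 then obtain u v where uv: "u : U" "v : U" "x = f u" "y = f v" by auto
 moreover have "u : V" "v : V" using uv U by auto
 ultimately have "x + y = f (u + v)" using linear_map_onD(2)[OF f] by simp
 then show "x + y : f ` U" using fv.subspace_add[OF U(1) uv(1,2)] by blast
next
 fix c x assume "x : f ` U"
 then obtain u where u: "u : U" "x = f u" by auto
 moreover have "u : V" using u U by auto
 ultimately have "fscale c x = f (fscale c u)" using linear_map_onD(3)[OF f] by simp
 then show "fscale c x : f ` U" using fv.subspace_scale[OF U(1) u(1)] by blast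
qed

lemma fin_dim_image:
 fixes f :: "('i => 'a::field) => ('j => 'a)"
 assumes f: "linear_map_on V W f" and V: "fin_dim_space V"
 shows "fin_dim_space (f ` V)"
proof -
 obtain g where g: "Vector_Spaces.linear fscale fscale g" "!!x. x : V ==> g x = f x"
  using linear_map_on_extend[OF f V] by blast
 interpret g: Vector_Spaces.linear fscale fscale g by fact
 obtain B where B: "finite B" "V = fv.span B" using V by (auto simp: fin_dim_space_def)
 have "f ` V = g ` fv.span B" using g(2) B by (metis (no_types, lifting) image_cong)
 then show ?thesis using B(1) g.span_image[of B] unfolding fin_dim_space_def by (metis finite_imageI)
qed

lemma dim_bij:
 fixes f :: "('i => 'a::field) => ('j => 'a)"
 assumes f: "linear_map_on V W f" "bij_betw f V W" and V: "fin_dim_space V"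
 shows "fv.dim W = fv.dim V" "fin_dim_space W"
proof -
 obtain g where g: "Vector_Spaces.linear fscale fscale g" "!!x. x : V ==> g x = f x"
  using linear_map_on_extend[OF f(1) V] by blast
 interpret g: Vector_Spaces.linear fscale fscale g by fact
 have W: "g ` V = W" "inj_on g V" using f(2) g(2) by (auto simp: bij_betw_def inj_on_def)
 obtain B where B: "finite B" "fv.independent B" "fv.span B = V" "card B = fv.dim V"
  using fin_dim_basis[OF V] by blast
 have "fv.independent (g ` B)" using g.independent_injective_image[OF B(2)] B(3) W(2) by simp
 moreover have "fv.span (g ` B) = W" using g.span_image[of B] B(3) W(1) by simp
 moreover have "card (g ` B) = card B"
  using B(3) W(2) fv.span_superset[of B] by (metis card_image inj_on_subset)
 ultimately show "fv.dim W = fv.dim V" using fv.dim_span_eq_card_independent B(4) by metis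
 show "fin_dim_space W" using fin_dim_image[OF f(1) V] f(2) by (simp add: bij_betw_def)
qed

lemma sp_iso:
 fixes V :: "('i => 'a::field) set"
 assumes V: "fin_dim_space V"
 obtains f where "linear_map_on (sp (fv.dim V)) V f" "bij_betw f (sp (fv.dim V)) V"
proof -
 obtain B where B: "finite B" "fv.independent B" "fv.span B = V" "card B = fv.dim V"
  using fin_dim_basis[OF V] by blast
 let ?n = "fv.dim V"
 obtain e where e: "bij_betw e {..<?n} B"
  using B(1,4) by (metis bij_betw_iff_card card_lessThan finite_lessThan)
 define f where "f v = (\<Sum>j<?n. fscale (v j) (e j))" for v
 have eB: "e j : B" if "j < ?n" for j using e that by (auto simp: bij_betw_def)
 have sub: "fv.subspace V" using V by (rule fin_dim_subspace)
 have BV: "B \<subseteq> V" using B(3) fv.span_superset by blast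
 have f: "linear_map_on (sp ?n) V f"
  unfolding linear_map_on_def
 proof (intro conjI ballI allI funcsetI)
  show "f v : V" for v
  unfolding f_def using eB BV by (auto intro!: fv.subspace_sum[OF sub] fv.subspace_scale[OF sub])
  show "f (v + w) = f v + f w" for v w
  by (simp add: f_def fv.scale_left_distrib sum.distrib)
  show "f (fscale c v) = fscale c (f v)" for c v
  by (simp add: f_def fscale_apply fv.scale_sum_right)
 qed
 have fB: "f v = (\<Sum>b\<in>B. fscale (v (inv_into {..<?n} e b)) b)" for v
  unfolding f_def sum.reindex_bij_betw[OF e, symmetric]
  using e by (intro sum.cong) (auto simp: bij_betw_def)
 have "inj_on f (sp ?n)"
 proof (rule inj_onI)
  fix v w assume vw: "v : sp ?n" "w : sp ?n" "f v = f w"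
  have "f (v - w) = 0" using vw linear_map_on_diff[OF f subspace_sp vw(1,2)] by simp
  then have 0: "(\<Sum>b\<in>B. fscale ((v - w) (inv_into {..<?n} e b)) b) = 0" by (simp only: fB)
  have "(v - w) j = 0" if "j < ?n" for j
  using fv.independentD[OF B(2,1) order_refl 0 eB[OF that]] e that by (simp add: bij_betw_def)
  then show "v = w" using vw(1,2) by (auto simp: sp_def fun_eq_iff) (metis not_le right_minus_eq)
 qed
 moreover have "f ` sp ?n = V"
 proof
  show "f ` sp ?n \<subseteq> V" using linear_map_onD(1)[OF f] by auto
  show "V \<subseteq> f ` sp ?n"
  proof
  fix x assume "x : V"
  then obtain c where c: "x = (\<Sum>b\<in>B. fscale (c b) b)" using B fv.span_finite by auto
  define v where "v j = (if j < ?n then c (e j) else 0)" for j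
  have "f v = (\<Sum>j<?n. fscale (c (e j)) (e j))" unfolding f_def by (intro sum.cong) (auto simp: v_def)
  also have "... = x" unfolding c by (rule sum.reindex_bij_betw[OF e])
  finally have "f v = x" .
  moreover have "v : sp ?n" by (simp add: v_def sp_def)
  ultimately show "x : f ` sp ?n" by blast
  qed
 qed
 ultimately show thesis using that f by (auto simp: bij_betw_def)
qed

lemma rel_subspace_iff:
 "fv2.p.subspace R \<longleftrightarrow> (0, 0) : R & (ALL x y x' y'. (x, y) : R --> (x', y') : R --> (x + x', y + y') : R) \<and>
  (ALL c x y. (x, y) : R --> (fscale c x, fscale c y) : R)"
 for R :: "(('i => 'k::field) \<times> ('j => 'k)) set"
proof -
 have "(ALL x:R. ALL y:R. x + y : R) \<longleftrightarrow> (ALL x y x' y'. (x, y) : R --> (x', y') : R --> (x + x', y + y') : R)"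
  unfolding Ball_def split_paired_All add_Pair by blast
 moreover have "(ALL c. ALL x:R. fv2.scale c x : R) \<longleftrightarrow> (ALL c x y. (x, y) : R --> (fscale c x, fscale c y) : R)"
  unfolding Ball_def split_paired_All fv2.scale_prod by blast
 ultimately show ?thesis by (simp add: fv2.p.subspace_def zero_prod_def)
qed

section \<open>Representations by linear relations, and biproducts\<close>

text \<open>One relation for each arrow of the oriented quiver, of any type. The type is kept apart
  in \<open>has_type\<close> so that decompositions, Krull-Schmidt and Frobenius are treated once,
  in the category of all relations.\<close>

definition rel_rep :: "('v, 'e) pre_digraph => ('v, 'e, 'i, 'k::field) erep => bool" where
 "rel_rep Q M \<longleftrightarrow> (ALL i:verts Q. fin_dim_space (espace M i)) \<and>
  (ALL a:arcs Q. linear_relation (espace M (tail Q a)) (espace M (head Q a)) (erel M a))"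

definition has_type ::
 "('v, 'e) pre_digraph => ('e => nat) => ('e => nat) => ('v, 'e, 'i, 'k::field) erep => bool" where
 "has_type Q rho sig M \<longleftrightarrow> (ALL a:arcs Q.
  (rho a = 0 --> Ker_rel (erel M a) = {0}) & (rho a = 1 --> Def_rel (erel M a) = espace M (tail Q a)) \<and>
  (sig a = 0 --> Ind_rel (erel M a) = {0}) & (sig a = 1 --> Im_rel (erel M a) = espace M (head Q a)))"

text \<open>\<open>M\<close> is a biproduct of \<open>N\<close> and \<open>L\<close> with inclusions
  \<open>a\<close>, \<open>b\<close> and projections \<open>p\<close>, \<open>q\<close>. Phrased by
  morphisms, the notion is visibly invariant under isomorphism and connects representations with
  different coordinate types; \<open>iso_sum_iff_bip\<close> relates it to external sums.\<close>

definition bip ::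
 "('v, 'e) pre_digraph => ('v, 'e, 'i, 'k::field) erep => ('v, 'e, 'j, 'k) erep => ('v, 'e, 'l, 'k) erep => bool" where
 "bip Q M N L \<longleftrightarrow> (EX a b p q. equipped_hom Q N M a & equipped_hom Q L M b & equipped_hom Q M N p \<and>
  equipped_hom Q M L q & (ALL i:verts Q.
  (ALL x:espace N i. p i (a i x) = x & q i (a i x) = 0) \<and>
  (ALL y:espace L i. q i (b i y) = y & p i (b i y) = 0) \<and>
  (ALL m:espace M i. a i (p i m) + b i (q i m) = m)))"

locale quiver = fin_digraph Q for Q :: "('v, 'e) pre_digraph"
begin

abbreviation "rhom \<equiv> equipped_hom Q"
abbreviation "riso \<equiv> equipped_iso Q"

lemma rep_space: "rel_rep Q M ==> i : verts Q ==> fin_dim_space (espace M i)"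
 by (simp add: rel_rep_def)

lemma rep_subspace: "rel_rep Q M ==> i : verts Q ==> fv.subspace (espace M i)"
 by (simp add: rel_rep_def fin_dim_subspace)

lemma rep_rel:
 assumes "rel_rep Q M" "a : arcs Q"
 shows "erel M a \<subseteq> espace M (tail Q a) \<times> espace M (head Q a)" "fv2.p.subspace (erel M a)" "(0, 0) : erel M a"
  "(x, y) : erel M a ==> (x', y') : erel M a ==> (x + x', y + y') : erel M a"
  "(x, y) : erel M a ==> (fscale c x, fscale c y) : erel M a"
  "(x, y) : erel M a ==> (x', y') : erel M a ==> (x - x', y - y') : erel M a"
  "(x, y) : erel M a ==> x : espace M (tail Q a)" "(x, y) : erel M a ==> y : espace M (head Q a)"
proof -
 have R: "erel M a \<subseteq> espace M (tail Q a) \<times> espace M (head Q a)" "fv2.p.subspace (erel M a)"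
  using assms by (auto simp: rel_rep_def linear_relation_def)
 show "erel M a \<subseteq> espace M (tail Q a) \<times> espace M (head Q a)" "fv2.p.subspace (erel M a)" by fact+
 show "(x, y) : erel M a ==> x : espace M (tail Q a)" "(x, y) : erel M a ==> y : espace M (head Q a)"
  using R(1) by auto
 show "(0, 0) : erel M a"
  "(x, y) : erel M a ==> (x', y') : erel M a ==> (x + x', y + y') : erel M a"
  "(x, y) : erel M a ==> (fscale c x, fscale c y) : erel M a"
  using R(2) unfolding rel_subspace_iff by blast+
 show "(x, y) : erel M a ==> (x', y') : erel M a ==> (x - x', y - y') : erel M a"
  using fv2.p.subspace_diff[OF R(2), of "(x, y)" "(x', y')"] by simp
qed

lemma homI:
 "(!!i. i : verts Q ==> linear_map_on (espace M i) (espace N i) (tht i)) ==>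
  (!!a x y. a : arcs Q ==> (x, y) : erel M a ==> (tht (tail Q a) x, tht (head Q a) y) : erel N a) ==> rhom M N tht"
 by (auto simp: equipped_hom_def)

lemma homD:
 assumes "rhom M N tht"
 shows "i : verts Q ==> linear_map_on (espace M i) (espace N i) (tht i)"
  "a : arcs Q ==> (x, y) : erel M a ==> (tht (tail Q a) x, tht (head Q a) y) : erel N a"
  "i : verts Q ==> x : espace M i ==> tht i x : espace N i"
  "i : verts Q ==> x : espace M i ==> y : espace M i ==> tht i (x + y) = tht i x + tht i y"
  "i : verts Q ==> x : espace M i ==> tht i (fscale c x) = fscale c (tht i x)"
 using assms by (auto simp: equipped_hom_def linear_map_on_def)

lemma hom_zero_at: "rhom M N tht ==> rel_rep Q M ==> i : verts Q ==> tht i 0 = 0"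
 by (rule linear_map_on_zero[OF homD(1) rep_subspace])

lemma hom_diff_at:
 "rhom M N tht ==> rel_rep Q M ==> i : verts Q ==> x : espace M i ==> y : espace M i ==> tht i (x - y) = tht i x - tht i y"
 by (rule linear_map_on_diff[OF homD(1) rep_subspace])

lemma hom_comp: "rhom M N tht ==> rhom N L \<psi> ==> rhom M L (%i x. \<psi> i (tht i x))"
 by (rule homI) (auto dest: homD(2) intro: linear_map_on_comp[unfolded comp_def] homD(1))

lemma hom_id: "rhom M M (%i x. x)"
 by (rule homI) (auto intro: linear_map_on_id)

lemma hom_add: "rel_rep Q N ==> rhom M N tht ==> rhom M N \<psi> ==> rhom M N (%i x. tht i x + \<psi> i x)"
 by (rule homI) (auto intro: linear_map_on_addf homD(1) rep_subspace rep_rel(4) homD(2))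

lemma hom_diff: "rel_rep Q N ==> rhom M N tht ==> rhom M N \<psi> ==> rhom M N (%i x. tht i x - \<psi> i x)"
 by (rule homI) (auto intro: linear_map_on_subf homD(1) rep_subspace rep_rel(6) homD(2))

lemma hom_zero: "rel_rep Q N ==> rhom M N (%i x. 0)"
 by (rule homI) (auto intro: linear_map_on_0 rep_subspace rep_rel(3))

lemma hom_funpow: "rhom M M tht ==> rhom M M (%i. tht i ^^ n)"
proof (induction n)
 case 0
 then show ?case using hom_id by (simp add: id_def)
next
 case (Suc n)
 then show ?case using hom_comp[of M M "%i. tht i ^^ n" M tht] by (simp add: comp_def)
qed

lemma isoI:
 "rhom M N tht ==> rhom N M \<psi> ==> (!!i x. i : verts Q ==> x : espace M i ==> \<psi> i (tht i x) = x) ==>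
  (!!i y. i : verts Q ==> y : espace N i ==> tht i (\<psi> i y) = y) ==> riso M N"
 unfolding equipped_iso_def by blast

lemma isoE:
 assumes "riso M N"
 obtains tht \<psi> where "rhom M N tht" "rhom N M \<psi>" "ALL i:verts Q. ALL x:espace M i. \<psi> i (tht i x) = x"
  "ALL i:verts Q. ALL y:espace N i. tht i (\<psi> i y) = y"
 using assms unfolding equipped_iso_def by blast

lemma iso_refl: "riso M M"
 by (rule isoI[OF hom_id hom_id]) auto

lemma iso_sym: "riso M N ==> riso N M"
 by (elim isoE, rule isoI) auto

lemma iso_trans: "riso M N ==> riso N L ==> riso M L"
proof (elim isoE)
 fix tht \<psi> tht' \<psi>'
 assume a: "rhom M N tht" "rhom N M \<psi>" "rhom N L tht'" "rhom L N \<psi>'"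
  and b: "ALL i:verts Q. ALL x:espace M i. \<psi> i (tht i x) = x"
  "ALL i:verts Q. ALL x:espace N i. tht i (\<psi> i x) = x"
  "ALL i:verts Q. ALL x:espace N i. \<psi>' i (tht' i x) = x"
  "ALL i:verts Q. ALL x:espace L i. tht' i (\<psi>' i x) = x"
 show "riso M L"
  by (rule isoI[OF hom_comp[OF a(1,3)] hom_comp[OF a(4,2)]]) (simp_all add: b homD(3)[OF a(1)] homD(3)[OF a(4)])
qed

lemma bipI:
 assumes "rhom N M a" "rhom L M b" "rhom M N p" "rhom M L q"
  "!!i x. i : verts Q ==> x : espace N i ==> p i (a i x) = x"
  "!!i x. i : verts Q ==> x : espace N i ==> q i (a i x) = 0"
  "!!i x. i : verts Q ==> x : espace L i ==> q i (b i x) = x"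
  "!!i x. i : verts Q ==> x : espace L i ==> p i (b i x) = 0"
  "!!i x. i : verts Q ==> x : espace M i ==> a i (p i x) + b i (q i x) = x"
 shows "bip Q M N L"
 unfolding bip_def using assms by (intro exI[of _ a] exI[of _ b] exI[of _ p] exI[of _ q]) blast

lemma bipE:
 assumes "bip Q M N L"
 obtains a b p q where "rhom N M a" "rhom L M b" "rhom M N p" "rhom M L q"
  "ALL i:verts Q. ALL x:espace N i. p i (a i x) = x"
  "ALL i:verts Q. ALL x:espace N i. q i (a i x) = 0"
  "ALL i:verts Q. ALL x:espace L i. q i (b i x) = x"
  "ALL i:verts Q. ALL x:espace L i. p i (b i x) = 0"
  "ALL i:verts Q. ALL x:espace M i. a i (p i x) + b i (q i x) = x"
 using assms unfolding bip_def by blast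

lemma bip_commute:
 assumes "bip Q M N L"
 shows "bip Q M L N"
proof -
 obtain a b p q where h: "rhom N M a" "rhom L M b" "rhom M N p" "rhom M L q"
  and e0: "ALL i:verts Q. ALL x:espace N i. p i (a i x) = x"
  "ALL i:verts Q. ALL x:espace N i. q i (a i x) = 0"
  "ALL i:verts Q. ALL x:espace L i. q i (b i x) = x"
  "ALL i:verts Q. ALL x:espace L i. p i (b i x) = 0"
  "ALL i:verts Q. ALL x:espace M i. a i (p i x) + b i (q i x) = x" using assms by (rule bipE)
 show ?thesis by (rule bipI[OF h(2,1,4,3)]) (use e0 in \<open>auto simp: add.commute\<close>)
qed

lemma bip_iso:
 assumes "rel_rep Q N" "rel_rep Q L" "bip Q M N L" "riso M M'" "riso N N'" "riso L L'"
 shows "bip Q M' N' L'"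
proof -
 obtain a b p q where h: "rhom N M a" "rhom L M b" "rhom M N p" "rhom M L q"
  and e0: "ALL i:verts Q. ALL x:espace N i. p i (a i x) = x"
  "ALL i:verts Q. ALL x:espace N i. q i (a i x) = 0"
  "ALL i:verts Q. ALL x:espace L i. q i (b i x) = x"
  "ALL i:verts Q. ALL x:espace L i. p i (b i x) = 0"
  "ALL i:verts Q. ALL x:espace M i. a i (p i x) + b i (q i x) = x" using assms(3) by (rule bipE)
 note e = e0[rule_format]
 obtain m m' where m0: "rhom M M' m" "rhom M' M m'" "ALL i:verts Q. ALL x:espace M i. m' i (m i x) = x"
  "ALL i:verts Q. ALL y:espace M' i. m i (m' i y) = y" using assms(4) by (rule isoE)
 note m = m0[rule_format]
 obtain n n' where n0: "rhom N N' n" "rhom N' N n'" "ALL i:verts Q. ALL x:espace N i. n' i (n i x) = x"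
  "ALL i:verts Q. ALL y:espace N' i. n i (n' i y) = y" using assms(5) by (rule isoE)
 note n = n0[rule_format]
 obtain l l' where l0: "rhom L L' l" "rhom L' L l'" "ALL i:verts Q. ALL x:espace L i. l' i (l i x) = x"
  "ALL i:verts Q. ALL y:espace L' i. l i (l' i y) = y" using assms(6) by (rule isoE)
 note l = l0[rule_format]
 note z = hom_zero_at[OF n(1) assms(1)] hom_zero_at[OF l(1) assms(2)]
 note mem = homD(3)[OF h(1)] homD(3)[OF h(2)] homD(3)[OF h(3)] homD(3)[OF h(4)] homD(3)[OF m(1)] homD(3)[OF m(2)]
  homD(3)[OF n(1)] homD(3)[OF n(2)] homD(3)[OF l(1)] homD(3)[OF l(2)]
 show ?thesis
 proof (rule bipI)
  show "rhom N' M' (%i x. m i (a i (n' i x)))" by (rule hom_comp[OF hom_comp[OF n(2) h(1)] m(1)])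
  show "rhom L' M' (%i x. m i (b i (l' i x)))" by (rule hom_comp[OF hom_comp[OF l(2) h(2)] m(1)])
  show "rhom M' N' (%i x. n i (p i (m' i x)))" by (rule hom_comp[OF hom_comp[OF m(2) h(3)] n(1)])
  show "rhom M' L' (%i x. l i (q i (m' i x)))" by (rule hom_comp[OF hom_comp[OF m(2) h(4)] l(1)])
  fix i x assume i: "i : verts Q"
  show "m i (a i (n' i (n i (p i (m' i x))))) + m i (b i (l' i (l i (q i (m' i x))))) = x" if "x : espace M' i"
  proof -
  have "m i (a i (p i (m' i x))) + m i (b i (q i (m' i x))) = m i (a i (p i (m' i x)) + b i (q i (m' i x)))"
  by (rule homD(4)[OF m(1) i, symmetric]) (simp_all add: mem i that)
  then show ?thesis using i that by (simp add: mem n l e m)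
  qed
 qed (simp_all add: mem m n l e z)
qed

lemma bip_unique:
 assumes "bip Q M N L" "bip Q M' N L" "rel_rep Q M" "rel_rep Q M'"
 shows "riso M M'"
proof -
 obtain a b p q where h: "rhom N M a" "rhom L M b" "rhom M N p" "rhom M L q"
  and e0: "ALL i:verts Q. ALL x:espace N i. p i (a i x) = x"
  "ALL i:verts Q. ALL x:espace N i. q i (a i x) = 0"
  "ALL i:verts Q. ALL x:espace L i. q i (b i x) = x"
  "ALL i:verts Q. ALL x:espace L i. p i (b i x) = 0"
  "ALL i:verts Q. ALL x:espace M i. a i (p i x) + b i (q i x) = x" using assms(1) by (rule bipE)
 note e = e0[rule_format]
 obtain a' b' p' q' where h': "rhom N M' a'" "rhom L M' b'" "rhom M' N p'" "rhom M' L q'"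
  and e'0: "ALL i:verts Q. ALL x:espace N i. p' i (a' i x) = x"
  "ALL i:verts Q. ALL x:espace N i. q' i (a' i x) = 0"
  "ALL i:verts Q. ALL x:espace L i. q' i (b' i x) = x"
  "ALL i:verts Q. ALL x:espace L i. p' i (b' i x) = 0"
  "ALL i:verts Q. ALL x:espace M' i. a' i (p' i x) + b' i (q' i x) = x" using assms(2) by (rule bipE)
 note e' = e'0[rule_format]
 note mem = homD(3)[OF h(1)] homD(3)[OF h(2)] homD(3)[OF h(3)] homD(3)[OF h(4)]
  homD(3)[OF h'(1)] homD(3)[OF h'(2)] homD(3)[OF h'(3)] homD(3)[OF h'(4)]
 note add = homD(4)[OF h(3)] homD(4)[OF h(4)] homD(4)[OF h'(3)] homD(4)[OF h'(4)]
 show ?thesis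
  by (rule isoI[OF hom_add[OF assms(4) hom_comp[OF h(3) h'(1)] hom_comp[OF h(4) h'(2)]]
  hom_add[OF assms(3) hom_comp[OF h'(3) h(1)] hom_comp[OF h'(4) h(2)]]])
  (simp_all add: mem add e e')
qed

lemma iso_bip_zero:
 assumes "bip Q M N L" "rel_rep Q M" "~ equipped_nonzero Q L"
 shows "riso M N"
proof -
 obtain a b p q where h: "rhom N M a" "rhom L M b" "rhom M N p" "rhom M L q"
  and e0: "ALL i:verts Q. ALL x:espace N i. p i (a i x) = x"
  "ALL i:verts Q. ALL x:espace N i. q i (a i x) = 0"
  "ALL i:verts Q. ALL x:espace L i. q i (b i x) = x"
  "ALL i:verts Q. ALL x:espace L i. p i (b i x) = 0"
  "ALL i:verts Q. ALL x:espace M i. a i (p i x) + b i (q i x) = x" using assms(1) by (rule bipE)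
 note e = e0[rule_format]
 show ?thesis
 proof (rule isoI[OF h(3,1)])
  fix i x assume i: "i : verts Q" and x: "x : espace M i"
  have "q i x = 0" using homD(3)[OF h(4) i x] assms(3) i by (auto simp: equipped_nonzero_def)
  then have "b i (q i x) = b i (q i (a i 0))"
  using e(2)[OF i, of 0] hom_zero_at[OF h(3) assms(2) i] homD(3)[OF h(3) i, of 0] rep_subspace[OF assms(2) i]
  by (metis fv.subspace_0)
  then have "b i (q i x) = 0"
  using \<open>q i x = 0\<close> homD(5)[OF h(2) i, of 0 0] homD(3)[OF h(4) i x] by (metis fv.scale_zero_left)
  then show "a i (p i x) = x" using e(5)[OF i x] by simp
 qed (use e in auto)
qed

lemma bip_zero:
 assumes "rel_rep Q M" "rel_rep Q Z" "~ equipped_nonzero Q Z"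
 shows "bip Q M M Z"
 by (rule bipI[OF hom_id hom_zero[OF assms(1)] hom_id hom_zero[OF assms(2)]])
  (use assms in \<open>auto simp: equipped_nonzero_def\<close>)

text \<open>A split monomorphism has the kernel of its retraction as a complement.\<close>

lemma split_mono:
 fixes M :: "('v, 'e, 'i, 'k::field) erep" and N :: "('v, 'e, 'j, 'k) erep"
 assumes M: "rel_rep Q M" and N: "rel_rep Q N" and f: "rhom N M f" and g: "rhom M N g"
  and gf: "!!i x. i : verts Q ==> x : espace N i ==> g i (f i x) = x"
 obtains L :: "('v, 'e, 'i, 'k) erep" where "rel_rep Q L" "bip Q M N L" "ALL i. espace L i = {m : espace M i. g i m = 0}"
proof -
 define L where "L = \<lparr>espace = %i. {m : espace M i. g i m = 0},
  erel = %a. erel M a \<inter> ({m : espace M (tail Q a). g (tail Q a) m = 0} \<times> {m : espace M (head Q a). g (head Q a) m = 0})\<rparr>"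
 have sub: "fv.subspace (espace L i)" if i: "i : verts Q" for i
  using rep_subspace[OF M i] hom_zero_at[OF g M i] homD(4,5)[OF g i]
  unfolding L_def fv.subspace_def by (auto simp: fscale_def zero_fun_def)
 have L: "rel_rep Q L"
  unfolding rel_rep_def linear_relation_def
 proof (intro conjI ballI)
  fix i assume i: "i : verts Q"
  show "fin_dim_space (espace L i)"
  by (rule fin_dim_subset[OF rep_space[OF M i] sub[OF i]]) (auto simp: L_def)
 next
  fix a assume a: "a : arcs Q"
  show "erel L a \<subseteq> espace L (tail Q a) \<times> espace L (head Q a)" by (auto simp: L_def)
  have "erel L a = erel M a \<inter> (espace L (tail Q a) \<times> espace L (head Q a))" by (auto simp: L_def)
  then show "fv2.p.subspace (erel L a)"
  using sub a rep_rel(2)[OF M a] by (simp add: fv2.p.subspace_inter fv2.subspace_Times)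
 qed
 have q: "rhom M L (%i m. m - f i (g i m))"
 proof (rule homI)
  fix i assume i: "i : verts Q"
  have "linear_map_on (espace M i) (espace M i) (%m. m - f i (g i m))"
  by (rule homD(1)[OF hom_diff[OF M hom_id hom_comp[OF g f]] i])
  moreover have "g i (m - f i (g i m)) = 0" if "m : espace M i" for m
  using gf[OF i] homD(3)[OF g i that] homD(3)[OF f i homD(3)[OF g i that]] hom_diff_at[OF g M i that] by simp
  ultimately show "linear_map_on (espace M i) (espace L i) (%m. m - f i (g i m))"
  by (auto simp: linear_map_on_def L_def Pi_iff)
 next
  fix a x y assume a: "a : arcs Q" and xy: "(x, y) : erel M a"
  have t: "g i (m - f i (g i m)) = 0" if "m : espace M i" "i : verts Q" for m i
  using gf homD(3)[OF g _ that(1)] homD(3)[OF f _ homD(3)[OF g _ that(1)]] hom_diff_at[OF g M _ that(1)] that by simp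
  have "(x - f (tail Q a) (g (tail Q a) x), y - f (head Q a) (g (head Q a) y)) : erel M a"
  using homD(2)[OF hom_diff[OF M hom_id hom_comp[OF g f]] a xy] .
  then show "(x - f (tail Q a) (g (tail Q a) x), y - f (head Q a) (g (head Q a) y)) : erel L a"
  using t rep_rel(7,8)[OF M a] xy a by (auto simp: L_def)
 qed
 have "rhom L M (%i x. x)" by (rule homI) (auto simp: L_def linear_map_on_def)
 then have "bip Q M N L"
  by (rule bipI[OF f _ g q]) (use gf homD(5)[OF f, of _ 0 0] rep_subspace[OF N, THEN fv.subspace_0] hom_zero_at[OF f N] in \<open>auto simp: L_def\<close>)
 then show thesis using that L by (simp add: L_def)
qed

text \<open>The exchange N1 + (N2 + L2) = N2 + (N1 + L2), with \<open>L3\<close> for the second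
  bracket. It pulls a summand that occurs deep inside a decomposition to the front.\<close>

lemma bip_assoc:
 fixes M :: "('v, 'e, 'i, 'k::field) erep"
 assumes M: "rel_rep Q M" and reps: "rel_rep Q N1" "rel_rep Q L1" "rel_rep Q N2" "rel_rep Q L2" "rel_rep Q L3"
  and b1: "bip Q M N1 L1" and b2: "bip Q L1 N2 L2" and b3: "bip Q L3 N1 L2"
 shows "bip Q M N2 L3"
proof -
 obtain a b p q where h: "rhom N1 M a" "rhom L1 M b" "rhom M N1 p" "rhom M L1 q"
  and e0: "ALL i:verts Q. ALL x:espace N1 i. p i (a i x) = x"
  "ALL i:verts Q. ALL x:espace N1 i. q i (a i x) = 0"
  "ALL i:verts Q. ALL x:espace L1 i. q i (b i x) = x"
  "ALL i:verts Q. ALL x:espace L1 i. p i (b i x) = 0"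
  "ALL i:verts Q. ALL x:espace M i. a i (p i x) + b i (q i x) = x" using b1 by (rule bipE)
 note e = e0[rule_format]
 obtain a' b' p' q' where h': "rhom N2 L1 a'" "rhom L2 L1 b'" "rhom L1 N2 p'" "rhom L1 L2 q'"
  and e'0: "ALL i:verts Q. ALL x:espace N2 i. p' i (a' i x) = x"
  "ALL i:verts Q. ALL x:espace N2 i. q' i (a' i x) = 0"
  "ALL i:verts Q. ALL x:espace L2 i. q' i (b' i x) = x"
  "ALL i:verts Q. ALL x:espace L2 i. p' i (b' i x) = 0"
  "ALL i:verts Q. ALL x:espace L1 i. a' i (p' i x) + b' i (q' i x) = x" using b2 by (rule bipE)
 note e' = e'0[rule_format]
 obtain u v r w where k: "rhom N1 L3 u" "rhom L2 L3 v" "rhom L3 N1 r" "rhom L3 L2 w"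
  and d0: "ALL i:verts Q. ALL x:espace N1 i. r i (u i x) = x"
  "ALL i:verts Q. ALL x:espace N1 i. w i (u i x) = 0"
  "ALL i:verts Q. ALL x:espace L2 i. w i (v i x) = x"
  "ALL i:verts Q. ALL x:espace L2 i. r i (v i x) = 0"
  "ALL i:verts Q. ALL x:espace L3 i. u i (r i x) + v i (w i x) = x" using b3 by (rule bipE)
 note d = d0[rule_format]
 note mem = homD(3)[OF h(1)] homD(3)[OF h(2)] homD(3)[OF h(3)] homD(3)[OF h(4)]
  homD(3)[OF h'(1)] homD(3)[OF h'(2)] homD(3)[OF h'(3)] homD(3)[OF h'(4)]
  homD(3)[OF k(1)] homD(3)[OF k(2)] homD(3)[OF k(3)] homD(3)[OF k(4)]
 note add = homD(4)[OF h(2)] homD(4)[OF h(3)] homD(4)[OF h(4)] homD(4)[OF h'(3)] homD(4)[OF h'(4)] homD(4)[OF k(3)] homD(4)[OF k(4)]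
 have z1: "p' i 0 = 0" "q' i 0 = 0" "u i 0 = 0" "v i 0 = 0" if "i : verts Q" for i
  using hom_zero_at[OF h'(3) reps(2) that] hom_zero_at[OF h'(4) reps(2) that]
  hom_zero_at[OF k(1) reps(1) that] hom_zero_at[OF k(2) reps(4) that] by auto
 show ?thesis
 proof (rule bipI)
  show "rhom N2 M (%i x. b i (a' i x))" by (rule hom_comp[OF h'(1) h(2)])
  show "rhom M N2 (%i x. p' i (q i x))" by (rule hom_comp[OF h(4) h'(3)])
  show "rhom L3 M (%i x. a i (r i x) + b i (b' i (w i x)))"
  by (rule hom_add[OF M hom_comp[OF k(3) h(1)] hom_comp[OF hom_comp[OF k(4) h'(2)] h(2)]])
  show "rhom M L3 (%i x. u i (p i x) + v i (q' i (q i x)))"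
  by (rule hom_add[OF reps(5) hom_comp[OF h(3) k(1)] hom_comp[OF hom_comp[OF h(4) h'(4)] k(2)]])
  fix i x assume i: "i : verts Q"
  show "b i (a' i (p' i (q i x))) + (a i (r i (u i (p i x) + v i (q' i (q i x)))) + b i (b' i (w i (u i (p i x) + v i (q' i (q i x)))))) = x"
  if x: "x : espace M i"
  proof -
  have "b i (a' i (p' i (q i x))) + b i (b' i (q' i (q i x))) = b i (q i x)"
  using i x by (subst homD(4)[OF h(2), symmetric]) (simp_all add: mem e')
  then show ?thesis using e(5)[OF i x] i x by (simp add: mem add d e e' algebra_simps)
  qed
 qed (simp_all add: mem add e e' d z1)
qed

text \<open>Vanishing conditions are checked by pushing a vector into \<open>M\<close> along the
  section \<open>f\<close>; fullness conditions by lifting there and coming back along the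
  retraction \<open>g\<close>.\<close>

lemma retract_type:
 assumes "rel_rep Q M" "rel_rep Q N" "rhom N M f" "rhom M N g" "!!i x. i : verts Q ==> x : espace N i ==> g i (f i x) = x"
  and T: "has_type Q rho sig M"
 shows "has_type Q rho sig N"
 unfolding has_type_def
proof (intro ballI conjI impI)
 fix a assume a: "a : arcs Q"
 then have v: "tail Q a : verts Q" "head Q a : verts Q" by auto
 note hf = homD(2)[OF assms(3) a] and hg = homD(2)[OF assms(4) a]
 note z = hom_zero_at[OF assms(3,2)] hom_zero_at[OF assms(4,1)]
 note R = rep_rel[OF assms(2) a]
 { assume ra: "rho a = 0"
  then have K: "Ker_rel (erel M a) = {0}" using T a ra by (simp add: has_type_def)
  have "x = 0" if "(x, 0) : erel N a" for x
  proof -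
  have "(f (tail Q a) x, 0) : erel M a" using hf[OF that] z v by simp
  then have "f (tail Q a) x = 0" using K by (auto simp: Ker_rel_def)
  then show ?thesis using assms(5)[OF v(1), of x] R(7)[OF that] z v by simp
  qed
  then show "Ker_rel (erel N a) = {0}" using R(3) by (auto simp: Ker_rel_def)
 }
 { assume ra: "sig a = 0"
  then have K: "Ind_rel (erel M a) = {0}" using T a ra by (simp add: has_type_def)
  have "x = 0" if "(0, x) : erel N a" for x
  proof -
  have "(0, f (head Q a) x) : erel M a" using hf[OF that] z v by simp
  then have "f (head Q a) x = 0" using K by (auto simp: Ind_rel_def)
  then show ?thesis using assms(5)[OF v(2), of x] R(8)[OF that] z v by simp
  qed
  then show "Ind_rel (erel N a) = {0}" using R(3) by (auto simp: Ind_rel_def)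
 }
 { assume ra: "rho a = 1"
  then have K: "Def_rel (erel M a) = espace M (tail Q a)" using T a ra by (simp add: has_type_def)
  have "x : Def_rel (erel N a)" if "x : espace N (tail Q a)" for x
  proof -
  have "f (tail Q a) x : Def_rel (erel M a)" using K homD(3)[OF assms(3) v(1) that] by simp
  then obtain y where "(f (tail Q a) x, y) : erel M a" by (auto simp: Def_rel_def)
  from hg[OF this] show ?thesis using assms(5)[OF v(1) that] by (auto simp: Def_rel_def)
  qed
  then show "Def_rel (erel N a) = espace N (tail Q a)" using R(7) by (auto simp: Def_rel_def)
 }
 { assume ra: "sig a = 1"
  then have K: "Im_rel (erel M a) = espace M (head Q a)" using T a ra by (simp add: has_type_def)
  have "x : Im_rel (erel N a)" if "x : espace N (head Q a)" for x
  proof -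
  have "f (head Q a) x : Im_rel (erel M a)" using K homD(3)[OF assms(3) v(2) that] by simp
  then obtain y where "(y, f (head Q a) x) : erel M a" by (auto simp: Im_rel_def)
  from hg[OF this] show ?thesis using assms(5)[OF v(2) that] by (auto simp: Im_rel_def)
  qed
  then show "Im_rel (erel N a) = espace N (head Q a)" using R(8) by (auto simp: Im_rel_def)
 }
qed

lemma iso_type:
 assumes "rel_rep Q M" "rel_rep Q N" "riso M N" "has_type Q rho sig M"
 shows "has_type Q rho sig N"
 using assms(3) by (rule isoE) (rule retract_type[OF assms(1,2) _ _ _ assms(4)], assumption+, blast)

text \<open>Types are inherited by summands and by sums, so decomposing within a fixed type is the
  same as decomposing among all relations.\<close>

lemma bip_type:
 assumes "rel_rep Q M" "rel_rep Q N" "rel_rep Q L" "bip Q M N L"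
 shows "has_type Q rho sig M \<longleftrightarrow> has_type Q rho sig N & has_type Q rho sig L"
proof -
 obtain f b p q where h: "rhom N M f" "rhom L M b" "rhom M N p" "rhom M L q"
  and e0: "ALL i:verts Q. ALL x:espace N i. p i (f i x) = x"
  "ALL i:verts Q. ALL x:espace N i. q i (f i x) = 0"
  "ALL i:verts Q. ALL x:espace L i. q i (b i x) = x"
  "ALL i:verts Q. ALL x:espace L i. p i (b i x) = 0"
  "ALL i:verts Q. ALL x:espace M i. f i (p i x) + b i (q i x) = x" using assms(4) by (rule bipE)
 note e = e0[rule_format]
 have "has_type Q rho sig M" if N: "has_type Q rho sig N" and L: "has_type Q rho sig L"
  unfolding has_type_def
 proof (intro ballI conjI impI)
  fix a assume a: "a : arcs Q"
  then have v: "tail Q a : verts Q" "head Q a : verts Q" by auto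
  note hf = homD(2)[OF h(1) a] and hb = homD(2)[OF h(2) a] and hp = homD(2)[OF h(3) a] and hq = homD(2)[OF h(4) a]
  note z = hom_zero_at[OF h(1) assms(2)] hom_zero_at[OF h(2) assms(3)] hom_zero_at[OF h(3) assms(1)] hom_zero_at[OF h(4) assms(1)]
  note R = rep_rel[OF assms(1) a]
  { assume ra: "rho a = 0"
  then have K: "Ker_rel (erel N a) = {0}" "Ker_rel (erel L a) = {0}" using N L a ra by (simp_all add: has_type_def)
  have "x = 0" if "(x, 0) : erel M a" for x
  proof -
  have "p (tail Q a) x = 0" "q (tail Q a) x = 0"
  using hp[OF that] hq[OF that] z v K by (auto simp: Ker_rel_def)
  then show ?thesis using e(5)[OF v(1) R(7)[OF that]] z v by simp
  qed
  then show "Ker_rel (erel M a) = {0}" using R(3) by (auto simp: Ker_rel_def)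
  }
  { assume ra: "sig a = 0"
  then have K: "Ind_rel (erel N a) = {0}" "Ind_rel (erel L a) = {0}" using N L a ra by (simp_all add: has_type_def)
  have "x = 0" if "(0, x) : erel M a" for x
  proof -
  have "p (head Q a) x = 0" "q (head Q a) x = 0"
  using hp[OF that] hq[OF that] z v K by (auto simp: Ind_rel_def)
  then show ?thesis using e(5)[OF v(2) R(8)[OF that]] z v by simp
  qed
  then show "Ind_rel (erel M a) = {0}" using R(3) by (auto simp: Ind_rel_def)
  }
  { assume ra: "rho a = 1"
  then have K: "Def_rel (erel N a) = espace N (tail Q a)" "Def_rel (erel L a) = espace L (tail Q a)" using N L a ra by (simp_all add: has_type_def)
  have "x : Def_rel (erel M a)" if x: "x : espace M (tail Q a)" for x
  proof -
  have "p (tail Q a) x : Def_rel (erel N a)" "q (tail Q a) x : Def_rel (erel L a)"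
  using K homD(3)[OF h(3) v(1) x] homD(3)[OF h(4) v(1) x] by simp_all
  then obtain y y' where "(p (tail Q a) x, y) : erel N a" "(q (tail Q a) x, y') : erel L a"
  by (auto simp: Def_rel_def)
  from R(4)[OF hf[OF this(1)] hb[OF this(2)]] show ?thesis using e(5)[OF v(1) x] by (auto simp: Def_rel_def)
  qed
  then show "Def_rel (erel M a) = espace M (tail Q a)" using R(7) by (auto simp: Def_rel_def)
  }
  { assume ra: "sig a = 1"
  then have K: "Im_rel (erel N a) = espace N (head Q a)" "Im_rel (erel L a) = espace L (head Q a)" using N L a ra by (simp_all add: has_type_def)
  have "x : Im_rel (erel M a)" if x: "x : espace M (head Q a)" for x
  proof -
  have "p (head Q a) x : Im_rel (erel N a)" "q (head Q a) x : Im_rel (erel L a)"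
  using K homD(3)[OF h(3) v(2) x] homD(3)[OF h(4) v(2) x] by simp_all
  then obtain y y' where "(y, p (head Q a) x) : erel N a" "(y', q (head Q a) x) : erel L a"
  by (auto simp: Im_rel_def)
  from R(4)[OF hf[OF this(1)] hb[OF this(2)]] show ?thesis using e(5)[OF v(2) x] by (auto simp: Im_rel_def)
  qed
  then show "Im_rel (erel M a) = espace M (head Q a)" using R(8) by (auto simp: Im_rel_def)
  }
 qed
 then show ?thesis
  using retract_type[OF assms(1,2) h(1,3) e(1)] retract_type[OF assms(1,3) h(2,4) e(3)] by blast
qed

end

section \<open>Standard forms, transport of structure, and direct sums\<close>

text \<open>The empty values off the quiver pin down the components that isomorphism disregards;
  equality of standard representations is then decided on vertices and arrows.\<close>

definition std_rep :: "('v, 'e) pre_digraph => ('v => nat) => ('v, 'e, nat, 'k::field) erep => bool" where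
 "std_rep Q d N \<longleftrightarrow> (ALL i. espace N i = (if i : verts Q then sp (d i) else {})) & (ALL a. a \<notin> arcs Q --> erel N a = {})"

text \<open>Transport of structure along bijections \<open>g\<close>. It produces standard forms,
  and with automorphisms of standard spaces it is the group action in the Burnside count.\<close>

definition transport ::
 "('v, 'e) pre_digraph => ('v => ('j => 'k) set) => ('v => ('i => 'k) => ('j => 'k)) => ('v, 'e, 'i, 'k::field) erep => ('v, 'e, 'j, 'k) erep" where
 "transport Q W g M = \<lparr>espace = %i. if i : verts Q then W i else {},
  erel = %a. if a : arcs Q then map_prod (g (tail Q a)) (g (head Q a)) ` erel M a else {}\<rparr>"

lemma sum_spaceI: "v : V ==> w : W ==> case_sum v w : sum_space V W"
 unfolding sum_space_def by blast

lemma sum_relI: "(v, w) : R ==> (v', w') : S ==> (case_sum v v', case_sum w w') : sum_rel R S"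
 unfolding sum_rel_def by blast

lemma sum_space_dim:
 fixes V :: "('i => 'k::field) set" and W :: "('j => 'k) set"
 assumes V: "fin_dim_space V" and W: "fin_dim_space W"
 shows "fin_dim_space (sum_space V W)" "fv.dim (sum_space V W) = fv.dim V + fv.dim W"
proof -
 let ?n = "fv.dim V" and ?m = "fv.dim W"
 obtain f where f: "linear_map_on (sp ?n) V f" "bij_betw f (sp ?n) V" using sp_iso[OF V] by blast
 obtain g where g: "linear_map_on (sp ?m) W g" "bij_betw g (sp ?m) W" using sp_iso[OF W] by blast
 define c where "c v = (%j. if j < ?n then v j else 0)" for v :: "nat => 'k"
 define t where "t v = (%j. v (j + ?n))" for v :: "nat => 'k"
 have ct: "c v : sp ?n" "v : sp (?n + ?m) ==> t v : sp ?m" for v by (auto simp: c_def t_def sp_def)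
 have cl: "c (v + w) = c v + c w" "t (v + w) = t v + t w" "c (fscale k v) = fscale k (c v)" "t (fscale k v) = fscale k (t v)" for v w k
  by (auto simp: c_def t_def fscale_apply fun_eq_iff)
 define h where "h v = case_sum (f (c v)) (g (t v))" for v
 have h: "linear_map_on (sp (?n + ?m)) (sum_space V W) h"
  unfolding linear_map_on_def
 proof (intro conjI ballI allI funcsetI)
  fix v w :: "nat => 'k" and k assume v: "v : sp (?n + ?m)"
  show "h v : sum_space V W" unfolding h_def
  by (intro sum_spaceI linear_map_onD(1)[OF f(1)] linear_map_onD(1)[OF g(1)] ct v)
  show "h (fscale k v) = fscale k (h v)"
  using linear_map_onD(3)[OF f(1) ct(1)] linear_map_onD(3)[OF g(1) ct(2)[OF v]]
  by (auto simp: h_def cl fun_eq_iff fscale_apply split: sum.splits)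
  assume w: "w : sp (?n + ?m)"
  show "h (v + w) = h v + h w"
  using linear_map_onD(2)[OF f(1) ct(1) ct(1)] linear_map_onD(2)[OF g(1) ct(2)[OF v] ct(2)[OF w]]
  by (auto simp: h_def cl fun_eq_iff split: sum.splits)
 qed
 have case_sum_inj: "v = v' & w = w'" if "case_sum v w = (case_sum v' w' :: 'i + 'j => 'k)" for v v' w w'
  using fun_cong[OF that, of "Inl _"] fun_cong[OF that, of "Inr _"] by auto
 have "inj_on h (sp (?n + ?m))"
 proof (rule inj_onI)
  fix v w assume vw: "v : sp (?n + ?m)" "w : sp (?n + ?m)" "h v = h w"
  then have "f (c v) = f (c w)" "g (t v) = g (t w)" using case_sum_inj by (auto simp: h_def)
  then have e: "c v = c w" "t v = t w" using f(2) g(2) ct vw by (auto simp: bij_betw_def dest: inj_onD)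
  show "v = w"
  proof
  fix j show "v j = w j"
  using fun_cong[OF e(1), of j] fun_cong[OF e(2), of "j - ?n"] by (cases "j < ?n") (auto simp: c_def t_def)
  qed
 qed
 moreover have "h ` sp (?n + ?m) = sum_space V W"
 proof
  show "h ` sp (?n + ?m) \<subseteq> sum_space V W" using linear_map_onD(1)[OF h] by auto
  show "sum_space V W \<subseteq> h ` sp (?n + ?m)"
  proof
  fix x assume "x : sum_space V W"
  then obtain v w where x: "v : V" "w : W" "x = case_sum v w" by (auto simp: sum_space_def)
  obtain v' w' where v': "v' : sp ?n" "v = f v'" "w' : sp ?m" "w = g w'"
  using x bij_betw_imp_surj_on[OF f(2)] bij_betw_imp_surj_on[OF g(2)] by blast
  define u where "u j = (if j < ?n then v' j else w' (j - ?n))" for j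
  have "c u = v'" "t u = w'" using v' by (auto simp: c_def t_def u_def sp_def fun_eq_iff)
  moreover have "u : sp (?n + ?m)" using v' by (auto simp: u_def sp_def)
  ultimately show "x : h ` sp (?n + ?m)" using x v' by (intro image_eqI[of _ _ u]) (auto simp: h_def)
  qed
 qed
 ultimately have bij: "bij_betw h (sp (?n + ?m)) (sum_space V W)" by (simp add: bij_betw_def)
 show "fin_dim_space (sum_space V W)" "fv.dim (sum_space V W) = ?n + ?m"
  using dim_bij[OF h bij fin_dim_sp] by (simp_all add: dim_sp)
qed

context quiver begin

lemma transport_rep:
 assumes M: "rel_rep Q M" and g: "!!i. i : verts Q ==> linear_map_on (espace M i) (W i) (g i)"
  "!!i. i : verts Q ==> bij_betw (g i) (espace M i) (W i)"
 shows "rel_rep Q (transport Q W g M)" "riso M (transport Q W g M)" "rhom M (transport Q W g M) g"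
proof -
 let ?N = "transport Q W g M"
 have sp: "espace ?N i = W i" if "i : verts Q" for i using that by (simp add: transport_def)
 have rl: "erel ?N a = map_prod (g (tail Q a)) (g (head Q a)) ` erel M a" if "a : arcs Q" for a
  using that by (simp add: transport_def)
 show hom: "rhom M ?N g" by (rule homI) (auto simp: sp rl g(1))
 show "rel_rep Q ?N" unfolding rel_rep_def linear_relation_def
 proof (intro conjI ballI)
  show "fin_dim_space (espace ?N i)" if "i : verts Q" for i
  using dim_bij(2)[OF g(1)[OF that] g(2)[OF that] rep_space[OF M that]] that by (simp add: sp)
 next
  fix a assume a: "a : arcs Q"
  then have v: "tail Q a : verts Q" "head Q a : verts Q" by auto
  note R = rep_rel[OF M a]
  note gt = linear_map_onD[OF g(1)[OF v(1)]] and gh = linear_map_onD[OF g(1)[OF v(2)]]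
  show "erel ?N a \<subseteq> espace ?N (tail Q a) \<times> espace ?N (head Q a)"
  using R(1) gt(1) gh(1) a v by (auto simp: sp rl)
  have z: "g (tail Q a) 0 = 0" "g (head Q a) 0 = 0"
  using linear_map_on_zero[OF g(1) rep_subspace[OF M]] v by auto
  show "fv2.p.subspace (erel ?N a)" unfolding rel_subspace_iff rl[OF a]
  proof (intro conjI allI impI)
  show "(0, 0) : map_prod (g (tail Q a)) (g (head Q a)) ` erel M a"
  by (rule image_eqI[of _ _ "(0, 0)"]) (auto simp: R z)
  next
  fix x y x' y'
  assume "(x, y) : map_prod (g (tail Q a)) (g (head Q a)) ` erel M a" "(x', y') : map_prod (g (tail Q a)) (g (head Q a)) ` erel M a"
  then obtain u v u' v' where e: "(u, v) : erel M a" "(u', v') : erel M a"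
  "x = g (tail Q a) u" "y = g (head Q a) v" "x' = g (tail Q a) u'" "y' = g (head Q a) v'" by auto
  show "(x + x', y + y') : map_prod (g (tail Q a)) (g (head Q a)) ` erel M a"
  using e R gt(2) gh(2) by (intro image_eqI[of _ _ "(u + u', v + v')"]) auto
  next
  fix c x y
  assume "(x, y) : map_prod (g (tail Q a)) (g (head Q a)) ` erel M a"
  then obtain u v where e: "(u, v) : erel M a" "x = g (tail Q a) u" "y = g (head Q a) v" by auto
  show "(fscale c x, fscale c y) : map_prod (g (tail Q a)) (g (head Q a)) ` erel M a"
  using e R gt(3) gh(3) by (intro image_eqI[of _ _ "(fscale c u, fscale c v)"]) auto
  qed
 qed
 have inv: "inv_into (espace M i) (g i) (g i x) = x" if "i : verts Q" "x : espace M i" for i x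
  using g(2)[OF that(1)] that by (simp add: bij_betw_def)
 show "riso M ?N"
 proof (rule isoI[OF hom])
  show "rhom ?N M (%i. inv_into (espace M i) (g i))"
  proof (rule homI)
  show "linear_map_on (espace ?N i) (espace M i) (inv_into (espace M i) (g i))" if "i : verts Q" for i
  using linear_map_on_inv_into[OF g(1)[OF that] g(2)[OF that] rep_subspace[OF M that]] that by (simp add: sp)
  fix a x y assume a: "a : arcs Q" and "(x, y) : erel ?N a"
  then show "(inv_into (espace M (tail Q a)) (g (tail Q a)) x, inv_into (espace M (head Q a)) (g (head Q a)) y) : erel M a"
  using inv rep_rel(7,8)[OF M a] by (auto simp: rl)
  qed
  show "g i (inv_into (espace M i) (g i) y) = y" if "i : verts Q" "y : espace ?N i" for i y
  using g(2)[OF that(1)] that by (simp add: sp bij_betw_def f_inv_into_f)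
 qed (use inv in auto)
qed

lemma iso_dim:
 assumes "rel_rep Q M" "riso M N" "i : verts Q"
 shows "fv.dim (espace N i) = fv.dim (espace M i)"
proof -
 obtain tht \<psi> where t: "rhom M N tht" "rhom N M \<psi>" "ALL i:verts Q. ALL x:espace M i. \<psi> i (tht i x) = x"
  "ALL i:verts Q. ALL y:espace N i. tht i (\<psi> i y) = y" using assms(2) by (rule isoE)
 have "bij_betw (tht i) (espace M i) (espace N i)"
  by (rule bij_betw_byWitness[of _ "\<psi> i"]) (use t assms(3) homD(3)[OF t(1)] homD(3)[OF t(2)] in auto)
 then show ?thesis using dim_bij(1)[OF homD(1)[OF t(1) assms(3)]] rep_space[OF assms(1,3)] by blast
qed

lemma std_exists:
 fixes M :: "('v, 'e, 'i, 'k::field) erep"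
 assumes M: "rel_rep Q M" and d: "!!i. i : verts Q ==> d i = fv.dim (espace M i)"
 obtains N :: "('v, 'e, nat, 'k) erep" where "rel_rep Q N" "std_rep Q d N" "riso M N"
proof -
 have "EX g. linear_map_on (espace M i) (sp (d i)) g & bij_betw g (espace M i) (sp (d i))" if i: "i : verts Q" for i
 proof -
  obtain f where f: "linear_map_on (sp (d i)) (espace M i) f" "bij_betw f (sp (d i)) (espace M i)"
  using sp_iso[OF rep_space[OF M i]] d[OF i] by metis
  then show ?thesis using linear_map_on_inv_into[OF f subspace_sp] bij_betw_inv_into[OF f(2)] by blast
 qed
 then obtain g where g: "!!i. i : verts Q ==> linear_map_on (espace M i) (sp (d i)) (g i)"
  "!!i. i : verts Q ==> bij_betw (g i) (espace M i) (sp (d i))" by metis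
 show thesis
  by (rule that[OF transport_rep(1)[OF M g] _ transport_rep(2)[OF M g]]) (auto simp: std_rep_def transport_def)
qed

lemma sum_rep:
 fixes N :: "('v, 'e, 'i, 'k::field) erep" and L :: "('v, 'e, 'j, 'k) erep"
 assumes N: "rel_rep Q N" and L: "rel_rep Q L"
 shows "rel_rep Q (equipped_sum N L)" "bip Q (equipped_sum N L) N L"
proof -
 have add: "case_sum v w + case_sum v' w' = (case_sum (v + v') (w + w') :: _ => 'k)"
  and scale: "fscale k (case_sum v w) = (case_sum (fscale k v) (fscale k w) :: _ => 'k)"
  and zero: "(0 :: _ => 'k) = case_sum 0 0" for v v' :: "'i => 'k" and w w' :: "'j => 'k" and k
  by (auto simp: fun_eq_iff fscale_apply split: sum.splits)
 have comp: "case_sum v w \<circ> Inl = v" "case_sum v w \<circ> Inr = w" for v :: "'i => 'k" and w :: "'j => 'k" by auto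
 have comp': "(v + w) \<circ> h = (v \<circ> h) + (w \<circ> h)" "fscale k v \<circ> h = fscale k (v \<circ> h)" for v w :: "'i + 'j => 'k" and k and h :: "'z => 'i + 'j"
  by (auto simp: fun_eq_iff fscale_apply)
 show S: "rel_rep Q (equipped_sum N L)" unfolding rel_rep_def linear_relation_def
 proof (intro conjI ballI)
  show "fin_dim_space (espace (equipped_sum N L) i)" if "i : verts Q" for i
  using sum_space_dim(1)[OF rep_space[OF N that] rep_space[OF L that]] by (simp add: equipped_sum_def)
 next
  fix a assume a: "a : arcs Q"
  show "erel (equipped_sum N L) a \<subseteq> espace (equipped_sum N L) (tail Q a) \<times> espace (equipped_sum N L) (head Q a)"
  using rep_rel(1)[OF N a] rep_rel(1)[OF L a] by (auto simp: equipped_sum_def sum_rel_def sum_space_def)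
  have mem: "(x, y) : erel (equipped_sum N L) a \<longleftrightarrow>
  (EX v v' w w'. x = case_sum v v' & y = case_sum w w' & (v, w) : erel N a & (v', w') : erel L a)" for x y
  by (auto simp: equipped_sum_def sum_rel_def)
  show "fv2.p.subspace (erel (equipped_sum N L) a)" unfolding rel_subspace_iff mem
  proof (intro conjI allI impI)
  show "EX v v' w w'. 0 = (case_sum v v' :: _ => 'k) & 0 = (case_sum w w' :: _ => 'k) & (v, w) : erel N a & (v', w') : erel L a"
  using zero rep_rel(3)[OF N a] rep_rel(3)[OF L a] by blast
  next
  fix x y x' y'
  assume "EX v v' w w'. x = case_sum v v' & y = case_sum w w' & (v, w) : erel N a & (v', w') : erel L a"
  "EX v v' w w'. x' = case_sum v v' & y' = case_sum w w' & (v, w) : erel N a & (v', w') : erel L a"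
  then obtain v1 v1' w1 w1' v2 v2' w2 w2' where e: "x = case_sum v1 v1'" "y = case_sum w1 w1'" "(v1, w1) : erel N a" "(v1', w1') : erel L a"
  "x' = case_sum v2 v2'" "y' = case_sum w2 w2'" "(v2, w2) : erel N a" "(v2', w2') : erel L a" by blast
  show "EX v v' w w'. x + x' = case_sum v v' & y + y' = case_sum w w' & (v, w) : erel N a & (v', w') : erel L a"
  unfolding e add using rep_rel(4)[OF N a e(3,7)] rep_rel(4)[OF L a e(4,8)] by blast
  next
  fix c x y
  assume "EX v v' w w'. x = case_sum v v' & y = case_sum w w' & (v, w) : erel N a & (v', w') : erel L a"
  then obtain v1 v1' w1 w1' where e: "x = case_sum v1 v1'" "y = case_sum w1 w1'" "(v1, w1) : erel N a" "(v1', w1') : erel L a" by blast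
  show "EX v v' w w'. fscale c x = case_sum v v' & fscale c y = case_sum w w' & (v, w) : erel N a & (v', w') : erel L a"
  unfolding e scale using rep_rel(5)[OF N a e(3)] rep_rel(5)[OF L a e(4)] by blast
  qed
 qed
 show "bip Q (equipped_sum N L) N L"
 proof (rule bipI)
  have sp0: "0 : espace N i" "0 : espace L i" if "i : verts Q" for i
  using fv.subspace_0 rep_subspace[OF N that] rep_subspace[OF L that] by auto
  show "rhom N (equipped_sum N L) (%i x. case_sum x 0)"
  by (rule homI) (use sp0 rep_rel(3)[OF L] in \<open>auto simp: linear_map_on_def equipped_sum_def add scale intro!: sum_spaceI sum_relI\<close>)
  show "rhom L (equipped_sum N L) (%i x. case_sum 0 x)"
  by (rule homI) (use sp0 rep_rel(3)[OF N] in \<open>auto simp: linear_map_on_def equipped_sum_def add scale intro!: sum_spaceI sum_relI\<close>)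
  show "rhom (equipped_sum N L) N (%i x. x \<circ> Inl)"
  by (rule homI) (auto simp: linear_map_on_def equipped_sum_def sum_space_def sum_rel_def comp comp')
  show "rhom (equipped_sum N L) L (%i x. x \<circ> Inr)"
  by (rule homI) (auto simp: linear_map_on_def equipped_sum_def sum_space_def sum_rel_def comp comp')
  show "case_sum (x \<circ> Inl) 0 + case_sum 0 (x \<circ> Inr) = x" for x :: "'i + 'j => 'k"
  by (auto simp: fun_eq_iff split: sum.splits)
 qed (auto simp: fun_eq_iff)
qed

lemma iso_sum_iff_bip:
 assumes "rel_rep Q M" "rel_rep Q N" "rel_rep Q L"
 shows "riso M (equipped_sum N L) \<longleftrightarrow> bip Q M N L"
proof
 assume "riso M (equipped_sum N L)"
 then show "bip Q M N L" using bip_iso[OF assms(2,3) sum_rep(2)[OF assms(2,3)] iso_sym iso_refl iso_refl] by blast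
next
 assume "bip Q M N L"
 then show "riso M (equipped_sum N L)" using bip_unique sum_rep[OF assms(2,3)] assms(1) by blast
qed

lemma sum_exists:
 fixes N :: "('v, 'e, 'i, 'k::field) erep" and L :: "('v, 'e, 'j, 'k) erep"
 assumes N: "rel_rep Q N" and L: "rel_rep Q L"
 obtains M :: "('v, 'e, nat, 'k) erep" where "rel_rep Q M" "bip Q M N L"
proof -
 obtain M :: "('v, 'e, nat, 'k) erep" where M: "rel_rep Q M" "riso (equipped_sum N L) M"
  using std_exists[OF sum_rep(1)[OF N L] refl] by blast
 then have "bip Q M N L" using iso_sum_iff_bip[OF M(1) N L] iso_sym by blast
 then show thesis using that M by blast
qed

lemma bip_dim:
 assumes "rel_rep Q M" "rel_rep Q N" "rel_rep Q L" "bip Q M N L" "i : verts Q"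
 shows "fv.dim (espace M i) = fv.dim (espace N i) + fv.dim (espace L i)"
proof -
 have "riso M (equipped_sum N L)" using iso_sum_iff_bip[OF assms(1-3)] assms(4) by blast
 then have "fv.dim (espace M i) = fv.dim (espace (equipped_sum N L) i)" using iso_dim assms(1,5) by metis
 also have "... = fv.dim (espace N i) + fv.dim (espace L i)"
  using sum_space_dim(2)[OF rep_space[OF assms(2,5)] rep_space[OF assms(3,5)]] by (simp add: equipped_sum_def)
 finally show ?thesis .
qed

lemma nonzero_iff_dim:
 assumes "rel_rep Q M"
 shows "equipped_nonzero Q M \<longleftrightarrow> (EX i:verts Q. fv.dim (espace M i) > 0)"
proof -
 have "espace M i ~= {0} \<longleftrightarrow> fv.dim (espace M i) > 0" if i: "i : verts Q" for i
 proof -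
  obtain B where B: "finite B" "fv.independent B" "fv.span B = espace M i" "card B = fv.dim (espace M i)"
  using fin_dim_basis[OF rep_space[OF assms i]] by blast
  have "espace M i = {0} \<longleftrightarrow> B = {}"
  proof
  assume "espace M i = {0}"
  then have "B \<subseteq> {0}" using B(3) fv.span_superset by blast
  then show "B = {}" using B(2) fv.dependent_zero by blast
  qed (use B in auto)
  then show ?thesis using B by (metis card_gt_0_iff)
 qed
 then show ?thesis by (auto simp: equipped_nonzero_def)
qed

lemma iso_nonzero: "rel_rep Q M ==> rel_rep Q N ==> riso M N ==> equipped_nonzero Q N \<longleftrightarrow> equipped_nonzero Q M"
 using nonzero_iff_dim iso_dim by metis

text \<open>The summands are image and kernel of \<open>e\<close>. The image carries the images of
  the relations; as \<open>e\<close> preserves the relations of \<open>M\<close>, these are also the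
  pairs of \<open>erel M a\<close> fixed by \<open>e\<close>, which gives both the inclusion
  morphism and linearity.\<close>

lemma idempotent_split:
 fixes M :: "('v, 'e, 'i, 'k::field) erep"
 assumes M: "rel_rep Q M" and e: "rhom M M e" and ee: "!!i x. i : verts Q ==> x : espace M i ==> e i (e i x) = e i x"
 obtains N L :: "('v, 'e, 'i, 'k) erep" where "rel_rep Q N" "rel_rep Q L" "bip Q M N L"
  "~ equipped_nonzero Q N ==> ALL i:verts Q. ALL x:espace M i. e i x = 0"
  "~ equipped_nonzero Q L ==> ALL i:verts Q. ALL x:espace M i. e i x = x"
proof -
 define N where "N = \<lparr>espace = %i. e i ` espace M i, erel = %a. map_prod (e (tail Q a)) (e (head Q a)) ` erel M a\<rparr>"
 have N: "rel_rep Q N" unfolding rel_rep_def linear_relation_def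
 proof (intro conjI ballI)
  show "fin_dim_space (espace N i)" if "i : verts Q" for i
  using fin_dim_image[OF homD(1)[OF e that] rep_space[OF M that]] by (simp add: N_def)
 next
  fix a assume a: "a : arcs Q"
  then have v: "tail Q a : verts Q" "head Q a : verts Q" by auto
  note R = rep_rel[OF M a]
  show "erel N a \<subseteq> espace N (tail Q a) \<times> espace N (head Q a)" using R(1) by (auto simp: N_def)
  have "erel N a = {(x, y) : erel M a. e (tail Q a) x = x & e (head Q a) y = y}"
  proof (intro equalityI subrelI)
  fix x y assume "(x, y) : erel N a"
  then show "(x, y) : {(x, y) : erel M a. e (tail Q a) x = x & e (head Q a) y = y}"
  using homD(2)[OF e a] ee v R(7,8) by (auto simp: N_def)
  next
  fix x y assume "(x, y) : {(x, y) : erel M a. e (tail Q a) x = x & e (head Q a) y = y}"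
  then show "(x, y) : erel N a" by (force simp: N_def intro: image_eqI[of _ _ "(x, y)"])
  qed
  then show "fv2.p.subspace (erel N a)" unfolding rel_subspace_iff
  using R(3-5,7,8) homD(4,5)[OF e v(1)] homD(4,5)[OF e v(2)] hom_zero_at[OF e M] v by auto
 qed
 have f: "rhom N M (%i x. x)"
  by (rule homI) (use homD(3)[OF e] homD(2)[OF e] in \<open>auto simp: N_def linear_map_on_def\<close>)
 have g: "rhom M N e"
  by (rule homI) (use homD(4,5)[OF e] in \<open>auto simp: N_def linear_map_on_def\<close>)
 obtain L :: "('v, 'e, 'i, 'k) erep" where L: "rel_rep Q L" "bip Q M N L" "ALL i. espace L i = {m : espace M i. e i m = 0}"
  by (rule split_mono[OF M N f g]) (use ee in \<open>auto simp: N_def\<close>)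
 show thesis
 proof (rule that[OF N L(1,2)])
  show "ALL i:verts Q. ALL x:espace M i. e i x = 0" if "~ equipped_nonzero Q N"
  using that by (auto simp: equipped_nonzero_def N_def)
  show "ALL i:verts Q. ALL x:espace M i. e i x = x" if Z: "~ equipped_nonzero Q L"
  proof (intro ballI)
  fix i x assume i: "i : verts Q" and x: "x : espace M i"
  have ex: "e i x : espace M i" by (rule homD(3)[OF e i x])
  have "x - e i x : espace L i"
  using L(3) ee[OF i x] hom_diff_at[OF e M i x ex] fv.subspace_diff[OF rep_subspace[OF M i] x ex] by simp
  then have "x - e i x = 0" using Z i by (auto simp: equipped_nonzero_def)
  then show "e i x = x" by simp
  qed
 qed
qed

end

section \<open>Endomorphisms of indecomposables, and cancellation\<close>

locale frob_quiver = quiver Q + frob ty s for Q :: "('v, 'e) pre_digraph" and ty :: "'a::field itself" and s :: nat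
begin

text \<open>\<open>finite_idempotent_power\<close> applies to the finite set of combinations of a
  basis with coefficients in a finite field containing the matrix entries; this set contains the
  basis, so the identity extends to all of \<open>V\<close>.\<close>

lemma linear_idempotent_power:
 fixes V :: "('i => 'a) set"
 assumes V: "fin_dim_space V" and g: "linear_map_on V V g"
 shows "EX m>0. ALL x:V. (g ^^ (m + m)) x = (g ^^ m) x"
proof -
 obtain B where B: "finite B" "fv.independent B" "fv.span B = V" "card B = fv.dim V"
  by (rule fin_dim_basis[OF V])
 have BV: "B \<subseteq> V" using B(3) fv.span_superset by blast
 note sub = fin_dim_subspace[OF V]
 have "ALL x:B. EX c. g x = (\<Sum>y\<in>B. fscale (c y) y)"
 proof
  fix x assume "x : B"
  then have "g x : fv.span B" using linear_map_onD(1)[OF g] BV B(3) by blast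
  then show "EX c. g x = (\<Sum>y\<in>B. fscale (c y) y)" using fv.span_finite[OF B(1)] by auto
 qed
 then obtain c where c: "!!x. x : B ==> g x = (\<Sum>y\<in>B. fscale (c x y) y)" by metis
 obtain N where N: "N > 0" "ALL k:case_prod c ` (B \<times> B). k ^ (s ^ N) = k"
  using common_period[of "case_prod c ` (B \<times> B)"] B by auto
 define K where "K = {k::'a. k ^ (s ^ N) = k}"
 have K: "0 : K" "1 : K" "!!x y. x : K ==> y : K ==> x + y : K"
  "!!x y. x : K ==> y : K ==> x * y : K"
  using s_gt1 by (auto simp: K_def frob_add_pow power_mult_distrib)
 have Ksum: "(\<Sum>x\<in>Y. f x) : K" if "!!x. x : Y ==> f x : K" for Y :: "('i => 'a) set" and f
  using that by (induction Y rule: infinite_finite_induct) (auto intro: K)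
 have cK: "c x y : K" if "x : B" "y : B" for x y using N that by (auto simp: K_def)
 define S where "S = (%k. \<Sum>x\<in>B. fscale (k x) x) ` (B \<rightarrow>\<^sub>E K)"
 have finS: "finite S" unfolding S_def
  using B finite_fixed[OF N(1)] by (intro finite_imageI finite_PiE) (auto simp: K_def)
 have SI: "(\<Sum>x\<in>B. fscale (k x) x) : S" if "!!x. x : B ==> k x : K" for k
 proof -
  have "(\<Sum>x\<in>B. fscale (k x) x) = (\<Sum>x\<in>B. fscale (restrict k B x) x)" by (intro sum.cong) auto
  then show ?thesis unfolding S_def
  by (rule image_eqI[where x = "restrict k B"]) (use that in auto)
 qed
 have gS: "g ` S \<subseteq> S"
 proof
  fix z assume "z : g ` S"
  then obtain k where k: "!!x. x : B ==> k x : K" "z = g (\<Sum>x\<in>B. fscale (k x) x)" by (auto simp: S_def)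
  have "z = (\<Sum>x\<in>B. fscale (k x) (g x))" unfolding k(2) by (rule linear_map_on_sum[OF g sub B(1) BV])
  also have "... = (\<Sum>x\<in>B. \<Sum>y\<in>B. fscale (k x * c x y) y)"
  by (intro sum.cong) (auto simp: c fv.scale_sum_right)
  also have "... = (\<Sum>y\<in>B. fscale (\<Sum>x\<in>B. k x * c x y) y)"
  by (subst sum.swap) (simp add: fv.scale_sum_left)
  also have "... : S" by (intro SI Ksum K(4) k cK)
  finally show "z : S" .
 qed
 obtain m where m: "m > 0" "ALL x:S. (g ^^ (m + m)) x = (g ^^ m) x"
  using finite_idempotent_power[OF finS gS] by blast
 have BS: "b : S" if b: "b : B" for b
 proof -
  have "b = (\<Sum>x\<in>B. fscale (if x = b then 1 else 0) x)"
  using b B(1) by (subst sum.cong[OF refl, of _ _ "%x. if x = b then x else 0"]) (auto simp: sum.delta)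
  then show ?thesis using SI[of "%x. if x = b then 1 else 0"] K by auto
 qed
 have lin: "linear_map_on V V (g ^^ n)" for n
 proof (induction n)
  case 0
  show ?case by (simp add: id_def linear_map_on_id)
 next
  case (Suc n)
  show ?case using linear_map_on_comp[OF Suc g] by (simp add: comp_def)
 qed
 have "(g ^^ (m + m)) x = (g ^^ m) x" if "x : V" for x
 proof -
  obtain k where k: "x = (\<Sum>b\<in>B. fscale (k b) b)" using \<open>x : V\<close> B fv.span_finite by auto
  show ?thesis unfolding k linear_map_on_sum[OF lin sub B(1) BV]
  using m(2) BS by (intro sum.cong) auto
 qed
 then show ?thesis using m(1) by blast
qed

lemma funpow_idempotent_mult:
 assumes "ALL x:V. (g ^^ (m + m)) x = (g ^^ m) x" "g ` V \<subseteq> V" "x : V" "k > 0"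
 shows "(g ^^ (m * k)) x = (g ^^ m) x"
 using assms(4)
proof (induction k rule: nat_induct_non_zero)
 case (Suc k)
 have "(g ^^ (m * Suc k)) x = (g ^^ m) ((g ^^ (m * k)) x)" by (simp add: funpow_add)
 also have "... = (g ^^ (m + m)) x" using Suc by (simp add: funpow_add)
 finally show ?case using assms by simp
qed simp

lemma hom_idempotent_power:
 fixes M :: "('v, 'e, 'i, 'a) erep"
 assumes M: "rel_rep Q M" and g: "rhom M M g"
 shows "EX m>0. ALL i:verts Q. ALL x:espace M i. (g i ^^ (m + m)) x = (g i ^^ m) x"
proof -
 have "ALL i:verts Q. EX m>0. ALL x:espace M i. (g i ^^ (m + m)) x = (g i ^^ m) x"
  using linear_idempotent_power[OF rep_space[OF M] homD(1)[OF g]] by blast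
 then obtain m where m: "!!i. i : verts Q ==> m i > 0"
  "!!i. i : verts Q ==> ALL x:espace M i. (g i ^^ (m i + m i)) x = (g i ^^ m i) x" by metis
 \<comment> \<open>A common multiple of the exponents at the vertices; positive multiples of an
   idempotent exponent give the same map by \<open>funpow_idempotent_mult\<close>.\<close>
 define n where "n = (\<Prod>i\<in>verts Q. m i)"
 have n: "n > 0" unfolding n_def using m by (intro prod_pos) auto
 have "(g i ^^ (n + n)) x = (g i ^^ n) x" if i: "i : verts Q" and x: "x : espace M i" for i x
 proof -
  define k where "k = (\<Prod>j\<in>verts Q - {i}. m j)"
  have k: "n = m i * k" "k > 0" using i n by (auto simp: n_def k_def prod.remove)
  have gi: "g i ` espace M i \<subseteq> espace M i" using homD(3)[OF g i] by auto
  have "(g i ^^ (m i * (k + k))) x = (g i ^^ m i) x" "(g i ^^ (m i * k)) x = (g i ^^ m i) x"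
  using funpow_idempotent_mult[OF m(2)[OF i] gi x] k(2) by auto
  then show ?thesis by (simp add: k(1) distrib_left)
 qed
 then show ?thesis using n by blast
qed

definition indec :: "('v, 'e, nat, 'a) erep => bool" where
 "indec N \<longleftrightarrow> rel_rep Q N & equipped_nonzero Q N \<and>
  ~ (EX (A :: ('v, 'e, nat, 'a) erep) (B :: ('v, 'e, nat, 'a) erep).
  rel_rep Q A & equipped_nonzero Q A & rel_rep Q B & equipped_nonzero Q B & bip Q N A B)"

text \<open>Some power of an endomorphism is idempotent, because its matrix entries lie in a finite field.\<close>

lemma indec_dichotomy:
 assumes N: "indec N" and g: "rhom N N g"
 obtains m where "m > 0" "ALL i:verts Q. ALL x:espace N i. (g i ^^ m) x = x"
  | m where "m > 0" "ALL i:verts Q. ALL x:espace N i. (g i ^^ m) x = 0"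
proof -
 have R: "rel_rep Q N" using N by (simp add: indec_def)
 obtain m where m: "m > 0" "ALL i:verts Q. ALL x:espace N i. (g i ^^ (m + m)) x = (g i ^^ m) x"
  using hom_idempotent_power[OF R g] by blast
 have ee: "(g i ^^ m) ((g i ^^ m) x) = (g i ^^ m) x" if "i : verts Q" "x : espace N i" for i x
  using m that by (simp add: funpow_add)
 obtain A B :: "('v, 'e, nat, 'a) erep" where AB: "rel_rep Q A" "rel_rep Q B" "bip Q N A B"
  "~ equipped_nonzero Q A ==> ALL i:verts Q. ALL x:espace N i. (g i ^^ m) x = 0"
  "~ equipped_nonzero Q B ==> ALL i:verts Q. ALL x:espace N i. (g i ^^ m) x = x"
  using idempotent_split[OF R hom_funpow[OF g, of m] ee] by blast
 then show thesis using N m(1) that unfolding indec_def by blast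
qed

text \<open>Stands in for locality of the endomorphism ring. A nilpotent \<open>u\<close> on a
  nonzero representation kills some nonzero vector, which \<open>v\<close> fixes; so
  \<open>v\<close> is not nilpotent and the dichotomy leaves the other case. Asking \<open>v\<close>
  to fix the kernel of \<open>u\<close>, instead of \<open>v = 1 - u\<close>, covers the map that
  arises in \<open>bip_cancel\<close>.\<close>

lemma indec_nilpotent_one_minus:
 assumes N: "indec N" and u: "rhom N N u" and v: "rhom N N v"
  and uv: "!!i x. i : verts Q ==> x : espace N i ==> u i x = 0 ==> v i x = x"
  and nil: "m > 0" "ALL i:verts Q. ALL x:espace N i. (u i ^^ m) x = 0"
 shows "EX k>0. ALL i:verts Q. ALL x:espace N i. (v i ^^ k) x = x"
proof (rule indec_dichotomy[OF N v])
 fix k assume k: "k > 0" "ALL i:verts Q. ALL x:espace N i. (v i ^^ k) x = 0"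
 have R: "rel_rep Q N" using N by (simp add: indec_def)
 have "equipped_nonzero Q N" using N by (simp add: indec_def)
 then obtain i x where i: "i : verts Q" and x: "x : espace N i" "x ~= 0"
  using fv.subspace_0[OF rep_subspace[OF R]] by (auto simp: equipped_nonzero_def)
 \<comment> \<open>The last nonzero iterate of \<open>x\<close> under \<open>u\<close> is a kernel
   vector of \<open>u\<close>.\<close>
 define j where "j = (LEAST j. (u i ^^ j) x = 0)"
 have j: "(u i ^^ j) x = 0" unfolding j_def by (rule LeastI[of _ m]) (use nil i x in auto)
 then obtain j' where j': "j = Suc j'" using x by (cases j) auto
 define y where "y = (u i ^^ j') x"
 have "y ~= 0" unfolding y_def using not_less_Least[of j' "%j. (u i ^^ j) x = 0"] j' j_def by auto
 moreover have uy: "u i y = 0" using j by (simp add: j' y_def)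
 have yN: "y : espace N i" unfolding y_def using homD(3)[OF hom_funpow[OF u] i x(1)] .
 have "(v i ^^ n) y = y" for n by (induction n) (use uv[OF i yN uy] in auto)
 then have "y = 0" using k(2) i yN by metis
 ultimately show ?thesis by simp
qed blast

definition retract :: "('v, 'e, 'i, 'a) erep => ('v, 'e, 'j, 'a) erep => bool" where
 "retract N M \<longleftrightarrow> (EX f g. rhom N M f & rhom M N g & (ALL i:verts Q. ALL x:espace N i. g i (f i x) = x))"

text \<open>If a power of the composite is the identity, the preceding power composed with
  \<open>g\<close> is a left inverse of \<open>f\<close>.\<close>

lemma retract_power:
 assumes f: "rhom N M f" and g: "rhom M N g" and k: "k > 0" "ALL i:verts Q. ALL x:espace N i. ((%x. g i (f i x)) ^^ k) x = x"
 shows "retract N M"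
proof -
 obtain k' where k': "k = Suc k'" using k(1) gr0_implies_Suc by blast
 have h: "rhom N N (%i. (%x. g i (f i x)) ^^ k')" by (rule hom_funpow[OF hom_comp[OF f g]])
 have "((%x. g i (f i x)) ^^ k') (g i (f i x)) = x" if "i : verts Q" "x : espace N i" for i x
  using k(2) that funpow_swap1[of "%x. g i (f i x)" k' x] unfolding k' by simp
 then show ?thesis unfolding retract_def using f hom_comp[OF g h] by blast
qed

text \<open>The identity of \<open>N\<close> is the sum of an endomorphism through \<open>A\<close>
  and one through \<open>B\<close>. By the dichotomy the first has a power equal to the identity, or
  it is nilpotent and then the second has such a power.\<close>

lemma indec_prime:
 assumes N: "indec N" and r: "retract N M" and b: "bip Q M A B"
 shows "retract N A \<or> retract N B"
proof -
 have R: "rel_rep Q N" using N by (simp add: indec_def)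
 obtain f g where f: "rhom N M f" "rhom M N g" and gf: "!!i x. i : verts Q ==> x : espace N i ==> g i (f i x) = x"
  using r unfolding retract_def by blast
 obtain a b p q where h: "rhom A M a" "rhom B M b" "rhom M A p" "rhom M B q"
  and e: "ALL i:verts Q. ALL x:espace A i. p i (a i x) = x"
  "ALL i:verts Q. ALL x:espace A i. q i (a i x) = 0"
  "ALL i:verts Q. ALL x:espace B i. q i (b i x) = x"
  "ALL i:verts Q. ALL x:espace B i. p i (b i x) = 0"
  "ALL i:verts Q. ALL x:espace M i. a i (p i x) + b i (q i x) = x" using b by (rule bipE)
 note pf = hom_comp[OF f(1) h(3)] and ga = hom_comp[OF h(1) f(2)]
 note qf = hom_comp[OF f(1) h(4)] and gb = hom_comp[OF h(2) f(2)]
 let ?u = "%i x. g i (a i (p i (f i x)))" and ?v = "%i x. g i (b i (q i (f i x)))"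
 have u: "rhom N N ?u" by (rule hom_comp[OF pf ga])
 have v: "rhom N N ?v" by (rule hom_comp[OF qf gb])
 have uv: "?u i x + ?v i x = x" if i: "i : verts Q" and x: "x : espace N i" for i x
 proof -
  have fx: "f i x : espace M i" by (rule homD(3)[OF f(1) i x])
  have "?u i x + ?v i x = g i (a i (p i (f i x)) + b i (q i (f i x)))"
  by (rule homD(4)[OF f(2) i, symmetric]) (use homD(3)[OF h(1) i] homD(3)[OF h(2) i] homD(3)[OF h(3) i] homD(3)[OF h(4) i] fx in auto)
  then show ?thesis using e(5) i fx gf[OF i x] by simp
 qed
 show ?thesis
 proof (rule indec_dichotomy[OF N u])
  fix m assume m: "m > 0" "ALL i:verts Q. ALL x:espace N i. (?u i ^^ m) x = x"
  have "retract N A"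
  by (rule retract_power[where f = "%i x. p i (f i x)" and g = "%i x. g i (a i x)", OF pf ga m])
  then show ?thesis ..
 next
  fix m assume m: "m > 0" "ALL i:verts Q. ALL x:espace N i. (?u i ^^ m) x = 0"
  have uv': "?v i x = x" if "i : verts Q" "x : espace N i" "?u i x = 0" for i x
  using uv[OF that(1,2)] that(3) by simp
  have "EX k>0. ALL i:verts Q. ALL x:espace N i. (?v i ^^ k) x = x"
  by (rule indec_nilpotent_one_minus[where u = ?u and v = ?v, OF N u v uv' m])
  then obtain k where k: "k > 0" "ALL i:verts Q. ALL x:espace N i. (?v i ^^ k) x = x" by blast
  have "retract N B"
  by (rule retract_power[where f = "%i x. q i (f i x)" and g = "%i x. g i (b i x)", OF qf gb k])
  then show ?thesis ..
 qed
qed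

lemma indec_retract_indec:
 assumes N: "indec N" and M: "indec M" and r: "retract N M"
 shows "riso M N"
proof -
 obtain f g where f: "rhom N M f" "rhom M N g" and gf: "!!i x. i : verts Q ==> x : espace N i ==> g i (f i x) = x"
  using r unfolding retract_def by blast
 have R: "rel_rep Q N" "rel_rep Q M" "equipped_nonzero Q N" using N M by (auto simp: indec_def)
 obtain L :: "('v, 'e, nat, 'a) erep" where L: "rel_rep Q L" "bip Q M N L" 
  by (rule split_mono[OF R(2,1) f gf])
 have "~ (rel_rep Q N & equipped_nonzero Q N & rel_rep Q L & equipped_nonzero Q L & bip Q M N L)"
  using M unfolding indec_def by metis
 then have "~ equipped_nonzero Q L" using R L by simp
 then show ?thesis using iso_bip_zero[OF L(2) R(2)] by blast
qed

text \<open>Gaussian elimination. If the component \<open>p' a\<close> from \<open>N\<close> to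
  \<open>N\<close> is invertible with inverse \<open>w\<close>, the Schur complement
  \<open>q' b - q' a w p' b\<close> is an isomorphism from \<open>A\<close> to \<open>B\<close>, and
  its inverse is \<open>q b'\<close>.\<close>

lemma cancel_unit:
 assumes reps: "rel_rep Q N" "rel_rep Q A" "rel_rep Q B" "rel_rep Q M"
  and h: "rhom N M a" "rhom A M b" "rhom M N p" "rhom M A q"
  and e0: "ALL i:verts Q. ALL x:espace N i. p i (a i x) = x"
  "ALL i:verts Q. ALL x:espace N i. q i (a i x) = 0"
  "ALL i:verts Q. ALL x:espace A i. q i (b i x) = x"
  "ALL i:verts Q. ALL x:espace A i. p i (b i x) = 0"
  "ALL i:verts Q. ALL x:espace M i. a i (p i x) + b i (q i x) = x"
  and h': "rhom N M a'" "rhom B M b'" "rhom M N p'" "rhom M B q'"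
  and e'0: "ALL i:verts Q. ALL x:espace N i. p' i (a' i x) = x"
  "ALL i:verts Q. ALL x:espace N i. q' i (a' i x) = 0"
  "ALL i:verts Q. ALL x:espace B i. q' i (b' i x) = x"
  "ALL i:verts Q. ALL x:espace B i. p' i (b' i x) = 0"
  "ALL i:verts Q. ALL x:espace M i. a' i (p' i x) + b' i (q' i x) = x"
  and m: "m > 0" "ALL i:verts Q. ALL x:espace N i. ((%x. p' i (a i x)) ^^ m) x = x"
 shows "riso A B"
proof -
 note e = e0[rule_format] and e' = e'0[rule_format]
 obtain m' where m': "m = Suc m'" using m(1) gr0_implies_Suc by blast
 define w where "w = (%i. (%x. p' i (a i x)) ^^ m')"
 have w: "rhom N N w" unfolding w_def by (rule hom_funpow[OF hom_comp[OF h(1) h'(3)]])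
 have w1: "w i (p' i (a i x)) = x" "p' i (a i (w i x)) = x" if "i : verts Q" "x : espace N i" for i x
  using m(2) that funpow_swap1[of "%x. p' i (a i x)" m' x] unfolding m' w_def by simp_all
 note mem = homD(3)[OF h(1)] homD(3)[OF h(2)] homD(3)[OF h(3)] homD(3)[OF h(4)]
  homD(3)[OF h'(1)] homD(3)[OF h'(2)] homD(3)[OF h'(3)] homD(3)[OF h'(4)] homD(3)[OF w]
 let ?F = "%i x. q' i (b i x) - q' i (a i (w i (p' i (b i x))))" and ?G = "%i x. q i (b' i x)"
 have F: "rhom A B ?F"
  by (rule hom_diff[OF reps(3) hom_comp[OF h(2) h'(4)] hom_comp[OF hom_comp[OF hom_comp[OF hom_comp[OF h(2) h'(3)] w] h(1)] h'(4)]])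
 have G: "rhom B A ?G" by (rule hom_comp[OF h'(2) h(4)])
 have ab: "a' i (p' i x) = x - b' i (q' i x)" "b i (q i x) = x - a i (p i x)" "b' i (q' i x) = x - a' i (p' i x)"
  if "i : verts Q" "x : espace M i" for i x
  using e(5)[OF that] e'(5)[OF that] by (auto simp: algebra_simps)
 note dq = hom_diff_at[OF h(4) reps(4)] and dq' = hom_diff_at[OF h'(4) reps(4)] and dp = hom_diff_at[OF h(3) reps(4)] and dp' = hom_diff_at[OF h'(3) reps(4)]
 note db' = hom_diff_at[OF h'(2) reps(3)] and da = hom_diff_at[OF h(1) reps(1)] and dw = hom_diff_at[OF w reps(1)]
 show ?thesis
 proof (rule isoI[OF F G])
  fix i x assume i: "i : verts Q" and x: "x : espace A i"
  define z where "z = w i (p' i (b i x))"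
  have z: "z : espace N i" "p' i (a i z) = p' i (b i x)" using i x by (simp_all add: z_def mem w1)
  have "?G i (?F i x) = q i (b' i (q' i (b i x)) - b' i (q' i (a i z)))"
  using i x z by (simp add: z_def[symmetric] db' mem)
  also have "b' i (q' i (b i x)) - b' i (q' i (a i z)) = b i x - a i z"
  using i x z by (simp add: ab(3) mem)
  also have "q i (b i x - a i z) = x" using i x z by (simp add: dq mem e)
  finally show "?G i (?F i x) = x" .
 next
  fix i y assume i: "i : verts Q" and y: "y : espace B i"
  have t: "b i (q i (b' i y)) = b' i y - a i (p i (b' i y))" using i y by (simp add: ab(2) mem)
  have "w i (p' i (b i (q i (b' i y)))) = w i (- p' i (a i (p i (b' i y))))"
  using i y by (simp add: t dp' mem e')
  also have "... = - p i (b' i y)"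
  proof -
  have "w i (0 - p' i (a i (p i (b' i y)))) = w i 0 - w i (p' i (a i (p i (b' i y))))"
  using i y fv.subspace_0[OF rep_subspace[OF reps(1) i]] by (intro dw) (simp_all add: mem)
  then show ?thesis using i y hom_zero_at[OF w reps(1) i] by (simp add: w1 mem)
  qed
  finally have wz: "w i (p' i (b i (q i (b' i y)))) = - p i (b' i y)" .
  have an: "q' i (a i (- p i (b' i y))) = - q' i (a i (p i (b' i y)))"
  proof -
  have "a i (0 - p i (b' i y)) = a i 0 - a i (p i (b' i y))"
  using i y fv.subspace_0[OF rep_subspace[OF reps(1) i]] by (intro da) (simp_all add: mem)
  moreover have "q' i (0 - a i (p i (b' i y))) = q' i 0 - q' i (a i (p i (b' i y)))"
  using i y fv.subspace_0[OF rep_subspace[OF reps(4) i]] by (intro dq') (simp_all add: mem)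
  ultimately show ?thesis using hom_zero_at[OF h(1) reps(1) i] hom_zero_at[OF h'(4) reps(4) i] by simp
  qed
  have "?F i (?G i y) = q' i (b i (q i (b' i y))) - q' i (a i (- p i (b' i y)))"
  by (simp only: wz)
  also have "... = q' i (b' i y - a i (p i (b' i y))) + q' i (a i (p i (b' i y)))"
  by (simp only: t an diff_minus_eq_add)
  also have "... = y" using i y by (simp add: dq' mem e')
  finally show "?F i (?G i y) = y" .
 qed
qed

text \<open>If the component \<open>N \<rightarrow> N\<close> of the identity is nilpotent, the second decomposition is changed by a
 shear so that this component becomes invertible.\<close>

lemma bip_cancel:
 assumes N: "indec N" and reps: "rel_rep Q A" "rel_rep Q B" "rel_rep Q M"
  and b1: "bip Q M N A" and b2: "bip Q M N B"
 shows "riso A B"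
proof -
 have R: "rel_rep Q N" using N by (simp add: indec_def)
 obtain a b p q where h: "rhom N M a" "rhom A M b" "rhom M N p" "rhom M A q"
  and e0: "ALL i:verts Q. ALL x:espace N i. p i (a i x) = x"
  "ALL i:verts Q. ALL x:espace N i. q i (a i x) = 0"
  "ALL i:verts Q. ALL x:espace A i. q i (b i x) = x"
  "ALL i:verts Q. ALL x:espace A i. p i (b i x) = 0"
  "ALL i:verts Q. ALL x:espace M i. a i (p i x) + b i (q i x) = x" using b1 by (rule bipE)
 obtain a' b' p' q' where h': "rhom N M a'" "rhom B M b'" "rhom M N p'" "rhom M B q'"
  and e'0: "ALL i:verts Q. ALL x:espace N i. p' i (a' i x) = x"
  "ALL i:verts Q. ALL x:espace N i. q' i (a' i x) = 0"
  "ALL i:verts Q. ALL x:espace B i. q' i (b' i x) = x"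
  "ALL i:verts Q. ALL x:espace B i. p' i (b' i x) = 0"
  "ALL i:verts Q. ALL x:espace M i. a' i (p' i x) + b' i (q' i x) = x" using b2 by (rule bipE)
 note e = e0[rule_format] and e' = e'0[rule_format]
 note mem = homD(3)[OF h(1)] homD(3)[OF h(2)] homD(3)[OF h(3)] homD(3)[OF h(4)]
  homD(3)[OF h'(1)] homD(3)[OF h'(2)] homD(3)[OF h'(3)] homD(3)[OF h'(4)]
 have u: "rhom N N (%i x. p' i (a i x))" by (rule hom_comp[OF h(1) h'(3)])
 show ?thesis
 proof (rule indec_dichotomy[OF N u])
  fix m assume "m > 0" "ALL i:verts Q. ALL x:espace N i. ((%x. p' i (a i x)) ^^ m) x = x"
  then show ?thesis by (rule cancel_unit[where a = a and b = b and p = p and q = q and a' = a' and b' = b' and p' = p' and q' = q',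
  OF R reps(1,2,3) h e0 h' e'0])
 next
  fix m assume m: "m > 0" "ALL i:verts Q. ALL x:espace N i. ((%x. p' i (a i x)) ^^ m) x = 0"
  let ?p = "%i x. p' i x + p i (b' i (q' i x))" and ?b = "%i x. b' i x - a' i (p i (b' i x))"
  have hp: "rhom M N ?p" by (rule hom_add[OF R h'(3) hom_comp[OF hom_comp[OF h'(4) h'(2)] h(3)]])
  have hb: "rhom B M ?b" by (rule hom_diff[OF reps(3) h'(2) hom_comp[OF hom_comp[OF h'(2) h(3)] h'(1)]])
  have z: "b' i 0 = 0" "p i 0 = 0" if "i : verts Q" for i
  using hom_zero_at[OF h'(2) reps(2) that] hom_zero_at[OF h(3) reps(3) that] by auto
  note d = hom_diff_at[OF h(3) reps(3)] hom_diff_at[OF h'(3) reps(3)] hom_diff_at[OF h'(4) reps(3)]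
  have v: "rhom N N (%i x. ?p i (a i x))" by (rule hom_comp[OF h(1) hp])
  \<comment> \<open>If \<open>p' (a x)\<close> vanishes then \<open>a x\<close> lies in the summand
    \<open>B\<close>, so \<open>b' q'\<close> leaves it unchanged and \<open>p\<close> returns
    \<open>x\<close>.\<close>
  have uv: "?p i (a i x) = x" if i: "i : verts Q" and x: "x : espace N i" and 0: "p' i (a i x) = 0" for i x
  proof -
  have "b' i (q' i (a i x)) = a i x"
  using e'(5)[OF i, of "a i x"] mem(1)[OF i x] 0 hom_zero_at[OF h'(1) R i] by simp
  then show ?thesis using e(1)[OF i x] 0 by simp
  qed
  have "EX k>0. ALL i:verts Q. ALL x:espace N i. ((%x. ?p i (a i x)) ^^ k) x = x"
  by (rule indec_nilpotent_one_minus[where u = "%i x. p' i (a i x)" and v = "%i x. ?p i (a i x)", OF N u v uv m])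
  then obtain k where k: "k > 0" "ALL i:verts Q. ALL x:espace N i. ((%x. ?p i (a i x)) ^^ k) x = x" by blast
  show ?thesis
  proof (rule cancel_unit[where a = a and b = b and p = p and q = q and a' = a' and b' = ?b and p' = ?p and q' = q',
  OF R reps(1,2,3) h e0 h'(1) hb hp h'(4) _ e'0(2) _ _ _ k])
  show "ALL i:verts Q. ALL x:espace N i. ?p i (a' i x) = x" by (simp add: e' z)
  show "ALL i:verts Q. ALL x:espace B i. q' i (?b i x) = x" by (simp add: d mem e')
  show "ALL i:verts Q. ALL x:espace B i. ?p i (?b i x) = 0" by (simp add: d mem e')
  show "ALL i:verts Q. ALL x:espace M i. a' i (?p i x) + ?b i (q' i x) = x"
  proof (intro ballI)
  fix i x assume i: "i : verts Q" and x: "x : espace M i"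
  have "a' i (?p i x) = a' i (p' i x) + a' i (p i (b' i (q' i x)))"
  by (rule homD(4)[OF h'(1) i]) (simp_all add: mem i x)
  then show "a' i (?p i x) + ?b i (q' i x) = x" using e'(5)[OF i x] by simp
  qed
  qed
 qed
qed

end

section \<open>Semilinear twists of representations, and isomorphism classes\<close>

abbreviation hinv :: "('b => 'c) => 'c => 'b" where
 "hinv \<equiv> inv_into UNIV"

text \<open>Abstracts from Frobenius to a notion closed under inverses, so that each transfer along
  the twist needs to be shown in one direction only. The twisting of scalars is an unnamed
  bijection.\<close>

definition semilinear_bij :: "(('i => 'k::field) => ('i => 'k)) => bool" where
 "semilinear_bij h \<longleftrightarrow> bij h & (ALL v w. h (v + w) = h v + h w) & (EX tau. bij tau & (ALL c v. h (fscale c v) = fscale (tau c) (h v)))"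

text \<open>For \<open>h = fr s\<close> this is the Frobenius twist. It acts on the vectors of the
  spaces and relations themselves, with the same \<open>h\<close> at all vertices.\<close>

definition map_rep :: "(('i => 'k) => ('i => 'k)) => ('v, 'e, 'i, 'k) erep => ('v, 'e, 'i, 'k) erep" where
 "map_rep h M = \<lparr>espace = %i. h ` espace M i, erel = %a. map_prod h h ` erel M a\<rparr>"

lemma semilinear_bijD:
 assumes "semilinear_bij h"
 shows "bij h" "h (v + w) = h v + h w" "h 0 = 0" "hinv h (h v) = v" "h (hinv h v) = v"
proof -
 show "bij h" "h (v + w) = h v + h w" using assms by (auto simp: semilinear_bij_def)
 have "h (0 + 0) = h 0 + h 0" using assms unfolding semilinear_bij_def by blast
 then show "h 0 = 0" by simp
 show "hinv h (h v) = v" "h (hinv h v) = v" using assms unfolding semilinear_bij_def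
  by (simp_all add: bij_is_inj bij_is_surj surj_f_inv_f)
qed

lemma semilinear_bij_scaleE:
 assumes "semilinear_bij h"
 obtains t where "!!c v. h (fscale (t c) v) = fscale c (h v)" "!!c v. h (fscale c v) = fscale (hinv t c) (h v)" "bij t"
proof -
 obtain tau where tau: "bij tau" "ALL c v. h (fscale c v) = fscale (tau c) (h v)" using assms by (auto simp: semilinear_bij_def)
 show thesis
  by (rule that[of "hinv tau"]) (use tau in \<open>auto simp: bij_imp_bij_inv inv_inv_eq bij_is_surj surj_f_inv_f\<close>)
qed

lemma semilinear_bij_inv:
 assumes h: "semilinear_bij h"
 shows "semilinear_bij (hinv h)"
proof -
 note H = semilinear_bijD[OF h]
 obtain t where t: "!!c v. h (fscale (t c) v) = fscale c (h v)" "bij t" by (rule semilinear_bij_scaleE[OF h]) blast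
 have "hinv h (v + w) = hinv h v + hinv h w" for v w
  using H(4)[of "hinv h v + hinv h w"] by (simp add: H(2,5))
 moreover have "hinv h (fscale c v) = fscale (t c) (hinv h v)" for c v
  using H(4)[of "fscale (t c) (hinv h v)"] by (simp add: H(5) t(1))
 ultimately show ?thesis unfolding semilinear_bij_def using H(1) t(2) bij_imp_bij_inv by blast
qed

text \<open>The image of a spanning set spans, so \<open>h\<close> cannot raise the dimension;
  neither can its inverse, which is again semilinear.\<close>

lemma semilinear_image:
 assumes h: "semilinear_bij h"
 shows "fv.subspace V ==> fv.subspace (h ` V)" "fin_dim_space V ==> fin_dim_space (h ` V)"
  "fin_dim_space V ==> fv.dim (h ` V) = fv.dim V"
proof -
 have sub: "fv.subspace (h ` V)" if h: "semilinear_bij h" and V: "fv.subspace V" for h :: "('a => 'b) => ('a => 'b)" and V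
 proof -
  note H = semilinear_bijD[OF h]
  obtain t where t: "!!c v. h (fscale (t c) v) = fscale c (h v)" by (rule semilinear_bij_scaleE[OF h]) blast
  show ?thesis unfolding fv.subspace_def
  proof (intro conjI ballI allI)
  show "0 : h ` V" using H(3) fv.subspace_0[OF V] by (metis imageI)
  show "x + y : h ` V" if "x : h ` V" "y : h ` V" for x y
  using that H(2) fv.subspace_add[OF V] by (auto simp flip: H(2))
  show "fscale c x : h ` V" if "x : h ` V" for x c
  using that fv.subspace_scale[OF V] by (auto simp flip: t)
  qed
 qed
 then show "fv.subspace V ==> fv.subspace (h ` V)" using h by blast
 have span: "h ` fv.span B \<subseteq> fv.span (h ` B)" if h: "semilinear_bij h" for h :: "('a => 'b) => ('a => 'b)" and B
 proof -
  have "fv.span B \<subseteq> hinv h ` fv.span (h ` B)"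
  proof (rule fv.span_minimal)
  show "B \<subseteq> hinv h ` fv.span (h ` B)"
  proof
  fix x assume "x : B"
  then show "x : hinv h ` fv.span (h ` B)"
  by (intro image_eqI[of _ _ "h x"]) (auto simp: semilinear_bijD[OF h] intro: fv.span_base)
  qed
  show "fv.subspace (hinv h ` fv.span (h ` B))" by (rule sub[OF semilinear_bij_inv[OF h]]) simp
  qed
  then have "h ` fv.span B \<subseteq> h ` hinv h ` fv.span (h ` B)" by (rule image_mono)
  then show ?thesis by (simp add: image_image semilinear_bijD[OF h])
 qed
 have fd: "fin_dim_space (h ` V)" "fv.dim (h ` V) <= fv.dim V" if h: "semilinear_bij h" and V: "fin_dim_space V" for h :: "('a => 'b) => ('a => 'b)" and V
 proof -
  obtain B where B: "finite B" "fv.independent B" "fv.span B = V" "card B = fv.dim V" by (rule fin_dim_basis[OF V])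
  have "fv.span (h ` B) \<subseteq> h ` V"
  using B(3) fv.span_superset[of B] by (intro fv.span_minimal image_mono sub[OF h] fin_dim_subspace[OF V]) auto
  then have eq: "h ` V = fv.span (h ` B)" using span[OF h, of B] B(3) by auto
  then show "fin_dim_space (h ` V)" using B(1) unfolding fin_dim_space_def by blast
  have "fv.dim (h ` V) <= card (h ` B)" using eq B(1) by (intro fv.dim_le_card) auto
  then show "fv.dim (h ` V) <= fv.dim V" using card_image_le[OF B(1), of h] B(4) by linarith
 qed
 assume V: "fin_dim_space V"
 show fh: "fin_dim_space (h ` V)" using fd h V by blast
 have "hinv h ` h ` V = V" by (simp add: image_image semilinear_bijD[OF h])
 then have "fv.dim V <= fv.dim (h ` V)" using fd(2)[OF semilinear_bij_inv[OF h] fh] by simp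
 then show "fv.dim (h ` V) = fv.dim V" using fd(2)[OF h V] by simp
qed

lemma map_rep_inv: "semilinear_bij h ==> map_rep (hinv h) (map_rep h M) = M" "semilinear_bij h ==> map_rep h (map_rep (hinv h) M) = M"
proof -
 have *: "map_rep g (map_rep h M) = M" if "!!v. g (h v) = v" for g h :: "('i => 'k::field) => ('i => 'k)" and M :: "('v, 'e, 'i, 'k) erep"
  by (simp add: map_rep_def image_image map_prod_def split_beta that)
 show "semilinear_bij h ==> map_rep (hinv h) (map_rep h M) = M" "semilinear_bij h ==> map_rep h (map_rep (hinv h) M) = M"
  by (rule *, simp add: semilinear_bijD)+
qed

context quiver begin

lemma map_rep_rep:
 assumes h: "semilinear_bij h" and M: "rel_rep Q M"
 shows "rel_rep Q (map_rep h M)"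
 unfolding rel_rep_def linear_relation_def
proof (intro conjI ballI)
 note H = semilinear_bijD[OF h]
 obtain t where t: "!!c v. h (fscale (t c) v) = fscale c (h v)" by (rule semilinear_bij_scaleE[OF h]) blast
 show "fin_dim_space (espace (map_rep h M) i)" if "i : verts Q" for i
  using semilinear_image(2)[OF h rep_space[OF M that]] by (simp add: map_rep_def)
 fix a assume a: "a : arcs Q"
 note R = rep_rel[OF M a]
 show "erel (map_rep h M) a \<subseteq> espace (map_rep h M) (tail Q a) \<times> espace (map_rep h M) (head Q a)"
  using R(1) by (auto simp: map_rep_def)
 have e: "(h x, h y) : erel (map_rep h M) a" if "(x, y) : erel M a" for x y
  using that by (auto simp: map_rep_def)
 show "fv2.p.subspace (erel (map_rep h M) a)" unfolding rel_subspace_iff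
 proof (intro conjI allI impI)
  show "(0, 0) : erel (map_rep h M) a" using e[OF R(3)] by (simp add: H)
  show "(x + x', y + y') : erel (map_rep h M) a" if xy: "(x, y) : erel (map_rep h M) a" "(x', y') : erel (map_rep h M) a" for x y x' y'
  proof -
  obtain u v where "(u, v) : erel M a" "x = h u" "y = h v" using xy(1) by (auto simp: map_rep_def)
  moreover obtain u' v' where "(u', v') : erel M a" "x' = h u'" "y' = h v'" using xy(2) by (auto simp: map_rep_def)
  ultimately show ?thesis using e[OF R(4), of u v u' v'] by (simp add: H)
  qed
  show "(fscale c x, fscale c y) : erel (map_rep h M) a" if xy: "(x, y) : erel (map_rep h M) a" for c x y
  proof -
  obtain u v where "(u, v) : erel M a" "x = h u" "y = h v" using xy by (auto simp: map_rep_def)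
  then show ?thesis using e[OF R(5), of u v "t c"] by (simp add: t)
  qed
 qed
qed

lemma map_rep_hom:
 assumes h: "semilinear_bij h" and tht: "rhom M N tht"
 shows "rhom (map_rep h M) (map_rep h N) (%i x. h (tht i (hinv h x)))"
proof (rule homI)
 note H = semilinear_bijD[OF h] and H' = semilinear_bijD[OF semilinear_bij_inv[OF h]]
 obtain t where t: "!!c v. h (fscale (t c) v) = fscale c (h v)" by (rule semilinear_bij_scaleE[OF h]) blast
 fix i assume i: "i : verts Q"
 show "linear_map_on (espace (map_rep h M) i) (espace (map_rep h N) i) (%x. h (tht i (hinv h x)))"
  unfolding linear_map_on_def
 proof (intro conjI ballI allI funcsetI)
  fix x y c assume x: "x : espace (map_rep h M) i"
  then obtain u where u: "u : espace M i" "x = h u" by (auto simp: map_rep_def)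
  show "h (tht i (hinv h x)) : espace (map_rep h N) i" using u homD(3)[OF tht i u(1)] by (simp add: map_rep_def H)
  have "fscale c x = h (fscale (t c) u)" by (simp add: t u)
  then have "hinv h (fscale c x) = fscale (t c) u" by (simp add: H)
  then show "h (tht i (hinv h (fscale c x))) = fscale c (h (tht i (hinv h x)))"
  using homD(5)[OF tht i u(1)] u by (simp add: H t)
  assume "y : espace (map_rep h M) i"
  then obtain v where v: "v : espace M i" "y = h v" by (auto simp: map_rep_def)
  show "h (tht i (hinv h (x + y))) = h (tht i (hinv h x)) + h (tht i (hinv h y))"
  using homD(4)[OF tht i u(1) v(1)] u v by (simp add: H H'(2))
 qed
next
 fix a x y assume "a : arcs Q" "(x, y) : erel (map_rep h M) a"
 then show "(h (tht (tail Q a) (hinv h x)), h (tht (head Q a) (hinv h y))) : erel (map_rep h N) a"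
  using homD(2)[OF tht] by (auto simp: map_rep_def semilinear_bijD[OF h])
qed

lemma map_rep_iso:
 assumes h: "semilinear_bij h" and "riso M N"
 shows "riso (map_rep h M) (map_rep h N)"
proof -
 obtain tht \<psi> where t: "rhom M N tht" "rhom N M \<psi>" "ALL i:verts Q. ALL x:espace M i. \<psi> i (tht i x) = x"
  "ALL i:verts Q. ALL y:espace N i. tht i (\<psi> i y) = y" using assms(2) by (rule isoE)
 show ?thesis
  by (rule isoI[OF map_rep_hom[OF h t(1)] map_rep_hom[OF h t(2)]])
  (use t(3,4) in \<open>auto simp: map_rep_def semilinear_bijD[OF h]\<close>)
qed

lemma map_rep_bip:
 assumes h: "semilinear_bij h" and "bip Q M N L"
 shows "bip Q (map_rep h M) (map_rep h N) (map_rep h L)"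
proof -
 note H = semilinear_bijD[OF h]
 obtain a b p q where k: "rhom N M a" "rhom L M b" "rhom M N p" "rhom M L q"
  and e: "ALL i:verts Q. ALL x:espace N i. p i (a i x) = x"
  "ALL i:verts Q. ALL x:espace N i. q i (a i x) = 0"
  "ALL i:verts Q. ALL x:espace L i. q i (b i x) = x"
  "ALL i:verts Q. ALL x:espace L i. p i (b i x) = 0"
  "ALL i:verts Q. ALL x:espace M i. a i (p i x) + b i (q i x) = x" using assms(2) by (rule bipE)
 show ?thesis
  by (rule bipI[OF map_rep_hom[OF h k(1)] map_rep_hom[OF h k(2)] map_rep_hom[OF h k(3)] map_rep_hom[OF h k(4)]])
  (use e in \<open>auto simp: map_rep_def H(3,4,5) simp flip: H(2)\<close>)
qed

lemma map_rep_nonzero: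
 assumes h: "semilinear_bij h"
 shows "equipped_nonzero Q (map_rep h M) \<longleftrightarrow> equipped_nonzero Q M"
proof -
 have "h ` V = {0} \<longleftrightarrow> V = {0}" for V
  using semilinear_bijD(3,4)[OF h] by (metis image_empty image_insert image_inv_f_f inj_on_inverseI)
 then show ?thesis by (simp add: equipped_nonzero_def map_rep_def)
qed

lemma map_rep_type:
 assumes h: "semilinear_bij h" and T: "has_type Q rho sig M"
 shows "has_type Q rho sig (map_rep h M)"
proof -
 note H = semilinear_bijD[OF h]
 have h0: "h x = 0 \<longleftrightarrow> x = 0" for x using H(3,4) by metis
 have "Ker_rel (map_prod h h ` R) = h ` Ker_rel R" "Def_rel (map_prod h h ` R) = h ` Def_rel R"
  "Ind_rel (map_prod h h ` R) = h ` Ind_rel R" "Im_rel (map_prod h h ` R) = h ` Im_rel R" for R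
  using h0 by (force simp: Ker_rel_def Def_rel_def Ind_rel_def Im_rel_def)+
 moreover have "h ` {0} = {0}" by (simp add: H)
 ultimately show ?thesis using T by (auto simp: has_type_def map_rep_def)
qed

lemma zero_rep:
 obtains Z :: "('v, 'e, nat, 'k::field) erep" where "rel_rep Q Z" "~ equipped_nonzero Q Z"
proof -
 let ?Z = "\<lparr>espace = %i. {0}, erel = %a. {(0, 0)}\<rparr> :: ('v, 'e, nat, 'k) erep"
 have "rel_rep Q ?Z" by (simp add: rel_rep_def linear_relation_def fin_dim_zero rel_subspace_iff)
 moreover have "~ equipped_nonzero Q ?Z" by (simp add: equipped_nonzero_def)
 ultimately show thesis using that by blast
qed

lemma zero_iso:
 assumes "rel_rep Q M" "rel_rep Q N" "~ equipped_nonzero Q M" "~ equipped_nonzero Q N"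
 shows "riso M N"
 by (rule isoI[OF hom_zero[OF assms(2)] hom_zero[OF assms(1)]]) (use assms(3,4) in \<open>auto simp: equipped_nonzero_def\<close>)

text \<open>Classes are sets of representations, so Frobenius acts on them by image
  (\<open>map_rep_cls\<close>).\<close>

definition cls :: "('v, 'e, nat, 'k::field) erep => ('v, 'e, nat, 'k) erep set" where
 "cls M = {N. rel_rep Q N & riso M N}"

lemma cls_eq_iff: "rel_rep Q M ==> rel_rep Q N ==> cls M = cls N \<longleftrightarrow> riso M N"
 unfolding cls_def using iso_refl iso_sym iso_trans by blast

lemma map_rep_cls:
 assumes h: "semilinear_bij h"
 shows "map_rep h ` cls M = cls (map_rep h M)"
proof (intro equalityI subsetI)
 fix N assume "N : cls (map_rep h M)"
 then have N: "rel_rep Q N" "riso (map_rep h M) N" by (auto simp: cls_def)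
 note h' = semilinear_bij_inv[OF h]
 have "map_rep (hinv h) N : cls M"
  using map_rep_rep[OF h' N(1)] map_rep_iso[OF h' N(2)] by (simp add: cls_def map_rep_inv[OF h])
 then show "N : map_rep h ` cls M" by (rule rev_image_eqI) (simp add: map_rep_inv[OF h])
qed (auto simp: cls_def map_rep_rep[OF h] map_rep_iso[OF h])

text \<open>The dimension vector of a class, read off from a chosen member. The value 0 off the
  vertices lets dimension vectors be compared as functions.\<close>

definition cdim :: "('v, 'e, nat, 'k::field) erep set => 'v => nat" where
 "cdim c = (%i. if i : verts Q then fv.dim (espace (SOME N. N : c) i) else 0)"

lemma cdim_cls:
 assumes "rel_rep Q M" "i : verts Q"
 shows "cdim (cls M) i = fv.dim (espace M i)"
proof -
 define N0 where "N0 = (SOME N. N : cls M)"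
 have "N0 : cls M" unfolding N0_def by (rule someI[of _ M]) (simp add: cls_def assms iso_refl)
 then have "riso M N0" by (simp add: cls_def)
 from iso_dim[OF assms(1) this assms(2)] show ?thesis using assms(2) by (simp add: cdim_def N0_def)
qed

end

section \<open>The Krull-Schmidt theorem\<close>

context frob_quiver begin

lemma indec_map_rep:
 assumes h: "semilinear_bij h" and N: "indec N"
 shows "indec (map_rep h N)"
proof -
 note h' = semilinear_bij_inv[OF h]
 have "False" if AB: "rel_rep Q A" "equipped_nonzero Q A" "rel_rep Q B" "equipped_nonzero Q B" "bip Q (map_rep h N) A B"
  for A B :: "('v, 'e, nat, 'a) erep"
 proof -
  have "bip Q N (map_rep (hinv h) A) (map_rep (hinv h) B)" using map_rep_bip[OF h' AB(5)] by (simp add: map_rep_inv[OF h])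
  moreover have "rel_rep Q (map_rep (hinv h) A)" "rel_rep Q (map_rep (hinv h) B)" using map_rep_rep[OF h'] AB by auto
  moreover have "equipped_nonzero Q (map_rep (hinv h) A)" "equipped_nonzero Q (map_rep (hinv h) B)"
  using map_rep_nonzero[OF h'] AB by auto
  ultimately show False using N unfolding indec_def by metis
 qed
 moreover have "rel_rep Q (map_rep h N)" "equipped_nonzero Q (map_rep h N)"
  using N map_rep_rep[OF h] map_rep_nonzero[OF h] by (auto simp: indec_def)
 ultimately show ?thesis unfolding indec_def by metis
qed

text \<open>Decompositions into indecomposables: summands are peeled off one at a time and only
  their classes are recorded, as a multiset. The predicate is shown to be a bijection between
  isomorphism classes and multisets of indecomposable classes.\<close>

inductive D :: "('v, 'e, nat, 'a) erep => ('v, 'e, nat, 'a) erep set multiset => bool" where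
 D_zero: "rel_rep Q M ==> ~ equipped_nonzero Q M ==> D M {#}"
| D_step: "rel_rep Q M ==> indec N ==> D L \<mu> ==> bip Q M N L ==> D M (add_mset (cls N) \<mu>)"

lemma D_rep: "D M \<mu> ==> rel_rep Q M"
 by (induction rule: D.induct) auto

lemma indec_rep: "indec N ==> rel_rep Q N"
 by (simp add: indec_def)

lemma D_mem: "D M \<mu> ==> c \<in># \<mu> ==> EX N. indec N & c = cls N"
 by (induction rule: D.induct) auto

lemma D_iso:
 assumes "D M \<mu>" "riso M M'" "rel_rep Q M'"
 shows "D M' \<mu>"
 using assms
proof (cases rule: D.cases)
 case D_zero
 then show ?thesis using D.D_zero iso_nonzero assms by metis
next
 case (D_step N L \<mu>')
 then have "bip Q M' N L" using bip_iso[OF indec_rep D_rep _ assms(2) iso_refl iso_refl] by blast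
 then show ?thesis using D.D_step[OF assms(3)] D_step by metis
qed

text \<open>Any recorded class may be taken as the first summand; \<open>bip_assoc\<close> moves it
  past the summands peeled off earlier.\<close>

lemma D_split:
 assumes "D M \<nu>" "c \<in># \<nu>"
 shows "EX N L. indec N & cls N = c & bip Q M N L & D L (\<nu> - {#c#})"
 using assms
proof (induction rule: D.induct)
 case (D_step M N L \<mu>)
 show ?case
 proof (cases "c = cls N")
  case True
  then show ?thesis using D_step by auto
 next
  case False
  then have "c \<in># \<mu>" using D_step.prems by simp
  then obtain N2 L2 where N2: "indec N2" "cls N2 = c" "bip Q L N2 L2" "D L2 (\<mu> - {#c#})" using D_step.IH by blast
  obtain L3 :: "('v, 'e, nat, 'a) erep" where L3: "rel_rep Q L3" "bip Q L3 N L2"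
  by (rule sum_exists[OF indec_rep[OF D_step.hyps(2)] D_rep[OF N2(4)]])
  have "bip Q M N2 L3"
  by (rule bip_assoc[OF D_step.hyps(1) indec_rep[OF D_step.hyps(2)] D_rep[OF D_step.hyps(3)]
  indec_rep[OF N2(1)] D_rep[OF N2(4)] L3(1) D_step.hyps(4) N2(3) L3(2)])
  moreover have "D L3 (add_mset (cls N) (\<mu> - {#c#}))" by (rule D.D_step[OF L3(1) D_step.hyps(2) N2(4) L3(2)])
  ultimately show ?thesis using N2(1,2) False by (metis diff_union_swap)
 qed
qed simp

lemma D_empty: "D M {#} ==> ~ equipped_nonzero Q M"
 by (cases rule: D.cases) auto

lemma D_unique_iso: "D M \<mu> ==> D M' \<mu> ==> riso M M'"
proof (induction arbitrary: M' rule: D.induct)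
 case (D_zero M)
 then show ?case using zero_iso D_rep D_empty by blast
next
 case (D_step M N L \<mu>)
 obtain N' L' where N': "indec N'" "cls N' = cls N" "bip Q M' N' L'" "D L' \<mu>"
  using D_split[OF D_step.prems, of "cls N"] by auto
 have "riso N' N" using cls_eq_iff N' D_step.hyps indec_rep by metis
 moreover have "riso L' L" using D_step.IH[OF N'(4)] iso_sym by blast
 ultimately have "bip Q M' N L"
  using bip_iso[OF indec_rep[OF N'(1)] D_rep[OF N'(4)] N'(3) iso_refl] by blast
 then show ?case using bip_unique[OF D_step.hyps(4) _ D_step.hyps(1) D_rep[OF D_step.prems]] by blast
qed

lemma bip_retract: "bip Q M N L ==> retract N M"
 unfolding bip_def retract_def by blast

lemma retract_nonzero:
 assumes "retract N M" "equipped_nonzero Q N" "rel_rep Q N" "rel_rep Q M"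
 shows "equipped_nonzero Q M"
proof (rule ccontr)
 assume Z: "~ equipped_nonzero Q M"
 obtain f g where f: "rhom N M f" "rhom M N g" "ALL i:verts Q. ALL x:espace N i. g i (f i x) = x"
  using assms(1) unfolding retract_def by blast
 obtain i x where x: "i : verts Q" "x : espace N i" "x ~= 0"
  using assms(2) fv.subspace_0[OF rep_subspace[OF assms(3)]] by (auto simp: equipped_nonzero_def)
 have "f i x = 0" using Z homD(3)[OF f(1) x(1,2)] x(1) by (auto simp: equipped_nonzero_def)
 then show False using f(3) x hom_zero_at[OF f(2) assms(4) x(1)] by metis
qed

text \<open>By \<open>indec_prime\<close> an indecomposable retract of \<open>M\<close> is a retract
  of one of the recorded summands, and a retract between indecomposables is an isomorphism.\<close>

lemma D_prime: "D M \<nu> ==> indec N ==> retract N M ==> cls N \<in># \<nu>"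
proof (induction rule: D.induct)
 case (D_zero M)
 then show ?case using retract_nonzero by (auto simp: indec_def)
next
 case (D_step M N1 L \<mu>)
 then consider "retract N N1" | "retract N L" using indec_prime by blast
 then show ?case
 proof cases
  case 1
  then have "riso N1 N" using indec_retract_indec D_step by blast
  then have "cls N1 = cls N" using cls_eq_iff D_step indec_rep by blast
  then show ?thesis by simp
 next
  case 2
  then show ?thesis using D_step by simp
 qed
qed

text \<open>The first summand of one decomposition is a retract of \<open>M\<close>, so its class
  occurs in the other. Brought to the front there, it cancels by \<open>bip_cancel\<close>, and
  induction compares the complements.\<close>

lemma D_unique: "D M \<mu> ==> D M \<nu> ==> \<mu> = \<nu>"
proof (induction arbitrary: \<nu> rule: D.induct)
 case (D_zero M)
 have "\<nu> = {#}"
 proof (rule ccontr)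
  assume "\<nu> ~= {#}"
  then obtain c where c: "c \<in># \<nu>" by blast
  obtain N and L :: "('v, 'e, nat, 'a) erep" where "indec N" "bip Q M N L"
  using D_split[OF D_zero.prems c] by blast
  then have "equipped_nonzero Q M"
  using retract_nonzero[OF bip_retract] D_zero.hyps(1) by (auto simp: indec_def)
  then show False using D_zero by simp
 qed
 then show ?case by simp
next
 case (D_step M N L \<mu>)
 have c: "cls N \<in># \<nu>" using D_prime[OF D_step.prems D_step.hyps(2)] bip_retract[OF D_step.hyps(4)] by blast
 obtain N' L' where N': "indec N'" "cls N' = cls N" "bip Q M N' L'" "D L' (\<nu> - {#cls N#})"
  using D_split[OF D_step.prems c] by blast
 have "riso N' N" using cls_eq_iff N' D_step.hyps indec_rep by metis
 then have "bip Q M N L'"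
  using bip_iso[OF indec_rep[OF N'(1)] D_rep[OF N'(4)] N'(3) iso_refl _ iso_refl] by blast
 then have "riso L' L"
  using bip_cancel[OF D_step.hyps(2) D_rep[OF N'(4)] D_rep[OF D_step.hyps(3)] D_step.hyps(1)] D_step.hyps(4) by blast
 then have "D L (\<nu> - {#cls N#})" using D_iso[OF N'(4)] D_rep[OF D_step.hyps(3)] by blast
 then have "\<mu> = \<nu> - {#cls N#}" by (rule D_step.IH)
 then show ?case using c by simp
qed

lemma D_add: "D A \<mu> ==> D B \<nu> ==> rel_rep Q M ==> bip Q M A B ==> D M (\<mu> + \<nu>)"
proof (induction arbitrary: M rule: D.induct)
 case (D_zero A)
 have "riso M B" using iso_bip_zero[OF bip_commute[OF D_zero.prems(3)] D_zero.prems(2)] D_zero.hyps(2) by blast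
 then show ?case using D_iso[OF D_zero.prems(1) iso_sym] D_zero.prems(2) by simp
next
 case (D_step A N L \<mu>)
 note rL = D_rep[OF D_step.hyps(3)] and rB = D_rep[OF D_step.prems(1)]
 obtain L3 :: "('v, 'e, nat, 'a) erep" where L3: "rel_rep Q L3" "bip Q L3 L B" by (rule sum_exists[OF rL rB])
 have "D L3 (\<mu> + \<nu>)" by (rule D_step.IH[OF D_step.prems(1) L3])
 moreover have "bip Q M N L3"
  by (rule bip_assoc[OF D_step.prems(2) rB D_step.hyps(1) indec_rep[OF D_step.hyps(2)] rL L3(1)
  bip_commute[OF D_step.prems(3)] D_step.hyps(4) bip_commute[OF L3(2)]])
 ultimately show ?case using D.D_step[OF D_step.prems(2) D_step.hyps(2)] by simp
qed

lemma D_exists: "rel_rep Q M ==> EX \<mu>. D M \<mu>"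
proof (induction "\<Sum>i\<in>verts Q. fv.dim (espace M i)" arbitrary: M rule: less_induct)
 case less
 consider "~ equipped_nonzero Q M" | "indec M"
  | "equipped_nonzero Q M" "~ indec M" by blast
 then show ?case
 proof cases
  case 1
  then show ?thesis using less.prems D_zero by blast
 next
  case 2
  obtain Z :: "('v, 'e, nat, 'a) erep" where Z: "rel_rep Q Z" "~ equipped_nonzero Q Z" by (rule zero_rep)
  then show ?thesis using D_step[OF less.prems 2 D_zero[OF Z] bip_zero[OF less.prems Z]] by blast
 next
  case 3
  then obtain A B :: "('v, 'e, nat, 'a) erep" where AB: "rel_rep Q A" "equipped_nonzero Q A" "rel_rep Q B" "equipped_nonzero Q B" "bip Q M A B"
  using less.prems unfolding indec_def by metis
  have lt: "(\<Sum>i\<in>verts Q. fv.dim (espace X' i)) < (\<Sum>i\<in>verts Q. fv.dim (espace M i))"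
  if "rel_rep Q X'" "rel_rep Q Y" "equipped_nonzero Q Y" "bip Q M X' Y" for X' Y :: "('v, 'e, nat, 'a) erep"
  proof -
  have "(\<Sum>i\<in>verts Q. fv.dim (espace M i)) = (\<Sum>i\<in>verts Q. fv.dim (espace X' i)) + (\<Sum>i\<in>verts Q. fv.dim (espace Y i))"
  using bip_dim[OF less.prems that(1,2,4)] by (simp add: sum.distrib)
  moreover have "(\<Sum>i\<in>verts Q. fv.dim (espace Y i)) > 0"
  using that(3) nonzero_iff_dim[OF that(2)] by (metis finite_verts gr_zeroI sum_eq_0_iff)
  ultimately show ?thesis by simp
  qed
  obtain \<mu> \<nu> where "D A \<mu>" "D B \<nu>"
  using less.hyps[OF lt[OF AB(1,3,4,5)] AB(1)] less.hyps[OF lt[OF AB(3,1,2) bip_commute[OF AB(5)]] AB(3)] by blast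
  then show ?thesis using D_add[OF _ _ less.prems AB(5)] by blast
 qed
qed

lemma D_map_rep: "D M \<mu> ==> semilinear_bij h ==> D (map_rep h M) (image_mset ((`) (map_rep h)) \<mu>)"
proof (induction rule: D.induct)
 case (D_zero M)
 show ?case
  using D.D_zero[OF map_rep_rep[OF D_zero.prems D_zero.hyps(1)]] map_rep_nonzero[OF D_zero.prems, of M] D_zero.hyps(2)
  by simp
next
 case (D_step M N L \<mu>)
 note h = D_step.prems
 show ?case
  using D.D_step[OF map_rep_rep[OF h D_step.hyps(1)] indec_map_rep[OF h D_step.hyps(2)] D_step.IH[OF h] map_rep_bip[OF h D_step.hyps(4)]]
  by (simp add: map_rep_cls[OF h])
qed

lemma D_dim: "D M \<mu> ==> i : verts Q ==> fv.dim (espace M i) = (\<Sum>c\<in>#\<mu>. cdim c i)"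
proof (induction rule: D.induct)
 case (D_zero M)
 then show ?case using nonzero_iff_dim[OF D_zero(1)] by auto
next
 case (D_step M N L \<mu>)
 note N = indec_rep[OF D_step.hyps(2)]
 have "fv.dim (espace M i) = fv.dim (espace N i) + fv.dim (espace L i)"
  by (rule bip_dim[OF D_step.hyps(1) N D_rep[OF D_step.hyps(3)] D_step.hyps(4) D_step.prems])
 also have "fv.dim (espace N i) = cdim (cls N) i" by (rule cdim_cls[OF N D_step.prems, symmetric])
 also have "fv.dim (espace L i) = (\<Sum>c\<in>#\<mu>. cdim c i)" by (rule D_step.IH[OF D_step.prems])
 finally show ?case by simp
qed

definition Ind :: "('e => nat) => ('e => nat) => ('v, 'e, nat, 'a) erep set set" where
 "Ind rho sig = {cls N |N. indec N & has_type Q rho sig N}"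

lemma cls_Ind_iff: "indec N ==> cls N : Ind rho sig \<longleftrightarrow> has_type Q rho sig N"
proof
 assume N: "indec N" and "cls N : Ind rho sig"
 then obtain N' where N': "indec N'" "has_type Q rho sig N'" "cls N = cls N'" by (auto simp: Ind_def)
 then have "riso N' N" using cls_eq_iff[OF indec_rep indec_rep] N by metis
 then show "has_type Q rho sig N" using iso_type indec_rep N N' by blast
qed (auto simp: Ind_def)

lemma D_type: "D M \<mu> ==> has_type Q rho sig M \<longleftrightarrow> set_mset \<mu> \<subseteq> Ind rho sig"
proof (induction rule: D.induct)
 case (D_zero M)
 have "has_type Q rho sig M" unfolding has_type_def
 proof (intro ballI)
  fix a assume a: "a : arcs Q"
  then have "espace M (tail Q a) = {0}" "espace M (head Q a) = {0}" using D_zero(2) by (auto simp: equipped_nonzero_def)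
  then have "erel M a = {(0, 0)}" using rep_rel(1,3)[OF D_zero(1) a] by auto
  then show "(rho a = 0 --> Ker_rel (erel M a) = {0}) & (rho a = 1 --> Def_rel (erel M a) = espace M (tail Q a)) \<and>
  (sig a = 0 --> Ind_rel (erel M a) = {0}) & (sig a = 1 --> Im_rel (erel M a) = espace M (head Q a))"
  using \<open>espace M (tail Q a) = {0}\<close> \<open>espace M (head Q a) = {0}\<close>
  by (auto simp: Ker_rel_def Def_rel_def Ind_rel_def Im_rel_def)
 qed
 then show ?case by simp
next
 case (D_step M N L \<mu>)
 then show ?case using bip_type[OF D_step.hyps(1) indec_rep D_rep] cls_Ind_iff by simp
qed

lemma D_of_multiset:
 assumes "\<forall>c\<in>#\<mu>. EX N. indec N & c = cls N"
 shows "EX M. D M \<mu>"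
 using assms
proof (induction \<mu>)
 case empty
 obtain Z :: "('v, 'e, nat, 'a) erep" where "rel_rep Q Z" "~ equipped_nonzero Q Z" by (rule zero_rep)
 then show ?case using D_zero by blast
next
 case (add c \<mu>)
 then obtain N L where N: "indec N" "c = cls N" "D L \<mu>" by auto
 obtain M :: "('v, 'e, nat, 'a) erep" where "rel_rep Q M" "bip Q M N L"
  by (rule sum_exists[OF indec_rep[OF N(1)] D_rep[OF N(3)]])
 then show ?case using D_step N by blast
qed

lemma D_indec: "indec N ==> D N {#cls N#}"
proof -
 assume N: "indec N"
 obtain Z :: "('v, 'e, nat, 'a) erep" where Z: "rel_rep Q Z" "~ equipped_nonzero Q Z" by (rule zero_rep)
 show ?thesis by (rule D_step[OF indec_rep[OF N] N D_zero[OF Z] bip_zero[OF indec_rep[OF N] Z]])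
qed

end

section \<open>Burnside's lemma, and relations fixed by Frobenius\<close>

text \<open>Burnside's lemma with the orbits given as fibres of \<open>f\<close>. The group
  structure enters through \<open>orb\<close> and through \<open>stab\<close>, which says that the
  set carrying \<open>x\<close> to a given point of its orbit is as large as the stabiliser.\<close>

lemma card_orbits_times_card_group:
 assumes fin: "finite G" "finite R"
  and act: "!!g x. g : G ==> x : R ==> act g x : R"
  and orb: "!!x y. x : R ==> y : R ==> f x = f y \<longleftrightarrow> (EX g:G. act g x = y)"
  and stab: "!!g x. g : G ==> x : R ==> card {h : G. act h x = act g x} = card {h : G. act h x = x}"
 shows "card (f ` R) * card G = (\<Sum>g\<in>G. card {x : R. act g x = x})"
proof -
 let ?st = "%x. card {g : G. act g x = x}" and ?cl = "%c. {x : R. f x = c}"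
 have G: "card G = card (?cl (f x)) * ?st x" if x: "x : R" for x
 proof -
  have im: "(%g. act g x) ` G = ?cl (f x)"
  proof (intro equalityI subsetI)
  fix y assume "y : (%g. act g x) ` G"
  then obtain g where g: "g : G" "y = act g x" by auto
  then have "y : R" using act x by simp
  moreover have "f x = f y" using orb[OF x \<open>y : R\<close>] g by blast
  ultimately show "y : ?cl (f x)" by simp
  next
  fix y assume "y : ?cl (f x)"
  then have "y : R" "f x = f y" by auto
  then show "y : (%g. act g x) ` G" using orb[OF x] by auto
  qed
  have "card G = (\<Sum>y\<in>(%g. act g x) ` G. card {g : G. act g x = y})" by (rule card_eq_sum_fibers[OF fin(1)])
  also have "... = (\<Sum>y\<in>(%g. act g x) ` G. ?st x)" using stab[OF _ x] by (intro sum.cong) auto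
  finally show ?thesis by (simp add: im)
 qed
 have cls: "(\<Sum>x\<in>?cl c. ?st x) = card G" if c: "c : f ` R" for c
 proof -
  obtain x0 where x0: "x0 : R" "f x0 = c" using c by auto
  then have pos: "card (?cl c) > 0" using fin(2) by (auto simp: card_gt_0_iff)
  \<comment> \<open>Both stabilisers, multiplied by the size of the common class, give the order of
    the group.\<close>
  have "?st x = ?st x0" if "x : ?cl c" for x
  using G[of x] G[of x0] that x0 pos by simp
  then have "(\<Sum>x\<in>?cl c. ?st x) = card (?cl c) * ?st x0" by simp
  then show ?thesis using G[OF x0(1)] x0(2) by simp
 qed
 have "(\<Sum>g\<in>G. card {x : R. act g x = x}) = (\<Sum>g\<in>G. \<Sum>x\<in>R. if act g x = x then 1 else 0)"
  using fin(2) by (intro sum.cong refl) (simp add: sum.If_cases Int_def)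
 also have "... = (\<Sum>x\<in>R. \<Sum>g\<in>G. if act g x = x then 1 else 0)" by (rule sum.swap)
 also have "... = (\<Sum>x\<in>R. ?st x)"
  using fin(1) by (intro sum.cong refl) (simp add: sum.If_cases Int_def)
 also have "... = (\<Sum>c\<in>f ` R. \<Sum>x\<in>?cl c. ?st x)" by (rule sum.image_gen[OF fin(2)])
 also have "... = card (f ` R) * card G" using cls by simp
 finally show ?thesis by simp
qed

context vector_space begin

lemma finite_span_subset:
 assumes "finite B0" "subspace U" "U \<subseteq> span B0"
 obtains B where "finite B" "U = span B"
proof -
 obtain B where B: "B \<subseteq> U" "independent B" "U \<subseteq> span B" by (rule maximal_independent_subset)
 have "finite B" using B assms(3) independent_span_bound[OF assms(1) B(2)] by blast
 moreover have "U = span B" using B assms(2) by (metis span_minimal subset_antisym)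
 ultimately show thesis by (rule that)
qed

end

context frob_space begin

text \<open>A space over the fixed field that consists of fixed vectors gains no fixed vectors by
  extending scalars: applying \<open>tau\<close> to an expansion in independent fixed vectors shows
  that the coefficients lie in the fixed field.\<close>

lemma span_fixed_subset:
 assumes tau: "!!v w. tau (v + w) = tau v + tau w" "!!c v. tau (scale c v) = scale (c ^ s) (tau v)"
  and S: "0 : S" "!!v w. v : S ==> w : S ==> v + w : S" "!!c v. c ^ s = c ==> v : S ==> scale c v : S"
  "!!v. v : S ==> tau v = v"
  and x: "x : span S" "tau x = x"
 shows "x : S"
proof -
 obtain B where B: "B \<subseteq> S" "independent B" "S \<subseteq> span B" by (rule maximal_independent_subset)
 have "x : span B" using x(1) span_minimal[OF B(3) subspace_span] by blast
 then obtain t r where t: "finite t" "t \<subseteq> B" "x = (\<Sum>b\<in>t. scale (r b) b)" by (auto simp: span_explicit)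
 have t0: "tau 0 = 0" using tau(1)[of 0 0] by simp
 have "tau (\<Sum>b\<in>u. scale (r b) b) = (\<Sum>b\<in>u. scale (r b ^ s) b)" if "finite u" "u \<subseteq> S" for u
  using that by (induction u rule: finite_induct) (auto simp: t0 tau S(4))
 then have "tau x = (\<Sum>b\<in>t. scale (r b ^ s) b)" using t B(1) by blast
 then have "(\<Sum>b\<in>t. scale (r b ^ s - r b) b) = 0"
  using x(2) t(3) by (simp add: scale_left_diff_distrib sum_subtractf)
 then have r: "r b ^ s = r b" if "b : t" for b
  using independentD[OF B(2) t(1,2) _ that, of "%b. r b ^ s - r b"] by simp
 have "(\<Sum>b\<in>u. scale (r b) b) : S" if "finite u" "u \<subseteq> t" for u
  using that
 proof (induction u rule: finite_induct)
  case (insert b u)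
  have "scale (r b) b : S" using insert.prems t(2) B(1) r by (intro S(3)) auto
  then show ?case using insert by (simp add: S(2))
 qed (simp add: S)
 then show ?thesis using t by blast
qed

end

sublocale frob \<subseteq> fvp: frob_space ty s "fv2.scale :: 'a => ('i => 'a) \<times> ('j => 'a) => _"
 by unfold_locales

context frob begin

definition kk :: "'a set" where "kk = {x. x ^ s = x}"

lemma finite_subfield_kk: "finite_subfield kk"
proof
 show "finite kk" using finite_fixed[of 1] by (simp add: kk_def)
 \<comment> \<open>Additivity applied to 1 + (-1) gives this in every characteristic at
   once.\<close>
 have m: "(- 1 :: 'a) ^ s = - 1"
  using frob_add[of 1 "- 1"] by (simp add: eq_neg_iff_add_eq_0 add.commute)
 show "- x : kk" if "x : kk" for x
  using that m power_mult_distrib[of "- 1" x s] by (simp add: kk_def)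
qed (auto simp: kk_def frob_add power_mult_distrib power_inverse)

sublocale fs: finite_subfield kk
 by (rule finite_subfield_kk)

abbreviation spF :: "nat => (nat => 'a) set" where "spF n \<equiv> fs.spk {..<n}"

lemma spF_iff: "v : spF n \<longleftrightarrow> v : sp n & fr s v = v"
 by (simp add: fs.spk_iff sp_def fr_def fun_eq_iff) (auto simp: kk_def)

lemma fr_sp: "fr s v : sp n \<longleftrightarrow> v : sp n"
 using s_gt1 by (auto simp: sp_def fr_def)

lemma fr_sp_image: "fr s ` sp n = (sp n :: (nat => 'a) set)"
proof
 show "sp n \<subseteq> fr s ` (sp n :: (nat => 'a) set)"
 proof
  fix v :: "nat => 'a" assume v: "v : sp n"
  obtain w where "v = fr s w" using surj_fr by blast
  then show "v : fr s ` sp n" using v fr_sp by blast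
 qed
qed (auto simp: fr_sp)

lemma unitv_spF: "j < n ==> unitv j : spF n"
proof -
 have "fr s (unitv j) = (unitv j :: nat => 'a)" using s_gt1 by (auto simp: fr_def unitv_def)
 then show "j < n ==> unitv j : spF n" by (simp add: spF_iff unitv_sp)
qed

lemma spF_sp: "spF n \<subseteq> sp n"
 by (auto simp: spF_iff)

abbreviation frp :: "(nat => 'a) \<times> (nat => 'a) => _" where "frp \<equiv> map_prod (fr s) (fr s)"

lemma frp_add: "frp (p + q) = frp p + frp q"
 by (cases p; cases q) (simp add: fr_add)

lemma frp_scale: "frp (fv2.scale c p) = fv2.scale (c ^ s) (frp p)"
 by (cases p) (simp add: fv2.scale_prod fr_scale)

lemma frp_eq_0: "frp p = 0 ==> p = 0"
 by (cases p) (simp add: zero_prod_def)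

lemma sp_pair_span:
 "EX B. finite B & (sp n \<times> sp m :: ((nat => 'a) \<times> (nat => 'a)) set) \<subseteq> fv2.p.span B"
proof -
 let ?A = "unitv ` {..<n} :: (nat => 'a) set" and ?C = "unitv ` {..<m} :: (nat => 'a) set"
 let ?B = "?A \<times> {0} \<union> {0} \<times> ?C"
 have "(x, y) : fv2.p.span ?B" if "x : sp n" "y : sp m" for x y :: "nat => 'a"
 proof -
  have "(x, 0) : fv2.p.span (?A \<times> {0})" using that by (simp add: fv2.span_Times_sing2 span_unitv)
  moreover have "(0, y) : fv2.p.span ({0} \<times> ?C)" using that by (simp add: fv2.span_Times_sing1 span_unitv)
  ultimately have "(x, 0) : fv2.p.span ?B" "(0, y) : fv2.p.span ?B"
  using fv2.p.span_mono[of _ ?B] by blast+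
  then have "(x, 0) + (0, y) : fv2.p.span ?B" by (rule fv2.p.span_add)
  then show ?thesis by simp
 qed
 then show ?thesis by (intro exI[of _ ?B]) auto
qed

text \<open>Lang's theorem for a stable relation, viewed as a subspace of the space of pairs: it is
  spanned by its pairs of vectors with coordinates in the fixed field.\<close>

lemma span_fixed_rel:
 assumes R: "fv2.p.subspace R" "R \<subseteq> sp n \<times> sp m" and F: "frp ` R \<subseteq> R"
 shows "fv2.p.span (R \<inter> (spF n \<times> spF m)) = R"
proof -
 obtain B0 where B0: "finite B0" "(sp n \<times> sp m :: ((nat => 'a) \<times> (nat => 'a)) set) \<subseteq> fv2.p.span B0"
  using sp_pair_span by blast
 obtain B where B: "finite B" "R = fv2.p.span B" using fv2.p.finite_span_subset[OF B0(1) R(1)] R(2) B0(2) by blast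
 have "fv2.p.span {p : R. frp p = p} = R"
  by (rule fvp.lang[OF B]) (use F frp_add frp_scale frp_eq_0 in auto)
 moreover have "{p : R. frp p = p} = R \<inter> (spF n \<times> spF m)" using R(2) by (auto simp: spF_iff)
 ultimately show ?thesis by simp
qed

text \<open>A nonzero stable kernel contains nonzero fixed vectors, by Lang's theorem. If the domain
  is full, it is spanned by the domain of the fixed pairs, and \<open>span_fixed_subset\<close> puts
  every fixed vector into the latter. Applied to the converse, this also treats indeterminacy and
  image.\<close>

lemma fixed_rel_type:
 assumes R: "fv2.p.subspace R" "R \<subseteq> sp n \<times> sp m" and F: "frp ` R \<subseteq> R"
 shows "Ker_rel R = {0} \<longleftrightarrow> Ker_rel (R \<inter> (spF n \<times> spF m)) = {0}"
  "Def_rel R = sp n \<longleftrightarrow> Def_rel (R \<inter> (spF n \<times> spF m)) = spF n"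
proof -
 let ?R = "R \<inter> (spF n \<times> spF m)"
 note R' = R(1)[unfolded rel_subspace_iff]
 have z: "0 : spF k" for k by (rule fs.ksubD(1)[OF fs.ksub_spk])
 show "Ker_rel R = {0} \<longleftrightarrow> Ker_rel ?R = {0}"
 proof
  assume "Ker_rel R = {0}"
  then show "Ker_rel ?R = {0}" using R' z by (auto simp: Ker_rel_def)
 next
  assume K: "Ker_rel ?R = {0}"
  have add: "(x + x', y + y') : R" if "(x, y) : R" "(x', y') : R" for x y x' y' using R' that by blast
  have sc: "(fscale c x, fscale c y) : R" if "(x, y) : R" for x y c using R' that by blast
  have sub: "fv.subspace (Ker_rel R)" unfolding fv.subspace_def
  proof (intro conjI ballI allI)
  show "0 : Ker_rel R" using R' by (simp add: Ker_rel_def)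
  show "x + y : Ker_rel R" if "x : Ker_rel R" "y : Ker_rel R" for x y
  using add[of x 0 y 0] that by (simp add: Ker_rel_def)
  show "fscale c x : Ker_rel R" if "x : Ker_rel R" for c x
  using sc[of x 0 c] that by (simp add: Ker_rel_def)
  qed
  have sp: "Ker_rel R \<subseteq> sp n" using R(2) by (auto simp: Ker_rel_def)
  obtain B where B: "finite B" "Ker_rel R = fv.span B"
  using fin_dim_subset[OF fin_dim_sp sub sp] by (auto simp: fin_dim_space_def)
  have "fv.span {v : Ker_rel R. fr s v = v} = Ker_rel R"
  proof (rule fvf.lang[OF B])
  show "fr s v : Ker_rel R" if "v : Ker_rel R" for v
  proof -
  have "frp (v, 0) : R" using that F by (auto simp: Ker_rel_def)
  then show ?thesis by (simp add: Ker_rel_def)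
  qed
  qed (auto simp: fr_add fr_scale)
  moreover have "fv.span {v : Ker_rel R. fr s v = v} \<subseteq> fv.span (Ker_rel ?R)"
  using sp z by (intro fv.span_mono) (auto simp: Ker_rel_def spF_iff)
  ultimately have "Ker_rel R \<subseteq> fv.span {0}" unfolding K by (rule subst)
  then show "Ker_rel R = {0}" using R' by (auto simp: Ker_rel_def)
 qed
 show "Def_rel R = sp n \<longleftrightarrow> Def_rel ?R = spF n"
 proof
  assume D: "Def_rel R = sp n"
  let ?S = "Def_rel ?R"
  have S: "0 : ?S" "!!v w. v : ?S ==> w : ?S ==> v + w : ?S" "!!c v. c ^ s = c ==> v : ?S ==> fscale c v : ?S"
  "!!v. v : ?S ==> fr s v = v"
  proof -
  show "0 : ?S" using R' z by (auto simp: Def_rel_def)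
  show "v + w : ?S" if "v : ?S" "w : ?S" for v w
  using that R' fs.ksubD(2)[OF fs.ksub_spk] unfolding Def_rel_def by simp blast
  show "fscale c v : ?S" if "c ^ s = c" "v : ?S" for c v
  using that R' fs.ksubD(3)[OF fs.ksub_spk, of c] unfolding Def_rel_def kk_def by simp blast
  show "fr s v = v" if "v : ?S" for v using that by (auto simp: Def_rel_def spF_iff)
  qed
  have "R \<subseteq> {(x, y). x : fv.span ?S}"
  proof -
  have "fv2.p.subspace {(x, y :: nat => 'a). x : fv.span ?S}"
  by (auto simp: rel_subspace_iff fv.span_zero fv.span_add fv.span_scale)
  moreover have "?R \<subseteq> {(x, y). x : fv.span ?S}" by (auto simp: Def_rel_def intro!: fv.span_base)
  ultimately have "fv2.p.span ?R \<subseteq> {(x, y). x : fv.span ?S}" by (intro fv2.p.span_minimal)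
  then show ?thesis unfolding span_fixed_rel[OF R F] .
  qed
  then have "sp n \<subseteq> fv.span ?S" using D by (auto simp: Def_rel_def)
  then have "spF n \<subseteq> ?S"
  using fvf.span_fixed_subset[OF fr_add fr_scale S] by (auto simp: spF_iff)
  then show "?S = spF n" by (auto simp: Def_rel_def)
 next
  assume D: "Def_rel ?R = spF n"
  have "fv.subspace (Def_rel R)" unfolding fv.subspace_def Def_rel_def using R' by simp blast
  moreover have "unitv ` {..<n} \<subseteq> Def_rel R" using D unitv_spF by (auto simp: Def_rel_def)
  ultimately have "fv.span (unitv ` {..<n}) \<subseteq> Def_rel R" by (intro fv.span_minimal)
  then have "sp n \<subseteq> Def_rel R" unfolding span_unitv .
  then show "Def_rel R = sp n" using R(2) by (auto simp: Def_rel_def)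
 qed
qed

text \<open>The general linear group over the fixed field, realised as the automorphisms over the
  large field that commute with Frobenius. Extensionality makes it a finite set of
  functions.\<close>

definition GL1 :: "nat => ((nat => 'a) => (nat => 'a)) set" where
 "GL1 n = {f : extensional (sp n). linear_map_on (sp n) (sp n) f & bij_betw f (sp n) (sp n) \<and>
  (ALL v:sp n. f (fr s v) = fr s (f v))}"

lemma GL1_D:
 assumes "f : GL1 n"
 shows "linear_map_on (sp n) (sp n) f" "bij_betw f (sp n) (sp n)" "v : sp n ==> f (fr s v) = fr s (f v)"
  "v : spF n ==> f v : spF n" "v : sp n ==> f v : sp n"
proof -
 show f: "linear_map_on (sp n) (sp n) f" "bij_betw f (sp n) (sp n)" "v : sp n ==> f (fr s v) = fr s (f v)" for v
  using assms by (auto simp: GL1_def)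
 then show "v : sp n ==> f v : sp n" using linear_map_onD(1) by blast
 then show "v : spF n ==> f v : spF n" using f(3)[of v] linear_map_onD(1)[OF f(1)] by (auto simp: spF_iff)
qed

lemma GL1_kmod: "f : GL1 n ==> fs.kmod (spF n) f"
 unfolding fs.kmod_def
 using fs.card_spk(1)[of "{..<n}"] fs.ksub_spk GL1_D(4) linear_map_onD(2,3)[OF GL1_D(1)] spF_sp
 by (auto simp: subset_iff)

definition fixed_rels :: "nat => nat => nat => nat => _ => _ => ((nat => 'a) \<times> (nat => 'a)) set set" where
 "fixed_rels r t n m g h = {R. equipped_relation r t (sp n) (sp m) R & frp ` R = R & map_prod g h ` R = R}"

text \<open>Both the preimage and the image of the span under Frobenius are subspaces containing
  \<open>B\<close>; for the image this uses that every scalar has an \<open>s\<close>-th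
  root.\<close>

lemma frp_span:
 assumes "!!p. p : B ==> frp p = p"
 shows "frp ` fv2.p.span B = fv2.p.span B"
proof
 let ?R = "fv2.p.span B"
 have "fv2.p.subspace {p. frp p : ?R}" unfolding fv2.p.subspace_def
 proof (intro conjI ballI allI CollectI)
  have "frp 0 = 0" by (simp add: zero_prod_def)
  then show "frp 0 : ?R" using fv2.p.span_zero by metis
  show "frp (x + y) : ?R" if "x : {p. frp p : ?R}" "y : {p. frp p : ?R}" for x y
  unfolding frp_add using that by (intro fv2.p.span_add) auto
  show "frp (fv2.scale c x) : ?R" if "x : {p. frp p : ?R}" for c x
  unfolding frp_scale using that by (intro fv2.p.span_scale) auto
 qed
 moreover have "B \<subseteq> {p. frp p : ?R}" using assms fv2.p.span_base[of _ B] by auto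
 ultimately have "?R \<subseteq> {p. frp p : ?R}" by (intro fv2.p.span_minimal)
 then show "frp ` ?R \<subseteq> ?R" by auto
 have "fv2.p.subspace (frp ` ?R)" unfolding fv2.p.subspace_def
 proof (intro conjI ballI allI)
  have "frp 0 = 0" by (simp add: zero_prod_def)
  then show "0 : frp ` ?R" using fv2.p.span_zero by (metis imageI)
  show "x + y : frp ` ?R" if xy: "x : frp ` ?R" "y : frp ` ?R" for x y
  proof -
  obtain p q where pq: "p : ?R" "q : ?R" "x = frp p" "y = frp q" using xy by (elim imageE)
  show ?thesis unfolding pq(3,4) frp_add[symmetric] using fv2.p.span_add[OF pq(1,2)] by (rule imageI)
  qed
  show "fv2.scale c x : frp ` ?R" if x: "x : frp ` ?R" for c x
  proof -
  obtain d where d: "d ^ s = c" using frob_surj[of c] by (elim exE)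
  obtain p where p: "p : ?R" "x = frp p" using x by (elim imageE)
  show ?thesis unfolding p(2) d[symmetric] frp_scale[symmetric]
  using fv2.p.span_scale[OF p(1)] by (rule imageI)
  qed
 qed
 moreover have "B \<subseteq> frp ` ?R"
 proof
  fix p assume p: "p : B"
  show "p : frp ` ?R" by (rule image_eqI[where f = frp, OF assms[OF p, symmetric] fv2.p.span_base[OF p]])
 qed
 ultimately show "?R \<subseteq> frp ` ?R" by (intro fv2.p.span_minimal)
qed

text \<open>Restricting to fixed pairs and taking spans are inverse to each other and respect types,
  so the count over the large field becomes the count over the finite field in
  \<open>card_invariant_relations\<close>. The resulting number no longer mentions the type.\<close>

lemma card_fixed_rels:
 assumes g: "g : GL1 n" and h: "h : GL1 m" and rt: "r : {0, 1}" "t : {0, 1}"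
 shows "card (fixed_rels r t n m g h) = card (fs.Hm (spF n) g (spF m) h)"
proof -
 let ?N = "{R : fs.Rl (spF n) g (spF m) h. (r = 0 --> Ker_rel R = {0}) & (r = 1 --> Def_rel R = spF n) \<and>
  (t = 0 --> Ind_rel R = {0}) & (t = 1 --> Im_rel R = spF m)}"
 let ?P = "%R. R \<inter> (spF n \<times> spF m)"
 have conv: "(?P R)\<inverse> = R\<inverse> \<inter> (spF m \<times> spF n)" for R :: "((nat => 'a) \<times> (nat => 'a)) set" by auto
 have types: "Ker_rel R = {0} \<longleftrightarrow> Ker_rel (?P R) = {0}" "Def_rel R = sp n \<longleftrightarrow> Def_rel (?P R) = spF n"
  "Ind_rel R = {0} \<longleftrightarrow> Ind_rel (?P R) = {0}" "Im_rel R = sp m \<longleftrightarrow> Im_rel (?P R) = spF m"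
  if R: "fv2.p.subspace R" "R \<subseteq> sp n \<times> sp m" "frp ` R \<subseteq> R" for R
 proof -
  have R': "fv2.p.subspace (R\<inverse>)" "R\<inverse> \<subseteq> sp m \<times> sp n" "frp ` (R\<inverse>) \<subseteq> R\<inverse>"
  using R by (auto simp: rel_subspace_iff)
  note t2 = fixed_rel_type[OF R', folded conv, unfolded fs.converse_simps]
  show "Ker_rel R = {0} \<longleftrightarrow> Ker_rel (?P R) = {0}" "Def_rel R = sp n \<longleftrightarrow> Def_rel (?P R) = spF n"
  by (rule fixed_rel_type[OF R])+
  show "Ind_rel R = {0} \<longleftrightarrow> Ind_rel (?P R) = {0}" "Im_rel R = sp m \<longleftrightarrow> Im_rel (?P R) = spF m"
  by (rule t2)+
 qed
 have 1: "?P R : ?N" "fv2.p.span (?P R) = R" if R: "R : fixed_rels r t n m g h" for R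
 proof -
  have R': "fv2.p.subspace R" "R \<subseteq> sp n \<times> sp m" "frp ` R \<subseteq> R" "map_prod g h ` R = R"
  and T: "(r = 0 --> Ker_rel R = {0}) & (r = 1 --> Def_rel R = sp n) & (t = 0 --> Ind_rel R = {0}) & (t = 1 --> Im_rel R = sp m)"
  using R by (auto simp: fixed_rels_def equipped_relation_def linear_relation_def)
  show "fv2.p.span (?P R) = R" by (rule span_fixed_rel[OF R'(1-3)])
  note Rs = R'(1)[unfolded rel_subspace_iff]
  have "?P R : fs.Rl (spF n) g (spF m) h" unfolding fs.Rl_def fs.krel_def
  proof (intro CollectI conjI allI impI ballI)
  show "(0, 0) : ?P R" using Rs fs.ksubD(1)[OF fs.ksub_spk] by auto
  show "(x + x', y + y') : ?P R" if "(x, y) : ?P R" "(x', y') : ?P R" for x y x' y'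
  using that Rs fs.ksubD(2)[OF fs.ksub_spk] by auto
  show "(fscale c x, fscale c y) : ?P R" if "c : kk" "(x, y) : ?P R" for c x y
  using that Rs fs.ksubD(3)[OF fs.ksub_spk] by auto
  show "(g x, h y) : ?P R" if "(x, y) : ?P R" for x y
  using that R'(4) GL1_D(4)[OF g] GL1_D(4)[OF h] by auto
  qed auto
  then have "?P R : fs.Rl (spF n) g (spF m) h & (r = 0 --> Ker_rel (?P R) = {0}) & (r = 1 --> Def_rel (?P R) = spF n) \<and>
  (t = 0 --> Ind_rel (?P R) = {0}) & (t = 1 --> Im_rel (?P R) = spF m)"
  using T unfolding types[OF R'(1-3)] by (rule conjI)
  then show "?P R : ?N" by (rule CollectI)
 qed
 have 2: "fv2.p.span R' : fixed_rels r t n m g h" "?P (fv2.p.span R') = R'" if R': "R' : ?N" for R'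
 proof -
  let ?R = "fv2.p.span R'"
  have K: "R' \<subseteq> spF n \<times> spF m" "fs.krel R'" "!!x y. (x, y) : R' ==> (g x, h y) : R'"
  and T: "(r = 0 --> Ker_rel R' = {0}) & (r = 1 --> Def_rel R' = spF n) & (t = 0 --> Ind_rel R' = {0}) & (t = 1 --> Im_rel R' = spF m)"
  using R' by (auto simp: fs.Rl_def)
  have fin: "finite R'" using K(1) fs.card_spk(1) by (meson finite_SigmaI finite_lessThan finite_subset)
  have sub: "fv2.p.subspace ?R" by simp
  note Rs = sub[unfolded rel_subspace_iff]
  have sp: "?R \<subseteq> sp n \<times> sp m"
  by (rule fv2.p.span_minimal[OF subset_trans[OF K(1) Sigma_mono[OF spF_sp spF_sp]] fv2.subspace_Times[OF subspace_sp subspace_sp]])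
  have fixed: "frp p = p" if "p : R'" for p using that K(1) by (cases p) (auto simp: spF_iff)
  have F: "frp ` ?R = ?R" by (rule frp_span[OF fixed])
  have gh0: "g 0 = 0" "h 0 = 0" using linear_map_on_zero[OF GL1_D(1) subspace_sp] g h by auto
  have ghadd: "map_prod g h (p + q) = map_prod g h p + map_prod g h q" if "p : sp n \<times> sp m" "q : sp n \<times> sp m" for p q
  using that linear_map_onD(2)[OF GL1_D(1)[OF g]] linear_map_onD(2)[OF GL1_D(1)[OF h]] by auto
  have ghscale: "map_prod g h (fv2.scale c p) = fv2.scale c (map_prod g h p)" if "p : sp n \<times> sp m" for p c
  using that linear_map_onD(3)[OF GL1_D(1)[OF g]] linear_map_onD(3)[OF GL1_D(1)[OF h]] by (auto simp: fv2.scale_prod)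
  have gh: "map_prod g h ` ?R = ?R"
  proof
  have spsub: "fv2.p.subspace (sp n \<times> sp m :: ((nat => 'a) \<times> (nat => 'a)) set)" by (intro fv2.subspace_Times subspace_sp)
  have "fv2.p.subspace {p : sp n \<times> sp m. map_prod g h p : ?R}" unfolding fv2.p.subspace_def
  proof (intro conjI ballI allI)
  have "map_prod g h 0 = 0" by (simp add: zero_prod_def gh0)
  then show "0 : {p : sp n \<times> sp m. map_prod g h p : ?R}"
  using fv2.p.span_zero[of R'] fv2.p.subspace_0[OF spsub] by simp
  show "x + y : {p : sp n \<times> sp m. map_prod g h p : ?R}"
  if "x : {p : sp n \<times> sp m. map_prod g h p : ?R}" "y : {p : sp n \<times> sp m. map_prod g h p : ?R}" for x y
  using that ghadd[of x y] fv2.p.span_add[of _ R'] fv2.p.subspace_add[OF spsub, of x y] by simp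
  show "fv2.scale c x : {p : sp n \<times> sp m. map_prod g h p : ?R}"
  if "x : {p : sp n \<times> sp m. map_prod g h p : ?R}" for c x
  using that ghscale[of x c] fv2.p.span_scale[of _ R'] fv2.p.subspace_scale[OF spsub, of x c] by simp
  qed
  moreover have "R' \<subseteq> {p : sp n \<times> sp m. map_prod g h p : ?R}"
  using K(1,3) spF_sp fv2.p.span_base[of _ R'] by fastforce
  ultimately have "?R \<subseteq> {p : sp n \<times> sp m. map_prod g h p : ?R}" by (intro fv2.p.span_minimal)
  then show "map_prod g h ` ?R \<subseteq> ?R" by auto
  have "fv2.p.subspace (map_prod g h ` ?R)" unfolding fv2.p.subspace_def
  proof (intro conjI ballI allI)
  have "map_prod g h 0 = 0" by (simp add: zero_prod_def gh0)
  then show "0 : map_prod g h ` ?R" using fv2.p.span_zero by (metis imageI)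
  show "x + y : map_prod g h ` ?R" if xy: "x : map_prod g h ` ?R" "y : map_prod g h ` ?R" for x y
  proof -
  obtain p q where pq: "p : ?R" "q : ?R" "x = map_prod g h p" "y = map_prod g h q" using xy by (elim imageE)
  have "x + y = map_prod g h (p + q)" using ghadd[OF subsetD[OF sp pq(1)] subsetD[OF sp pq(2)]] pq(3,4) by simp
  then show ?thesis using fv2.p.span_add[OF pq(1,2)] by (rule image_eqI)
  qed
  show "fv2.scale c x : map_prod g h ` ?R" if xy: "x : map_prod g h ` ?R" for c x
  proof -
  obtain p where p: "p : ?R" "x = map_prod g h p" using xy by (elim imageE)
  have "fv2.scale c x = map_prod g h (fv2.scale c p)" using ghscale[OF subsetD[OF sp p(1)], of c] p(2) by simp
  then show ?thesis using fv2.p.span_scale[OF p(1)] by (rule image_eqI)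
  qed
  qed
  moreover have "R' \<subseteq> map_prod g h ` ?R"
  proof -
  \<comment> \<open>An injective self-map of the finite set of fixed pairs is onto, which upgrades
    invariance to the equality demanded by \<open>fixed_rels\<close>.\<close>
  have "inj_on (map_prod g h) R'"
  using K(1) spF_sp GL1_D(2)[OF g] GL1_D(2)[OF h]
  by (intro inj_on_subset[OF map_prod_inj_on[of g "sp n" h "sp m"]]) (auto simp: bij_betw_def)
  then have "map_prod g h ` R' = R'"
  using K(3) by (intro endo_inj_surj[OF fin]) auto
  then show ?thesis using image_mono[OF fv2.p.span_superset[of R'], of "map_prod g h"] by simp
  qed
  ultimately show "?R \<subseteq> map_prod g h ` ?R" by (intro fv2.p.span_minimal)
  qed
  show P: "?P ?R = R'"
  proof
  show "R' \<subseteq> ?P ?R" by (rule Int_greatest[OF fv2.p.span_superset K(1)])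
  show "?P ?R \<subseteq> R'"
  proof
  fix p assume p: "p : ?P ?R"
  show "p : R'"
  proof (rule fvp.span_fixed_subset[of frp])
  show "p : fv2.p.span R'" "frp p = p" using p by (auto simp: spF_iff)
  show "0 : R'" using fs.krelD(1)[OF K(2)] by (simp add: zero_prod_def)
  show "v + w : R'" if "v : R'" "w : R'" for v w using that fs.krelD(2)[OF K(2)] by (cases v; cases w) auto
  show "fv2.scale c v : R'" if "c ^ s = c" "v : R'" for c v
  using that fs.krelD(3)[OF K(2), of c] by (cases v) (auto simp: fv2.scale_prod kk_def)
  qed (auto simp: frp_add frp_scale fixed simp del: map_prod_simp)
  qed
  qed
  have "(r = 0 --> Ker_rel ?R = {0}) & (r = 1 --> Def_rel ?R = sp n) & (t = 0 --> Ind_rel ?R = {0}) & (t = 1 --> Im_rel ?R = sp m)"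
  using T unfolding types[OF sub sp equalityD1[OF F]] P .
  then show "?R : fixed_rels r t n m g h"
  unfolding fixed_rels_def equipped_relation_def linear_relation_def
  by (intro CollectI conjI sub sp F gh) (elim conjE, assumption)+
 qed
 have "bij_betw ?P (fixed_rels r t n m g h) ?N"
 proof (rule bij_betw_byWitness[of _ fv2.p.span])
  show "ALL R:fixed_rels r t n m g h. fv2.p.span (?P R) = R" by (rule ballI, rule 1(2))
  show "ALL R':?N. ?P (fv2.p.span R') = R'" by (rule ballI, rule 2(2))
  show "?P ` fixed_rels r t n m g h \<subseteq> ?N" by (rule image_subsetI, rule 1(1))
  show "fv2.p.span ` ?N \<subseteq> fixed_rels r t n m g h" by (rule image_subsetI, rule 2(1))
 qed
 then have "card (fixed_rels r t n m g h) = card ?N" by (rule bij_betw_same_card)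
 also have "... = card (fs.Hm (spF n) g (spF m) h)"
  by (rule fs.card_invariant_relations[OF finite_lessThan finite_lessThan GL1_kmod[OF g] GL1_kmod[OF h] rt])
 finally show ?thesis .
qed

end

section \<open>Lang's theorem for representations\<close>

lemma fin_dim_support:
 assumes "finite J"
 shows "fin_dim_space {T :: 'j => 'k::field. ALL p. p \<notin> J --> T p = 0}"
proof -
 let ?u = "%p0 p. if p = p0 then 1 else (0::'k)"
 have "{T. ALL p. p \<notin> J --> T p = 0} = fv.span (?u ` J)"
 proof
  show "{T. ALL p. p \<notin> J --> T p = 0} \<subseteq> fv.span (?u ` J)"
  proof
  fix T :: "'j => 'k" assume T: "T : {T. ALL p. p \<notin> J --> T p = 0}"
  have "T = (\<Sum>p0\<in>J. fscale (T p0) (?u p0))"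
  proof
  fix p
  have "(\<Sum>p0\<in>J. fscale (T p0) (?u p0)) p = (\<Sum>p0\<in>J. if p = p0 then T p0 else 0)"
  unfolding sum_fun_at by (intro sum.cong) (auto simp: fscale_apply)
  then show "T p = (\<Sum>p0\<in>J. fscale (T p0) (?u p0)) p" using T assms by auto
  qed
  also have "... : fv.span (?u ` J)" by (intro fv.span_sum fv.span_scale fv.span_base) auto
  finally show "T : fv.span (?u ` J)" .
  qed
  have "fv.subspace {T :: 'j => 'k. ALL p. p \<notin> J --> T p = 0}" by (auto simp: fv.subspace_def fscale_apply)
  then show "fv.span (?u ` J) \<subseteq> {T. ALL p. p \<notin> J --> T p = 0}" by (intro fv.span_minimal) auto
 qed
 then show ?thesis unfolding fin_dim_space_def using assms by blast
qed

lemma dim_proper_subspace: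
 assumes V: "fin_dim_space V" and U: "fv.subspace U" "U \<subseteq> V"
 shows "fv.dim U <= fv.dim V" "U ~= V ==> fv.dim U < fv.dim V"
proof -
 obtain B where B: "finite B" "fv.independent B" "fv.span B = V" "card B = fv.dim V" by (rule fin_dim_basis[OF V])
 obtain C where C: "finite C" "fv.independent C" "fv.span C = U" "card C = fv.dim U"
  by (rule fin_dim_basis[OF fin_dim_subset[OF V U]])
 have CV: "C \<subseteq> V" using C(3) U(2) fv.span_superset by blast
 show "fv.dim U <= fv.dim V"
  using fv.independent_span_bound[OF B(1) C(2)] CV B(3,4) C(4) by simp
 assume "U ~= V"
 then obtain x where x: "x : V" "x \<notin> U" using U(2) by blast
 then have "fv.independent (insert x C)" using C(2,3) by (intro fv.independent_insertI) auto
 then have "card (insert x C) <= card B" using fv.independent_span_bound[OF B(1)] CV x B(3) by simp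
 moreover have "x \<notin> C" using x C(3) fv.span_base by blast
 ultimately show "fv.dim U < fv.dim V" using C(1,4) B(4) by simp
qed

lemma basis_iso:
 fixes V :: "(nat => 'k::field) set"
 assumes B: "finite B" "fv.independent B" "fv.span B = V" "card B = n"
 obtains f where "linear_map_on (sp n) V f" "bij_betw f (sp n) V" "!!j. j < n ==> f (unitv j) : B"
proof -
 obtain e where e: "bij_betw e {..<n} B" using B(1,4) by (metis bij_betw_iff_card card_lessThan finite_lessThan)
 obtain f where f: "Vector_Spaces.linear fscale fscale f"
  "ALL x:unitv ` {..<n}. f x = e (inv_into {..<n} unitv x)"
  using fv2.linear_independent_extend[OF independent_unitv, of n "%x. e (inv_into {..<n} unitv x)"] by blast
 interpret f: Vector_Spaces.linear fscale fscale f by fact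
 have fe: "f (unitv j) = e j" if "j < n" for j
 proof -
  have "inv_into {..<n} unitv (unitv j :: nat => 'k) = j"
  by (rule inv_into_f_f[OF inj_on_subset[OF inj_unitv subset_UNIV]]) (simp add: that)
  then show ?thesis using f(2) that by simp
 qed
 have im: "f ` unitv ` {..<n} = B" using e fe by (auto simp: bij_betw_def image_image)
 have "inj_on f (unitv ` {..<n})"
  using e fe by (auto simp: inj_on_def bij_betw_def)
 then have inj: "inj_on f (sp n)"
  using f.inj_on_span_iff_independent_image[of "unitv ` {..<n}"] B(2) im span_unitv by metis
 have "f ` sp n = V" using f.span_image[of "unitv ` {..<n}"] im B(3) by (simp add: span_unitv)
 moreover from this have "linear_map_on (sp n) V f" by (auto simp: linear_map_on_def f.add f.scale)
 ultimately show thesis using that inj fe e by (auto simp: bij_betw_def)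
qed

context frob begin

lemma semilinear_bij_fr: "semilinear_bij (fr s :: (nat => 'a) => _)"
 unfolding semilinear_bij_def
proof (intro conjI allI exI)
 show "bij (%c::'a. c ^ s)" unfolding bij_def inj_def surj_def using frob_inj frob_surj by metis
qed (auto simp: bij_fr fr_add fr_scale)

lemma frob_sum: "(\<Sum>x\<in>A. f x) ^ s = (\<Sum>x\<in>A. f x ^ s :: 'a)"
 by (induction A rule: infinite_finite_induct) (auto simp: frob_add)

end

context frob_quiver begin

text \<open>An isomorphism from the twist of \<open>M\<close> to \<open>M\<close>, composed with
  Frobenius, is a semilinear injective map on each vertex space. Lang's theorem gives a basis of its
  fixed vectors, and the change of basis \<open>x\<close> turns Frobenius into this map. Moving
  \<open>M\<close> back along \<open>x\<close> gives a representation equal to its own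
  twist.\<close>

lemma lang_std:
 fixes M :: "('v, 'e, nat, 'a) erep"
 assumes M: "rel_rep Q M" and std: "std_rep Q d M" and iso: "riso (map_rep (fr s) M) M"
 obtains Y :: "('v, 'e, nat, 'a) erep" where "rel_rep Q Y" "std_rep Q d Y" "map_rep (fr s) Y = Y" "riso M Y"
proof -
 let ?F = "map_rep (fr s) M"
 note h = semilinear_bij_fr
 have sp: "espace M i = sp (d i)" "espace ?F i = sp (d i)" if "i : verts Q" for i
  using std that by (auto simp: std_rep_def map_rep_def fr_sp_image)
 obtain tht \<psi> where t: "rhom ?F M tht" "rhom M ?F \<psi>" "ALL i:verts Q. ALL x:espace ?F i. \<psi> i (tht i x) = x"
  "ALL i:verts Q. ALL y:espace M i. tht i (\<psi> i y) = y" using iso by (rule isoE)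
 have "EX x. linear_map_on (sp (d i)) (sp (d i)) x & bij_betw x (sp (d i)) (sp (d i)) \<and>
  (ALL v:sp (d i). x (fr s v) = tht i (fr s (x v)))" if i: "i : verts Q" for i
 proof -
  let ?tau = "%v. tht i (fr s v)"
  have lin: "linear_map_on (sp (d i)) (sp (d i)) (tht i)" using homD(1)[OF t(1) i] sp[OF i] by simp
  have z: "tht i 0 = 0" by (rule linear_map_on_zero[OF lin subspace_sp])
  have add: "?tau (v + w) = ?tau v + ?tau w" if "v : sp (d i)" "w : sp (d i)" for v w
  using linear_map_onD(2)[OF lin] that by (simp add: fr_add fr_sp)
  have scale: "?tau (fscale c v) = fscale (c ^ s) (?tau v)" if "v : sp (d i)" for c v
  using linear_map_onD(3)[OF lin] that by (simp add: fr_scale fr_sp)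
  have mem: "?tau v : sp (d i)" if "v : sp (d i)" for v using linear_map_onD(1)[OF lin] that by (simp add: fr_sp)
  have inj: "v = 0" if "v : sp (d i)" "?tau v = 0" for v
  proof -
  have "fr s v = \<psi> i (?tau v)" using t(3) i sp that(1) by (simp add: fr_sp)
  also have "... = 0" using that(2) hom_zero_at[OF t(2) M i] by simp
  finally show ?thesis by simp
  qed
  obtain B where B: "finite B" "(sp (d i) :: (nat => 'a) set) = fv.span B" using fin_dim_sp by (auto simp: fin_dim_space_def)
  obtain C where C: "finite C" "fv.independent C" "fv.span C = sp (d i)" "!!x. x : C ==> ?tau x = x" "card C = fv.dim (sp (d i) :: (nat => 'a) set)"
  using fvf.fixed_basis[OF B, of ?tau, OF mem add scale inj] by blast
  obtain x where x: "linear_map_on (sp (d i)) (sp (d i)) x" "bij_betw x (sp (d i)) (sp (d i))" "!!j. j < d i ==> x (unitv j) : C"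
  using basis_iso[OF C(1-3)] C(5) dim_sp by metis
  have xm: "x v : sp (d i)" if "v : sp (d i)" for v using linear_map_onD(1)[OF x(1)] that by blast
  have x0: "x 0 = 0" by (rule linear_map_on_zero[OF x(1) subspace_sp])
  have "x (fr s v) = ?tau (x v)" if v: "v : sp (d i)" for v
  proof -
  have *: "x (fr s (\<Sum>j\<in>A. fscale (v j) (unitv j))) = ?tau (x (\<Sum>j\<in>A. fscale (v j) (unitv j))) & (\<Sum>j\<in>A. fscale (v j) (unitv j)) : sp (d i)"
  if "finite A" "A \<subseteq> {..<d i}" for A
  using that
  proof (induction A rule: finite_induct)
  case empty
  have "(0 :: nat => 'a) : sp (d i)" by (rule fv.subspace_0[OF subspace_sp])
  then show ?case by (simp only: sum.empty fr_zero x0 z simp_thms)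
  next
  case (insert j A)
  let ?s = "\<Sum>j\<in>A. fscale (v j) (unitv j)" and ?u = "fscale (v j) (unitv j) :: nat => 'a"
  have j: "j < d i" using insert.prems by auto
  have IH: "x (fr s ?s) = ?tau (x ?s)" "?s : sp (d i)" using insert by auto
  have us: "unitv j : sp (d i)" "?u : sp (d i)" using unitv_sp[OF j] fv.subspace_scale[OF subspace_sp] by auto
  have fu: "fr s (unitv j) = (unitv j :: nat => 'a)" using unitv_spF[OF j] by (simp add: spF_iff)
  have "x (fr s (?u + ?s)) = x (fscale (v j ^ s) (unitv j)) + x (fr s ?s)"
  unfolding fr_add fr_scale fu
  by (rule linear_map_onD(2)[OF x(1)]) (use us IH(2) fv.subspace_scale[OF subspace_sp us(1)] in \<open>auto simp: fr_sp\<close>)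
  also have "... = fscale (v j ^ s) (x (unitv j)) + ?tau (x ?s)"
  using linear_map_onD(3)[OF x(1) us(1)] IH(1) by simp
  also have "... = ?tau (fscale (v j) (x (unitv j))) + ?tau (x ?s)"
  using scale[OF xm[OF us(1)]] C(4)[OF x(3)[OF j]] by simp
  also have "... = ?tau (fscale (v j) (x (unitv j)) + x ?s)"
  by (rule add[symmetric]) (use xm us IH(2) fv.subspace_scale[OF subspace_sp] in auto)
  also have "fscale (v j) (x (unitv j)) + x ?s = x (?u + ?s)"
  using linear_map_onD(2)[OF x(1) us(2) IH(2)] linear_map_onD(3)[OF x(1) us(1)] by simp
  finally show ?case
  using insert.hyps fv.subspace_add[OF subspace_sp us(2) IH(2)] by (simp only: sum.insert simp_thms)
  qed
  show ?thesis using *[of "{..<d i}"] sp_expand[OF v] by simp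
  qed
  then show ?thesis using x(1,2) by blast
 qed
 then obtain x where x: "!!i. i : verts Q ==> linear_map_on (sp (d i)) (sp (d i)) (x i)"
  "!!i. i : verts Q ==> bij_betw (x i) (sp (d i)) (sp (d i))"
  "!!i v. i : verts Q ==> v : sp (d i) ==> x i (fr s v) = tht i (fr s (x i v))" by metis
 define y where "y i = inv_into (sp (d i)) (x i)" for i
 have y: "linear_map_on (espace M i) (sp (d i)) (y i)" "bij_betw (y i) (espace M i) (sp (d i))" if "i : verts Q" for i
  using linear_map_on_inv_into[OF x(1,2)[OF that] subspace_sp] bij_betw_inv_into[OF x(2)[OF that]] sp[OF that]
  by (auto simp: y_def)
 have xy: "x i (y i v) = v" "y i (x i v) = v" "y i v : sp (d i)" "x i v : sp (d i)" if "i : verts Q" "v : sp (d i)" for i v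
  using x(2)[OF that(1)] that unfolding y_def bij_betw_def by (auto simp: f_inv_into_f inv_into_into)
 define Y where "Y = transport Q (%i. sp (d i)) y M"
 have Y: "rel_rep Q Y" "riso M Y" unfolding Y_def using transport_rep(1,2)[OF M, of "%i. sp (d i)" y] y by blast+
 have std': "std_rep Q d Y" by (auto simp: std_rep_def Y_def transport_def)
 have Ya: "(u, v) : erel Y a \<longleftrightarrow> u : sp (d (tail Q a)) & v : sp (d (head Q a)) & (x (tail Q a) u, x (head Q a) v) : erel M a"
  if a: "a : arcs Q" for a u v
 proof -
  have ht: "tail Q a : verts Q" "head Q a : verts Q" using a by auto
  have R: "erel M a \<subseteq> sp (d (tail Q a)) \<times> sp (d (head Q a))" using rep_rel(1)[OF M a] sp ht by simp
  have eY: "erel Y a = map_prod (y (tail Q a)) (y (head Q a)) ` erel M a" using a by (simp add: Y_def transport_def)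
  show ?thesis
  proof
  assume "(u, v) : erel Y a"
  then show "u : sp (d (tail Q a)) & v : sp (d (head Q a)) & (x (tail Q a) u, x (head Q a) v) : erel M a"
  unfolding eY using R xy ht by auto
  next
  assume uv: "u : sp (d (tail Q a)) & v : sp (d (head Q a)) & (x (tail Q a) u, x (head Q a) v) : erel M a"
  then show "(u, v) : erel Y a" unfolding eY
  using xy(2) ht by (intro image_eqI[of _ _ "(x (tail Q a) u, x (head Q a) v)"]) auto
  qed
 qed
 have fixed: "frp ` erel Y a = erel Y a" if a: "a : arcs Q" for a
 proof -
  have ht: "tail Q a : verts Q" "head Q a : verts Q" using a by auto
  \<comment> \<open>Through \<open>x\<close>, Frobenius on \<open>Y\<close> is Frobenius followed by
    \<open>tht\<close> on \<open>M\<close>; \<open>tht\<close> carries the twisted relation exactly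
    onto that of \<open>M\<close>, because its inverse is a morphism too.\<close>
  have key: "(fr s u, fr s v) : erel Y a \<longleftrightarrow> (u, v) : erel Y a" for u v
  proof (cases "u : sp (d (tail Q a)) & v : sp (d (head Q a))")
  case True
  have FM: "(fr s p, fr s q) : erel ?F a \<longleftrightarrow> (p, q) : erel M a" for p q
  using inj_fr by (auto simp: map_rep_def inj_def)
  have "(tht (tail Q a) (fr s (x (tail Q a) u)), tht (head Q a) (fr s (x (head Q a) v))) : erel M a \<longleftrightarrow>
  (fr s (x (tail Q a) u), fr s (x (head Q a) v)) : erel ?F a" (is "(?p, ?q) : _ \<longleftrightarrow> (?p', ?q') : _")
  proof
  assume "(?p, ?q) : erel M a"
  from homD(2)[OF t(2) a this] show "(?p', ?q') : erel ?F a"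
  using t(3) ht True xy(4) sp(2) by (simp add: fr_sp)
  qed (rule homD(2)[OF t(1) a])
  then show ?thesis unfolding Ya[OF a] using True x(3) ht FM by (simp add: fr_sp)
  qed (auto simp: Ya[OF a] fr_sp)
  show ?thesis
  proof
  show "frp ` erel Y a \<subseteq> erel Y a" using key by auto
  show "erel Y a \<subseteq> frp ` erel Y a"
  proof (rule subrelI)
  fix u v assume uv: "(u, v) : erel Y a"
  obtain u' v' where "u = fr s u'" "v = fr s v'" using surj_fr by (metis surjD)
  then show "(u, v) : frp ` erel Y a" using uv key by (intro image_eqI[of _ _ "(u', v')"]) auto
  qed
  qed
 qed
 have "map_rep (fr s) Y = Y"
 proof (rule erep.equality)
  show "espace (map_rep (fr s) Y) = espace Y"
  using std' by (auto simp: map_rep_def std_rep_def fun_eq_iff fr_sp_image)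
  show "erel (map_rep (fr s) Y) = erel Y"
  proof
  fix a show "erel (map_rep (fr s) Y) a = erel Y a"
  using fixed[of a] std' by (cases "a : arcs Q") (auto simp: map_rep_def std_rep_def)
  qed
 qed simp
 then show thesis using that Y std' by blast
qed

end

section \<open>Homomorphism spaces and the Noether-Deuring theorem\<close>

lemma linear_map_on_lincomb:
 assumes f: "linear_map_on V W f" and V: "fv.subspace V" and "finite A" "!!j. j : A ==> g j : V"
 shows "f (\<Sum>j\<in>A. fscale (c j) (g j)) = (\<Sum>j\<in>A. fscale (c j) (f (g j)))"
 using assms(3,4)
proof (induction A rule: finite_induct)
 case empty
 show ?case using linear_map_on_zero[OF f V] by (simp only: sum.empty)
next
 case (insert j A)
 have g: "g i : V" if "i : insert j A" for i using insert.prems that .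
 have S: "(\<Sum>j\<in>A. fscale (c j) (g j)) : V" using g by (intro fv.subspace_sum[OF V] fv.subspace_scale[OF V]) auto
 have IH: "f (\<Sum>j\<in>A. fscale (c j) (g j)) = (\<Sum>j\<in>A. fscale (c j) (f (g j)))" using insert.IH g by blast
 have "f (fscale (c j) (g j) + (\<Sum>j\<in>A. fscale (c j) (g j))) = f (fscale (c j) (g j)) + f (\<Sum>j\<in>A. fscale (c j) (g j))"
  by (rule linear_map_onD(2)[OF f fv.subspace_scale[OF V g] S]) simp
 also have "f (fscale (c j) (g j)) = fscale (c j) (f (g j))" by (rule linear_map_onD(3)[OF f g]) simp
 finally show ?case unfolding sum.insert[OF insert.hyps] IH .
qed

text \<open>A single function \<open>T\<close> stores the matrices at all vertices, so families of
  linear maps are vectors: homomorphism spaces become subspaces, and Frobenius acts on them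
  coordinatewise.\<close>

definition matmap :: "('v => nat) => ('v \<times> nat \<times> nat => 'a::field) => 'v => (nat => 'a) => nat => 'a" where
 "matmap d T i v = (%l. \<Sum>j<d i. v j * T (i, j, l))"

lemma matmap_add: "matmap d T i (v + w) = matmap d T i v + matmap d T i w"
 and matmap_scale: "matmap d T i (fscale c v) = fscale c (matmap d T i v)"
 and matmap_add_left: "matmap d (S + T) i v = matmap d S i v + matmap d T i v"
 and matmap_scale_left: "matmap d (fscale c T) i v = fscale c (matmap d T i v)"
 by (simp_all add: matmap_def fun_eq_iff algebra_simps sum.distrib fscale_apply sum_distrib_left)

context quiver begin

definition msupp :: "('v => nat) => ('v \<times> nat \<times> nat) set" where
 "msupp d = (SIGMA i:verts Q. {..<d i} \<times> {..<d i})"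

lemma finite_msupp: "finite (msupp d)"
 by (auto simp: msupp_def)

definition mat_of :: "('v => nat) => ('v => (nat => 'k) => nat => 'k::field) => 'v \<times> nat \<times> nat => 'k" where
 "mat_of d f = (%p. if p : msupp d then f (fst p) (unitv (fst (snd p))) (snd (snd p)) else 0)"

lemma matmap_linear:
 assumes "ALL p. p \<notin> msupp d --> T p = 0" "i : verts Q"
 shows "linear_map_on (sp (d i)) (sp (d i)) (matmap d T i)"
proof -
 have "matmap d T i v : sp (d i)" for v
  using assms by (simp add: sp_def matmap_def msupp_def)
 then show ?thesis by (simp add: linear_map_on_def matmap_add matmap_scale)
qed

lemma matmap_mat_of:
 assumes f: "linear_map_on (sp (d i)) (sp (d i)) (f i)" and i: "i : verts Q" and v: "v : sp (d i)"
 shows "matmap d (mat_of d f) i v = f i v"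
proof
 fix l
 show "matmap d (mat_of d f) i v l = f i v l"
 proof (cases "l < d i")
  case True
  have "f i v = f i (\<Sum>j<d i. fscale (v j) (unitv j))" using sp_expand[OF v] by simp
  also have "... = (\<Sum>j<d i. fscale (v j) (f i (unitv j)))"
  by (rule linear_map_on_lincomb[OF f subspace_sp finite_lessThan]) (simp add: unitv_sp)
  finally have "f i v l = (\<Sum>j<d i. v j * f i (unitv j) l)" by (simp add: sum_fun_at fscale_apply)
  then show ?thesis using i True by (simp add: matmap_def mat_of_def msupp_def)
 next
  case False
  then show ?thesis using linear_map_onD(1)[OF f v] by (simp add: matmap_def mat_of_def msupp_def sp_def)
 qed
qed

lemma mat_of_cong:
 assumes "!!i v. i : verts Q ==> v : sp (d i) ==> f i v = g i v"
 shows "mat_of d f = mat_of d g"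
proof
 fix p show "mat_of d f p = mat_of d g p"
  using assms[of "fst p" "unitv (fst (snd p))"] by (auto simp: mat_of_def msupp_def unitv_sp)
qed

lemma mat_of_matmap:
 assumes "ALL p. p \<notin> msupp d --> T p = 0"
 shows "mat_of d (matmap d T) = T"
proof
 fix p :: "'v \<times> nat \<times> nat"
 obtain i j l where p: "p = (i, j, l)" by (cases p) auto
 have "(\<Sum>j'<d i. unitv j j' * T (i, j', l)) = (\<Sum>j'<d i. if j' = j then T (i, j', l) else 0)"
  by (rule sum.cong[OF refl]) (simp add: unitv_def)
 then show "mat_of d (matmap d T) p = T p" using assms by (auto simp: mat_of_def p matmap_def msupp_def)
qed

lemma hom_cong:
 assumes M: "rel_rep Q M" and tht: "rhom M N tht" and eq: "!!i x. i : verts Q ==> x : espace M i ==> tht i x = tht' i x"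
 shows "rhom M N tht'"
proof (rule homI)
 show "linear_map_on (espace M i) (espace N i) (tht' i)" if i: "i : verts Q" for i
  by (rule linear_map_on_cong[OF eq[OF i] rep_subspace[OF M i] homD(1)[OF tht i]])
 show "(tht' (tail Q a) x, tht' (head Q a) y) : erel N a" if a: "a : arcs Q" and xy: "(x, y) : erel M a" for a x y
  using homD(2)[OF tht a xy] eq rep_rel(7,8)[OF M a xy] a by simp
qed

text \<open>Homomorphisms with image inside a prescribed family \<open>U\<close> of subspaces;
  varying \<open>U\<close> permits the recursive count of surjections.\<close>

definition hom_into :: "('v => nat) => ('v, 'e, nat, 'k::field) erep => ('v, 'e, nat, 'k) erep =>
  ('v => (nat => 'k) set) => ('v \<times> nat \<times> nat => 'k) set" where
 "hom_into d M N U = {T. (ALL p. p \<notin> msupp d --> T p = 0) & rhom M N (matmap d T) \<and>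
  (ALL i:verts Q. matmap d T i ` sp (d i) \<subseteq> U i)}"

lemma hom_into_mem: "T : hom_into d M N U ==> i : verts Q ==> v : sp (d i) ==> matmap d T i v : U i"
 unfolding hom_into_def by blast

lemma std_space: "std_rep Q d M ==> i : verts Q ==> espace M i = sp (d i)"
 by (simp add: std_rep_def)

lemma hom_into_subspace:
 fixes M N :: "('v, 'e, nat, 'k::field) erep"
 assumes N: "rel_rep Q N" and U: "!!i. i : verts Q ==> fv.subspace (U i)"
 shows "fv.subspace (hom_into d M N U)" "fin_dim_space (hom_into d M N U)"
proof -
 show sub: "fv.subspace (hom_into d M N U)"
  unfolding fv.subspace_def
 proof (intro conjI ballI allI)
  have z: "matmap d 0 = (%i v. 0 :: nat => 'k)" by (simp add: matmap_def fun_eq_iff)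
  show "0 : hom_into d M N U"
  using hom_zero[OF N, of M] fv.subspace_0[OF U] by (auto simp: hom_into_def z)
  show "S + T : hom_into d M N U" if S: "S : hom_into d M N U" and T: "T : hom_into d M N U" for S T
  proof -
  have e: "matmap d (S + T) = (%i v. matmap d S i v + matmap d T i v)" by (simp add: matmap_add_left fun_eq_iff)
  have "rhom M N (matmap d (S + T))" unfolding e
  by (rule hom_add[OF N]) (use S T in \<open>simp_all only: hom_into_def mem_Collect_eq\<close>)
  moreover have "matmap d (S + T) i v : U i" if "i : verts Q" "v : sp (d i)" for i v
  unfolding e by (intro fv.subspace_add[OF U] hom_into_mem[OF S] hom_into_mem[OF T] that)
  ultimately show ?thesis using S T by (auto simp: hom_into_def)
  qed
  show "fscale c T : hom_into d M N U" if T: "T : hom_into d M N U" for c T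
  proof -
  have e: "matmap d (fscale c T) = (%i v. fscale c (matmap d T i v))" by (simp add: matmap_scale_left fun_eq_iff)
  have h: "rhom M N (matmap d T)" using T by (simp add: hom_into_def)
  have "rhom M N (matmap d (fscale c T))" unfolding e
  proof (rule homI)
  show "linear_map_on (espace M i) (espace N i) (%v. fscale c (matmap d T i v))" if i: "i : verts Q" for i
  using homD(3)[OF h i] fv.subspace_scale[OF rep_subspace[OF N i]]
  by (auto simp: linear_map_on_def matmap_add matmap_scale fv.scale_right_distrib fv.scale_left_commute)
  show "(fscale c (matmap d T (tail Q a) x), fscale c (matmap d T (head Q a) y)) : erel N a"
  if a: "a : arcs Q" and xy: "(x, y) : erel M a" for a x y
  by (rule rep_rel(5)[OF N a homD(2)[OF h a xy]])
  qed
  moreover have "matmap d (fscale c T) i v : U i" if "i : verts Q" "v : sp (d i)" for i v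
  unfolding e by (intro fv.subspace_scale[OF U] hom_into_mem[OF T] that)
  ultimately show ?thesis using T by (auto simp: hom_into_def fscale_apply)
  qed
 qed
 show "fin_dim_space (hom_into d M N U)"
  by (rule fin_dim_subset[OF fin_dim_support[OF finite_msupp] sub]) (auto simp: hom_into_def)
qed

text \<open>Precomposition with an isomorphism from \<open>M\<close> to \<open>M'\<close> identifies
  the two spaces, since it leaves targets and images alone.\<close>

lemma hom_into_dim:
 fixes M M' N :: "('v, 'e, nat, 'k::field) erep"
 assumes reps: "rel_rep Q M" "rel_rep Q M'" "rel_rep Q N" and std: "std_rep Q d M" "std_rep Q d M'" "std_rep Q d N"
  and U: "!!i. i : verts Q ==> fv.subspace (U i)" and iso: "riso M M'"
 shows "fv.dim (hom_into d M N U) = fv.dim (hom_into d M' N U)"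
proof -
 have pre: "EX f. linear_map_on (hom_into d M' N U) (hom_into d M N U) f \<and>
  (ALL T:hom_into d M' N U. ALL i:verts Q. ALL v:sp (d i). matmap d (f T) i v = matmap d T i (tht i v))"
  if r: "rel_rep Q M" "rel_rep Q M'" and std: "std_rep Q d M" "std_rep Q d M'" and tht: "rhom M M' tht"
  for tht and M M' :: "('v, 'e, nat, 'k) erep"
 proof -
  let ?f = "%T. mat_of d (%i v. matmap d T i (tht i v))"
  have tm: "tht i v : sp (d i)" if "i : verts Q" "v : sp (d i)" for i v
  using homD(3)[OF tht that(1)] that std by (simp add: std_space)
  have eq: "matmap d (?f T) i v = matmap d T i (tht i v)"
  if T: "T : hom_into d M' N U" and i: "i : verts Q" and v: "v : sp (d i)" for T i v
  proof (rule matmap_mat_of[where d = d and f = "%i v. matmap d T i (tht i v)", OF _ i v])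
  have "linear_map_on (sp (d i)) (sp (d i)) (matmap d T i)" using T i by (intro matmap_linear) (auto simp: hom_into_def)
  moreover have "linear_map_on (sp (d i)) (sp (d i)) (tht i)" using homD(1)[OF tht i] std i by (simp add: std_space)
  ultimately show "linear_map_on (sp (d i)) (sp (d i)) (%v. matmap d T i (tht i v))"
  using linear_map_on_comp[of _ _ "tht i" _ "matmap d T i"] by (auto simp: comp_def)
  qed
  have mem: "?f T : hom_into d M N U" if T: "T : hom_into d M' N U" for T
  proof -
  have "rhom M' N (matmap d T)" using T by (simp add: hom_into_def)
  then have "rhom M N (%i v. matmap d T i (tht i v))" by (rule hom_comp[OF tht])
  then have "rhom M N (matmap d (?f T))"
  by (rule hom_cong[OF r(1)]) (use eq[OF T] std in \<open>simp add: std_space\<close>)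
  moreover have "matmap d (?f T) i v : U i" if "i : verts Q" "v : sp (d i)" for i v
  unfolding eq[OF T that] by (rule hom_into_mem[OF T that(1) tm[OF that]])
  ultimately show ?thesis by (auto simp: hom_into_def mat_of_def)
  qed
  have "linear_map_on (hom_into d M' N U) (hom_into d M N U) ?f"
  unfolding linear_map_on_def using mem
  by (auto simp: mat_of_def matmap_add_left matmap_scale_left fun_eq_iff fscale_apply)
  then show ?thesis using eq by (intro exI[of _ ?f] conjI ballI) auto
 qed
 obtain tht \<psi> where t: "rhom M M' tht" "rhom M' M \<psi>" "ALL i:verts Q. ALL x:espace M i. \<psi> i (tht i x) = x"
  "ALL i:verts Q. ALL y:espace M' i. tht i (\<psi> i y) = y" using iso by (rule isoE)
 obtain f where f: "linear_map_on (hom_into d M' N U) (hom_into d M N U) f"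
  "ALL T:hom_into d M' N U. ALL i:verts Q. ALL v:sp (d i). matmap d (f T) i v = matmap d T i (tht i v)"
  using pre[OF reps(1,2) std(1,2) t(1)] by (elim exE conjE)
 obtain g where g: "linear_map_on (hom_into d M N U) (hom_into d M' N U) g"
  "ALL T:hom_into d M N U. ALL i:verts Q. ALL v:sp (d i). matmap d (g T) i v = matmap d T i (\<psi> i v)"
  using pre[OF reps(2,1) std(2,1) t(2)] by (elim exE conjE)
 have m: "tht i v : sp (d i)" "\<psi> i v : sp (d i)" if "i : verts Q" "v : sp (d i)" for i v
  using homD(3)[OF t(1) that(1)] homD(3)[OF t(2) that(1)] that std by (simp_all add: std_space)
 have supp: "ALL p. p \<notin> msupp d --> T p = 0" if "T : hom_into d M N U \<or> T : hom_into d M' N U" for T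
  using that by (auto simp: hom_into_def)
 have eqI: "S = T" if "ALL p. p \<notin> msupp d --> S p = 0" "ALL p. p \<notin> msupp d --> T p = 0"
  "!!i v. i : verts Q ==> v : sp (d i) ==> matmap d S i v = matmap d T i v" for S T :: "'v \<times> nat \<times> nat => 'k"
  using mat_of_cong[of d "matmap d S" "matmap d T", OF that(3)] by (simp add: mat_of_matmap that(1,2))
 have gf: "g (f T) = T" if T: "T : hom_into d M' N U" for T
 proof (rule eqI)
  note fT = linear_map_onD(1)[OF f(1) T] and gfT = linear_map_onD(1)[OF g(1) linear_map_onD(1)[OF f(1) T]]
  show "ALL p. p \<notin> msupp d --> g (f T) p = 0" using gfT by (intro supp disjI2)
  show "ALL p. p \<notin> msupp d --> T p = 0" using T by (intro supp disjI2)
  show "matmap d (g (f T)) i v = matmap d T i v" if i: "i : verts Q" and v: "v : sp (d i)" for i v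
  using g(2) fT f(2) T i v m(2)[OF i v] t(4) std by (simp add: std_space)
 qed
 have fg: "f (g T) = T" if T: "T : hom_into d M N U" for T
 proof (rule eqI)
  note gT = linear_map_onD(1)[OF g(1) T] and fgT = linear_map_onD(1)[OF f(1) linear_map_onD(1)[OF g(1) T]]
  show "ALL p. p \<notin> msupp d --> f (g T) p = 0" using fgT by (intro supp disjI1)
  show "ALL p. p \<notin> msupp d --> T p = 0" using T by (intro supp disjI1)
  show "matmap d (f (g T)) i v = matmap d T i v" if i: "i : verts Q" and v: "v : sp (d i)" for i v
  using f(2) gT g(2) T i v m(1)[OF i v] t(3) std by (simp add: std_space)
 qed
 have "bij_betw f (hom_into d M' N U) (hom_into d M N U)"
  by (rule bij_betw_byWitness[of _ g]) (use gf fg linear_map_onD(1)[OF f(1)] linear_map_onD(1)[OF g(1)] in auto)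
 then show ?thesis by (rule dim_bij(1)[OF f(1) _ hom_into_subspace(2)[OF reps(3) U]])
qed

end

context frob_quiver begin

text \<open>Representations over the field with \<open>s\<close> elements, seen inside the large
  field: \<open>sext_surj\<close> and \<open>sext_fixed_std\<close> make this precise for
  \<open>s = q\<close>.\<close>

definition fixed_std :: "('v => nat) => ('v, 'e, nat, 'a) erep => bool" where
 "fixed_std d M \<longleftrightarrow> rel_rep Q M & std_rep Q d M & map_rep (fr s) M = M"

lemma fixed_stdD:
 assumes "fixed_std d M"
 shows "rel_rep Q M" "std_rep Q d M" "map_rep (fr s) M = M" "i : verts Q ==> espace M i = sp (d i)"
  "frp ` erel M a = erel M a"
proof -
 show "rel_rep Q M" "std_rep Q d M" and m: "map_rep (fr s) M = M" using assms by (auto simp: fixed_std_def)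
 then show "i : verts Q ==> espace M i = sp (d i)" by (simp add: std_space)
 have "erel (map_rep (fr s) M) a = erel M a" unfolding m ..
 then show "frp ` erel M a = erel M a" by (simp add: map_rep_def)
qed

lemma matmap_fr: "fr s (matmap d T i v) = matmap d (fr s T) i (fr s v)" for T :: "'v \<times> nat \<times> nat => 'a"
 by (simp add: matmap_def fr_def frob_sum power_mult_distrib)

definition fixed_homs where
 "fixed_homs d M N U = {T : hom_into d M N U. fr s T = T}"

text \<open>Families of subspaces defined over the fixed field. The empty value off the vertices
  makes such families determined by their values at vertices, so that images can be compared as
  functions.\<close>

definition stable_family :: "('v => nat) => ('v => (nat => 'a) set) => bool" where
 "stable_family d U \<longleftrightarrow> (ALL i. if i : verts Q then fv.subspace (U i) & fr s ` U i = U i & U i \<subseteq> sp (d i) else U i = {})"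

text \<open>Frobenius is semilinear on the homomorphism space, so the number of fixed homomorphisms
  is a power of \<open>s\<close> determined by the dimension over the large field.\<close>

lemma card_fixed_homs:
 assumes M: "fixed_std d M" and N: "fixed_std d N" and U: "stable_family d U"
 shows "card (fixed_homs d M N U) = s ^ fv.dim (hom_into d M N U)" "finite (fixed_homs d M N U)"
proof -
 have Us: "fv.subspace (U i)" "fr s ` U i = U i" if "i : verts Q" for i
  using U that unfolding stable_family_def by metis+
 obtain B where B: "finite B" "hom_into d M N U = fv.span B"
  using hom_into_subspace(2)[where U = U and M = M and d = d, OF fixed_stdD(1)[OF N] Us(1)] by (auto simp: fin_dim_space_def)
 have mem: "fr s T : hom_into d M N U" if T: "T : hom_into d M N U" for T
 proof -
  have h: "rhom M N (matmap d T)" using T by (simp add: hom_into_def)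
  have supp: "ALL p. p \<notin> msupp d --> fr s T p = 0" using T s_gt1 by (simp add: hom_into_def fr_def)
  have "rhom M N (matmap d (fr s T))"
  proof (rule homI)
  show "linear_map_on (espace M i) (espace N i) (matmap d (fr s T) i)" if "i : verts Q" for i
  using matmap_linear[OF supp that] fixed_stdD(4)[OF M that] fixed_stdD(4)[OF N that] by simp
  fix a x y assume a: "a : arcs Q" and xy: "(x, y) : erel M a"
  then have "(x, y) : frp ` erel M a" by (simp only: fixed_stdD(5)[OF M])
  then obtain x' y' where xy': "(x', y') : erel M a" "x = fr s x'" "y = fr s y'" by auto
  have "frp (matmap d T (tail Q a) x', matmap d T (head Q a) y') : frp ` erel N a"
  by (rule imageI[OF homD(2)[OF h a xy'(1)]])
  then show "(matmap d (fr s T) (tail Q a) x, matmap d (fr s T) (head Q a) y) : erel N a"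
  by (simp add: fixed_stdD(5)[OF N] matmap_fr xy'(2,3))
  qed
  moreover have "matmap d (fr s T) i ` sp (d i) \<subseteq> U i" if i: "i : verts Q" for i
  proof -
  have "matmap d (fr s T) i ` fr s ` sp (d i) = fr s ` matmap d T i ` sp (d i)" by (simp add: image_image matmap_fr)
  also have "... \<subseteq> fr s ` U i" using T i by (intro image_mono) (simp add: hom_into_def)
  finally show ?thesis by (simp add: fr_sp_image Us(2)[OF i])
  qed
  ultimately show ?thesis using supp by (simp add: hom_into_def)
 qed
 show "card (fixed_homs d M N U) = s ^ fv.dim (hom_into d M N U)" "finite (fixed_homs d M N U)"
  unfolding fixed_homs_def using fvf.card_fixed_vectors[OF B, of "fr s"] mem by (auto simp: fr_add fr_scale)
qed

definition mat_image :: "('v => nat) => ('v \<times> nat \<times> nat => 'a) => 'v => (nat => 'a) set" where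
 "mat_image d T = (%i. if i : verts Q then matmap d T i ` sp (d i) else {})"

lemma stable_mat_image:
 assumes T: "T : fixed_homs d M N U"
 shows "stable_family d (mat_image d T)" "i : verts Q ==> mat_image d T i \<subseteq> U i"
proof -
 have T': "ALL p. p \<notin> msupp d --> T p = 0" "fr s T = T" "!!i. i : verts Q ==> matmap d T i ` sp (d i) \<subseteq> U i"
  using T by (auto simp: fixed_homs_def hom_into_def)
 then show "i : verts Q ==> mat_image d T i \<subseteq> U i" by (simp add: mat_image_def)
 show "stable_family d (mat_image d T)" unfolding stable_family_def
 proof (intro allI)
  fix i
  show "if i : verts Q then fv.subspace (mat_image d T i) & fr s ` mat_image d T i = mat_image d T i \<and>
  mat_image d T i \<subseteq> sp (d i) else mat_image d T i = {}"
  proof (cases "i : verts Q")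
  case i: True
  note lin = matmap_linear[OF T'(1) i]
  have "fr s ` matmap d T i ` sp (d i) = matmap d (fr s T) i ` fr s ` sp (d i)" by (simp add: image_image matmap_fr)
  then have "fr s ` matmap d T i ` sp (d i) = matmap d T i ` sp (d i)" by (simp add: fr_sp_image T'(2))
  then show ?thesis using linear_map_on_image_subspace[OF lin subspace_sp order_refl] linear_map_onD(1)[OF lin] i
  by (auto simp: mat_image_def)
  qed (simp add: mat_image_def)
 qed
qed

text \<open>For isomorphic \<open>M\<close> and \<open>N\<close> all fixed homomorphisms into
  \<open>U\<close> are equinumerous, since the dimensions agree. Sorting them by image and removing
  those with smaller image, equinumerous by induction, leaves the ones with image exactly
  \<open>U\<close>.\<close>

lemma card_fixed_surjections:
 assumes M: "fixed_std d M" and N: "fixed_std d N" and L: "fixed_std d L" and iso: "riso M N" and U: "stable_family d U"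
 shows "card {T : fixed_homs d M L U. mat_image d T = U} = card {T : fixed_homs d N L U. mat_image d T = U}"
 using U
proof (induction "\<Sum>i\<in>verts Q. fv.dim (U i)" arbitrary: U rule: less_induct)
 case (less U)
 note U = less.prems
 let ?A = "%M. fixed_homs d M L U"
 let ?W = "insert U (mat_image d ` ?A M \<union> mat_image d ` ?A N)"
 have fin: "finite (?A M)" "finite (?A N)" by (rule card_fixed_homs(2)[OF M L U], rule card_fixed_homs(2)[OF N L U])
 then have fW: "finite ?W" by simp
 have Us: "fv.subspace (U i)" "U i \<subseteq> sp (d i)" if "i : verts Q" for i
  using U that unfolding stable_family_def by metis+
 have tot: "card (?A M) = card (?A N)"
  unfolding card_fixed_homs(1)[OF M L U] card_fixed_homs(1)[OF N L U]
  using hom_into_dim[OF fixed_stdD(1)[OF M] fixed_stdD(1)[OF N] fixed_stdD(1)[OF L]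
  fixed_stdD(2)[OF M] fixed_stdD(2)[OF N] fixed_stdD(2)[OF L] Us(1) iso] by simp
 have sum: "card (?A P) = (\<Sum>V\<in>?W. card {T : ?A P. mat_image d T = V})" if "P = M \<or> P = N" for P
 proof -
  have 1: "finite (?A P)" and 2: "mat_image d ` ?A P \<subseteq> ?W" using that fin by auto
  show ?thesis using sum.group[OF 1 fW 2, of "%_. 1::nat"] by simp
 qed
 have "card {T : ?A M. mat_image d T = V} = card {T : ?A N. mat_image d T = V}" if V: "V : ?W - {U}" for V
 proof -
  obtain P T where T: "T : fixed_homs d P L U" "V = mat_image d T" using V by auto
  note sV = stable_mat_image[OF T(1), folded T(2)]
  have VU: "V i \<subseteq> U i" if "i : verts Q" for i using sV(2)[OF that] .
  obtain i where i: "V i ~= U i" using V by (auto simp: fun_eq_iff)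
  then have iv: "i : verts Q" using sV(1) U unfolding stable_family_def by metis
  have Vs: "fv.subspace (V i)" if "i : verts Q" for i
  using sV(1) that unfolding stable_family_def by metis
  have fd: "fin_dim_space (U i)" if "i : verts Q" for i
  by (rule fin_dim_subset[OF fin_dim_sp Us(1)[OF that] Us(2)[OF that]])
  have "(\<Sum>i\<in>verts Q. fv.dim (V i)) < (\<Sum>i\<in>verts Q. fv.dim (U i))"
  proof (rule sum_strict_mono_ex1)
  show "ALL i:verts Q. fv.dim (V i) <= fv.dim (U i)" by (intro ballI dim_proper_subspace(1)[OF fd Vs VU])
  show "EX i:verts Q. fv.dim (V i) < fv.dim (U i)" using dim_proper_subspace(2)[OF fd[OF iv] Vs[OF iv] VU[OF iv] i] iv by (rule_tac bexI)
  qed simp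
  from less.hyps[OF this sV(1)]
  have "card {T : fixed_homs d M L V. mat_image d T = V} = card {T : fixed_homs d N L V. mat_image d T = V}" .
  moreover have "{T : fixed_homs d P L V. mat_image d T = V} = {T : ?A P. mat_image d T = V}" for P
  proof -
  have "T : fixed_homs d P L V \<longleftrightarrow> T : fixed_homs d P L U"
  if "mat_image d T = V" for T
  proof -
  have "matmap d T i ` sp (d i) = V i" if "i : verts Q" for i
  using fun_cong[OF \<open>mat_image d T = V\<close>, of i] that by (simp add: mat_image_def)
  then show ?thesis using VU by (simp add: fixed_homs_def hom_into_def)
  qed
  then show ?thesis by (intro Collect_cong) auto
  qed
  ultimately show ?thesis by simp
 qed
 then have rest: "(\<Sum>V\<in>?W - {U}. card {T : ?A M. mat_image d T = V}) = (\<Sum>V\<in>?W - {U}. card {T : ?A N. mat_image d T = V})"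
  by (rule sum.cong[OF refl])
 have dec: "card (?A P) = card {T : ?A P. mat_image d T = U} + (\<Sum>V\<in>?W - {U}. card {T : ?A P. mat_image d T = V})"
  if "P = M \<or> P = N" for P
  unfolding sum[OF that] by (rule sum.remove[OF fW]) simp
 show ?case using tot dec[of M] dec[of N] unfolding rest by (simp only: simp_thms add_right_cancel)
qed

text \<open>Two representations over the finite field that become isomorphic over the closure are
  isomorphic already. The identity of \<open>N\<close> is a fixed surjection onto \<open>N\<close>,
  so there is also one from \<open>M\<close>; what remains is that it is an isomorphism.\<close>

theorem noether_deuring:
 assumes M: "fixed_std d M" and N: "fixed_std d N" and iso: "riso M N"
 obtains tht where "tht : (\<Pi>\<^sub>E i\<in>verts Q. GL1 (d i))" "transport Q (%i. sp (d i)) tht M = N"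
proof -
 define U where "U i = (if i : verts Q then sp (d i) else {} :: (nat => 'a) set)" for i
 have U: "stable_family d U" by (simp add: stable_family_def U_def subspace_sp fr_sp_image)
 define I where "I = mat_of d (%i v. v :: nat => 'a)"
 have I: "matmap d I i v = v" if "i : verts Q" "v : sp (d i)" for i v
  unfolding I_def using matmap_mat_of[of d i "%i v. v"] that linear_map_on_id by blast
 have "rhom N N (matmap d I)"
  by (rule hom_cong[OF fixed_stdD(1)[OF N] hom_id]) (simp add: I fixed_stdD(4)[OF N])
 then have "I : hom_into d N N U"
  unfolding hom_into_def by (simp add: U_def I image_subset_iff) (simp add: I_def mat_of_def)
 moreover have "fr s I = I"
 proof
  fix p show "fr s I p = I p" using s_gt1 by (auto simp: I_def fr_def mat_of_def unitv_def)
 qed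
 moreover have "mat_image d I = U" by (auto simp: mat_image_def U_def I fun_eq_iff)
 ultimately have "I : {T : fixed_homs d N N U. mat_image d T = U}" by (simp add: fixed_homs_def)
 moreover have "finite {T : fixed_homs d N N U. mat_image d T = U}" using card_fixed_homs(2)[OF N N U] by simp
 ultimately have "card {T : fixed_homs d M N U. mat_image d T = U} ~= 0"
  unfolding card_fixed_surjections[OF M N N iso U] by auto
 then obtain T where T: "T : fixed_homs d M N U" "mat_image d T = U" by (auto simp: card_eq_0_iff)
 have T': "ALL p. p \<notin> msupp d --> T p = 0" "fr s T = T" "rhom M N (matmap d T)"
  using T(1) by (auto simp: fixed_homs_def hom_into_def)
 have surj: "matmap d T i ` sp (d i) = sp (d i)" if "i : verts Q" for i
  using fun_cong[OF T(2), of i] that by (simp add: mat_image_def U_def)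
 note sM = fixed_stdD(4)[OF M] and sN = fixed_stdD(4)[OF N]
 obtain tht \<psi> where t: "rhom M N tht" "rhom N M \<psi>" "ALL i:verts Q. ALL x:espace M i. \<psi> i (tht i x) = x"
  "ALL i:verts Q. ALL y:espace N i. tht i (\<psi> i y) = y" using iso by (rule isoE)
 \<comment> \<open>A morphism that is bijective on the spaces need not carry the relations onto each
   other. Followed by \<open>\<psi>\<close> it becomes a surjective endomorphism of
   \<open>M\<close>, some power of which is the identity, so its inverse is a composite of
   morphisms.\<close>
 define \<phi> where "\<phi> i v = \<psi> i (matmap d T i v)" for i v
 have \<phi>: "rhom M M \<phi>" using hom_comp[OF T'(3) t(2)] by (simp add: \<phi>_def[abs_def])
 have \<phi>s: "\<phi> i ` sp (d i) = sp (d i)" if i: "i : verts Q" for i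
 proof -
  have "\<phi> i ` sp (d i) = \<psi> i ` matmap d T i ` sp (d i)" by (simp add: \<phi>_def image_image)
  also have "... = \<psi> i ` sp (d i)" by (simp add: surj[OF i])
  also have "... = sp (d i)"
  using homD(3)[OF t(1) i] homD(3)[OF t(2) i] t(3) i sM[OF i] sN[OF i] by (auto simp: image_iff) metis
  finally show ?thesis .
 qed
 have \<phi>p: "(\<phi> i ^^ n) ` sp (d i) = sp (d i)" if "i : verts Q" for i n
 proof (induction n)
  case (Suc n)
  have "(\<phi> i ^^ Suc n) ` sp (d i) = \<phi> i ` (\<phi> i ^^ n) ` sp (d i)" by (simp add: image_image)
  then show ?case by (simp only: Suc \<phi>s[OF that])
 qed simp
 obtain m where m: "m > 0" "ALL i:verts Q. ALL x:espace M i. (\<phi> i ^^ (m + m)) x = (\<phi> i ^^ m) x"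
  using hom_idempotent_power[OF fixed_stdD(1)[OF M] \<phi>] by blast
 \<comment> \<open>An idempotent map that is onto is the identity.\<close>
 have \<phi>m: "(\<phi> i ^^ m) x = x" if i: "i : verts Q" and x: "x : sp (d i)" for i x
 proof -
  obtain y where y: "y : sp (d i)" "x = (\<phi> i ^^ m) y" using \<phi>p[OF i, of m] x by (metis imageE)
  have "(\<phi> i ^^ m) x = (\<phi> i ^^ (m + m)) y" by (simp add: y(2) funpow_add)
  then show ?thesis using m(2) i y sM by simp
 qed
 obtain n where n: "m = Suc n" using m(1) by (metis gr0_implies_Suc)
 define \<chi> where "\<chi> i v = (\<phi> i ^^ n) (\<psi> i v)" for i v
 have \<chi>: "rhom N M \<chi>" using hom_comp[OF t(2) hom_funpow[OF \<phi>, of n]] by (simp add: \<chi>_def[abs_def])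
 have \<chi>T: "\<chi> i (matmap d T i v) = v" if "i : verts Q" "v : sp (d i)" for i v
 proof -
  have "\<chi> i (matmap d T i v) = (\<phi> i ^^ m) v" by (simp add: \<chi>_def n funpow_swap1 \<phi>_def[symmetric])
  then show ?thesis using \<phi>m[OF that] by simp
 qed
 have T\<chi>: "matmap d T i (\<chi> i v) = v" if i: "i : verts Q" and v: "v : sp (d i)" for i v
 proof -
  obtain w where "w : sp (d i)" "v = matmap d T i w" using surj[OF i] v by (metis imageE)
  then show ?thesis using \<chi>T[OF i] by simp
 qed
 define \<Theta> where "\<Theta> = (\<lambda>i\<in>verts Q. restrict (matmap d T i) (sp (d i)))"
 have \<Theta>: "\<Theta> i v = matmap d T i v" if "i : verts Q" "v : sp (d i)" for i v using that by (simp add: \<Theta>_def)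
 have "\<Theta> i : GL1 (d i)" if i: "i : verts Q" for i unfolding GL1_def
 proof (intro CollectI conjI ballI)
  show "\<Theta> i : extensional (sp (d i))" using i by (simp add: \<Theta>_def)
  show "linear_map_on (sp (d i)) (sp (d i)) (\<Theta> i)"
  by (rule linear_map_on_cong[OF _ subspace_sp matmap_linear[OF T'(1) i]]) (simp add: \<Theta> i)
  have "bij_betw (matmap d T i) (sp (d i)) (sp (d i))"
  unfolding bij_betw_def using surj[OF i] inj_on_inverseI[of "sp (d i)" "\<chi> i"] \<chi>T[OF i] by blast
  then show "bij_betw (\<Theta> i) (sp (d i)) (sp (d i))" using \<Theta>[OF i] by (simp cong: bij_betw_cong)
  show "\<Theta> i (fr s v) = fr s (\<Theta> i v)" if "v : sp (d i)" for v
  using that \<Theta>[OF i] matmap_fr[of d T i v] by (simp add: fr_sp T'(2))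
 qed
 then have "\<Theta> : (\<Pi>\<^sub>E i\<in>verts Q. GL1 (d i))" by (auto simp: \<Theta>_def)
 moreover have "transport Q (%i. sp (d i)) \<Theta> M = N"
 proof (rule erep.equality)
  show "espace (transport Q (%i. sp (d i)) \<Theta> M) = espace N"
  using fixed_stdD(2)[OF N] by (simp add: transport_def std_rep_def fun_eq_iff)
  show "erel (transport Q (%i. sp (d i)) \<Theta> M) = erel N"
  proof
  fix a
  show "erel (transport Q (%i. sp (d i)) \<Theta> M) a = erel N a"
  proof (cases "a : arcs Q")
  case a: True
  then have ht: "tail Q a : verts Q" "head Q a : verts Q" by auto
  have e: "map_prod (\<Theta> (tail Q a)) (\<Theta> (head Q a)) p = map_prod (matmap d T (tail Q a)) (matmap d T (head Q a)) p"
  if "p : erel M a" for p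
  using that rep_rel(7,8)[OF fixed_stdD(1)[OF M] a, of "fst p" "snd p"] sM ht \<Theta> by (cases p) simp
  have "map_prod (\<Theta> (tail Q a)) (\<Theta> (head Q a)) ` erel M a = map_prod (matmap d T (tail Q a)) (matmap d T (head Q a)) ` erel M a"
  using e by (rule image_cong[OF refl])
  also have "... = erel N a"
  proof
  show "map_prod (matmap d T (tail Q a)) (matmap d T (head Q a)) ` erel M a \<subseteq> erel N a"
  using homD(2)[OF T'(3) a] by auto
  show "erel N a \<subseteq> map_prod (matmap d T (tail Q a)) (matmap d T (head Q a)) ` erel M a"
  proof (rule subrelI)
  fix u v assume uv: "(u, v) : erel N a"
  have "u : sp (d (tail Q a))" "v : sp (d (head Q a))" using rep_rel(7,8)[OF fixed_stdD(1)[OF N] a uv] sN ht by auto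
  then have "(u, v) = map_prod (matmap d T (tail Q a)) (matmap d T (head Q a)) (\<chi> (tail Q a) u, \<chi> (head Q a) v)"
  using T\<chi> ht by simp
  then show "(u, v) : map_prod (matmap d T (tail Q a)) (matmap d T (head Q a)) ` erel M a"
  using homD(2)[OF \<chi> a uv] by (rule image_eqI)
  qed
  qed
  finally show ?thesis using a by (simp add: transport_def)
  qed (use fixed_stdD(2)[OF N] in \<open>simp add: transport_def std_rep_def\<close>)
  qed
 qed simp
 ultimately show thesis by (rule that)
qed

end

section \<open>Counting the isomorphism classes fixed by Frobenius\<close>

context frob_quiver begin

definition GLd :: "('v => nat) => ('v => (nat => 'a) => nat => 'a) set" where
 "GLd d = (\<Pi>\<^sub>E i\<in>verts Q. GL1 (d i))"

definition StdF :: "('v => nat) => ('e => nat) => ('e => nat) => ('v, 'e, nat, 'a) erep set" where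
 "StdF d rho sig = {M. fixed_std d M & has_type Q rho sig M}"

abbreviation act :: "('v => nat) => _ => ('v, 'e, nat, 'a) erep => ('v, 'e, nat, 'a) erep" where
 "act d \<equiv> transport Q (%i. sp (d i))"

lemma GL1_inj: "f : GL1 n ==> g : GL1 n ==> (!!v. v : sp n ==> f v = g v) ==> f = g"
 unfolding GL1_def by (rule extensionalityI[of _ "sp n"]) auto

lemma finite_GL1: "finite (GL1 n)"
proof (rule inj_on_finite)
 let ?r = "%f. \<lambda>j\<in>{..<n}. f (unitv j)"
 show "?r ` GL1 n \<subseteq> {..<n} \<rightarrow>\<^sub>E spF n" using GL1_D(4) unitv_spF by auto
 show "finite ({..<n} \<rightarrow>\<^sub>E spF n)" by (intro finite_PiE) (use fs.card_spk(1)[of "{..<n}"] in auto)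
 show "inj_on ?r (GL1 n)"
 proof (rule inj_onI)
  fix f g assume f: "f : GL1 n" and g: "g : GL1 n" and eq: "?r f = ?r g"
  have u: "f (unitv j) = g (unitv j)" if "j < n" for j using fun_cong[OF eq, of j] that by simp
  show "f = g"
  proof (rule GL1_inj[OF f g])
  fix v :: "nat => 'a" assume v: "v : sp n"
  have *: "h v = (\<Sum>j<n. fscale (v j) (h (unitv j)))" if "h : GL1 n" for h
  proof -
  have "h v = h (\<Sum>j<n. fscale (v j) (unitv j))" using sp_expand[OF v] by simp
  also have "... = (\<Sum>j<n. fscale (v j) (h (unitv j)))"
  by (rule linear_map_on_lincomb[OF GL1_D(1)[OF that] subspace_sp finite_lessThan]) (simp add: unitv_sp)
  finally show ?thesis .
  qed
  have "(\<Sum>j<n. fscale (v j) (f (unitv j))) = (\<Sum>j<n. fscale (v j) (g (unitv j)))"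
  by (rule sum.cong[OF refl]) (simp add: u)
  then show "f v = g v" using *[OF f] *[OF g] by simp
  qed
 qed
qed

lemma finite_GLd: "finite (GLd d)"
 unfolding GLd_def by (intro finite_PiE finite_GL1) simp

lemma GLd_GL1: "tht : GLd d ==> i : verts Q ==> tht i : GL1 (d i)"
 by (auto simp: GLd_def)

lemma GLd_eqI:
 assumes "tht : GLd d" "eta : GLd d" "!!i v. i : verts Q ==> v : sp (d i) ==> tht i v = eta i v"
 shows "tht = eta"
 by (rule PiE_ext[OF assms(1)[unfolded GLd_def] assms(2)[unfolded GLd_def]])
  (use assms in \<open>auto intro: GL1_inj GLd_GL1\<close>)

lemma restrict_GLd:
 assumes "!!i. i : verts Q ==> linear_map_on (sp (d i)) (sp (d i)) (f i)" "!!i. i : verts Q ==> bij_betw (f i) (sp (d i)) (sp (d i))"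
  "!!i v. i : verts Q ==> v : sp (d i) ==> f i (fr s v) = fr s (f i v)"
 shows "(\<lambda>i\<in>verts Q. restrict (f i) (sp (d i))) : GLd d"
 unfolding GLd_def
proof (rule PiE_I)
 fix i assume i: "i : verts Q"
 have "linear_map_on (sp (d i)) (sp (d i)) (restrict (f i) (sp (d i)))"
  by (rule linear_map_on_cong[OF _ subspace_sp assms(1)[OF i]]) simp
 moreover have "bij_betw (restrict (f i) (sp (d i))) (sp (d i)) (sp (d i))"
  using assms(2)[OF i] by (simp cong: bij_betw_cong)
 ultimately show "(\<lambda>i\<in>verts Q. restrict (f i) (sp (d i))) i : GL1 (d i)"
  using i assms(3)[OF i] by (simp add: GL1_def fr_sp)
qed auto

lemma fixed_std_rel:
 assumes "fixed_std d M" "a : arcs Q"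
 shows "erel M a \<subseteq> sp (d (tail Q a)) \<times> sp (d (head Q a))"
 using rep_rel(1)[OF fixed_stdD(1)[OF assms(1)] assms(2)] fixed_stdD(4)[OF assms(1)] assms(2) by simp

lemma fixed_std_eqI:
 assumes "fixed_std d M" "fixed_std d N" "!!a. a : arcs Q ==> erel M a = erel N a"
 shows "M = N"
proof (rule erep.equality)
 note s = fixed_stdD(2)[OF assms(1)] fixed_stdD(2)[OF assms(2)]
 show "espace M = espace N" using s by (simp add: std_rep_def fun_eq_iff)
 show "erel M = erel N"
 proof
  fix a show "erel M a = erel N a" using s assms(3)[of a] by (cases "a : arcs Q") (simp_all add: std_rep_def)
 qed
qed simp

lemma act_fixed_std:
 assumes tht: "tht : GLd d" and M: "fixed_std d M"
 shows "fixed_std d (act d tht M)" "riso M (act d tht M)"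
proof -
 note sM = fixed_stdD(4)[OF M]
 have l: "linear_map_on (espace M i) (sp (d i)) (tht i)" "bij_betw (tht i) (espace M i) (sp (d i))" if "i : verts Q" for i
  using GL1_D(1,2)[OF GLd_GL1[OF tht that]] sM[OF that] by simp_all
 note t = transport_rep[OF fixed_stdD(1)[OF M], where W = "%i. sp (d i)" and g = tht, OF l]
 show "riso M (act d tht M)" by (rule t(2))
 have std: "std_rep Q d (act d tht M)" by (simp add: std_rep_def transport_def)
 moreover have "map_rep (fr s) (act d tht M) = act d tht M"
 proof (rule erep.equality)
  show "espace (map_rep (fr s) (act d tht M)) = espace (act d tht M)"
  by (simp add: map_rep_def transport_def fun_eq_iff fr_sp_image)
  show "erel (map_rep (fr s) (act d tht M)) = erel (act d tht M)"
  proof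
  fix a show "erel (map_rep (fr s) (act d tht M)) a = erel (act d tht M) a"
  proof (cases "a : arcs Q")
  case a: True
  then have ht: "tail Q a : verts Q" "head Q a : verts Q" by auto
  let ?g = "map_prod (tht (tail Q a)) (tht (head Q a))"
  have "frp (?g p) = ?g (frp p)" if "p : erel M a" for p
  using subsetD[OF fixed_std_rel[OF M a] that] GL1_D(3)[OF GLd_GL1[OF tht ht(1)]] GL1_D(3)[OF GLd_GL1[OF tht ht(2)]]
  by (cases p) simp
  then have "frp ` ?g ` erel M a = ?g ` frp ` erel M a" unfolding image_image by (rule image_cong[OF refl])
  then show ?thesis using a by (simp only: fixed_stdD(5)[OF M]) (simp add: map_rep_def transport_def)
  qed (simp add: map_rep_def transport_def)
  qed
 qed simp
 ultimately show "fixed_std d (act d tht M)" using t(1) by (simp add: fixed_std_def)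
qed

lemma act_StdF:
 assumes "tht : GLd d" "M : StdF d rho sig"
 shows "act d tht M : StdF d rho sig"
proof -
 have M: "fixed_std d M" and T: "has_type Q rho sig M" using assms(2) by (auto simp: StdF_def)
 note a = act_fixed_std[OF assms(1) M]
 show ?thesis using a(1) iso_type[OF fixed_stdD(1)[OF M] fixed_stdD(1)[OF a(1)] a(2) T] by (simp add: StdF_def)
qed

text \<open>A stable relation is determined by its fixed pairs, and these form a subset of a finite
  set.\<close>

lemma finite_StdF: "finite (StdF d rho sig)"
proof (rule inj_on_finite)
 let ?S = "%a. spF (d (tail Q a)) \<times> spF (d (head Q a))"
 let ?r = "%M. \<lambda>a\<in>arcs Q. erel M a \<inter> ?S a"
 show "?r ` StdF d rho sig \<subseteq> (\<Pi>\<^sub>E a\<in>arcs Q. Pow (?S a))" by auto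
 show "finite (\<Pi>\<^sub>E a\<in>arcs Q. Pow (?S a))"
  by (intro finite_PiE finite_Pow_iff[THEN iffD2] finite_cartesian_product fs.card_spk(1)[OF finite_lessThan]) simp
 show "inj_on ?r (StdF d rho sig)"
 proof (rule inj_onI)
  fix M N assume M: "M : StdF d rho sig" and N: "N : StdF d rho sig" and eq: "?r M = ?r N"
  have M': "fixed_std d M" and N': "fixed_std d N" using M N by (auto simp: StdF_def)
  show "M = N"
  proof (rule fixed_std_eqI[OF M' N'])
  fix a assume a: "a : arcs Q"
  have *: "fv2.p.span (erel P a \<inter> ?S a) = erel P a" if "fixed_std d P" for P
  by (rule span_fixed_rel[OF rep_rel(2)[OF fixed_stdD(1)[OF that] a] fixed_std_rel[OF that a] equalityD1[OF fixed_stdD(5)[OF that]]])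
  have i: "erel M a \<inter> ?S a = erel N a \<inter> ?S a" using fun_cong[OF eq, of a] a by (simp only: restrict_apply if_True)
  show "erel M a = erel N a" by (rule trans[OF *[OF M', symmetric] trans[OF arg_cong[where f = fv2.p.span, OF i] *[OF N']]])
  qed
 qed
qed

lemma act_act:
 assumes M: "fixed_std d M" and eq: "!!i v. i : verts Q ==> v : sp (d i) ==> tht i (eta i v) = kap i v"
 shows "act d tht (act d eta M) = act d kap M"
proof (rule erep.equality)
 show "espace (act d tht (act d eta M)) = espace (act d kap M)" by (simp add: transport_def)
 show "erel (act d tht (act d eta M)) = erel (act d kap M)"
 proof
  fix a show "erel (act d tht (act d eta M)) a = erel (act d kap M) a"
  proof (cases "a : arcs Q")
  case a: True
  then have ht: "tail Q a : verts Q" "head Q a : verts Q" by auto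
  have "map_prod (tht (tail Q a)) (tht (head Q a)) (map_prod (eta (tail Q a)) (eta (head Q a)) p) =
  map_prod (kap (tail Q a)) (kap (head Q a)) p" if "p : erel M a" for p
  using subsetD[OF fixed_std_rel[OF M a] that] eq ht by (cases p) simp
  then have "map_prod (tht (tail Q a)) (tht (head Q a)) ` map_prod (eta (tail Q a)) (eta (head Q a)) ` erel M a =
  map_prod (kap (tail Q a)) (kap (head Q a)) ` erel M a" unfolding image_image by (rule image_cong[OF refl])
  then show ?thesis using a by (simp add: transport_def)
  qed (simp add: transport_def)
 qed
qed simp

lemma act_id:
 assumes M: "fixed_std d M" and eq: "!!i v. i : verts Q ==> v : sp (d i) ==> kap i v = v"
 shows "act d kap M = M"
proof (rule erep.equality)
 note s = fixed_stdD(2)[OF M]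
 show "espace (act d kap M) = espace M" using s by (simp add: transport_def std_rep_def fun_eq_iff)
 show "erel (act d kap M) = erel M"
 proof
  fix a show "erel (act d kap M) a = erel M a"
  proof (cases "a : arcs Q")
  case a: True
  then have ht: "tail Q a : verts Q" "head Q a : verts Q" by auto
  have "map_prod (kap (tail Q a)) (kap (head Q a)) p = p" if "p : erel M a" for p
  using subsetD[OF fixed_std_rel[OF M a] that] eq ht by (cases p) simp
  then have "map_prod (kap (tail Q a)) (kap (head Q a)) ` erel M a = (%p. p) ` erel M a" by (rule image_cong[OF refl])
  then show ?thesis using a by (simp add: transport_def)
  qed (use s in \<open>simp add: transport_def std_rep_def\<close>)
 qed
qed simp

lemma GLd_comp:
 assumes "tht : GLd d" "eta : GLd d"
 shows "EX kap. kap : GLd d & (ALL i:verts Q. ALL v:sp (d i). tht i (eta i v) = kap i v)"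
proof (intro exI conjI ballI)
 note t = GL1_D[OF GLd_GL1[OF assms(1)]] and h = GL1_D[OF GLd_GL1[OF assms(2)]]
 show "(\<lambda>i\<in>verts Q. restrict (tht i \<circ> eta i) (sp (d i))) : GLd d"
 proof (rule restrict_GLd)
  fix i assume i: "i : verts Q"
  show "linear_map_on (sp (d i)) (sp (d i)) (tht i \<circ> eta i)" by (rule linear_map_on_comp[OF h(1)[OF i] t(1)[OF i]])
  show "bij_betw (tht i \<circ> eta i) (sp (d i)) (sp (d i))" by (rule bij_betw_trans[OF h(2)[OF i] t(2)[OF i]])
  show "(tht i \<circ> eta i) (fr s v) = fr s ((tht i \<circ> eta i) v)" if "v : sp (d i)" for v
  using that h(3,5)[OF i] t(3)[OF i] by simp
 qed
qed simp

lemma GLd_inv: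
 assumes tht: "tht : GLd d"
 shows "EX eta. eta : GLd d & (ALL i:verts Q. ALL v:sp (d i). eta i (tht i v) = v)"
proof (intro exI conjI ballI)
 note t = GL1_D[OF GLd_GL1[OF tht]]
 let ?n = "%i. inv_into (sp (d i)) (tht i)"
 have inv: "?n i (tht i v) = v" "tht i (?n i v) = v" "?n i v : sp (d i)" if i: "i : verts Q" and v: "v : sp (d i)" for i v
  using t(2)[OF i] v by (simp_all add: bij_betw_def f_inv_into_f inv_into_into)
 show "(\<lambda>i\<in>verts Q. restrict (?n i) (sp (d i))) : GLd d"
 proof (rule restrict_GLd)
  fix i assume i: "i : verts Q"
  show "linear_map_on (sp (d i)) (sp (d i)) (?n i)" by (rule linear_map_on_inv_into[OF t(1,2)[OF i] subspace_sp])
  show "bij_betw (?n i) (sp (d i)) (sp (d i))" by (rule bij_betw_inv_into[OF t(2)[OF i]])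
  fix v :: "nat => 'a" assume v: "v : sp (d i)"
  have "fr s v = tht i (fr s (?n i v))" using inv(2)[OF i v] t(3)[OF i inv(3)[OF i v]] by simp
  then show "?n i (fr s v) = fr s (?n i v)" using inv(1)[OF i, of "fr s (?n i v)"] inv(3)[OF i v] by (simp add: fr_sp)
 qed
 show "(\<lambda>i\<in>verts Q. restrict (?n i) (sp (d i))) i (tht i v) = v" if "i : verts Q" "v : sp (d i)" for i v
  using that inv(1)[OF that] t(5)[OF that] by simp
qed

text \<open>Composition with \<open>tht\<close> injects the stabiliser into the coset, and
  composition with the inverse of \<open>tht\<close> injects the coset into the stabiliser.\<close>

lemma card_stabilizer_coset:
 assumes tht: "tht : GLd d" and M: "fixed_std d M"
 shows "card {eta : GLd d. act d eta M = act d tht M} = card {eta : GLd d. act d eta M = M}"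
proof -
 have fin: "finite {eta : GLd d. P eta}" for P using finite_GLd[of d] by simp
 have le: "card {eta : GLd d. act d eta M = N} <= card {eta : GLd d. act d eta M = act d kap N}" if kap: "kap : GLd d" for kap N
 proof -
  have "EX f. ALL eta:GLd d. f eta : GLd d & (ALL i:verts Q. ALL v:sp (d i). kap i (eta i v) = f eta i v)"
  by (rule bchoice, rule ballI, rule GLd_comp[OF kap])
  then obtain f where f0: "ALL eta:GLd d. f eta : GLd d & (ALL i:verts Q. ALL v:sp (d i). kap i (eta i v) = f eta i v)"
  by (elim exE)
  have f: "f eta : GLd d & (ALL i:verts Q. ALL v:sp (d i). kap i (eta i v) = f eta i v)" if "eta : GLd d" for eta
  using f0 that by (rule bspec)
  have "inj_on f {eta : GLd d. act d eta M = N}"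
  proof (rule inj_onI)
  fix eta eta' assume e: "eta : {eta : GLd d. act d eta M = N}" "eta' : {eta : GLd d. act d eta M = N}" "f eta = f eta'"
  then have g: "eta : GLd d" "eta' : GLd d" by auto
  show "eta = eta'"
  proof (rule GLd_eqI[OF g])
  fix i and v :: "nat => 'a" assume i: "i : verts Q" and v: "v : sp (d i)"
  have "kap i (eta i v) = kap i (eta' i v)" using f[OF g(1)] f[OF g(2)] e(3) i v by simp
  moreover have "eta i v : sp (d i)" "eta' i v : sp (d i)"
  by (rule GL1_D(5)[OF GLd_GL1[OF g(1) i] v], rule GL1_D(5)[OF GLd_GL1[OF g(2) i] v])
  ultimately show "eta i v = eta' i v"
  using GL1_D(2)[OF GLd_GL1[OF kap i]] by (simp add: bij_betw_def inj_on_def)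
  qed
  qed
  moreover have "f ` {eta : GLd d. act d eta M = N} \<subseteq> {eta : GLd d. act d eta M = act d kap N}"
  proof (rule image_subsetI)
  fix eta assume "eta : {eta : GLd d. act d eta M = N}"
  then have g: "eta : GLd d" and N: "act d eta M = N" by auto
  have "act d kap (act d eta M) = act d (f eta) M" by (rule act_act[OF M]) (use f[OF g] in blast)
  then show "f eta : {eta : GLd d. act d eta M = act d kap N}" using f[OF g] N by simp
  qed
  ultimately show ?thesis using fin by (rule card_inj_on_le)
 qed
 obtain eta where eta0: "eta : GLd d & (ALL i:verts Q. ALL v:sp (d i). eta i (tht i v) = v)"
  using GLd_inv[OF tht] by (elim exE)
 note eta = conjunct1[OF eta0] conjunct2[OF eta0, rule_format]
 have "act d eta (act d tht M) = M"
  using act_act[OF M, of eta tht "%i v. v"] eta(2) act_id[OF M, of "%i v. v"] by simp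
 then show ?thesis using le[OF tht, of M] le[OF eta(1), of "act d tht M"] by simp
qed

text \<open>For a given group element, being fixed is a separate condition on the relation at each
  arrow, involving only the automorphisms at its two ends.\<close>

lemma card_fixed_StdF:
 assumes tht: "tht : GLd d"
 shows "card {M : StdF d rho sig. act d tht M = M} =
  (\<Prod>a\<in>arcs Q. card (fixed_rels (rho a) (sig a) (d (tail Q a)) (d (head Q a)) (tht (tail Q a)) (tht (head Q a))))"
proof -
 let ?F = "%a. fixed_rels (rho a) (sig a) (d (tail Q a)) (d (head Q a)) (tht (tail Q a)) (tht (head Q a))"
 let ?r = "%M. \<lambda>a\<in>arcs Q. erel M a"
 let ?m = "%f. \<lparr>espace = %i. if i : verts Q then sp (d i) else {}, erel = %a. if a : arcs Q then f a else {}\<rparr>"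
 have ht: "tail Q a : verts Q" "head Q a : verts Q" if "a : arcs Q" for a using that by auto
 have "bij_betw ?r {M : StdF d rho sig. act d tht M = M} (\<Pi>\<^sub>E a\<in>arcs Q. ?F a)"
 proof (rule bij_betw_byWitness[of _ ?m])
  show "ALL M:{M : StdF d rho sig. act d tht M = M}. ?m (?r M) = M"
  proof
  fix M assume "M : {M : StdF d rho sig. act d tht M = M}"
  then have s: "std_rep Q d M" by (simp add: StdF_def fixed_std_def)
  show "?m (?r M) = M"
  proof (rule erep.equality)
  show "espace (?m (?r M)) = espace M" using s unfolding std_rep_def by (intro ext) simp
  show "erel (?m (?r M)) = erel M"
  proof
  fix a show "erel (?m (?r M)) a = erel M a" using s unfolding std_rep_def by (cases "a : arcs Q") simp_all
  qed
  qed simp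
  qed
  show "ALL f:\<Pi>\<^sub>E a\<in>arcs Q. ?F a. ?r (?m f) = f"
  proof
  fix f assume f: "f : (\<Pi>\<^sub>E a\<in>arcs Q. ?F a)"
  show "?r (?m f) = f"
  proof
  fix a show "?r (?m f) a = f a" by (cases "a : arcs Q") (simp_all add: PiE_arb[OF f])
  qed
  qed
  show "?r ` {M : StdF d rho sig. act d tht M = M} \<subseteq> (\<Pi>\<^sub>E a\<in>arcs Q. ?F a)"
  proof (rule image_subsetI, rule PiE_I)
  fix M a assume "M : {M : StdF d rho sig. act d tht M = M}" and a: "a : arcs Q"
  then have M: "fixed_std d M" and T: "has_type Q rho sig M" and e: "act d tht M = M"
  by (simp_all only: StdF_def mem_Collect_eq simp_thms)
  have "erel (act d tht M) a = erel M a" unfolding e ..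
  then have 1: "map_prod (tht (tail Q a)) (tht (head Q a)) ` erel M a = erel M a" using a by (simp add: transport_def)
  have 2: "linear_relation (sp (d (tail Q a))) (sp (d (head Q a))) (erel M a)"
  unfolding linear_relation_def using fixed_std_rel[OF M a] rep_rel(2)[OF fixed_stdD(1)[OF M] a] by (rule conjI)
  have 3: "(rho a = 0 --> Ker_rel (erel M a) = {0}) & (rho a = 1 --> Def_rel (erel M a) = sp (d (tail Q a))) \<and>
  (sig a = 0 --> Ind_rel (erel M a) = {0}) & (sig a = 1 --> Im_rel (erel M a) = sp (d (head Q a)))"
  using bspec[OF T[unfolded has_type_def] a] unfolding fixed_stdD(4)[OF M ht(1)[OF a]] fixed_stdD(4)[OF M ht(2)[OF a]] .
  have "erel M a : ?F a" unfolding fixed_rels_def equipped_relation_def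
  by (intro CollectI conjI[OF conjI[OF 2 3]] conjI[OF fixed_stdD(5)[OF M] 1])
  then show "?r M a : ?F a" using a by simp
  qed simp
  show "?m ` (\<Pi>\<^sub>E a\<in>arcs Q. ?F a) \<subseteq> {M : StdF d rho sig. act d tht M = M}"
  proof (rule image_subsetI)
  fix f assume f: "f : (\<Pi>\<^sub>E a\<in>arcs Q. ?F a)"
  have fa: "f a : ?F a" if "a : arcs Q" for a using PiE_mem[OF f that] .
  note all = fa[unfolded fixed_rels_def equipped_relation_def mem_Collect_eq]
  note lin = all[THEN conjunct1, THEN conjunct1] and ty = all[THEN conjunct1, THEN conjunct2]
  and frf = all[THEN conjunct2, THEN conjunct1] and gf = all[THEN conjunct2, THEN conjunct2]
  have "rel_rep Q (?m f)" unfolding rel_rep_def using lin ht by (simp add: fin_dim_sp)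
  moreover have "std_rep Q d (?m f)" by (simp add: std_rep_def)
  moreover have "map_rep (fr s) (?m f) = ?m f"
  proof (rule erep.equality)
  show "espace (map_rep (fr s) (?m f)) = espace (?m f)" by (rule ext) (simp add: map_rep_def fr_sp_image)
  show "erel (map_rep (fr s) (?m f)) = erel (?m f)"
  proof
  fix a show "erel (map_rep (fr s) (?m f)) a = erel (?m f) a"
  using frf[of a] by (cases "a : arcs Q") (simp_all only: map_rep_def erep.simps if_True if_False simp_thms image_empty)
  qed
  qed simp
  moreover have "has_type Q rho sig (?m f)" unfolding has_type_def
  proof
  fix a assume a: "a : arcs Q"
  show "(rho a = 0 --> Ker_rel (erel (?m f) a) = {0}) & (rho a = 1 --> Def_rel (erel (?m f) a) = espace (?m f) (tail Q a)) \<and>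
  (sig a = 0 --> Ind_rel (erel (?m f) a) = {0}) & (sig a = 1 --> Im_rel (erel (?m f) a) = espace (?m f) (head Q a))"
  using ty[OF a] by (simp only: erep.simps if_True if_False a ht[OF a])
  qed
  moreover have "act d tht (?m f) = ?m f"
  proof (rule erep.equality)
  show "espace (act d tht (?m f)) = espace (?m f)" by (rule ext) (simp add: transport_def)
  show "erel (act d tht (?m f)) = erel (?m f)"
  proof
  fix a show "erel (act d tht (?m f)) a = erel (?m f) a"
  using gf[of a] by (cases "a : arcs Q") (simp_all only: transport_def erep.simps if_True if_False simp_thms)
  qed
  qed simp
  ultimately show "?m f : {M : StdF d rho sig. act d tht M = M}" unfolding StdF_def fixed_std_def by (intro CollectI conjI)
  qed
 qed
 then have "card {M : StdF d rho sig. act d tht M = M} = card (\<Pi>\<^sub>E a\<in>arcs Q. ?F a)" by (rule bij_betw_same_card)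
 also have "... = (\<Prod>a\<in>arcs Q. card (?F a))" by (rule card_PiE) simp
 finally show ?thesis .
qed

text \<open>Noether-Deuring identifies isomorphism with lying in one orbit of the finite group, so
  Burnside's lemma applies; by \<open>card_fixed_rels\<close> the Burnside sum is the same
  expression for all types.\<close>

theorem card_classes_independent:
 assumes t: "rho : arcs Q \<rightarrow> {0, 1}" "sig : arcs Q \<rightarrow> {0, 1}" and t': "rho' : arcs Q \<rightarrow> {0, 1}" "sig' : arcs Q \<rightarrow> {0, 1}"
 shows "card (cls ` StdF d rho sig) = card (cls ` StdF d rho' sig')"
proof -
 have burnside: "card (cls ` StdF d rho sig) * card (GLd d) = (\<Sum>tht\<in>GLd d. \<Prod>a\<in>arcs Q.
  card (fs.Hm (spF (d (tail Q a))) (tht (tail Q a)) (spF (d (head Q a))) (tht (head Q a))))"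
  if t: "rho : arcs Q \<rightarrow> {0, 1}" "sig : arcs Q \<rightarrow> {0, 1}" for rho sig
 proof -
  have "card (cls ` StdF d rho sig) * card (GLd d) = (\<Sum>tht\<in>GLd d. card {M : StdF d rho sig. act d tht M = M})"
  proof (rule card_orbits_times_card_group[OF finite_GLd finite_StdF])
  show "act d tht M : StdF d rho sig" if "tht : GLd d" "M : StdF d rho sig" for tht M using that by (rule act_StdF)
  show "cls M = cls N \<longleftrightarrow> (EX tht:GLd d. act d tht M = N)" if M: "M : StdF d rho sig" and N: "N : StdF d rho sig" for M N
  proof -
  have M': "fixed_std d M" and N': "fixed_std d N" using M N by (auto simp: StdF_def)
  have "riso M N \<longleftrightarrow> (EX tht:GLd d. act d tht M = N)"
  proof
  assume "riso M N"
  then obtain tht where "tht : (\<Pi>\<^sub>E i\<in>verts Q. GL1 (d i))" "act d tht M = N" by (rule noether_deuring[OF M' N'])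
  then show "EX tht:GLd d. act d tht M = N" by (auto simp: GLd_def)
  qed (use act_fixed_std(2)[OF _ M'] in auto)
  then show ?thesis using cls_eq_iff[OF fixed_stdD(1)[OF M'] fixed_stdD(1)[OF N']] by simp
  qed
  show "card {eta : GLd d. act d eta M = act d tht M} = card {eta : GLd d. act d eta M = M}"
  if "tht : GLd d" "M : StdF d rho sig" for tht M
  using that by (intro card_stabilizer_coset) (simp_all add: StdF_def)
  qed
  also have "... = (\<Sum>tht\<in>GLd d. \<Prod>a\<in>arcs Q. card (fs.Hm (spF (d (tail Q a))) (tht (tail Q a)) (spF (d (head Q a))) (tht (head Q a))))"
  proof (rule sum.cong[OF refl])
  fix tht assume tht: "tht : GLd d"
  show "card {M : StdF d rho sig. act d tht M = M} = (\<Prod>a\<in>arcs Q. card (fs.Hm (spF (d (tail Q a))) (tht (tail Q a)) (spF (d (head Q a))) (tht (head Q a))))"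
  unfolding card_fixed_StdF[OF tht]
  proof (rule prod.cong[OF refl])
  fix a assume a: "a : arcs Q"
  then have ht: "tail Q a : verts Q" "head Q a : verts Q" by auto
  show "card (fixed_rels (rho a) (sig a) (d (tail Q a)) (d (head Q a)) (tht (tail Q a)) (tht (head Q a))) =
  card (fs.Hm (spF (d (tail Q a))) (tht (tail Q a)) (spF (d (head Q a))) (tht (head Q a)))"
  by (rule card_fixed_rels[OF GLd_GL1[OF tht ht(1)] GLd_GL1[OF tht ht(2)] funcset_mem[OF t(1) a] funcset_mem[OF t(2) a]])
  qed
  qed
  finally show ?thesis .
 qed
 have "(\<lambda>i\<in>verts Q. restrict (%v. v) (sp (d i))) : GLd d"
  by (rule restrict_GLd) (auto intro: linear_map_on_id simp: bij_betw_def)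
 then have "card (GLd d) > 0" using finite_GLd by (auto simp: card_gt_0_iff)
 moreover have "card (cls ` StdF d rho sig) * card (GLd d) = card (cls ` StdF d rho' sig') * card (GLd d)"
  unfolding burnside[OF t] burnside[OF t'] ..
 ultimately show ?thesis by simp
qed

definition fixed_classes :: "('v => nat) => ('e => nat) => ('e => nat) => ('v, 'e, nat, 'a) erep set set" where
 "fixed_classes d rho sig = {cls M |M. rel_rep Q M & has_type Q rho sig M & (ALL i:verts Q. fv.dim (espace M i) = d i) \<and>
  map_rep (fr s) ` cls M = cls M}"

text \<open>By Lang's theorem every class stable under Frobenius contains a standard representation
  that equals its own twist.\<close>

lemma fixed_classes_eq: "fixed_classes d rho sig = cls ` StdF d rho sig"
proof
 show "cls ` StdF d rho sig \<subseteq> fixed_classes d rho sig"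
 proof (rule image_subsetI)
  fix M assume "M : StdF d rho sig"
  then have M: "fixed_std d M" and T: "has_type Q rho sig M" by (auto simp: StdF_def)
  have "map_rep (fr s) ` cls M = cls M" unfolding map_rep_cls[OF semilinear_bij_fr] fixed_stdD(3)[OF M] ..
  moreover have "ALL i:verts Q. fv.dim (espace M i) = d i" using fixed_stdD(4)[OF M] by (simp add: dim_sp)
  ultimately show "cls M : fixed_classes d rho sig" using fixed_stdD(1)[OF M] T unfolding fixed_classes_def by blast
 qed
 show "fixed_classes d rho sig \<subseteq> cls ` StdF d rho sig"
 proof
  fix c assume "c : fixed_classes d rho sig"
  then obtain M where M: "c = cls M" "rel_rep Q M" "has_type Q rho sig M" "ALL i:verts Q. fv.dim (espace M i) = d i"
  "map_rep (fr s) ` cls M = cls M" unfolding fixed_classes_def by blast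
  obtain N :: "('v, 'e, nat, 'a) erep" where N: "rel_rep Q N" "std_rep Q d N" "riso M N"
  using std_exists[OF M(2), of d] M(4) by metis
  have cN: "cls N = c" using N(1,3) M(1,2) cls_eq_iff by metis
  have "cls (map_rep (fr s) N) = cls N"
  using M(5) unfolding M(1)[symmetric] cN[symmetric] map_rep_cls[OF semilinear_bij_fr] .
  then have "riso (map_rep (fr s) N) N"
  using cls_eq_iff[OF map_rep_rep[OF semilinear_bij_fr N(1)] N(1)] by simp
  from lang_std[OF N(1,2) this] obtain Y :: "('v, 'e, nat, 'a) erep"
  where Y: "rel_rep Q Y" "std_rep Q d Y" "map_rep (fr s) Y = Y" "riso N Y" .
  have "has_type Q rho sig Y" using iso_type[OF M(2) Y(1) iso_trans[OF N(3) Y(4)] M(3)] .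
  then have "Y : StdF d rho sig" using Y by (simp add: StdF_def fixed_std_def)
  moreover have "cls Y = c" using cls_eq_iff[OF N(1) Y(1)] Y(4) cN by simp
  ultimately show "c : cls ` StdF d rho sig" by blast
 qed
qed

lemma finite_fixed_classes: "finite (fixed_classes d rho sig)"
 unfolding fixed_classes_eq by (rule finite_imageI[OF finite_StdF])

lemma card_fixed_classes:
 assumes "rho : arcs Q \<rightarrow> {0, 1}" "sig : arcs Q \<rightarrow> {0, 1}" "rho' : arcs Q \<rightarrow> {0, 1}" "sig' : arcs Q \<rightarrow> {0, 1}"
 shows "card (fixed_classes d rho sig) = card (fixed_classes d rho' sig')"
 unfolding fixed_classes_eq by (rule card_classes_independent[OF assms])

end

section \<open>Equivariant bijections from fixed-point counts\<close>

definition min_period :: "('a => 'a) => 'a => nat" where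
 "min_period f x = (LEAST m. m > 0 & (f ^^ m) x = x)"

lemma min_period:
 assumes "EX m>0. (f ^^ m) x = x"
 shows "min_period f x > 0" "(f ^^ min_period f x) x = x"
 using LeastI_ex[OF assms] by (simp_all add: min_period_def)

lemma funpow_fixed_iff_dvd:
 assumes ex: "EX m>0. (f ^^ m) x = x"
 shows "(f ^^ e) x = x \<longleftrightarrow> min_period f x dvd e"
proof -
 let ?p = "min_period f x"
 have m: "(f ^^ (e mod ?p)) x = (f ^^ e) x" by (rule funpow_mod_eq[OF min_period(2)[OF ex]])
 show ?thesis
 proof
  assume e: "(f ^^ e) x = x"
  have "e mod ?p = 0"
  proof (rule ccontr)
  assume "e mod ?p ~= 0"
  then have "e mod ?p > 0 & (f ^^ (e mod ?p)) x = x" using m e by simp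
  then have "?p <= e mod ?p" unfolding min_period_def by (rule Least_le)
  then show False using mod_less_divisor[OF min_period(1)[OF ex], of e] by simp
  qed
  then show "?p dvd e" by auto
 qed (use m in simp)
qed

lemma orbit_inj_on:
 assumes k: "k > 0" and p: "!!m. (f ^^ m) x = x \<longleftrightarrow> k dvd m"
 shows "inj_on (%j. (f ^^ j) x) {..<k}"
proof -
 have "i = j" if ij: "i <= j" "j < k" "(f ^^ i) x = (f ^^ j) x" for i j
 proof -
  have "(f ^^ (k - i + j)) x = (f ^^ (k - i)) ((f ^^ j) x)" by (simp add: funpow_add)
  also have "... = (f ^^ (k - i + i)) x" by (simp only: ij(3)[symmetric] funpow_add o_apply)
  also have "... = x" using p[of k] ij by simp
  finally have "k dvd k - i + j" using p by simp
  then have "k dvd (j - i) + k" using ij by (simp add: add.commute)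
  then have "k dvd j - i" by simp
  then show ?thesis using ij by (auto dest: dvd_imp_le)
 qed
 then show ?thesis by (intro linorder_inj_onI') (auto intro: less_imp_le)
qed

text \<open>Every orbit is a cycle of length exactly \<open>k\<close>. One orbit on each side is
  matched by rotating along both, and induction treats the complements.\<close>

lemma equivariant_bij_const_period:
 fixes f :: "'a => 'a" and g :: "'b => 'b"
 assumes "finite E" "finite E'" "card E = card E'" "f ` E \<subseteq> E" "g ` E' \<subseteq> E'" and k: "k > 0"
  and "!!x m. x : E ==> (f ^^ m) x = x \<longleftrightarrow> k dvd m" "!!y m. y : E' ==> (g ^^ m) y = y \<longleftrightarrow> k dvd m"
 shows "EX b. bij_betw b E E' & (ALL x:E. b (f x) = g (b x))"
 using assms(1-5,7,8)
proof (induction "card E" arbitrary: E E' rule: less_induct)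
 case (less E E')
 show ?case
 proof (cases "E = {}")
  case True
  then have "E' = {}" using less.prems by simp
  then show ?thesis using True by (simp add: bij_betw_def)
 next
  case False
  then obtain x where x: "x : E" by blast
  have "card E > 0" using x less.prems(1) by (auto simp: card_gt_0_iff)
  then obtain y where y: "y : E'" using less.prems(3) by fastforce
  \<comment> \<open>Stated for an arbitrary map \<open>h\<close> so as to serve for both
    \<open>f\<close> and \<open>g\<close>: an orbit consists of \<open>k\<close> distinct points,
    and its complement is again stable.\<close>
  have orb: "inj_on (%j. (h ^^ j) z) {..<k} & (%j. (h ^^ j) z) ` {..<k} \<subseteq> Z \<and>
  h ` (Z - (%j. (h ^^ j) z) ` {..<k}) \<subseteq> Z - (%j. (h ^^ j) z) ` {..<k} \<and>
  (ALL n. (h ^^ (n mod k)) z = (h ^^ n) z)"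
  if Z: "h ` Z \<subseteq> Z" "!!z m. z : Z ==> (h ^^ m) z = z \<longleftrightarrow> k dvd m" "z : Z" for h :: "'c => 'c" and Z z
  proof -
  have i: "inj_on (%j. (h ^^ j) z) {..<k}" by (rule orbit_inj_on[OF k Z(2)[OF Z(3)]])
  have "(h ^^ j) z : Z" for j using Z(1,3) by (induction j) auto
  then have s: "(%j. (h ^^ j) z) ` {..<k} \<subseteq> Z" by auto
  have m: "(h ^^ (n mod k)) z = (h ^^ n) z" for n using Z(2)[OF Z(3), of k] by (intro funpow_mod_eq) simp
  have "h u \<notin> (%j. (h ^^ j) z) ` {..<k}" if u: "u : Z" "u \<notin> (%j. (h ^^ j) z) ` {..<k}" for u
  proof
  assume "h u : (%j. (h ^^ j) z) ` {..<k}"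
  then obtain j where j: "h u = (h ^^ j) z" by auto
  have "u = (h ^^ k) u" using Z(2)[OF u(1), of k] by simp
  also have "... = (h ^^ (k - 1)) (h u)" using k by (cases k) (simp_all add: funpow_swap1)
  also have "... = (h ^^ (k - 1 + j)) z" by (simp add: j funpow_add)
  also have "... = (h ^^ ((k - 1 + j) mod k)) z" by (rule m[symmetric])
  finally show False using u(2) k by auto
  qed
  then show ?thesis using i s m Z(1) by auto
  qed
  let ?o = "%j. (f ^^ j) x" and ?o' = "%j. (g ^^ j) y"
  let ?O = "?o ` {..<k}" and ?O' = "?o' ` {..<k}"
  have o: "inj_on ?o {..<k} & ?O \<subseteq> E & f ` (E - ?O) \<subseteq> E - ?O & (ALL n. (f ^^ (n mod k)) x = (f ^^ n) x)"
  by (rule orb[OF less.prems(4,6) x])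
  have o': "inj_on ?o' {..<k} & ?O' \<subseteq> E' & g ` (E' - ?O') \<subseteq> E' - ?O' & (ALL n. (g ^^ (n mod k)) y = (g ^^ n) y)"
  by (rule orb[OF less.prems(5,7) y])
  have c: "card ?O = k" "card ?O' = k" using o o' by (simp_all add: card_image)
  have "card (E - ?O) = card E - k" "card (E' - ?O') = card E' - k"
  using o o' c by (simp_all add: card_Diff_subset)
  then have "card (E - ?O) = card (E' - ?O')" "card (E - ?O) < card E"
  using less.prems(3) k \<open>card E > 0\<close> by simp_all
  then have "EX b. bij_betw b (E - ?O) (E' - ?O') & (ALL z:E - ?O. b (f z) = g (b z))"
  using o o' less.prems by (intro less.hyps) auto
  then obtain b where b: "bij_betw b (E - ?O) (E' - ?O')" "ALL z:E - ?O. b (f z) = g (b z)" by blast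
  let ?i = "inv_into {..<k} ?o"
  have i: "?i (?o j) = j" if "j < k" for j using o that by (intro inv_into_f_f) auto
  define B where "B z = (if z : ?O then ?o' (?i z) else b z)" for z
  have "bij_betw ?o {..<k} ?O" "bij_betw ?o' {..<k} ?O'" using o o' by (simp_all add: bij_betw_def)
  then have "bij_betw (?o' \<circ> ?i) ?O ?O'" by (intro bij_betw_trans[OF bij_betw_inv_into])
  then have 1: "bij_betw B ?O ?O'" by (rule iffD1[OF bij_betw_cong, rotated]) (simp add: B_def)
  have 2: "bij_betw B (E - ?O) (E' - ?O')" by (rule iffD1[OF bij_betw_cong b(1)]) (simp add: B_def)
  have "bij_betw B (?O \<union> (E - ?O)) (?O' \<union> (E' - ?O'))" by (rule bij_betw_combine[OF 1 2]) blast
  moreover have "?O \<union> (E - ?O) = E" "?O' \<union> (E' - ?O') = E'" using o o' by blast+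
  moreover have "B (f z) = g (B z)" if z: "z : E" for z
  proof (cases "z : ?O")
  case True
  then obtain j where j: "j < k" "z = ?o j" by auto
  have fz: "f z = ?o (Suc j mod k)" using o j by (metis funpow.simps(2) o_apply)
  have "B (f z) = ?o' (Suc j mod k)" unfolding fz using i[of "Suc j mod k"] k by (simp add: B_def)
  also have "... = ?o' (Suc j)" using o' by blast
  also have "... = g (B z)" using i[OF j(1)] True j by (simp add: B_def)
  finally show ?thesis .
  next
  case False
  then have "f z \<notin> ?O" using o z by blast
  then show ?thesis using False b(2) z by (simp add: B_def)
  qed
  ultimately show ?thesis by auto
 qed
qed

lemma min_period_step:
 assumes f: "f ` S \<subseteq> S" and per: "!!x. x : S ==> EX m>0. (f ^^ m) x = x" and x: "x : S"
 shows "min_period f (f x) = min_period f x"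
proof -
 obtain p where p: "p > 0" "(f ^^ p) x = x" using per[OF x] by blast
 have "(f ^^ m) (f x) = f x \<longleftrightarrow> (f ^^ m) x = x" for m
 proof
  assume "(f ^^ m) (f x) = f x"
  then have e: "f ((f ^^ m) x) = f x" by (simp add: funpow_swap1)
  have "(f ^^ m) x = (f ^^ m) ((f ^^ p) x)" using p by simp
  also have "... = (f ^^ p) ((f ^^ m) x)" by (metis add.commute funpow_add o_apply)
  also have "... = (f ^^ (p - 1)) (f ((f ^^ m) x))" using p(1) by (cases p) (simp_all add: funpow_swap1)
  also have "... = (f ^^ (p - 1)) (f x)" by (simp only: e)
  also have "... = (f ^^ p) x" using p(1) by (cases p) (simp_all add: funpow_swap1)
  finally show "(f ^^ m) x = x" using p by simp
 qed (simp add: funpow_swap1[symmetric])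
 then show ?thesis by (simp add: min_period_def)
qed

text \<open>The fixed points of the \<open>k\<close>-th iterate are those whose exact period divides
  \<open>k\<close>. Subtracting the proper divisors, known by induction, isolates the points of
  period \<open>k\<close>; this is Moebius inversion done recursively.\<close>

lemma card_period_eq:
 fixes f :: "'a => 'a" and g :: "'b => 'b"
 assumes per: "!!x. x : S ==> EX m>0. (f ^^ m) x = x" and per': "!!y. y : S' ==> EX m>0. (g ^^ m) y = y"
  and fin: "!!e. e > 0 ==> finite {x : S. (f ^^ e) x = x}" and fin': "!!e. e > 0 ==> finite {y : S'. (g ^^ e) y = y}"
  and eq: "!!e. e > 0 ==> card {x : S. (f ^^ e) x = x} = card {y : S'. (g ^^ e) y = y}"
  and k: "k > 0"
 shows "card {x : S. min_period f x = k} = card {y : S'. min_period g y = k}"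
 using k
proof (induction k rule: less_induct)
 case (less k)
 have part: "card {x : Z. (h ^^ k) x = x} = card {x : Z. min_period h x = k} +
  (\<Sum>j\<in>{j. j dvd k} - {k}. card {x : Z. min_period h x = j})"
  if per: "!!x. x : Z ==> EX m>0. (h ^^ m) x = x" and fin: "!!e. e > 0 ==> finite {x : Z. (h ^^ e) x = x}"
  for h :: "'c => 'c" and Z
 proof -
  have fk: "finite {j. j dvd k}" using less.prems by simp
  have fj: "finite {x : Z. min_period h x = j}" if "j dvd k" for j
  proof (rule finite_subset[OF _ fin])
  show "j > 0" using that less.prems by (auto intro: dvd_pos_nat)
  show "{x : Z. min_period h x = j} \<subseteq> {x : Z. (h ^^ j) x = x}" using min_period(2)[OF per] by auto
  qed
  have "{x : Z. (h ^^ k) x = x} = (\<Union>j\<in>{j. j dvd k}. {x : Z. min_period h x = j})"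
  using funpow_fixed_iff_dvd[OF per] by auto
  then have "card {x : Z. (h ^^ k) x = x} = (\<Sum>j\<in>{j. j dvd k}. card {x : Z. min_period h x = j})"
  using card_UN_disjoint[OF fk, of "%j. {x : Z. min_period h x = j}"] fj by auto
  also have "... = card {x : Z. min_period h x = k} + (\<Sum>j\<in>{j. j dvd k} - {k}. card {x : Z. min_period h x = j})"
  by (rule sum.remove[OF fk]) simp
  finally show ?thesis .
 qed
 have "(\<Sum>j\<in>{j. j dvd k} - {k}. card {x : S. min_period f x = j}) = (\<Sum>j\<in>{j. j dvd k} - {k}. card {y : S'. min_period g y = j})"
 proof (rule sum.cong[OF refl])
  fix j assume "j : {j. j dvd k} - {k}"
  then have "j < k" "j > 0" using less.prems by (auto dest: dvd_imp_le intro: dvd_pos_nat)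
  then show "card {x : S. min_period f x = j} = card {y : S'. min_period g y = j}" by (rule less.IH)
 qed
 then show ?case using part[OF per fin] part[OF per' fin'] eq[OF less.prems] by simp
qed

text \<open>The sets may be infinite, but each piece of given weight and given exact period is
  finite and has the same size on both sides. The bijections of the pieces are glued.\<close>

lemma equivariant_bij:
 fixes f :: "'a => 'a" and g :: "'b => 'b" and w :: "'a => 'c" and w' :: "'b => 'c"
 assumes f: "f ` S \<subseteq> S" and g: "g ` S' \<subseteq> S'"
  and per: "!!x. x : S ==> EX m>0. (f ^^ m) x = x" and per': "!!y. y : S' ==> EX m>0. (g ^^ m) y = y"
  and w: "!!x. x : S ==> w (f x) = w x" and w': "!!y. y : S' ==> w' (g y) = w' y"
  and fin: "!!e \<beta>. e > 0 ==> finite {x : S. w x = \<beta> & (f ^^ e) x = x}"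
  and fin': "!!e \<beta>. e > 0 ==> finite {y : S'. w' y = \<beta> & (g ^^ e) y = y}"
  and eq: "!!e \<beta>. e > 0 ==> card {x : S. w x = \<beta> & (f ^^ e) x = x} = card {y : S'. w' y = \<beta> & (g ^^ e) y = y}"
 shows "EX b. bij_betw b S S' & (ALL x:S. w' (b x) = w x & b (f x) = g (b x))"
proof -
 let ?E = "%\<beta> k. {x : S. w x = \<beta> & min_period f x = k}" and ?E' = "%\<beta> k. {y : S'. w' y = \<beta> & min_period g y = k}"
 have ex: "EX b. bij_betw b (?E \<beta> k) (?E' \<beta> k) & (ALL x:?E \<beta> k. b (f x) = g (b x))" if k: "k > 0" for \<beta> k
 proof (rule equivariant_bij_const_period[OF _ _ _ _ _ k])
  show "finite (?E \<beta> k)" using min_period(2)[OF per] by (intro finite_subset[OF _ fin[OF k, of \<beta>]]) auto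
  show "finite (?E' \<beta> k)" using min_period(2)[OF per'] by (intro finite_subset[OF _ fin'[OF k, of \<beta>]]) auto
  have "card {x : {x : S. w x = \<beta>}. min_period f x = k} = card {y : {y : S'. w' y = \<beta>}. min_period g y = k}"
  by (rule card_period_eq[OF _ _ _ _ _ k]) (use per per' fin[of _ \<beta>] fin'[of _ \<beta>] eq[of _ \<beta>] in \<open>simp_all add: conj_assoc\<close>)
  then show "card (?E \<beta> k) = card (?E' \<beta> k)" by (simp add: conj_assoc)
  show "f ` ?E \<beta> k \<subseteq> ?E \<beta> k" using f w min_period_step[OF f per] by auto
  show "g ` ?E' \<beta> k \<subseteq> ?E' \<beta> k" using g w' min_period_step[OF g per'] by auto
  show "(f ^^ m) x = x \<longleftrightarrow> k dvd m" if "x : ?E \<beta> k" for x m using funpow_fixed_iff_dvd[OF per] that by auto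
  show "(g ^^ m) y = y \<longleftrightarrow> k dvd m" if "y : ?E' \<beta> k" for y m using funpow_fixed_iff_dvd[OF per'] that by auto
 qed
 \<comment> \<open>The choice depends on weight and period only, not on the point, so that all
   points of a piece use the same bijection.\<close>
 define B where "B \<beta> k = (SOME b. bij_betw b (?E \<beta> k) (?E' \<beta> k) & (ALL x:?E \<beta> k. b (f x) = g (b x)))" for \<beta> k
 have B0: "bij_betw (B \<beta> k) (?E \<beta> k) (?E' \<beta> k) & (ALL x:?E \<beta> k. B \<beta> k (f x) = g (B \<beta> k x))" if "k > 0" for \<beta> k
  unfolding B_def by (rule someI_ex[OF ex[OF that]])
 note B = B0[THEN conjunct1] B0[THEN conjunct2, rule_format]
 define b where "b x = B (w x) (min_period f x) x" for x
 have bE: "b x : ?E' (w x) (min_period f x)" if x: "x : S" for x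
  using bij_betwE[OF B(1)[OF min_period(1)[OF per[OF x]]]] x by (simp add: b_def)
 have "inj_on b S"
 proof (rule inj_onI)
  fix x y assume x: "x : S" and y: "y : S" and xy: "b x = b y"
  then have e: "w x = w y" "min_period f x = min_period f y" using bE[OF x] bE[OF y] by auto
  show "x = y"
  using bij_betw_imp_inj_on[OF B(1)[OF min_period(1)[OF per[OF x]]], of "w x"] xy x y e
  by (auto simp: b_def inj_on_def)
 qed
 moreover have "b ` S = S'"
 proof
  show "b ` S \<subseteq> S'" using bE by auto
  show "S' \<subseteq> b ` S"
  proof
  fix y assume y: "y : S'"
  have "y : B (w' y) (min_period g y) ` ?E (w' y) (min_period g y)"
  using bij_betw_imp_surj_on[OF B(1)[OF min_period(1)[OF per'[OF y]]], of "w' y"] y by simp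
  then obtain x where "x : S" "w x = w' y" "min_period f x = min_period g y" "y = B (w' y) (min_period g y) x" by auto
  then have "y = b x" by (simp add: b_def)
  then show "y : b ` S" using \<open>x : S\<close> by blast
  qed
 qed
 moreover have "b (f x) = g (b x)" if x: "x : S" for x
  using B(2)[OF min_period(1)[OF per[OF x]], of x "w x"] x w min_period_step[OF f per x] by (simp add: b_def)
 ultimately show ?thesis using bE by (auto simp: bij_betw_def)
qed

section \<open>Frobenius on isomorphism classes, and the reduction to indecomposables\<close>

lemma map_rep_comp: "map_rep g (map_rep h M) = map_rep (g \<circ> h) M"
 by (simp add: map_rep_def image_image map_prod.comp[symmetric] fun_eq_iff)

lemma fr_funpow: "fr s ^^ e = fr (s ^ e)"
proof (induction e)
 case (Suc e)
 have "fr s \<circ> fr (s ^ e) = fr (s ^ Suc e)" by (simp add: fr_def fun_eq_iff power_mult[symmetric] mult.commute)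
 then show ?case by (simp only: funpow.simps Suc)
qed (simp add: fr_def fun_eq_iff)

context frob_quiver begin

definition Phi :: "('v, 'e, nat, 'a) erep set => ('v, 'e, nat, 'a) erep set" where
 "Phi c = map_rep (fr s) ` c"

lemma Phi_funpow: "(Phi ^^ e) c = map_rep (fr (s ^ e)) ` c"
proof (induction e)
 case 0
 have 1: "(fr (Suc 0) :: (nat => 'a) => _) = id" by (simp add: fr_def fun_eq_iff)
 have "map_rep (fr 1) N = N" for N :: "('v, 'e, nat, 'a) erep"
  by (rule erep.equality) (simp_all add: map_rep_def 1 prod.map_id0)
 then show ?case by simp
next
 case (Suc e)
 have "fr s \<circ> fr (s ^ e) = (fr (s ^ Suc e) :: (nat => 'a) => _)" by (simp only: fr_funpow[symmetric] funpow.simps)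
 note eq = this
 have "(Phi ^^ Suc e) c = Phi (map_rep (fr (s ^ e)) ` c)" by (simp add: Suc)
 also have "... = map_rep (fr s \<circ> fr (s ^ e)) ` c" by (simp add: Phi_def image_image map_rep_comp)
 finally show ?case unfolding eq .
qed

lemma frob_quiver_power: "e > 0 ==> frob_quiver TYPE('a) Q (s ^ e)"
 by (intro frob_quiver.intro quiver_axioms frob_power)

lemma cdim_arb: "i \<notin> verts Q ==> cdim c i = 0"
 by (simp add: cdim_def)

lemma Ind_E:
 assumes "c : Ind rho sig"
 obtains N where "indec N" "has_type Q rho sig N" "c = cls N"
 using assms unfolding Ind_def by blast

lemma Phi_Ind:
 assumes "c : Ind rho sig"
 shows "Phi c : Ind rho sig" "cdim (Phi c) = cdim c"
proof -
 obtain N where N: "indec N" "has_type Q rho sig N" "c = cls N" using assms by (rule Ind_E)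
 have P: "Phi c = cls (map_rep (fr s) N)" unfolding Phi_def N(3) by (rule map_rep_cls[OF semilinear_bij_fr])
 show "Phi c : Ind rho sig"
  unfolding P cls_Ind_iff[OF indec_map_rep[OF semilinear_bij_fr N(1)]] by (rule map_rep_type[OF semilinear_bij_fr N(2)])
 note r = indec_rep[OF N(1)]
 show "cdim (Phi c) = cdim c"
 proof
  fix i show "cdim (Phi c) i = cdim c i"
  proof (cases "i : verts Q")
  case True
  have "cdim (Phi c) i = fv.dim (espace (map_rep (fr s) N) i)"
  unfolding P by (rule cdim_cls[OF map_rep_rep[OF semilinear_bij_fr r] True])
  moreover have "cdim c i = fv.dim (espace N i)" unfolding N(3) by (rule cdim_cls[OF r True])
  ultimately show ?thesis
  using semilinear_image(3)[OF semilinear_bij_fr rep_space[OF r True]] by (simp add: map_rep_def)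
  qed (simp add: cdim_arb)
 qed
qed

text \<open>Every representation is defined over a finite field: in standard form its relations have
  finite spanning sets, and all their coordinates are fixed by some power of Frobenius, which then
  fixes the representation itself.\<close>

lemma Phi_periodic:
 assumes "c : Ind rho sig"
 shows "EX m>0. (Phi ^^ m) c = c"
proof -
 obtain M where M: "indec M" "has_type Q rho sig M" "c = cls M" using assms by (rule Ind_E)
 define d where "d i = fv.dim (espace M i)" for i
 obtain N :: "('v, 'e, nat, 'a) erep" where N: "rel_rep Q N" "std_rep Q d N" "riso M N"
  using std_exists[OF indec_rep[OF M(1)], of d] by (auto simp: d_def)
 have cN: "cls N = c" using cls_eq_iff[OF indec_rep[OF M(1)] N(1)] N(3) M(3) by simp
 have sub: "erel N a \<subseteq> sp (d (tail Q a)) \<times> sp (d (head Q a))" if "a : arcs Q" for a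
  using rep_rel(1)[OF N(1) that] std_space[OF N(2)] that by simp
 have "EX B. finite B & erel N a = fv2.p.span B" if a: "a : arcs Q" for a
 proof -
  obtain B0 where B0: "finite B0" "(sp (d (tail Q a)) \<times> sp (d (head Q a)) :: ((nat => 'a) \<times> (nat => 'a)) set) \<subseteq> fv2.p.span B0"
  using sp_pair_span by blast
  obtain B where "finite B" "erel N a = fv2.p.span B"
  by (rule fv2.p.finite_span_subset[OF B0(1) rep_rel(2)[OF N(1) a] subset_trans[OF sub[OF a] B0(2)]])
  then show ?thesis by (intro exI conjI)
 qed
 then obtain B where B: "!!a. a : arcs Q ==> finite (B a)" "!!a. a : arcs Q ==> erel N a = fv2.p.span (B a)" by metis
 \<comment> \<open>All coordinates of the chosen generators within the dimensions; the other
   coordinates are zero and hence fixed anyway.\<close>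
 let ?C = "\<Union>a\<in>arcs Q. \<Union>p\<in>B a. fst p ` {..<d (tail Q a)} \<union> snd p ` {..<d (head Q a)}"
 have "finite ?C" using B(1) by auto
 then obtain e where e: "e > 0" "ALL x:?C. x ^ (s ^ e) = x" using common_period[of ?C] by blast
 interpret E: frob_quiver Q "TYPE('a)" "s ^ e" by (rule frob_quiver_power[OF e(1)])
 have v: "fr (s ^ e) u = u" if "u : sp n" "u ` {..<n} \<subseteq> ?C" for u n
 proof
  fix j show "fr (s ^ e) u j = u j"
  proof (cases "j < n")
  case True
  then have "u j : ?C" using that(2) by (intro subsetD[OF that(2) imageI]) simp
  from bspec[OF e(2) this] show ?thesis by (simp add: fr_def)
  next
  case False
  then show ?thesis using that(1) E.s_gt1 by (simp add: fr_def sp_def)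
  qed
 qed
 have R: "E.frp ` erel N a = erel N a" if a: "a : arcs Q" for a
  unfolding B(2)[OF a]
 proof (rule E.frp_span)
  fix p assume p: "p : B a"
  have "p : sp (d (tail Q a)) \<times> sp (d (head Q a))"
  using sub[OF a] fv2.p.span_base[OF p] unfolding B(2)[OF a] by (rule subsetD)
  then have m: "fst p : sp (d (tail Q a))" "snd p : sp (d (head Q a))" by auto
  have "fst p ` {..<d (tail Q a)} \<subseteq> ?C" "snd p ` {..<d (head Q a)} \<subseteq> ?C" using a p by auto
  then show "E.frp p = p" using v[OF m(1)] v[OF m(2)] by (simp add: prod_eq_iff)
 qed
 have "map_rep (fr (s ^ e)) N = N"
 proof (rule erep.equality)
  show "espace (map_rep (fr (s ^ e)) N) = espace N"
  using N(2) by (simp add: map_rep_def std_rep_def fun_eq_iff E.fr_sp_image)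
  show "erel (map_rep (fr (s ^ e)) N) = erel N"
  proof
  fix a show "erel (map_rep (fr (s ^ e)) N) a = erel N a"
  using R[of a] N(2) by (cases "a : arcs Q") (simp_all add: map_rep_def std_rep_def)
  qed
 qed simp
 then have "(Phi ^^ e) c = c"
  unfolding Phi_funpow cN[symmetric] map_rep_cls[OF E.semilinear_bij_fr] by simp
 then show ?thesis using e(1) by blast
qed

definition fixed_msets :: "nat => ('v => nat) => ('e => nat) => ('e => nat) => ('v, 'e, nat, 'a) erep set multiset set" where
 "fixed_msets e \<alpha> rho sig = {\<mu>. set_mset \<mu> \<subseteq> Ind rho sig & (ALL i:verts Q. (\<Sum>c\<in>#\<mu>. cdim c i) = \<alpha> i) & image_mset (Phi ^^ e) \<mu> = \<mu>}"

text \<open>Krull-Schmidt turns classes into multisets of indecomposable classes, compatibly with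
  twists; uniqueness makes a class stable exactly when its multiset is. The target is the set of
  stable classes of the locale instantiated at \<open>s ^ e\<close>.\<close>

lemma fixed_msets_bij:
 assumes e: "e > 0"
 shows "EX f :: _ => ('v, 'e, nat, 'a) erep set. bij_betw f (fixed_msets e \<alpha> rho sig) (frob_quiver.fixed_classes Q (s ^ e) \<alpha> rho sig)"
proof -
 interpret E: frob_quiver Q "TYPE('a)" "s ^ e" by (rule frob_quiver_power[OF e])
 note h = E.semilinear_bij_fr
 define f where "f \<mu> = cls (SOME M. D M \<mu>)" for \<mu>
 have P: "(Phi ^^ e) = (`) (map_rep (fr (s ^ e)))" by (rule ext) (rule Phi_funpow)
 have ex: "D (SOME M. D M \<mu>) \<mu>" if "\<mu> : fixed_msets e \<alpha> rho sig" for \<mu>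
 proof (rule someI_ex[OF D_of_multiset])
  show "\<forall>c\<in>#\<mu>. EX N. indec N & c = cls N" using that by (auto simp: fixed_msets_def elim: Ind_E)
 qed
 have fD: "f \<mu> = cls M" if "D M \<mu>" "\<mu> : fixed_msets e \<alpha> rho sig" for M \<mu>
  using D_unique_iso[OF ex[OF that(2)] that(1)] cls_eq_iff[OF D_rep[OF ex[OF that(2)]] D_rep[OF that(1)]] by (simp add: f_def)
 have "inj_on f (fixed_msets e \<alpha> rho sig)"
 proof (rule inj_onI)
  fix \<mu> \<nu> assume m: "\<mu> : fixed_msets e \<alpha> rho sig" and n: "\<nu> : fixed_msets e \<alpha> rho sig" and eq: "f \<mu> = f \<nu>"
  have "riso (SOME M. D M \<mu>) (SOME M. D M \<nu>)"
  using eq cls_eq_iff[OF D_rep[OF ex[OF m]] D_rep[OF ex[OF n]]] by (simp add: f_def)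
  from D_iso[OF ex[OF m] this D_rep[OF ex[OF n]]] show "\<mu> = \<nu>" using ex[OF n] by (rule D_unique)
 qed
 moreover have "f ` fixed_msets e \<alpha> rho sig = E.fixed_classes \<alpha> rho sig"
 proof
  show "f ` fixed_msets e \<alpha> rho sig \<subseteq> E.fixed_classes \<alpha> rho sig"
  proof (rule image_subsetI)
  fix \<mu> assume m: "\<mu> : fixed_msets e \<alpha> rho sig"
  define M where "M = (SOME M. D M \<mu>)"
  have D: "D M \<mu>" unfolding M_def by (rule ex[OF m])
  have 1: "has_type Q rho sig M" using D_type[OF D] m by (simp add: fixed_msets_def)
  have 2: "ALL i:verts Q. fv.dim (espace M i) = \<alpha> i" using D_dim[OF D] m by (simp add: fixed_msets_def)
  have "image_mset ((`) (map_rep (fr (s ^ e)))) \<mu> = \<mu>" using m unfolding fixed_msets_def P by simp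
  then have D': "D (map_rep (fr (s ^ e)) M) \<mu>" using D_map_rep[OF D h] by simp
  have "map_rep (fr (s ^ e)) ` cls M = cls M"
  unfolding map_rep_cls[OF h] using D_unique_iso[OF D' D] cls_eq_iff[OF D_rep[OF D'] D_rep[OF D]] by simp
  then show "f \<mu> : E.fixed_classes \<alpha> rho sig"
  unfolding fD[OF D m] E.fixed_classes_def using 1 2 D_rep[OF D] by (intro CollectI exI[of _ M] conjI refl)
  qed
  show "E.fixed_classes \<alpha> rho sig \<subseteq> f ` fixed_msets e \<alpha> rho sig"
  proof
  fix c assume "c : E.fixed_classes \<alpha> rho sig"
  then obtain M where M: "c = cls M" "rel_rep Q M" "has_type Q rho sig M" "ALL i:verts Q. fv.dim (espace M i) = \<alpha> i"
  "map_rep (fr (s ^ e)) ` cls M = cls M" unfolding E.fixed_classes_def by blast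
  obtain \<mu> where D: "D M \<mu>" using D_exists[OF M(2)] by (elim exE)
  have "riso (map_rep (fr (s ^ e)) M) M"
  using M(5) unfolding map_rep_cls[OF h] cls_eq_iff[OF map_rep_rep[OF h M(2)] M(2)] .
  from D_iso[OF D_map_rep[OF D h] this M(2)] have "image_mset (Phi ^^ e) \<mu> = \<mu>"
  using D unfolding P by (rule D_unique)
  then have m: "\<mu> : fixed_msets e \<alpha> rho sig"
  using D_type[OF D] M(3,4) D_dim[OF D] by (simp add: fixed_msets_def)
  show "c : f ` fixed_msets e \<alpha> rho sig" unfolding M(1) fD[OF D m, symmetric] using m by (rule imageI)
  qed
 qed
 ultimately show ?thesis by (auto simp: bij_betw_def)
qed

lemma card_fixed_msets:
 assumes e: "e > 0"
  and t: "rho : arcs Q \<rightarrow> {0, 1}" "sig : arcs Q \<rightarrow> {0, 1}" "rho' : arcs Q \<rightarrow> {0, 1}" "sig' : arcs Q \<rightarrow> {0, 1}"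
 shows "card (fixed_msets e \<alpha> rho sig) = card (fixed_msets e \<alpha> rho' sig')" "finite (fixed_msets e \<alpha> rho sig)"
proof -
 interpret E: frob_quiver Q "TYPE('a)" "s ^ e" by (rule frob_quiver_power[OF e])
 obtain f g where fg: "bij_betw f (fixed_msets e \<alpha> rho sig) (E.fixed_classes \<alpha> rho sig)"
  "bij_betw g (fixed_msets e \<alpha> rho' sig') (E.fixed_classes \<alpha> rho' sig')"
  using fixed_msets_bij[OF e, of \<alpha> rho sig] fixed_msets_bij[OF e, of \<alpha> rho' sig'] by (elim exE)
 show "finite (fixed_msets e \<alpha> rho sig)" using bij_betw_finite[OF fg(1)] E.finite_fixed_classes by simp
 show "card (fixed_msets e \<alpha> rho sig) = card (fixed_msets e \<alpha> rho' sig')"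
  using bij_betw_same_card[OF fg(1)] bij_betw_same_card[OF fg(2)] E.card_fixed_classes[OF t] by simp
qed

definition fixed_indec :: "nat => ('v => nat) => ('e => nat) => ('e => nat) => ('v, 'e, nat, 'a) erep set set" where
 "fixed_indec e \<alpha> rho sig = {c : Ind rho sig. (ALL i:verts Q. cdim c i = \<alpha> i) & (Phi ^^ e) c = c}"

definition csize :: "('v, 'e, nat, 'a) erep set => nat" where
 "csize c = (\<Sum>i\<in>verts Q. cdim c i)"

lemma csize_pos:
 assumes "c : Ind rho sig"
 shows "csize c > 0"
proof -
 obtain N where N: "indec N" "c = cls N" using assms by (rule Ind_E)
 have "equipped_nonzero Q N" using N(1) by (simp add: indec_def)
 then obtain i where i: "i : verts Q" "fv.dim (espace N i) > 0" using nonzero_iff_dim[OF indec_rep[OF N(1)]] by blast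
 then have "cdim c i > 0" using cdim_cls[OF indec_rep[OF N(1)] i(1)] N(2) by simp
 then show ?thesis unfolding csize_def using i(1) by (intro sum_pos2[of _ i]) auto
qed

text \<open>Indecomposables have positive total dimension, so a multiset with a member of full total
  dimension is a singleton. All others have strictly smaller members only.\<close>

lemma fixed_msets_decomp:
 assumes e: "e > 0"
  and t: "rho : arcs Q \<rightarrow> {0, 1}" "sig : arcs Q \<rightarrow> {0, 1}"
 shows "card (fixed_msets e \<alpha> rho sig) = card (fixed_indec e \<alpha> rho sig) +
  card {\<mu> : fixed_msets e \<alpha> rho sig. \<forall>c\<in>#\<mu>. csize c < (\<Sum>i\<in>verts Q. \<alpha> i)}" (is "_ = _ + card ?Y")
  "finite (fixed_indec e \<alpha> rho sig)"
proof -
 let ?T = "fixed_msets e \<alpha> rho sig" and ?X = "fixed_indec e \<alpha> rho sig" and ?n = "\<Sum>i\<in>verts Q. \<alpha> i"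
 let ?s = "%c. {#c#} :: ('v, 'e, nat, 'a) erep set multiset"
 have fin: "finite ?T" by (rule card_fixed_msets(2)[OF e t t])
 have sub: "?s ` ?X \<subseteq> ?T" by (auto simp: fixed_indec_def fixed_msets_def)
 have inj: "inj_on ?s ?X" by (auto simp: inj_on_def)
 show "finite ?X" using finite_subset[OF sub fin] inj by (rule finite_imageD)
 have size: "csize c = ?n" if "c : ?X" for c using that by (simp add: csize_def fixed_indec_def)
 have "?T \<subseteq> ?s ` ?X \<union> ?Y"
 proof
  fix \<mu> assume m: "\<mu> : ?T"
  then have m': "set_mset \<mu> \<subseteq> Ind rho sig" "ALL i:verts Q. (\<Sum>c\<in>#\<mu>. cdim c i) = \<alpha> i" "image_mset (Phi ^^ e) \<mu> = \<mu>"
  by (auto simp: fixed_msets_def)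
  show "\<mu> : ?s ` ?X \<union> ?Y"
  proof (cases "\<forall>c\<in>#\<mu>. csize c < ?n")
  case False
  then obtain c where c: "c \<in># \<mu>" "csize c \<ge> ?n" by auto
  obtain \<nu> where n: "\<mu> = add_mset c \<nu>" using c(1) by (metis insert_DiffM)
  have "\<nu> = {#}"
  proof (rule ccontr)
  assume "\<nu> ~= {#}"
  then obtain c' where c': "c' \<in># \<nu>" by blast
  obtain kap where k: "\<nu> = add_mset c' kap" using c' by (metis insert_DiffM)
  have "cdim c i + cdim c' i <= \<alpha> i" if "i : verts Q" for i using m'(2) that n k by auto
  then have "(\<Sum>i\<in>verts Q. cdim c i + cdim c' i) <= ?n" by (intro sum_mono)
  then have "csize c + csize c' <= ?n" by (simp add: csize_def sum.distrib)
  moreover have "csize c' > 0" using m'(1) n k by (intro csize_pos[of _ rho sig]) auto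
  ultimately show False using c(2) by simp
  qed
  then have "\<mu> = ?s c" using n by simp
  moreover have "c : ?X" using m' \<open>\<mu> = ?s c\<close> by (simp add: fixed_indec_def)
  ultimately show ?thesis by blast
  qed (use m in simp)
 qed
 then have "?T = ?s ` ?X \<union> ?Y" using sub by blast
 then have "card ?T = card (?s ` ?X \<union> ?Y)" by (rule arg_cong)
 also have "... = card (?s ` ?X) + card ?Y"
 proof (rule card_Un_disjoint[OF finite_subset[OF sub fin]])
  show "finite ?Y" using fin by simp
  show "?s ` ?X \<inter> ?Y = {}" using size by auto
 qed
 finally show "card ?T = card ?X + card ?Y" by (simp add: card_image[OF inj])
qed

text \<open>Applying the bijection \<open>b\<close> to each member keeps dimensions and, by
  equivariance, stability under the power of Frobenius. An inequality is enough, since it is used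
  with the types in both orders.\<close>

lemma small_msets_le:
 assumes e: "e > 0"
  and b: "bij_betw b {c : Ind rho sig. csize c < n} {c : Ind rho' sig'. csize c < n}"
  "ALL c:{c : Ind rho sig. csize c < n}. cdim (b c) = cdim c & b (Phi c) = Phi (b c)"
  and fin: "finite (fixed_msets e \<alpha> rho' sig')"
 shows "card {\<mu> : fixed_msets e \<alpha> rho sig. \<forall>c\<in>#\<mu>. csize c < n} <= card {\<mu> : fixed_msets e \<alpha> rho' sig'. \<forall>c\<in>#\<mu>. csize c < n}"
  (is "card ?Y <= card ?Y'")
proof (rule card_inj_on_le[of "image_mset b"])
 let ?S = "{c : Ind rho sig. csize c < n}" and ?S' = "{c : Ind rho' sig'. csize c < n}"
 have S: "set_mset \<mu> \<subseteq> ?S" if "\<mu> : ?Y" for \<mu> using that by (auto simp: fixed_msets_def)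
 have PS: "Phi c : ?S" if "c : ?S" for c using that Phi_Ind[of c rho sig] by (simp add: csize_def)
 have bP: "b ((Phi ^^ k) c) = (Phi ^^ k) (b c) & (Phi ^^ k) c : ?S" if "c : ?S" for c k
  using that
 proof (induction k)
  case (Suc k)
  then have k: "b ((Phi ^^ k) c) = (Phi ^^ k) (b c)" "(Phi ^^ k) c : ?S" by blast+
  show ?case using bspec[OF b(2) k(2)] k(1) PS[OF k(2)] by simp
 qed simp
 have inv: "image_mset (inv_into ?S b) (image_mset b \<mu>) = \<mu>" if "\<mu> : ?Y" for \<mu>
 proof -
  have "image_mset (inv_into ?S b) (image_mset b \<mu>) = image_mset (%c. inv_into ?S b (b c)) \<mu>"
  by (simp add: multiset.map_comp comp_def)
  also have "... = image_mset (%c. c) \<mu>"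
  proof (rule image_mset_cong)
  fix c assume "c \<in># \<mu>"
  then have "c : ?S" using S[OF that] by (rule subsetD[rotated])
  then show "inv_into ?S b (b c) = c" by (rule inv_into_f_f[OF bij_betw_imp_inj_on[OF b(1)]])
  qed
  finally show ?thesis by simp
 qed
 show "inj_on (image_mset b) ?Y" by (rule inj_on_inverseI) (rule inv)
 show "image_mset b ` ?Y \<subseteq> ?Y'"
 proof (rule image_subsetI)
  fix \<mu> assume m: "\<mu> : ?Y"
  note sS = S[OF m]
  have 1: "b c : ?S'" if "c \<in># \<mu>" for c using bij_betwE[OF b(1)] subsetD[OF sS that] by (rule bspec)
  have 2: "(\<Sum>c\<in>#image_mset b \<mu>. cdim c i) = (\<Sum>c\<in>#\<mu>. cdim c i)" for i
  proof -
  have "image_mset (%c. cdim (b c) i) \<mu> = image_mset (%c. cdim c i) \<mu>"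
  by (rule image_mset_cong) (use b(2) sS in auto)
  then show ?thesis by (simp add: multiset.map_comp comp_def)
  qed
  have "image_mset (Phi ^^ e) (image_mset b \<mu>) = image_mset (%c. (Phi ^^ e) (b c)) \<mu>"
  by (simp add: multiset.map_comp comp_def)
  also have "... = image_mset (%c. b ((Phi ^^ e) c)) \<mu>"
  proof (rule image_mset_cong)
  fix c assume "c \<in># \<mu>"
  then have "c : ?S" by (rule subsetD[OF sS])
  then show "(Phi ^^ e) (b c) = b ((Phi ^^ e) c)" using bP[of c e] by simp
  qed
  also have "... = image_mset b (image_mset (Phi ^^ e) \<mu>)" by (simp add: multiset.map_comp comp_def)
  also have "... = image_mset b \<mu>" using m by (simp add: fixed_msets_def)
  finally have 3: "image_mset (Phi ^^ e) (image_mset b \<mu>) = image_mset b \<mu>" .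
  have "set_mset (image_mset b \<mu>) \<subseteq> ?S'" using 1 by auto
  moreover have "ALL i:verts Q. (\<Sum>c\<in>#image_mset b \<mu>. cdim c i) = \<alpha> i" unfolding 2 using m by (simp add: fixed_msets_def)
  ultimately show "image_mset b \<mu> : ?Y'" using 3 unfolding fixed_msets_def by blast
 qed
 show "finite ?Y'" using fin by simp
qed

text \<open>The induction hypothesis is used for every power \<open>k\<close> of Frobenius, not just
  for \<open>e\<close>, hence the generalisation over \<open>e\<close>: only all powers together
  give the equivariant bijection between smaller indecomposables. Small multisets are then
  equinumerous, and subtracting them from the equal totals leaves the indecomposables.\<close>

theorem card_fixed_indec:
 assumes e: "e > 0"
  and t: "rho : arcs Q \<rightarrow> {0, 1}" "sig : arcs Q \<rightarrow> {0, 1}" and t': "rho' : arcs Q \<rightarrow> {0, 1}" "sig' : arcs Q \<rightarrow> {0, 1}"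
 shows "card (fixed_indec e \<alpha> rho sig) = card (fixed_indec e \<alpha> rho' sig')"
 using assms
proof (induction "\<Sum>i\<in>verts Q. \<alpha> i" arbitrary: \<alpha> e rho sig rho' sig' rule: less_induct)
 case (less \<alpha> e rho sig rho' sig')
 let ?n = "\<Sum>i\<in>verts Q. \<alpha> i"
 let ?S = "%rho sig. {c : Ind rho sig. csize c < ?n}"
 have le: "card {\<mu> : fixed_msets e \<alpha> rho sig. \<forall>c\<in>#\<mu>. csize c < ?n} <= card {\<mu> : fixed_msets e \<alpha> rho' sig'. \<forall>c\<in>#\<mu>. csize c < ?n}"
  if t: "rho : arcs Q \<rightarrow> {0, 1}" "sig : arcs Q \<rightarrow> {0, 1}" and t': "rho' : arcs Q \<rightarrow> {0, 1}" "sig' : arcs Q \<rightarrow> {0, 1}" for rho sig rho' sig'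
 proof -
  \<comment> \<open>Weights are whole functions, so a weight of too large total dimension, or one
    that does not vanish off the vertices, occurs for no class considered here.\<close>
  have fx: "{c : ?S rho sig. cdim c = \<beta> & (Phi ^^ k) c = c} =
  (if (\<Sum>i\<in>verts Q. \<beta> i) < ?n & (ALL i. i \<notin> verts Q --> \<beta> i = 0) then fixed_indec k \<beta> rho sig else {})" for k \<beta> rho sig
  proof -
  have A: "cdim c = \<beta> \<longleftrightarrow> (ALL i:verts Q. cdim c i = \<beta> i)" if "ALL i. i \<notin> verts Q --> \<beta> i = 0" for c :: "('v, 'e, nat, 'a) erep set"
  unfolding fun_eq_iff using that cdim_arb[of _ c] by metis
  have B: "csize c = (\<Sum>i\<in>verts Q. \<beta> i)" if "cdim c = \<beta>" for c :: "('v, 'e, nat, 'a) erep set" using that by (simp add: csize_def)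
  have C: "ALL i. i \<notin> verts Q --> \<beta> i = 0" if "cdim c = \<beta>" for c :: "('v, 'e, nat, 'a) erep set" using that cdim_arb[of _ c] by simp
  show ?thesis
  proof (cases "(\<Sum>i\<in>verts Q. \<beta> i) < ?n & (ALL i. i \<notin> verts Q --> \<beta> i = 0)")
  case True
  have "csize c < ?n" if "cdim c = \<beta>" for c using B[OF that] True by simp
  then have "{c : ?S rho sig. cdim c = \<beta> & (Phi ^^ k) c = c} = {c : Ind rho sig. cdim c = \<beta> & (Phi ^^ k) c = c}" by blast
  also have "... = fixed_indec k \<beta> rho sig" unfolding fixed_indec_def using A[OF conjunct2[OF True]] by simp
  finally show ?thesis by (rule trans[OF _ if_P[OF True, symmetric]])
  next
  case False
  then have "~ (csize c < ?n & cdim c = \<beta>)" for c using B[of c] C[of c] by metis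
  then have "{c : ?S rho sig. cdim c = \<beta> & (Phi ^^ k) c = c} = {}" by blast
  then show ?thesis by (simp only: False if_False)
  qed
  qed
  have "EX b. bij_betw b (?S rho sig) (?S rho' sig') & (ALL c:?S rho sig. cdim (b c) = cdim c & b (Phi c) = Phi (b c))"
  proof (rule equivariant_bij)
  show "Phi ` ?S rho sig \<subseteq> ?S rho sig" using Phi_Ind[of _ rho sig] by (auto simp: csize_def)
  show "Phi ` ?S rho' sig' \<subseteq> ?S rho' sig'" using Phi_Ind[of _ rho' sig'] by (auto simp: csize_def)
  show "EX m>0. (Phi ^^ m) c = c" if "c : ?S rho sig" for c using that by (intro Phi_periodic[of _ rho sig]) simp
  show "EX m>0. (Phi ^^ m) c = c" if "c : ?S rho' sig'" for c using that by (intro Phi_periodic[of _ rho' sig']) simp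
  show "cdim (Phi c) = cdim c" if "c : ?S rho sig" for c using that by (intro Phi_Ind(2)[of _ rho sig]) simp
  show "cdim (Phi c) = cdim c" if "c : ?S rho' sig'" for c using that by (intro Phi_Ind(2)[of _ rho' sig']) simp
  show "finite {c : ?S rho sig. cdim c = \<beta> & (Phi ^^ k) c = c}" if "k > 0" for k \<beta>
  unfolding fx using fixed_msets_decomp(2)[OF that t] by simp
  show "finite {c : ?S rho' sig'. cdim c = \<beta> & (Phi ^^ k) c = c}" if "k > 0" for k \<beta>
  unfolding fx using fixed_msets_decomp(2)[OF that t'] by simp
  show "card {c : ?S rho sig. cdim c = \<beta> & (Phi ^^ k) c = c} = card {c : ?S rho' sig'. cdim c = \<beta> & (Phi ^^ k) c = c}" if "k > 0" for k \<beta>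
  proof (cases "(\<Sum>i\<in>verts Q. \<beta> i) < ?n & (ALL i. i \<notin> verts Q --> \<beta> i = 0)")
  case True
  show ?thesis unfolding fx if_P[OF True] by (rule less.hyps[OF conjunct1[OF True] that t t'])
  next
  case False
  show ?thesis unfolding fx if_not_P[OF False] ..
  qed
  qed
  then obtain b where b: "bij_betw b (?S rho sig) (?S rho' sig') & (ALL c:?S rho sig. cdim (b c) = cdim c & b (Phi c) = Phi (b c))"
  by (elim exE)
  show ?thesis by (rule small_msets_le[OF less.prems(1) b[THEN conjunct1] b[THEN conjunct2] card_fixed_msets(2)[OF less.prems(1) t' t']])
 qed
 note t = less.prems(2,3) and t' = less.prems(4,5)
 show ?case
  using fixed_msets_decomp(1)[OF less.prems(1) t, of \<alpha>] fixed_msets_decomp(1)[OF less.prems(1) t', of \<alpha>]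
  card_fixed_msets(1)[OF less.prems(1) t t', of \<alpha>] le[OF t t'] le[OF t' t] by simp
qed

end

section \<open>Extension of scalars for relations and morphisms\<close>

lemma ext_space_subspace: "fv.subspace (ext_space V)"
 by (simp add: ext_space_def)

lemma ext_vec_in: "v : V ==> ext_vec v : ext_space V"
 unfolding ext_space_def by (intro fv.span_base imageI)

lemma ext_space_span: "ext_space (fv.span B) = fv.span (ext_vec ` B)"
proof
 have "fv.subspace {v. ext_vec v : fv.span (ext_vec ` B)}" unfolding fv.subspace_def
 proof (intro conjI ballI allI CollectI)
  show "ext_vec 0 : fv.span (ext_vec ` B)" unfolding ext_vec_zero by (rule fv.span_zero)
  show "ext_vec (x + y) : fv.span (ext_vec ` B)" if "x : {v. ext_vec v : fv.span (ext_vec ` B)}" "y : {v. ext_vec v : fv.span (ext_vec ` B)}" for x y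
  unfolding ext_vec_add using that by (intro fv.span_add) auto
  show "ext_vec (fscale c x) : fv.span (ext_vec ` B)" if "x : {v. ext_vec v : fv.span (ext_vec ` B)}" for c x
  unfolding ext_vec_scale using that by (intro fv.span_scale) auto
 qed
 moreover have "B \<subseteq> {v. ext_vec v : fv.span (ext_vec ` B)}" using fv.span_base[of _ "ext_vec ` B"] by auto
 ultimately have "fv.span B \<subseteq> {v. ext_vec v : fv.span (ext_vec ` B)}" by (intro fv.span_minimal)
 then show "ext_space (fv.span B) \<subseteq> fv.span (ext_vec ` B)"
  unfolding ext_space_def by (intro fv.span_minimal fv.subspace_span) auto
 show "fv.span (ext_vec ` B) \<subseteq> ext_space (fv.span B)"
  unfolding ext_space_def by (intro fv.span_mono image_mono fv.span_superset)
qed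

lemma ext_space_dim:
 assumes "fin_dim_space V"
 shows "fin_dim_space (ext_space V)" "fv.dim (ext_space V) = fv.dim V"
proof -
 obtain B where B: "finite B" "fv.independent B" "fv.span B = V" "card B = fv.dim V" by (rule fin_dim_basis[OF assms])
 have E: "ext_space V = fv.span (ext_vec ` B)" using ext_space_span[of B] B(3) by simp
 show "fin_dim_space (ext_space V)" unfolding fin_dim_space_def E using B(1) by (intro exI[of _ "ext_vec ` B"]) simp
 have "fv.dim (ext_space V) = card (ext_vec ` B)"
  unfolding E by (rule fv.dim_span_eq_card_independent[OF independent_ext[OF B(1,2)]])
 also have "... = card B" by (rule card_image[OF inj_on_subset[OF inj_ext_vec subset_UNIV]])
 finally show "fv.dim (ext_space V) = fv.dim V" by (simp add: B(4))
qed

text \<open>The tool for every identity between extended morphisms: it needs to be checked on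
  vectors of the base field alone.\<close>

lemma linear_ext_eq:
 assumes f: "linear_map_on (ext_space V) W f" and g: "linear_map_on (ext_space V) W' g"
  and eq: "!!v. v : V ==> f (ext_vec v) = g (ext_vec v)" and x: "x : ext_space V"
 shows "f x = g x"
proof -
 let ?S = "{x : ext_space V. f x = g x}"
 note s = ext_space_subspace[of V]
 have "fv.subspace ?S" unfolding fv.subspace_def
 proof (intro conjI ballI allI CollectI)
  show "0 : ext_space V" by (rule fv.subspace_0[OF s])
  show "f 0 = g 0" by (rule trans[OF linear_map_on_zero[OF f s] linear_map_on_zero[OF g s, symmetric]])
  show "x + y : ext_space V" if "x : ?S" "y : ?S" for x y using that by (intro fv.subspace_add[OF s]) auto
  show "f (x + y) = g (x + y)" if "x : ?S" "y : ?S" for x y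
  using that linear_map_onD(2)[OF f, of x y] linear_map_onD(2)[OF g, of x y] by simp
  show "fscale c x : ext_space V" if "x : ?S" for c x using that by (intro fv.subspace_scale[OF s]) auto
  show "f (fscale c x) = g (fscale c x)" if "x : ?S" for c x
  using that linear_map_onD(3)[OF f, of x c] linear_map_onD(3)[OF g, of x c] by simp
 qed
 moreover have "ext_vec ` V \<subseteq> ?S" using eq ext_vec_in by auto
 ultimately have "fv.span (ext_vec ` V) \<subseteq> ?S" by (intro fv.span_minimal)
 then show ?thesis using x unfolding ext_space_def by blast
qed

lemma ext_rel_subset:
 assumes "R \<subseteq> V \<times> W"
 shows "ext_rel R \<subseteq> ext_space V \<times> ext_space W"
 unfolding ext_rel_def
proof (rule fv2.p.span_minimal[OF image_subsetI fv2.subspace_Times[OF ext_space_subspace ext_space_subspace]])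
 show "map_prod ext_vec ext_vec p : ext_space V \<times> ext_space W" if "p : R" for p
  using subsetD[OF assms that] by (cases p) (auto intro: ext_vec_in)
qed

lemma ext_rel_base: "(x, y) : R ==> (ext_vec x, ext_vec y) : ext_rel R"
 unfolding ext_rel_def by (intro fv2.p.span_base) force

lemma ext_rel_subspace: "fv2.p.subspace (ext_rel R)"
 by (simp add: ext_rel_def)

lemma equipped_ext_simps [simp]: "espace (equipped_ext M) i = ext_space (espace M i)" "erel (equipped_ext M) a = ext_rel (erel M a)"
 by (simp_all add: equipped_ext_def)

context quiver begin

lemma rel_iso_same:
 assumes M: "rel_rep Q M" and e: "!!i. i : verts Q ==> espace N i = espace M i" "!!a. a : arcs Q ==> erel N a = erel M a"
 shows "rel_rep Q N" "riso N M"
proof -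
 show "rel_rep Q N" using M e by (simp add: rel_rep_def)
 show "riso N M" by (rule isoI[where tht = "%i x. x" and \<psi> = "%i x. x"]) (auto intro!: homI simp: e linear_map_on_id)
qed

lemma ext_rep: "rel_rep Q M ==> rel_rep Q (equipped_ext M)"
 by (simp add: rel_rep_def linear_relation_def ext_space_dim ext_rel_subset ext_rel_subspace)

abbreviation ext_hom :: "('v, 'e, 'i, 'k::field) erep => ('v, 'e, 'i, 'k) erep => _" where
 "ext_hom M N tht \<equiv> %i. ext_map (espace M i) (espace N i) (tht i)"

lemma ext_hom_vec:
 assumes "rel_rep Q M" "rhom M N tht" "i : verts Q" "v : espace M i"
 shows "ext_hom M N tht i (ext_vec v) = ext_vec (tht i v)"
 by (rule ext_map_props(2)[OF rep_space[OF assms(1,3)] homD(1)[OF assms(2,3)] assms(4)])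

lemma ext_hom_rhom:
 assumes M: "rel_rep Q M" and N: "rel_rep Q N" and tht: "rhom M N tht"
 shows "rhom (equipped_ext M) (equipped_ext N) (ext_hom M N tht)"
proof (rule homI)
 have lin: "linear_map_on (ext_space (espace M i)) (ext_space (espace N i)) (ext_hom M N tht i)" if "i : verts Q" for i
  by (rule ext_map_props(1)[OF rep_space[OF M that] homD(1)[OF tht that]])
 then show "linear_map_on (espace (equipped_ext M) i) (espace (equipped_ext N) i) (ext_hom M N tht i)" if "i : verts Q" for i
  using that by simp
 fix a x y assume a: "a : arcs Q" and xy: "(x, y) : erel (equipped_ext M) a"
 have ht: "tail Q a : verts Q" "head Q a : verts Q" using a by auto
 let ?f = "ext_hom M N tht (tail Q a)" and ?g = "ext_hom M N tht (head Q a)"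
 let ?P = "ext_space (espace M (tail Q a)) \<times> ext_space (espace M (head Q a))"
 let ?S = "{p : ?P. map_prod ?f ?g p : ext_rel (erel N a)}"
 have P: "fv2.p.subspace ?P" by (intro fv2.subspace_Times ext_space_subspace)
 note f = linear_map_onD[OF lin[OF ht(1)]] and g = linear_map_onD[OF lin[OF ht(2)]]
 have "fv2.p.subspace ?S" unfolding fv2.p.subspace_def
 proof (intro conjI ballI allI CollectI)
  show "0 : ?P" by (rule fv2.p.subspace_0[OF P])
  have "map_prod ?f ?g 0 = 0"
  using linear_map_on_zero[OF lin[OF ht(1)] ext_space_subspace] linear_map_on_zero[OF lin[OF ht(2)] ext_space_subspace]
  by (simp add: zero_prod_def)
  then show "map_prod ?f ?g 0 : ext_rel (erel N a)" using fv2.p.subspace_0[OF ext_rel_subspace] by metis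
  fix p assume p: "p : ?S"
  {
  fix r assume r: "r : ?S"
  show "p + r : ?P" using p r by (intro fv2.p.subspace_add[OF P]) auto
  have "map_prod ?f ?g (p + r) = map_prod ?f ?g p + map_prod ?f ?g r" using p r f(2) g(2) by (cases p; cases r) simp
  then show "map_prod ?f ?g (p + r) : ext_rel (erel N a)" using fv2.p.subspace_add[OF ext_rel_subspace] p r by auto
  }
  fix c
  show "fv2.scale c p : ?P" using p by (intro fv2.p.subspace_scale[OF P]) auto
  have "map_prod ?f ?g (fv2.scale c p) = fv2.scale c (map_prod ?f ?g p)" using p f(3) g(3) by (cases p) (simp add: fv2.scale_prod)
  then show "map_prod ?f ?g (fv2.scale c p) : ext_rel (erel N a)" using fv2.p.subspace_scale[OF ext_rel_subspace] p by auto
 qed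
 moreover have "map_prod ext_vec ext_vec ` erel M a \<subseteq> ?S"
 proof (rule image_subsetI)
  fix p assume p: "p : erel M a"
  obtain u v where uv: "p = (u, v)" by (cases p)
  note m = rep_rel(7,8)[OF M a p[unfolded uv]]
  show "map_prod ext_vec ext_vec p : ?S"
  using ext_hom_vec[OF M tht ht(1) m(1)] ext_hom_vec[OF M tht ht(2) m(2)] ext_vec_in[OF m(1)] ext_vec_in[OF m(2)]
  ext_rel_base[OF homD(2)[OF tht a p[unfolded uv]]] by (simp add: uv)
 qed
 ultimately have "ext_rel (erel M a) \<subseteq> ?S" unfolding ext_rel_def[of "erel M a"] by (intro fv2.p.span_minimal)
 then show "(?f x, ?g y) : erel (equipped_ext N) a" using xy by auto
qed

lemma ext_hom_comp:
 assumes "rel_rep Q M" "rel_rep Q N" "rel_rep Q L" "rhom M N tht" "rhom N L \<psi>" and i: "i : verts Q"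
 shows "linear_map_on (ext_space (espace M i)) (ext_space (espace L i)) (%x. ext_hom N L \<psi> i (ext_hom M N tht i x))"
  "v : espace M i ==> ext_hom N L \<psi> i (ext_hom M N tht i (ext_vec v)) = ext_vec (\<psi> i (tht i v))"
 using homD(1)[OF hom_comp[OF ext_hom_rhom[OF assms(1,2,4)] ext_hom_rhom[OF assms(2,3,5)]] i]
  ext_hom_vec[OF assms(1,4) i] ext_hom_vec[OF assms(2,5) i] homD(3)[OF assms(4) i] by simp_all

lemma ext_iso:
 fixes M N :: "('v, 'e, 'i, 'k::field) erep"
 assumes M: "rel_rep Q M" and N: "rel_rep Q N" and iso: "riso M N"
 shows "riso (equipped_ext M) (equipped_ext N)"
proof -
 obtain tht \<psi> where t: "rhom M N tht" "rhom N M \<psi>" "ALL i:verts Q. ALL x:espace M i. \<psi> i (tht i x) = x"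
  "ALL i:verts Q. ALL y:espace N i. tht i (\<psi> i y) = y" using iso by (rule isoE)
 show ?thesis
 proof (rule isoI[OF ext_hom_rhom[OF M N t(1)] ext_hom_rhom[OF N M t(2)]])
  fix i x assume i: "i : verts Q" and x: "x : espace (equipped_ext M) i"
  show "ext_hom N M \<psi> i (ext_hom M N tht i x) = x"
  by (rule linear_ext_eq[where g = "%x. x", OF ext_hom_comp(1)[OF M N M t(1,2) i] linear_map_on_id _ x[unfolded equipped_ext_simps]])
  (use ext_hom_comp(2)[OF M N M t(1,2) i] t(3) i in simp)
 next
  fix i x assume i: "i : verts Q" and x: "x : espace (equipped_ext N) i"
  show "ext_hom M N tht i (ext_hom N M \<psi> i x) = x"
  by (rule linear_ext_eq[where g = "%x. x", OF ext_hom_comp(1)[OF N M N t(2,1) i] linear_map_on_id _ x[unfolded equipped_ext_simps]])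
  (use ext_hom_comp(2)[OF N M N t(2,1) i] t(4) i in simp)
 qed
qed

lemma ext_bip:
 fixes M N L :: "('v, 'e, 'i, 'k::field) erep"
 assumes M: "rel_rep Q M" and N: "rel_rep Q N" and L: "rel_rep Q L" and b: "bip Q M N L"
 shows "bip Q (equipped_ext M) (equipped_ext N) (equipped_ext L)"
proof -
 obtain a b p q where h: "rhom N M a" "rhom L M b" "rhom M N p" "rhom M L q"
  and e: "ALL i:verts Q. ALL x:espace N i. p i (a i x) = x" "ALL i:verts Q. ALL x:espace N i. q i (a i x) = 0"
  "ALL i:verts Q. ALL x:espace L i. q i (b i x) = x" "ALL i:verts Q. ALL x:espace L i. p i (b i x) = 0"
  "ALL i:verts Q. ALL x:espace M i. a i (p i x) + b i (q i x) = x" using b by (rule bipE)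
 note c = ext_hom_comp
 show ?thesis
 proof (rule bipI[OF ext_hom_rhom[OF N M h(1)] ext_hom_rhom[OF L M h(2)] ext_hom_rhom[OF M N h(3)] ext_hom_rhom[OF M L h(4)]])
  fix i x assume i: "i : verts Q"
  {
  assume x: "x : espace (equipped_ext N) i"
  note x' = x[unfolded equipped_ext_simps]
  show "ext_hom M N p i (ext_hom N M a i x) = x"
  by (rule linear_ext_eq[where g = "%x. x", OF c(1)[OF N M N h(1,3) i] linear_map_on_id _ x'])
  (use c(2)[OF N M N h(1,3) i] e(1) i in simp)
  show "ext_hom M L q i (ext_hom N M a i x) = 0"
  by (rule linear_ext_eq[where g = "%x. 0", OF c(1)[OF N M L h(1,4) i] linear_map_on_0[OF ext_space_subspace] _ x'])
  (use c(2)[OF N M L h(1,4) i] e(2) i in \<open>simp add: ext_vec_zero\<close>)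
  next
  assume x: "x : espace (equipped_ext L) i"
  note x' = x[unfolded equipped_ext_simps]
  show "ext_hom M L q i (ext_hom L M b i x) = x"
  by (rule linear_ext_eq[where g = "%x. x", OF c(1)[OF L M L h(2,4) i] linear_map_on_id _ x'])
  (use c(2)[OF L M L h(2,4) i] e(3) i in simp)
  show "ext_hom M N p i (ext_hom L M b i x) = 0"
  by (rule linear_ext_eq[where g = "%x. 0", OF c(1)[OF L M N h(2,3) i] linear_map_on_0[OF ext_space_subspace] _ x'])
  (use c(2)[OF L M N h(2,3) i] e(4) i in \<open>simp add: ext_vec_zero\<close>)
  next
  assume x: "x : espace (equipped_ext M) i"
  note x' = x[unfolded equipped_ext_simps]
  note l = linear_map_on_addf[OF c(1)[OF M N M h(3,1) i] c(1)[OF M L M h(4,2) i] ext_space_subspace]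
  show "ext_hom N M a i (ext_hom M N p i x) + ext_hom L M b i (ext_hom M L q i x) = x"
  by (rule linear_ext_eq[where g = "%x. x", OF l linear_map_on_id _ x'])
  (use c(2)[OF M N M h(3,1) i] c(2)[OF M L M h(4,2) i] e(5) i in \<open>simp add: ext_vec_add[symmetric]\<close>)
  }
 qed
qed

lemma ext_nonzero:
 assumes "rel_rep Q M"
 shows "equipped_nonzero Q (equipped_ext M) \<longleftrightarrow> equipped_nonzero Q M"
 unfolding nonzero_iff_dim[OF assms] nonzero_iff_dim[OF ext_rep[OF assms]]
 by (rule bex_cong[OF refl]) (simp add: ext_space_dim(2)[OF rep_space[OF assms]])

text \<open>The formula of \<open>indec\<close> for an arbitrary field, so that it can be used over
  the base field as well as over its closure.\<close>

definition indecomposable_rel :: "('v, 'e, nat, 'f::field) erep => bool" where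
 "indecomposable_rel N \<longleftrightarrow> rel_rep Q N & equipped_nonzero Q N \<and>
  ~ (EX (A :: ('v, 'e, nat, 'f) erep) (B :: ('v, 'e, nat, 'f) erep).
  rel_rep Q A & equipped_nonzero Q A & rel_rep Q B & equipped_nonzero Q B & bip Q N A B)"

lemma indecomposable_rel_iso:
 assumes "indecomposable_rel M" "riso M N" "rel_rep Q N"
 shows "indecomposable_rel N"
proof -
 have M: "rel_rep Q M" using assms(1) by (simp add: indecomposable_rel_def)
 have "bip Q M A B" if "bip Q N A B" "rel_rep Q A" "rel_rep Q B" for A B :: "('v, 'e, nat, 'a) erep"
  using bip_iso[OF that(2,3,1) iso_sym[OF assms(2)] iso_refl iso_refl] .
 then show ?thesis
  using assms(1) iso_nonzero[OF M assms(3,2)] assms(3) unfolding indecomposable_rel_def by blast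
qed

text \<open>A decomposition extends to the closure, and extension keeps nonzero summands nonzero
  because it preserves dimensions.\<close>

lemma indecomposable_rel_ext:
 assumes M: "rel_rep Q M" and i: "indecomposable_rel (equipped_ext M)"
 shows "indecomposable_rel M"
proof -
 have "~ bip Q M A B" if "rel_rep Q A" "equipped_nonzero Q A" "rel_rep Q B" "equipped_nonzero Q B" for A B :: "('v, 'e, nat, 'a) erep"
 proof
  assume "bip Q M A B"
  from ext_bip[OF M that(1,3) this] show False
  using i ext_rep[OF that(1)] ext_rep[OF that(3)] ext_nonzero[OF that(1)] ext_nonzero[OF that(3)] that(2,4)
  unfolding indecomposable_rel_def by blast
 qed
 then show ?thesis using i ext_nonzero[OF M] M unfolding indecomposable_rel_def by blast
qed

end

section \<open>Descent from the algebraic closure to the finite field\<close>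

locale ext_quiver = quiver Q for Q :: "('v, 'e) pre_digraph" +
 fixes ky :: "'k::field itself" and q :: nat
 assumes pp: "primepow q" "card (UNIV :: 'k set) = q"

sublocale ext_quiver \<subseteq> frob_quiver Q "TYPE('k alg_closure)" q
 by (intro frob_quiver.intro quiver_axioms frob_alg_closure pp)

context ext_quiver begin

lemma fr_ext_vec: "fr q (ext_vec v) = ext_vec (v :: 'i => 'k)"
proof
 fix i
 have "to_ac (v i) : {x :: 'k alg_closure. x ^ q = x}" unfolding fixed_eq_range_to_ac[OF pp] by simp
 then show "fr q (ext_vec v) i = ext_vec v i" by (simp add: fr_def ext_vec_def)
qed

lemma fixed_ext_vec:
 fixes v :: "'i => 'k alg_closure"
 assumes "fr q v = v"
 obtains u :: "'i => 'k" where "v = ext_vec u"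
proof -
 have "v i : range (to_ac :: 'k => _)" for i
  using fun_cong[OF assms, of i] unfolding fixed_eq_range_to_ac[OF pp, symmetric] by (simp add: fr_def)
 then have "ALL i. EX u :: 'k. v i = to_ac u" by blast
 then obtain u :: "'i => 'k" where "ALL i. v i = to_ac (u i)" by (rule choice[THEN exE])
 then have "v = ext_vec u" by (simp add: ext_vec_def fun_eq_iff)
 then show thesis by (rule that)
qed

lemma ext_vec_sp: "ext_vec v : sp n \<longleftrightarrow> (v :: nat => 'k) : sp n"
 by (simp add: sp_def ext_vec_def)

lemma spF_eq: "spF n = ext_vec ` (sp n :: (nat => 'k) set)"
proof
 show "spF n \<subseteq> ext_vec ` (sp n :: (nat => 'k) set)"
 proof
  fix v assume "v : spF n"
  then have v: "v : sp n" "fr q v = v" by (auto simp: spF_iff)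
  obtain u :: "nat => 'k" where "v = ext_vec u" by (rule fixed_ext_vec[OF v(2)])
  then show "v : ext_vec ` (sp n :: (nat => 'k) set)" using v(1) by (simp add: ext_vec_sp)
 qed
qed (auto simp: spF_iff ext_vec_sp fr_ext_vec)

lemma ext_space_sp: "ext_space (sp n :: (nat => 'k) set) = sp n"
proof -
 have "ext_vec (unitv j) = (unitv j :: nat => 'k alg_closure)" for j :: nat and x :: 'k
  by (simp add: ext_vec_def unitv_def fun_eq_iff)
 then have "ext_vec ` unitv ` {..<n} = (unitv ` {..<n} :: (nat => 'k alg_closure) set)" by (simp add: image_image)
 then show ?thesis using ext_space_span[of "unitv ` {..<n} :: (nat => 'k) set"] by (simp add: span_unitv)
qed

abbreviation evp :: "(nat => 'k) \<times> (nat => 'k) => _" where "evp \<equiv> map_prod ext_vec ext_vec"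

lemma inj_evp: "inj evp"
 using map_prod_inj_on[OF inj_ext_vec inj_ext_vec] by simp

text \<open>The image of \<open>R\<close> is a space over the fixed field consisting of fixed pairs,
  so \<open>span_fixed_subset\<close> shows that its span contains no other fixed pairs.\<close>

lemma ext_rel_fixed:
 assumes R: "fv2.p.subspace (R :: ((nat => 'k) \<times> (nat => 'k)) set)" and p: "p : ext_rel R" "frp p = p"
 shows "p : evp ` R"
proof -
 note R' = R[unfolded rel_subspace_iff]
 show ?thesis
 proof (rule fvp.span_fixed_subset[of frp])
  show "p : fv2.p.span (evp ` R)" using p(1) by (simp add: ext_rel_def)
  have "evp (0, 0) : evp ` R" using R' by (intro imageI) simp
  then show "0 : evp ` R" by (simp add: ext_vec_zero zero_prod_def)
  show "v + w : evp ` R" if v: "v : evp ` R" and w: "w : evp ` R" for v w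
  proof -
  obtain x y where x: "(x, y) : R" "v = (ext_vec x, ext_vec y)" using v by (auto simp: map_prod_def)
  obtain x' y' where x': "(x', y') : R" "w = (ext_vec x', ext_vec y')" using w by (auto simp: map_prod_def)
  have "evp (x + x', y + y') : evp ` R" using R' x(1) x'(1) by (intro imageI) simp
  then show ?thesis by (simp add: x(2) x'(2) ext_vec_add)
  qed
  show "fv2.scale c v : evp ` R" if c: "c ^ q = c" and v: "v : evp ` R" for c v
  proof -
  obtain x y where x: "(x, y) : R" "v = (ext_vec x, ext_vec y)" using v by (auto simp: map_prod_def)
  have "c : range (to_ac :: 'k => _)" unfolding fixed_eq_range_to_ac[OF pp, symmetric] using c by simp
  then obtain c' :: 'k where c': "c = to_ac c'" by blast
  have "evp (fscale c' x, fscale c' y) : evp ` R" using R' x(1) by (intro imageI) simp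
  then show ?thesis by (simp add: x(2) c' ext_vec_scale fv2.scale_prod)
  qed
  show "frp v = v" if "v : evp ` R" for v using that by (auto simp: fr_ext_vec)
 qed (use p frp_add frp_scale in auto)
qed

lemma ext_rel_iff:
 assumes R: "fv2.p.subspace (R :: ((nat => 'k) \<times> (nat => 'k)) set)"
 shows "(ext_vec x, ext_vec y) : ext_rel R \<longleftrightarrow> (x, y) : R"
proof
 assume "(ext_vec x, ext_vec y) : ext_rel R"
 from ext_rel_fixed[OF R this] have "evp (x, y) : evp ` R" by (simp add: fr_ext_vec)
 then show "(x, y) : R" by (simp only: inj_image_mem_iff[OF inj_evp])
qed (rule ext_rel_base)

lemma ext_rel_sp:
 assumes "R \<subseteq> sp n \<times> (sp m :: (nat => 'k) set)"
 shows "ext_rel R \<subseteq> sp n \<times> sp m"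
 using ext_rel_subset[OF assms] by (simp add: ext_space_sp)

lemma frp_ext_rel: "frp ` ext_rel R = ext_rel (R :: ((nat => 'k) \<times> (nat => 'k)) set)"
 unfolding ext_rel_def by (rule frp_span) (auto simp: fr_ext_vec)

lemma ext_rel_spF:
 assumes R: "fv2.p.subspace R" "R \<subseteq> sp n \<times> (sp m :: (nat => 'k) set)"
 shows "ext_rel R \<inter> (spF n \<times> spF m) = evp ` R"
proof
 show "ext_rel R \<inter> (spF n \<times> spF m) \<subseteq> evp ` R"
 proof
  fix p assume p: "p : ext_rel R \<inter> (spF n \<times> spF m)"
  then have "frp p = p" by (auto simp: spF_iff)
  then show "p : evp ` R" using p by (intro ext_rel_fixed[OF R(1)]) auto
 qed
 show "evp ` R \<subseteq> ext_rel R \<inter> (spF n \<times> spF m)"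
 proof (rule image_subsetI)
  fix p assume p: "p : R"
  obtain x y where xy: "p = (x, y)" by (cases p)
  show "evp p : ext_rel R \<inter> (spF n \<times> spF m)"
  using ext_rel_base[OF p[unfolded xy]] subsetD[OF R(2) p] by (simp add: xy spF_eq)
 qed
qed

text \<open>The fixed pairs of the extended relation are the image of \<open>R\<close>, and
  \<open>fixed_rel_type\<close> reads the type off from them.\<close>

lemma ext_rel_type1:
 assumes R: "fv2.p.subspace R" "R \<subseteq> sp n \<times> (sp m :: (nat => 'k) set)"
 shows "Ker_rel (ext_rel R) = {0} \<longleftrightarrow> Ker_rel R = {0}" "Def_rel (ext_rel R) = sp n \<longleftrightarrow> Def_rel R = sp n"
proof -
 note t = fixed_rel_type[OF ext_rel_subspace ext_rel_sp[OF R(2)] equalityD1[OF frp_ext_rel], unfolded ext_rel_spF[OF R]]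
 have z: "ext_vec y = 0 \<longleftrightarrow> y = 0" for y :: "nat => 'k" using inj_ext_vec ext_vec_zero by (metis injD)
 have "Ker_rel (evp ` R) = ext_vec ` Ker_rel R"
 proof
  have "0 = ext_vec y \<longleftrightarrow> y = 0" for y :: "nat => 'k" using z by metis
  then show "Ker_rel (evp ` R) \<subseteq> ext_vec ` Ker_rel R" by (auto simp: Ker_rel_def)
  show "ext_vec ` Ker_rel R \<subseteq> Ker_rel (evp ` R)"
  proof (rule image_subsetI)
  fix x assume "x : Ker_rel R"
  then have "evp (x, 0) : evp ` R" unfolding Ker_rel_def by (intro imageI) simp
  then show "ext_vec x : Ker_rel (evp ` R)" by (simp add: Ker_rel_def ext_vec_zero)
  qed
 qed
 moreover have "{0} = ext_vec ` {0 :: nat => 'k}" by (simp only: image_insert image_empty ext_vec_zero)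
 ultimately have "Ker_rel (evp ` R) = {0} \<longleftrightarrow> Ker_rel R = {0}" by (simp only: inj_image_eq_iff[OF inj_ext_vec])
 then show "Ker_rel (ext_rel R) = {0} \<longleftrightarrow> Ker_rel R = {0}" unfolding t(1) .
 have "Def_rel (evp ` R) = ext_vec ` Def_rel R" by (force simp: Def_rel_def)
 then have "Def_rel (evp ` R) = spF n \<longleftrightarrow> Def_rel R = sp n" by (simp only: spF_eq inj_image_eq_iff[OF inj_ext_vec])
 then show "Def_rel (ext_rel R) = sp n \<longleftrightarrow> Def_rel R = sp n" unfolding t(2) .
qed

lemma ext_rel_converse: "ext_rel (R\<inverse>) = (ext_rel R)\<inverse>" for R :: "((nat => 'k) \<times> (nat => 'k)) set"
proof -
 have sub: "ext_rel (S\<inverse>) \<subseteq> (ext_rel S)\<inverse>" for S :: "((nat => 'k) \<times> (nat => 'k)) set"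
 proof -
  have "fv2.p.subspace ((ext_rel S)\<inverse>)"
  using ext_rel_subspace[of S] unfolding rel_subspace_iff by simp
  moreover have "evp ` (S\<inverse>) \<subseteq> (ext_rel S)\<inverse>" using ext_rel_base[of _ _ S] by auto
  ultimately show ?thesis unfolding ext_rel_def[of "S\<inverse>"] by (intro fv2.p.span_minimal)
 qed
 have "(ext_rel R)\<inverse> \<subseteq> ext_rel (R\<inverse>)" using sub[of "R\<inverse>"] by auto
 then show ?thesis using sub[of R] by blast
qed

lemma ext_rel_type2:
 assumes R: "fv2.p.subspace R" "R \<subseteq> sp n \<times> (sp m :: (nat => 'k) set)"
 shows "Ind_rel (ext_rel R) = {0} \<longleftrightarrow> Ind_rel R = {0}" "Im_rel (ext_rel R) = sp m \<longleftrightarrow> Im_rel R = sp m"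
proof -
 have R': "fv2.p.subspace (R\<inverse>)" "R\<inverse> \<subseteq> sp m \<times> sp n" using R by (auto simp: rel_subspace_iff)
 have c: "Ker_rel (S\<inverse>) = Ind_rel S" "Def_rel (S\<inverse>) = Im_rel S" for S :: "((nat => 'z::field) \<times> (nat => 'z)) set"
  by (simp_all add: Ker_rel_def Ind_rel_def Def_rel_def Im_rel_def)
 note t = ext_rel_type1[OF R', unfolded ext_rel_converse]
 show "Ind_rel (ext_rel R) = {0} \<longleftrightarrow> Ind_rel R = {0}" using t(1) unfolding c .
 show "Im_rel (ext_rel R) = sp m \<longleftrightarrow> Im_rel R = sp m" using t(2) unfolding c .
qed

text \<open>Restores the empty values off the quiver, which extension of scalars destroys: the span
  of the empty set contains zero. \<open>sext\<close> is thus extension in standard form.\<close>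

definition trim :: "('v, 'e, nat, 'f) erep => ('v, 'e, nat, 'f::field) erep" where
 "trim N = \<lparr>espace = %i. if i : verts Q then espace N i else {}, erel = %a. if a : arcs Q then erel N a else {}\<rparr>"

definition sext :: "('v, 'e, nat, 'k) erep => ('v, 'e, nat, 'k alg_closure) erep" where
 "sext M = trim (equipped_ext M)"

lemma sext_simps:
 "i : verts Q ==> espace (sext M) i = ext_space (espace M i)" "a : arcs Q ==> erel (sext M) a = ext_rel (erel M a)"
 "i \<notin> verts Q ==> espace (sext M) i = {}" "a \<notin> arcs Q ==> erel (sext M) a = {}"
 by (simp_all add: sext_def trim_def)

lemma sext_iso:
 assumes "rel_rep Q M"
 shows "rel_rep Q (sext M)" "riso (equipped_ext M) (sext M)"
proof -
 have 1: "espace (sext M) i = espace (equipped_ext M) i" if "i : verts Q" for i using that by (simp add: sext_simps)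
 have 2: "erel (sext M) a = erel (equipped_ext M) a" if "a : arcs Q" for a using that by (simp add: sext_simps)
 show "rel_rep Q (sext M)" by (rule rel_iso_same(1)[OF ext_rep[OF assms] 1 2])
 show "riso (equipped_ext M) (sext M)" by (rule iso_sym[OF rel_iso_same(2)[OF ext_rep[OF assms] 1 2]])
qed

lemma std_rel:
 fixes M :: "('v, 'e, nat, 'f::field) erep"
 assumes "rel_rep Q M" "std_rep Q d M" "a : arcs Q"
 shows "erel M a \<subseteq> sp (d (tail Q a)) \<times> sp (d (head Q a))"
 using rep_rel(1)[OF assms(1,3)] std_space[OF assms(2)] assms(3) by simp

lemma sext_fixed_std:
 assumes M: "rel_rep Q M" "std_rep Q d M"
 shows "fixed_std d (sext M)"
proof -
 have std: "std_rep Q d (sext M)"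
  by (simp add: std_rep_def sext_simps std_space[OF M(2)] ext_space_sp)
 have "map_rep (fr q) (sext M) = sext M"
 proof (rule erep.equality)
  show "espace (map_rep (fr q) (sext M)) = espace (sext M)"
  using std by (simp add: map_rep_def std_rep_def fun_eq_iff fr_sp_image)
  show "erel (map_rep (fr q) (sext M)) = erel (sext M)"
  proof
  fix a show "erel (map_rep (fr q) (sext M)) a = erel (sext M) a"
  using frp_ext_rel[of "erel M a"] by (cases "a : arcs Q") (simp_all add: map_rep_def sext_simps)
  qed
 qed simp
 then show ?thesis using std sext_iso(1)[OF M(1)] by (simp add: fixed_std_def)
qed

lemma sext_type:
 assumes M: "rel_rep Q M" "std_rep Q d M"
 shows "has_type Q rho sig (sext M) \<longleftrightarrow> has_type Q rho sig M"
 unfolding has_type_def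
proof (rule ball_cong[OF refl])
 fix a assume a: "a : arcs Q"
 then have ht: "tail Q a : verts Q" "head Q a : verts Q" by auto
 note R = rep_rel(2)[OF M(1) a] std_rel[OF M a]
 note s = fixed_stdD(4)[OF sext_fixed_std[OF M]]
 show "(rho a = 0 --> Ker_rel (erel (sext M) a) = {0}) & (rho a = 1 --> Def_rel (erel (sext M) a) = espace (sext M) (tail Q a)) \<and>
  (sig a = 0 --> Ind_rel (erel (sext M) a) = {0}) & (sig a = 1 --> Im_rel (erel (sext M) a) = espace (sext M) (head Q a)) \<longleftrightarrow>
  (rho a = 0 --> Ker_rel (erel M a) = {0}) & (rho a = 1 --> Def_rel (erel M a) = espace M (tail Q a)) \<and>
  (sig a = 0 --> Ind_rel (erel M a) = {0}) & (sig a = 1 --> Im_rel (erel M a) = espace M (head Q a))"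
  unfolding s[OF ht(1)] s[OF ht(2)] std_space[OF M(2) ht(1)] std_space[OF M(2) ht(2)] sext_simps(2)[OF a]
  ext_rel_type1[OF R] ext_rel_type2[OF R] ..
qed

text \<open>Galois descent for representations: the fixed pairs form relations over the base field,
  and by \<open>span_fixed_rel\<close> they span the given ones.\<close>

lemma sext_surj:
 assumes Y: "fixed_std d Y"
 obtains M :: "('v, 'e, nat, 'k) erep" where "rel_rep Q M" "std_rep Q d M" "sext M = Y"
proof -
 define M :: "('v, 'e, nat, 'k) erep" where "M = \<lparr>espace = %i. if i : verts Q then sp (d i) else {},
  erel = %a. if a : arcs Q then {(x, y). (ext_vec x, ext_vec y) : erel Y a} else {}\<rparr>"
 have std: "std_rep Q d M" by (simp add: std_rep_def M_def)
 have rel: "fv2.p.subspace (erel M a)" "erel M a \<subseteq> sp (d (tail Q a)) \<times> sp (d (head Q a))" "evp ` erel M a = erel Y a \<inter> (spF (d (tail Q a)) \<times> spF (d (head Q a)))"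
  if a: "a : arcs Q" for a
 proof -
  have m: "(x, y) : erel M a \<longleftrightarrow> (ext_vec x, ext_vec y) : erel Y a" for x y using a by (simp add: M_def)
  show "fv2.p.subspace (erel M a)"
  unfolding rel_subspace_iff m ext_vec_add ext_vec_scale ext_vec_zero
  using rep_rel(3,4,5)[OF fixed_stdD(1)[OF Y] a] by simp
  have Ys: "ext_vec x : sp (d (tail Q a)) & ext_vec y : sp (d (head Q a))" if "(x, y) : erel M a" for x y
  using subsetD[OF fixed_std_rel[OF Y a], of "(ext_vec x, ext_vec y)"] that m by simp
  then show "erel M a \<subseteq> sp (d (tail Q a)) \<times> sp (d (head Q a))" by (auto simp: ext_vec_sp)
  show "evp ` erel M a = erel Y a \<inter> (spF (d (tail Q a)) \<times> spF (d (head Q a)))"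
  proof
  show "evp ` erel M a \<subseteq> erel Y a \<inter> (spF (d (tail Q a)) \<times> spF (d (head Q a)))"
  using m Ys by (auto simp: spF_iff fr_ext_vec)
  show "erel Y a \<inter> (spF (d (tail Q a)) \<times> spF (d (head Q a))) \<subseteq> evp ` erel M a"
  proof (rule subrelI)
  fix u v assume uv: "(u, v) : erel Y a \<inter> (spF (d (tail Q a)) \<times> spF (d (head Q a)))"
  then have "u : ext_vec ` (sp (d (tail Q a)) :: (nat => 'k) set)" "v : ext_vec ` (sp (d (head Q a)) :: (nat => 'k) set)"
  unfolding spF_eq by auto
  then obtain x y :: "nat => 'k" where xy: "u = ext_vec x" "v = ext_vec y" by auto
  then have "(x, y) : erel M a" using uv m by simp
  then have "evp (x, y) : evp ` erel M a" by (rule imageI)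
  then show "(u, v) : evp ` erel M a" by (simp add: xy)
  qed
  qed
 qed
 have rep: "rel_rep Q M" unfolding rel_rep_def linear_relation_def
 proof (intro conjI ballI)
  show "fin_dim_space (espace M i)" if "i : verts Q" for i using that by (simp add: M_def fin_dim_sp)
  show "erel M a \<subseteq> espace M (tail Q a) \<times> espace M (head Q a)" "fv2.p.subspace (erel M a)" if a: "a : arcs Q" for a
  using rel(1,2)[OF a] std_space[OF std] a by simp_all
 qed
 have "sext M = Y"
 proof (rule fixed_std_eqI[OF sext_fixed_std[OF rep std] Y])
  fix a assume a: "a : arcs Q"
  have "fv2.p.span (erel Y a \<inter> (spF (d (tail Q a)) \<times> spF (d (head Q a)))) = erel Y a"
  by (rule span_fixed_rel[OF rep_rel(2)[OF fixed_stdD(1)[OF Y] a] fixed_std_rel[OF Y a] equalityD1[OF fixed_stdD(5)[OF Y]]])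
  then show "erel (sext M) a = erel Y a" unfolding sext_simps(2)[OF a] ext_rel_def rel(3)[OF a] .
 qed
 then show thesis using rep std by (intro that)
qed

text \<open>An automorphism commuting with Frobenius maps fixed vectors to fixed vectors, which are
  the images of vectors over the base field.\<close>

lemma GLd_descend:
 assumes M: "rel_rep Q M" "std_rep Q d M" and N: "rel_rep Q N" "std_rep Q d N" and tht: "tht : GLd d"
  and rel: "!!a x y. a : arcs Q ==> (x, y) : ext_rel (erel M a) ==> (tht (tail Q a) x, tht (head Q a) y) : ext_rel (erel N a)"
 shows "EX eta. rhom M N eta & (ALL i:verts Q. ALL v:sp (d i). ext_vec (eta i v) = tht i (ext_vec (v :: nat => 'k)))"
proof -
 define eta where "eta i v = hinv ext_vec (tht i (ext_vec (v :: nat => 'k)))" for i v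
 have e: "ext_vec (eta i v) = tht i (ext_vec v) & eta i v : sp (d i)" if i: "i : verts Q" and v: "v : sp (d i)" for i v
 proof -
  have "ext_vec v : spF (d i)" using v by (simp add: spF_eq)
  from GL1_D(4)[OF GLd_GL1[OF tht i] this] obtain u :: "nat => 'k" where u: "u : sp (d i)" "tht i (ext_vec v) = ext_vec u"
  unfolding spF_eq by blast
  then show ?thesis by (simp add: eta_def inv_f_f[OF inj_ext_vec])
 qed
 have "rhom M N eta"
 proof (rule homI)
  fix i assume i: "i : verts Q"
  note g = GL1_D(1)[OF GLd_GL1[OF tht i]] and s = subspace_sp[of "d i"]
  have "linear_map_on (sp (d i)) (sp (d i)) (eta i)" unfolding linear_map_on_def
  proof (intro conjI ballI allI funcsetI)
  show "eta i x : sp (d i)" if "x : sp (d i)" for x using e[OF i that] by blast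
  show "eta i (x + y) = eta i x + eta i y" if x: "x : sp (d i)" and y: "y : sp (d i)" for x y
  proof (rule injD[OF inj_ext_vec])
  show "ext_vec (eta i (x + y)) = ext_vec (eta i x + eta i y)"
  using e[OF i fv.subspace_add[OF s x y]] e[OF i x] e[OF i y] linear_map_onD(2)[OF g, of "ext_vec x" "ext_vec y"] x y
  by (simp add: ext_vec_add ext_vec_sp)
  qed
  show "eta i (fscale c x) = fscale c (eta i x)" if x: "x : sp (d i)" for c x
  proof (rule injD[OF inj_ext_vec])
  show "ext_vec (eta i (fscale c x)) = ext_vec (fscale c (eta i x))"
  using e[OF i fv.subspace_scale[OF s x]] e[OF i x] linear_map_onD(3)[OF g, of "ext_vec x" "to_ac c"] x
  by (simp add: ext_vec_scale ext_vec_sp)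
  qed
  qed
  then show "linear_map_on (espace M i) (espace N i) (eta i)" by (simp add: std_space[OF M(2) i] std_space[OF N(2) i])
 next
  fix a x y assume a: "a : arcs Q" and xy: "(x, y) : erel M a"
  then have ht: "tail Q a : verts Q" "head Q a : verts Q" by auto
  have m: "x : sp (d (tail Q a))" "y : sp (d (head Q a))" using subsetD[OF std_rel[OF M a] xy] by auto
  have "(ext_vec (eta (tail Q a) x), ext_vec (eta (head Q a) y)) : ext_rel (erel N a)"
  using rel[OF a ext_rel_base[OF xy]] e[OF ht(1) m(1)] e[OF ht(2) m(2)] by simp
  then show "(eta (tail Q a) x, eta (head Q a) y) : erel N a" unfolding ext_rel_iff[OF rep_rel(2)[OF N(1) a]] .
 qed
 then show ?thesis using e by blast
qed

lemma sext_iso_descend: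
 assumes M: "rel_rep Q M" "std_rep Q d M" and N: "rel_rep Q N" "std_rep Q d N" and iso: "riso (sext M) (sext N)"
 shows "riso M N"
proof -
 note fM = sext_fixed_std[OF M] and fN = sext_fixed_std[OF N]
 obtain tht where t0: "tht : (\<Pi>\<^sub>E i\<in>verts Q. GL1 (d i))" and t: "act d tht (sext M) = sext N" by (rule noether_deuring[OF fM fN iso])
 have tht: "tht : GLd d" using t0 by (simp add: GLd_def)
 obtain kap where k0: "kap : GLd d & (ALL i:verts Q. ALL v:sp (d i). kap i (tht i v) = v)" using GLd_inv[OF tht] by (elim exE)
 note kap = conjunct1[OF k0] and ktht = conjunct2[OF k0, rule_format]
 have N_a: "ext_rel (erel N a) = map_prod (tht (tail Q a)) (tht (head Q a)) ` ext_rel (erel M a)" if a: "a : arcs Q" for a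
 proof -
  have "erel (sext N) a = erel (act d tht (sext M)) a" unfolding t ..
  then show ?thesis using a by (simp add: transport_def sext_simps)
 qed
 have "EX eta. rhom M N eta & (ALL i:verts Q. ALL v:sp (d i). ext_vec (eta i v) = tht i (ext_vec v))"
 proof (rule GLd_descend[OF M N tht])
  fix a x y assume a: "a : arcs Q" and "(x, y) : ext_rel (erel M a)"
  then have "map_prod (tht (tail Q a)) (tht (head Q a)) (x, y) : ext_rel (erel N a)" unfolding N_a[OF a] by (intro imageI)
  then show "(tht (tail Q a) x, tht (head Q a) y) : ext_rel (erel N a)" by simp
 qed
 then obtain eta where eta: "rhom M N eta & (ALL i:verts Q. ALL v:sp (d i). ext_vec (eta i v) = tht i (ext_vec v))" by (elim exE)
 have "EX \<zeta>. rhom N M \<zeta> & (ALL i:verts Q. ALL v:sp (d i). ext_vec (\<zeta> i v) = kap i (ext_vec v))"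
 proof (rule GLd_descend[OF N M kap])
  fix a x y assume a: "a : arcs Q" and "(x, y) : ext_rel (erel N a)"
  then obtain u v where uv: "(u, v) : ext_rel (erel M a)" "x = tht (tail Q a) u" "y = tht (head Q a) v"
  unfolding N_a[OF a] by auto
  have ht: "tail Q a : verts Q" "head Q a : verts Q" using a by auto
  have "u : sp (d (tail Q a))" "v : sp (d (head Q a))" using subsetD[OF ext_rel_sp[OF std_rel[OF M a]] uv(1)] by auto
  then show "(kap (tail Q a) x, kap (head Q a) y) : ext_rel (erel M a)" using uv ktht ht by simp
 qed
 then obtain \<zeta> where \<zeta>: "rhom N M \<zeta> & (ALL i:verts Q. ALL v:sp (d i). ext_vec (\<zeta> i v) = kap i (ext_vec v))" by (elim exE)
 note h = conjunct1[OF eta] conjunct1[OF \<zeta>] and he = conjunct2[OF eta, rule_format] conjunct2[OF \<zeta>, rule_format]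
 show "riso M N"
 proof (rule isoI[OF h])
  fix i x assume i: "i : verts Q" and "x : espace M i"
  then have x: "x : sp (d i)" by (simp add: std_space[OF M(2) i])
  have m: "eta i x : sp (d i)" using homD(3)[OF h(1) i \<open>x : espace M i\<close>] by (simp add: std_space[OF N(2) i])
  show "\<zeta> i (eta i x) = x"
  by (rule injD[OF inj_ext_vec]) (simp add: he(2)[OF i m] he(1)[OF i x] ktht[OF i] ext_vec_sp x)
 next
  fix i y assume i: "i : verts Q" and "y : espace N i"
  then have y: "y : sp (d i)" by (simp add: std_space[OF N(2) i])
  have m: "\<zeta> i y : sp (d i)" using homD(3)[OF h(2) i \<open>y : espace N i\<close>] by (simp add: std_space[OF M(2) i])
  have "ext_vec y : tht i ` sp (d i)" using GL1_D(2)[OF GLd_GL1[OF tht i]] y by (simp add: bij_betw_def ext_vec_sp)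
  then obtain u where u: "u : sp (d i)" "ext_vec y = tht i u" by blast
  show "eta i (\<zeta> i y) = y"
  by (rule injD[OF inj_ext_vec]) (simp add: he(1)[OF i m] he(2)[OF i y] u ktht[OF i])
 qed
qed

text \<open>In standard form Noether-Deuring replaces an isomorphism over the closure by one
  commuting with Frobenius, and this one descends together with its inverse.\<close>

theorem ext_reflects_iso:
 fixes M N :: "('v, 'e, nat, 'k) erep"
 assumes M: "rel_rep Q M" and N: "rel_rep Q N"
 shows "riso (equipped_ext M) (equipped_ext N) \<longleftrightarrow> riso M N"
proof
 assume iso: "riso (equipped_ext M) (equipped_ext N)"
 define d where "d i = fv.dim (espace M i)" for i
 have d': "d i = fv.dim (espace N i)" if "i : verts Q" for i
  using iso_dim[OF ext_rep[OF M] iso that] that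
  by (simp add: d_def ext_space_dim(2)[OF rep_space[OF M]] ext_space_dim(2)[OF rep_space[OF N]])
 obtain M' :: "('v, 'e, nat, 'k) erep" where M': "rel_rep Q M'" "std_rep Q d M'" "riso M M'"
  using std_exists[OF M, of d] by (auto simp: d_def)
 obtain N' :: "('v, 'e, nat, 'k) erep" where N': "rel_rep Q N'" "std_rep Q d N'" "riso N N'"
  using std_exists[OF N, of d] d' by blast
 have a: "riso (equipped_ext M) (sext M')" by (rule iso_trans[OF ext_iso[OF M M'(1,3)] sext_iso(2)[OF M'(1)]])
 have b: "riso (equipped_ext N) (sext N')" by (rule iso_trans[OF ext_iso[OF N N'(1,3)] sext_iso(2)[OF N'(1)]])
 have "riso (sext M') (sext N')" by (rule iso_trans[OF iso_sym[OF a] iso_trans[OF iso b]])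
 then have "riso M' N'" by (rule sext_iso_descend[OF M'(1,2) N'(1,2)])
 then show "riso M N" by (rule iso_trans[OF M'(3) iso_trans[OF _ iso_sym[OF N'(3)]]])
qed (rule ext_iso[OF M N])

lemma ext_type:
 fixes M :: "('v, 'e, nat, 'k) erep"
 assumes M: "rel_rep Q M"
 shows "has_type Q rho sig (equipped_ext M) \<longleftrightarrow> has_type Q rho sig M"
proof -
 define d where "d i = fv.dim (espace M i)" for i
 obtain M' :: "('v, 'e, nat, 'k) erep" where M': "rel_rep Q M'" "std_rep Q d M'" "riso M M'"
  using std_exists[OF M, of d] by (auto simp: d_def)
 note i = iso_trans[OF ext_iso[OF M M'(1,3)] sext_iso(2)[OF M'(1)]]
 note r = ext_rep[OF M] sext_iso(1)[OF M'(1)]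
 have "has_type Q rho sig (equipped_ext M) \<longleftrightarrow> has_type Q rho sig (sext M')"
  using iso_type[OF r i] iso_type[OF r(2,1) iso_sym[OF i]] by blast
 also have "... \<longleftrightarrow> has_type Q rho sig M'" by (rule sext_type[OF M'(1,2)])
 also have "... \<longleftrightarrow> has_type Q rho sig M"
  using iso_type[OF M M'(1,3)] iso_type[OF M'(1) M iso_sym[OF M'(3)]] by blast
 finally show ?thesis .
qed

text \<open>Extensions are stable under Frobenius. Conversely, by Lang's theorem a stable
  indecomposable class contains a representation equal to its twist, and that descends to the base
  field.\<close>

theorem ext_classes:
 "{cls (equipped_ext M) |M :: ('v, 'e, nat, 'k) erep. rel_rep Q M & has_type Q rho sig M & (ALL i:verts Q. fv.dim (espace M i) = \<alpha> i) \<and>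
  indecomposable_rel (equipped_ext M)} = fixed_indec 1 \<alpha> rho sig" (is "?L = _")
proof -
 have ind: "indec N \<longleftrightarrow> indecomposable_rel N" for N by (simp add: indec_def indecomposable_rel_def)
 show ?thesis
 proof
  show "?L \<subseteq> fixed_indec 1 \<alpha> rho sig"
  proof
  fix c assume "c : ?L"
  then obtain M :: "('v, 'e, nat, 'k) erep" where M: "c = cls (equipped_ext M)" "rel_rep Q M" "has_type Q rho sig M"
  "ALL i:verts Q. fv.dim (espace M i) = \<alpha> i" "indecomposable_rel (equipped_ext M)" by blast
  have 1: "c : Ind rho sig" unfolding M(1) using M(5) cls_Ind_iff[of "equipped_ext M"] ext_type[OF M(2)] M(3) by (simp add: ind)
  have 2: "ALL i:verts Q. cdim c i = \<alpha> i"
  unfolding M(1) using cdim_cls[OF ext_rep[OF M(2)]] ext_space_dim(2)[OF rep_space[OF M(2)]] M(4) by simp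
  obtain M' :: "('v, 'e, nat, 'k) erep" where M': "rel_rep Q M'" "std_rep Q \<alpha> M'" "riso M M'"
  using std_exists[OF M(2), of \<alpha>] M(4) by metis
  have c: "c = cls (sext M')"
  unfolding M(1) cls_eq_iff[OF ext_rep[OF M(2)] sext_iso(1)[OF M'(1)]]
  by (rule iso_trans[OF ext_iso[OF M(2) M'(1,3)] sext_iso(2)[OF M'(1)]])
  have "Phi c = c"
  unfolding c Phi_def map_rep_cls[OF semilinear_bij_fr] fixed_stdD(3)[OF sext_fixed_std[OF M'(1,2)]] ..
  then show "c : fixed_indec 1 \<alpha> rho sig" using 1 2 by (simp add: fixed_indec_def)
  qed
  show "fixed_indec 1 \<alpha> rho sig \<subseteq> ?L"
  proof
  fix c assume "c : fixed_indec 1 \<alpha> rho sig"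
  then have c: "c : Ind rho sig" "ALL i:verts Q. cdim c i = \<alpha> i" "map_rep (fr q) ` c = c"
  by (simp_all add: fixed_indec_def Phi_def)
  obtain N where N: "indec N" "has_type Q rho sig N" "c = cls N" using c(1) by (rule Ind_E)
  have "ALL i:verts Q. fv.dim (espace N i) = \<alpha> i" using c(2) cdim_cls[OF indec_rep[OF N(1)]] N(3) by simp
  then have "c : fixed_classes \<alpha> rho sig" unfolding fixed_classes_def using N c(3) indec_rep[OF N(1)] by blast
  then obtain Y where Y: "Y : StdF \<alpha> rho sig" "c = cls Y" unfolding fixed_classes_eq by blast
  have fY: "fixed_std \<alpha> Y" and tY: "has_type Q rho sig Y" using Y(1) by (auto simp: StdF_def)
  obtain M :: "('v, 'e, nat, 'k) erep" where M: "rel_rep Q M" "std_rep Q \<alpha> M" "sext M = Y" by (rule sext_surj[OF fY])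
  have 1: "c = cls (equipped_ext M)"
  unfolding Y(2) M(3)[symmetric] cls_eq_iff[OF sext_iso(1)[OF M(1)] ext_rep[OF M(1)]] by (rule iso_sym[OF sext_iso(2)[OF M(1)]])
  have 2: "has_type Q rho sig M" using tY sext_type[OF M(1,2)] M(3) by simp
  have 3: "ALL i:verts Q. fv.dim (espace M i) = \<alpha> i" by (simp add: std_space[OF M(2)] dim_sp)
  have "riso N (equipped_ext M)" using 1 N(3) cls_eq_iff[OF indec_rep[OF N(1)] ext_rep[OF M(1)]] by simp
  then have 4: "indecomposable_rel (equipped_ext M)"
  using N(1) ext_rep[OF M(1)] indecomposable_rel_iso unfolding ind by blast
  show "c : ?L" using 1 2 3 4 M(1) by blast
  qed
 qed
qed

text \<open>Shared by quivers and equipped graphs. The translation \<open>g\<close> into relations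
  detects isomorphism, hits every relation representation of the given type up to isomorphism, and
  matches the two notions of absolute indecomposability; then sending a class to the class of its
  extension is a bijection.\<close>

lemma card_quotient_eq:
 fixes g :: "'o => ('v, 'e, nat, 'k) erep"
 assumes 1: "!!M. Rk M ==> rel_rep Q (g M) & has_type Q rho sig (g M)"
  and 2: "!!M N. Rk M ==> Rk N ==> J M N \<longleftrightarrow> riso (g M) (g N)"
  and 3: "!!A :: ('v, 'e, nat, 'k) erep. rel_rep Q A ==> has_type Q rho sig A ==> EX M. Rk M & riso (g M) A"
  and 4: "!!M. Rk M ==> P M \<longleftrightarrow> indecomposable_rel (equipped_ext (g M))"
 shows "card ({M. Rk M & (ALL i:verts Q. fv.dim (espace (g M) i) = \<alpha> i) & P M} // {(M, N). Rk M & Rk N & J M N}) =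
  card (fixed_indec 1 \<alpha> rho sig)"
proof -
 let ?A = "{M. Rk M & (ALL i:verts Q. fv.dim (espace (g M) i) = \<alpha> i) & P M}" and ?r = "{(M, N). Rk M & Rk N & J M N}"
 let ?f = "%M. cls (equipped_ext (g M))"
 have f: "?f M = ?f N \<longleftrightarrow> (M, N) : ?r" if "Rk M" "Rk N" for M N
  using that 1[OF that(1)] 1[OF that(2)] 2[OF that] cls_eq_iff[OF ext_rep ext_rep, of "g M" "g N"] ext_reflects_iso[of "g M" "g N"]
  by simp
 have J: "?r `` {M} = {N. Rk N & ?f N = ?f M}" if "Rk M" for M using f[OF that] that by auto
 have "bij_betw (%c. {N. Rk N & ?f N = c}) (?f ` ?A) (?A // ?r)"
  unfolding bij_betw_def
 proof
  show "inj_on (%c. {N. Rk N & ?f N = c}) (?f ` ?A)" by (rule inj_onI) blast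
  show "(%c. {N. Rk N & ?f N = c}) ` ?f ` ?A = ?A // ?r"
  unfolding quotient_def image_image using J by auto
 qed
 then have "card (?A // ?r) = card (?f ` ?A)" by (simp add: bij_betw_same_card)
 also have "?f ` ?A = fixed_indec 1 \<alpha> rho sig" unfolding ext_classes[symmetric]
 proof
  show "?f ` ?A \<subseteq> {cls (equipped_ext M) |M :: ('v, 'e, nat, 'k) erep. rel_rep Q M & has_type Q rho sig M & (ALL i:verts Q. fv.dim (espace M i) = \<alpha> i) \<and>
  indecomposable_rel (equipped_ext M)}" using 1 4 by blast
  show "{cls (equipped_ext M) |M :: ('v, 'e, nat, 'k) erep. rel_rep Q M & has_type Q rho sig M & (ALL i:verts Q. fv.dim (espace M i) = \<alpha> i) \<and>
  indecomposable_rel (equipped_ext M)} \<subseteq> ?f ` ?A"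
  proof
  fix c assume "c : {cls (equipped_ext M) |M :: ('v, 'e, nat, 'k) erep. rel_rep Q M & has_type Q rho sig M & (ALL i:verts Q. fv.dim (espace M i) = \<alpha> i) \<and>
  indecomposable_rel (equipped_ext M)}"
  then obtain A :: "('v, 'e, nat, 'k) erep" where A: "c = cls (equipped_ext A)" "rel_rep Q A" "has_type Q rho sig A"
  "ALL i:verts Q. fv.dim (espace A i) = \<alpha> i" "indecomposable_rel (equipped_ext A)" by blast
  obtain M where M: "Rk M" "riso (g M) A" using 3[OF A(2,3)] by blast
  have gM: "rel_rep Q (g M)" using 1[OF M(1)] by blast
  note e = ext_iso[OF gM A(2) M(2)]
  have "ALL i:verts Q. fv.dim (espace (g M) i) = \<alpha> i" using iso_dim[OF gM M(2)] A(4) by simp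
  moreover have "P M" unfolding 4[OF M(1)] by (rule indecomposable_rel_iso[OF A(5) iso_sym[OF e] ext_rep[OF gM]])
  moreover have "c = ?f M" unfolding A(1) cls_eq_iff[OF ext_rep[OF A(2)] ext_rep[OF gM]] by (rule iso_sym[OF e])
  ultimately show "c : ?f ` ?A" using M(1) by blast
  qed
 qed
 finally show ?thesis .
qed

end

section \<open>Quiver representations as relations of type (1,0)\<close>

context quiver begin

text \<open>Summands inherit the type of \<open>M\<close>, so up to isomorphism they are in the
  image of \<open>g\<close>. Indecomposability among objects translated by \<open>g\<close> is
  therefore indecomposability among all relations.\<close>

lemma decomposition_iff:
 fixes g :: "'o => ('v, 'e, nat, 'f::field) erep" and M :: "('v, 'e, nat, 'f) erep"
 assumes M: "rel_rep Q M" "has_type Q rho sig M"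
  and R: "!!N. Rk N ==> rel_rep Q (g N)"
  and dense: "!!A :: ('v, 'e, nat, 'f) erep. rel_rep Q A ==> has_type Q rho sig A ==> EX N. Rk N & riso (g N) A"
 shows "(EX N L. Rk N & equipped_nonzero Q (g N) & Rk L & equipped_nonzero Q (g L) & bip Q M (g N) (g L)) \<longleftrightarrow>
  (EX (A :: ('v, 'e, nat, 'f) erep) (B :: ('v, 'e, nat, 'f) erep).
  rel_rep Q A & equipped_nonzero Q A & rel_rep Q B & equipped_nonzero Q B & bip Q M A B)"
proof
 assume "EX (A :: ('v, 'e, nat, 'f) erep) (B :: ('v, 'e, nat, 'f) erep).
  rel_rep Q A & equipped_nonzero Q A & rel_rep Q B & equipped_nonzero Q B & bip Q M A B"
 then obtain A B :: "('v, 'e, nat, 'f) erep" where A: "rel_rep Q A" "equipped_nonzero Q A"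
  and B: "rel_rep Q B" "equipped_nonzero Q B" and b: "bip Q M A B" by (elim exE conjE)
 have t: "has_type Q rho sig A" "has_type Q rho sig B" using bip_type[OF M(1) A(1) B(1) b] M(2) by blast+
 obtain N where N: "Rk N & riso (g N) A" using dense[OF A(1) t(1)] by (elim exE)
 obtain L where L: "Rk L & riso (g L) B" using dense[OF B(1) t(2)] by (elim exE)
 have r: "rel_rep Q (g N)" "rel_rep Q (g L)" using R N L by blast+
 have "equipped_nonzero Q (g N)" "equipped_nonzero Q (g L)"
  using iso_nonzero[OF r(1) A(1)] iso_nonzero[OF r(2) B(1)] N L A(2) B(2) by blast+
 moreover have "bip Q M (g N) (g L)"
  by (rule bip_iso[OF A(1) B(1) b iso_refl iso_sym[OF conjunct2[OF N]] iso_sym[OF conjunct2[OF L]]])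
 ultimately show "EX N L. Rk N & equipped_nonzero Q (g N) & Rk L & equipped_nonzero Q (g L) & bip Q M (g N) (g L)"
  using N L by (intro exI[of _ N] exI[of _ L] conjI) simp_all
qed (use R in blast)

definition graph_rep :: "('v, 'e, 'i, 'f::field) qrep => ('v, 'e, 'i, 'f) erep" where
 "graph_rep M = \<lparr>espace = qspace M, erel = %a. {(x, qmap M a x) |x. x : qspace M (tail Q a)}\<rparr>"

lemma graph_rep_simps [simp]: "espace (graph_rep M) = qspace M"
 "(x, y) : erel (graph_rep M) a \<longleftrightarrow> x : qspace M (tail Q a) & y = qmap M a x"
 by (auto simp: graph_rep_def)

lemma graph_rep_rep:
 assumes M: "quiver_rep Q M"
 shows "rel_rep Q (graph_rep M)" "has_type Q (%_. 1) (%_. 0) (graph_rep M)"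
proof -
 have fd: "fin_dim_space (qspace M i)" if "i : verts Q" for i using M that by (simp add: quiver_rep_def)
 have lin: "linear_map_on (qspace M (tail Q a)) (qspace M (head Q a)) (qmap M a)" if "a : arcs Q" for a
  using M that by (simp add: quiver_rep_def)
 have s: "fv.subspace (qspace M (tail Q a))" if "a : arcs Q" for a using fin_dim_subspace[OF fd] that by simp
 have z: "qmap M a 0 = 0" if "a : arcs Q" for a by (rule linear_map_on_zero[OF lin[OF that] s[OF that]])
 show "rel_rep Q (graph_rep M)" unfolding rel_rep_def linear_relation_def
 proof (intro conjI ballI)
  show "fin_dim_space (espace (graph_rep M) i)" if "i : verts Q" for i using fd[OF that] by simp
  fix a assume a: "a : arcs Q"
  show "erel (graph_rep M) a \<subseteq> espace (graph_rep M) (tail Q a) \<times> espace (graph_rep M) (head Q a)"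
  using linear_map_onD(1)[OF lin[OF a]] by auto
  show "fv2.p.subspace (erel (graph_rep M) a)" unfolding rel_subspace_iff graph_rep_simps
  proof (intro conjI allI impI)
  show "0 : qspace M (tail Q a)" by (rule fv.subspace_0[OF s[OF a]])
  show "0 = qmap M a 0" using z[OF a] by simp
  qed (use linear_map_onD(2,3)[OF lin[OF a]] fv.subspace_add[OF s[OF a]] fv.subspace_scale[OF s[OF a]] in simp_all)
 qed
 have "Def_rel (erel (graph_rep M) a) = espace (graph_rep M) (tail Q a)" for a by (simp add: Def_rel_def)
 moreover have "Ind_rel (erel (graph_rep M) a) = {0}" if "a : arcs Q" for a
  unfolding Ind_rel_def graph_rep_simps z[OF that] using fv.subspace_0[OF s[OF that]] by blast
 ultimately show "has_type Q (%_. 1) (%_. 0) (graph_rep M)"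
  unfolding has_type_def by (intro ballI conjI) (simp_all only: one_neq_zero zero_neq_one simp_thms)
qed

lemma graph_rep_hom: "quiver_hom Q M N tht \<longleftrightarrow> rhom (graph_rep M) (graph_rep N) tht"
proof -
 have "(ALL x:qspace M (tail Q a). tht (head Q a) (qmap M a x) = qmap N a (tht (tail Q a) x)) \<longleftrightarrow>
  (ALL (x, y):erel (graph_rep M) a. (tht (tail Q a) x, tht (head Q a) y) : erel (graph_rep N) a)"
  if a: "a : arcs Q" and lin: "ALL i:verts Q. linear_map_on (qspace M i) (qspace N i) (tht i)" for a
 proof -
  have "tht (tail Q a) x : qspace N (tail Q a)" if "x : qspace M (tail Q a)" for x
  using linear_map_onD(1)[OF bspec[OF lin, of "tail Q a"]] a that by simp
  moreover have "(ALL (x, y):erel (graph_rep M) a. (tht (tail Q a) x, tht (head Q a) y) : erel (graph_rep N) a) \<longleftrightarrow>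
  (ALL x:qspace M (tail Q a). (tht (tail Q a) x, tht (head Q a) (qmap M a x)) : erel (graph_rep N) a)"
  by (auto simp: graph_rep_def[of M])
  ultimately show ?thesis by simp
 qed
 note key = this
 show ?thesis unfolding quiver_hom_def equipped_hom_def graph_rep_simps(1)
  by (rule conj_cong[OF refl], rule ball_cong[OF refl], rule key; assumption)
qed

lemma graph_rep_iso: "quiver_iso Q M N \<longleftrightarrow> riso (graph_rep M) (graph_rep N)"
 unfolding quiver_iso_def equipped_iso_def graph_rep_hom by simp

lemma graph_rep_nonzero: "quiver_nonzero Q M \<longleftrightarrow> equipped_nonzero Q (graph_rep M)"
 by (simp add: quiver_nonzero_def equipped_nonzero_def)

lemma graph_rep_sum: "graph_rep (quiver_sum M N) = equipped_sum (graph_rep M) (graph_rep N)"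
proof (rule erep.equality)
 show "espace (graph_rep (quiver_sum M N)) = espace (equipped_sum (graph_rep M) (graph_rep N))"
  by (simp add: quiver_sum_def equipped_sum_def)
 show "erel (graph_rep (quiver_sum M N)) = erel (equipped_sum (graph_rep M) (graph_rep N))"
 proof
  fix a
  have c: "case_sum v w \<circ> Inl = v" "case_sum v w \<circ> Inr = w" for v :: "'g => 'f" and w :: "'h => 'f" by auto
  show "erel (graph_rep (quiver_sum M N)) a = erel (equipped_sum (graph_rep M) (graph_rep N)) a"
  by (auto simp: graph_rep_def quiver_sum_def equipped_sum_def sum_space_def sum_rel_def c; blast)
 qed
qed simp

lemma graph_rep_dense:
 fixes A :: "('v, 'e, nat, 'f::field) erep"
 assumes A: "rel_rep Q A" and T: "has_type Q (%_. 1) (%_. 0) A"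
 shows "EX M :: ('v, 'e, nat, 'f) qrep. quiver_rep Q M & riso (graph_rep M) A"
proof -
 \<comment> \<open>The chosen value exists because the domain is full, and is unique because the
   indeterminacy is zero.\<close>
 define M where "M = \<lparr>qspace = espace A, qmap = %a x. SOME y. (x, y) : erel A a\<rparr>"
 have T': "Def_rel (erel A a) = espace A (tail Q a)" "Ind_rel (erel A a) = {0}" if "a : arcs Q" for a
  using bspec[OF T[unfolded has_type_def] that] by (simp_all only: one_neq_zero zero_neq_one simp_thms)
 have un: "y = y'" if a: "a : arcs Q" and "(x, y) : erel A a" "(x, y') : erel A a" for a x y y'
 proof -
  have "(x - x, y - y') : erel A a" by (rule rep_rel(6)[OF A that])
  then have "y - y' : Ind_rel (erel A a)" by (simp add: Ind_rel_def)
  then have "y - y' = 0" unfolding T'(2)[OF a] by (rule singletonD)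
  then show ?thesis by (simp only: right_minus_eq)
 qed
 have ex: "(x, qmap M a x) : erel A a" if a: "a : arcs Q" and x: "x : espace A (tail Q a)" for a x
 proof -
  have "x : Def_rel (erel A a)" unfolding T'(1)[OF a] by (rule x)
  then have "EX y. (x, y) : erel A a" by (simp add: Def_rel_def)
  then have "(x, SOME y. (x, y) : erel A a) : erel A a" by (rule someI_ex)
  then show ?thesis by (simp add: M_def)
 qed
 have "linear_map_on (qspace M (tail Q a)) (qspace M (head Q a)) (qmap M a)" if a: "a : arcs Q" for a
  unfolding linear_map_on_def
 proof (intro conjI ballI allI funcsetI)
  have qs: "qspace M = espace A" by (simp add: M_def)
  have sub: "fv.subspace (espace A (tail Q a))" using rep_subspace[OF A] a by simp
  show "qmap M a x : qspace M (head Q a)" if "x : qspace M (tail Q a)" for x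
  using rep_rel(8)[OF A a ex[OF a]] that by (simp add: qs)
  show "qmap M a (x + y) = qmap M a x + qmap M a y" if x: "x : qspace M (tail Q a)" and y: "y : qspace M (tail Q a)" for x y
  by (rule un[OF a ex[OF a fv.subspace_add[OF sub x[unfolded qs] y[unfolded qs]]] rep_rel(4)[OF A a ex[OF a x[unfolded qs]] ex[OF a y[unfolded qs]]]])
  show "qmap M a (fscale c x) = fscale c (qmap M a x)" if x: "x : qspace M (tail Q a)" for c x
  by (rule un[OF a ex[OF a fv.subspace_scale[OF sub x[unfolded qs]]] rep_rel(5)[OF A a ex[OF a x[unfolded qs]]]])
 qed
 then have "quiver_rep Q M" unfolding quiver_rep_def using rep_space[OF A] by (simp add: M_def)
 moreover have "riso (graph_rep M) A"
 proof (rule rel_iso_same(2)[OF A])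
  show "espace (graph_rep M) i = espace A i" for i by (simp add: M_def)
  fix a assume a: "a : arcs Q"
  have "(x, y) : erel (graph_rep M) a \<longleftrightarrow> (x, y) : erel A a" for x y
  proof
  assume "(x, y) : erel (graph_rep M) a"
  then show "(x, y) : erel A a" using ex[OF a, of x] by (simp add: M_def)
  next
  assume xy: "(x, y) : erel A a"
  note x = rep_rel(7)[OF A a xy]
  show "(x, y) : erel (graph_rep M) a" using un[OF a xy ex[OF a x]] x by (simp add: M_def)
  qed
  then show "erel (graph_rep M) a = erel A a" by auto
 qed
 ultimately show ?thesis by blast
qed

lemma quiver_indecomposable_iff:
 fixes M :: "('v, 'e, nat, 'f::field) qrep"
 assumes M: "quiver_rep Q M"
 shows "quiver_indecomposable Q M \<longleftrightarrow> indecomposable_rel (graph_rep M)"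
proof -
 have s: "quiver_iso Q M (quiver_sum N L) \<longleftrightarrow> bip Q (graph_rep M) (graph_rep N) (graph_rep L)"
  if "quiver_rep Q N" "quiver_rep Q L" for N L :: "('v, 'e, nat, 'f) qrep"
  unfolding graph_rep_iso graph_rep_sum
  by (rule iso_sum_iff_bip[OF graph_rep_rep(1)[OF M] graph_rep_rep(1)[OF that(1)] graph_rep_rep(1)[OF that(2)]])
 have "(EX (N :: ('v, 'e, nat, 'f) qrep) (L :: ('v, 'e, nat, 'f) qrep).
  quiver_rep Q N & quiver_nonzero Q N & quiver_rep Q L & quiver_nonzero Q L & quiver_iso Q M (quiver_sum N L)) \<longleftrightarrow>
  (EX (N :: ('v, 'e, nat, 'f) qrep) (L :: ('v, 'e, nat, 'f) qrep). quiver_rep Q N & equipped_nonzero Q (graph_rep N) & quiver_rep Q L & equipped_nonzero Q (graph_rep L) \<and>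
  bip Q (graph_rep M) (graph_rep N) (graph_rep L))"
  using s unfolding graph_rep_nonzero by blast
 also have "... \<longleftrightarrow> (EX (A :: ('v, 'e, nat, 'f) erep) (B :: ('v, 'e, nat, 'f) erep).
  rel_rep Q A & equipped_nonzero Q A & rel_rep Q B & equipped_nonzero Q B & bip Q (graph_rep M) A B)"
  by (rule decomposition_iff[OF graph_rep_rep[OF M], where g = graph_rep and Rk = "quiver_rep Q"])
  (rule graph_rep_rep(1) graph_rep_dense; assumption)+
 finally show ?thesis
  unfolding quiver_indecomposable_def indecomposable_rel_def graph_rep_nonzero[of M] using M graph_rep_rep(1)[OF M] by simp
qed

text \<open>Extending a map and extending its graph agree. The graph of the extended map is a
  subspace containing the base pairs, so it contains their span; the converse inclusion compares on
  vectors of the base field.\<close>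

lemma graph_rep_ext:
 fixes M :: "('v, 'e, nat, 'f::field) qrep"
 assumes M: "quiver_rep Q M"
 shows "quiver_rep Q (quiver_ext Q M)" "riso (graph_rep (quiver_ext Q M)) (equipped_ext (graph_rep M))"
proof -
 have fd: "fin_dim_space (qspace M i)" if "i : verts Q" for i using M that by (simp add: quiver_rep_def)
 have lin: "linear_map_on (qspace M (tail Q a)) (qspace M (head Q a)) (qmap M a)" if "a : arcs Q" for a
  using M that by (simp add: quiver_rep_def)
 let ?e = "%a. ext_map (qspace M (tail Q a)) (qspace M (head Q a)) (qmap M a)"
 have e: "linear_map_on (ext_space (qspace M (tail Q a))) (ext_space (qspace M (head Q a))) (?e a)"
  and ev: "v : qspace M (tail Q a) ==> ?e a (ext_vec v) = ext_vec (qmap M a v)" if "a : arcs Q" for a v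
  using ext_map_props[OF fd lin[OF that]] that by simp_all
 show E: "quiver_rep Q (quiver_ext Q M)"
  unfolding quiver_rep_def using fd e by (simp add: quiver_ext_def ext_space_dim(1))
 show "riso (graph_rep (quiver_ext Q M)) (equipped_ext (graph_rep M))"
 proof (rule rel_iso_same(2)[OF ext_rep[OF graph_rep_rep(1)[OF M]]])
  show "espace (graph_rep (quiver_ext Q M)) i = espace (equipped_ext (graph_rep M)) i" for i
  by (simp add: quiver_ext_def)
  fix a assume a: "a : arcs Q"
  show "erel (graph_rep (quiver_ext Q M)) a = erel (equipped_ext (graph_rep M)) a"
  proof
  have g: "fv2.p.subspace (erel (graph_rep (quiver_ext Q M)) a)" by (rule rep_rel(2)[OF graph_rep_rep(1)[OF E] a])
  have "map_prod ext_vec ext_vec ` erel (graph_rep M) a \<subseteq> erel (graph_rep (quiver_ext Q M)) a"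
  using ev[OF a] ext_vec_in[of _ "qspace M (tail Q a)"] by (auto simp: quiver_ext_def)
  then show "erel (equipped_ext (graph_rep M)) a \<subseteq> erel (graph_rep (quiver_ext Q M)) a"
  unfolding equipped_ext_simps ext_rel_def by (rule fv2.p.span_minimal[OF _ g])
  \<comment> \<open>The vectors at which the extended graph already has the value of the extended
    map; they form a subspace containing the base vectors, hence are all of the extended
    space.\<close>
  let ?S = "{x : ext_space (qspace M (tail Q a)). (x, ?e a x) : ext_rel (erel (graph_rep M) a)}"
  note ss = ext_space_subspace[of "qspace M (tail Q a)"] and rs = ext_rel_subspace[of "erel (graph_rep M) a", unfolded rel_subspace_iff]
  have "fv.subspace ?S" unfolding fv.subspace_def
  proof (intro conjI ballI allI CollectI)
  show "0 : ext_space (qspace M (tail Q a))" by (rule fv.subspace_0[OF ss])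
  show "(0, ?e a 0) : ext_rel (erel (graph_rep M) a)"
  unfolding linear_map_on_zero[OF e[OF a] ss] using rs by blast
  fix x assume x: "x : ?S"
  {
  fix y assume y: "y : ?S"
  show "x + y : ext_space (qspace M (tail Q a))" using x y by (intro fv.subspace_add[OF ss]) auto
  have "?e a (x + y) = ?e a x + ?e a y" using x y by (intro linear_map_onD(2)[OF e[OF a]]) auto
  then show "(x + y, ?e a (x + y)) : ext_rel (erel (graph_rep M) a)" using rs x y by simp
  }
  fix c
  show "fscale c x : ext_space (qspace M (tail Q a))" using x by (intro fv.subspace_scale[OF ss]) auto
  have "?e a (fscale c x) = fscale c (?e a x)" using x by (intro linear_map_onD(3)[OF e[OF a]]) auto
  then show "(fscale c x, ?e a (fscale c x)) : ext_rel (erel (graph_rep M) a)" using rs x by simp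
  qed
  moreover have "ext_vec ` qspace M (tail Q a) \<subseteq> ?S"
  proof (rule image_subsetI)
  fix v assume v: "v : qspace M (tail Q a)"
  have "(ext_vec v, ext_vec (qmap M a v)) : ext_rel (erel (graph_rep M) a)" by (rule ext_rel_base) (simp add: v)
  then show "ext_vec v : ?S" using ext_vec_in[OF v] ev[OF a v] by simp
  qed
  ultimately have "ext_space (qspace M (tail Q a)) \<subseteq> ?S" unfolding ext_space_def[of "qspace M (tail Q a)"] by (intro fv.span_minimal)
  then show "erel (graph_rep (quiver_ext Q M)) a \<subseteq> erel (equipped_ext (graph_rep M)) a"
  by (auto simp: quiver_ext_def)
  qed
 qed
qed

end

context ext_quiver begin

lemma quiver_abs_indecomposable_iff:
 fixes M :: "('v, 'e, nat, 'k) qrep"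
 assumes M: "quiver_rep Q M"
 shows "quiver_abs_indecomposable Q M \<longleftrightarrow> indecomposable_rel (equipped_ext (graph_rep M))"
proof -
 note g = graph_rep_rep(1)[OF M] and e = graph_rep_ext[OF M]
 have "indecomposable_rel (graph_rep (quiver_ext Q M)) \<longleftrightarrow> indecomposable_rel (equipped_ext (graph_rep M))"
  using indecomposable_rel_iso[OF _ e(2) ext_rep[OF g]] indecomposable_rel_iso[OF _ iso_sym[OF e(2)] graph_rep_rep(1)[OF e(1)]] by blast
 then show ?thesis
  unfolding quiver_abs_indecomposable_def quiver_indecomposable_iff[OF M] quiver_indecomposable_iff[OF e(1)]
  using indecomposable_rel_ext[OF g] by blast
qed

theorem quiver_A_eq: "quiver_A TYPE('k) Q \<alpha> = card (fixed_indec 1 \<alpha> (%_. 1) (%_. 0))"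
proof -
 have "card ({M :: ('v, 'e, nat, 'k) qrep. quiver_rep Q M & (ALL i:verts Q. fv.dim (espace (graph_rep M) i) = \<alpha> i) & quiver_abs_indecomposable Q M} //
  {(M, N). quiver_rep Q M & quiver_rep Q N & quiver_iso Q M N}) = card (fixed_indec 1 \<alpha> (%_. 1) (%_. 0))"
 proof (rule card_quotient_eq)
  show "rel_rep Q (graph_rep M) & has_type Q (%_. 1) (%_. 0) (graph_rep M)" if "quiver_rep Q M" for M :: "('v, 'e, nat, 'k) qrep"
  by (rule conjI[OF graph_rep_rep[OF that]])
  show "EX M :: ('v, 'e, nat, 'k) qrep. quiver_rep Q M & riso (graph_rep M) A" if "rel_rep Q A" "has_type Q (%_. 1) (%_. 0) A" for A :: "('v, 'e, nat, 'k) erep"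
  by (rule graph_rep_dense[OF that])
 qed (rule graph_rep_iso, rule quiver_abs_indecomposable_iff)
 then show ?thesis unfolding quiver_A_def quiver_iso_classes_def graph_rep_simps .
qed

end

section \<open>Equipped graphs through an orientation\<close>

locale oriented_graph = eg: equipped_graph G star \<phi> + ext_quiver Q ky q
 for G :: "('v, 'e) pre_digraph" and star \<phi> and Q :: "('v, 'e) pre_digraph" and ky :: "'k::field itself" and q +
 assumes under: "has_underlying_graph Q G star"
begin

lemma orient:
 shows "verts G = verts Q" "a : arcs Q ==> a : arcs G" "a : arcs Q ==> tail G a = tail Q a" "a : arcs Q ==> head G a = head Q a"
  "a : arcs G ==> a \<notin> arcs Q ==> star a : arcs Q" "a : arcs Q ==> star a \<notin> arcs Q"
proof -
 show "verts G = verts Q" and 1: "a : arcs Q ==> a : arcs G" and "a : arcs Q ==> tail G a = tail Q a" "a : arcs Q ==> head G a = head Q a"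
  using under by (auto simp: has_underlying_graph_def)
 have ex: "\<exists>!b. b : {a, star a} & b : arcs Q" if "a : arcs G" using under that by (simp add: has_underlying_graph_def)
 show "a : arcs G ==> a \<notin> arcs Q ==> star a : arcs Q" using ex by blast
 show "star a \<notin> arcs Q" if a: "a : arcs Q"
 proof
  assume "star a : arcs Q"
  then have "star a = a" using ex[OF 1[OF a]] a by blast
  then show False using eg.star_fixed_point_free[OF 1[OF a]] by simp
 qed
qed

lemma star_ends:
 assumes "a : arcs G" "star a : arcs Q"
 shows "tail G a = head Q (star a)" "head G a = tail Q (star a)"
 using eg.head_eq_tail_star[OF eg.star_closed[OF assms(1)]] eg.head_eq_tail_star[OF assms(1)] eg.star_star[OF assms(1)]
  orient(3,4)[OF assms(2)] by simp_all

text \<open>The compatibility of opposite arrows, isolated because it is what lets the relations on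
  arrows outside \<open>Q\<close> be recovered from those on \<open>Q\<close>.\<close>

definition star_sym :: "('v, 'e, 'i, 'f::field) erep => bool" where
 "star_sym M \<longleftrightarrow> (ALL a:arcs G. erel M (star a) = (erel M a)\<inverse>)"

lemma star_sym_erel: "star_sym M ==> a : arcs G ==> erel M a = (erel M (star a))\<inverse>"
 by (auto simp: star_sym_def)

lemma converse_types:
 "Ker_rel (R\<inverse>) = Ind_rel R" "Ind_rel (R\<inverse>) = Ker_rel R" "Def_rel (R\<inverse>) = Im_rel R" "Im_rel (R\<inverse>) = Def_rel R"
 for R :: "('i, 'f::field) linrel"
 by (simp_all add: Ker_rel_def Ind_rel_def Def_rel_def Im_rel_def)

lemma linear_relation_converse: "linear_relation V W R ==> linear_relation W V (R\<inverse>)"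
 unfolding linear_relation_def rel_subspace_iff by auto

lemma equipped_relation_converse:
 assumes "equipped_relation r t V W R"
 shows "equipped_relation t r W V (R\<inverse>)"
 unfolding equipped_relation_def converse_types
 using assms[unfolded equipped_relation_def] linear_relation_converse[of V W R] by (elim conjE) (intro conjI; assumption?; simp)

text \<open>On an arrow outside \<open>Q\<close> the relation is the converse of that on its
  opposite, and passing to the converse exchanges the two entries of the type, so the conditions
  there follow from those on \<open>Q\<close>.\<close>

lemma equipped_rep_iff:
 fixes M :: "('v, 'e, 'i, 'f::field) erep"
 shows "equipped_rep G star \<phi> M \<longleftrightarrow> rel_rep Q M & has_type Q \<phi> (%a. \<phi> (star a)) M & star_sym M"
proof -
 let ?e = "%a. equipped_relation (\<phi> a) (\<phi> (star a)) (espace M (tail Q a)) (espace M (head Q a)) (erel M a)"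
 have "equipped_relation (\<phi> a) (\<phi> (star a)) (espace M (tail G a)) (espace M (head G a)) (erel M a)"
  if Qa: "ALL a:arcs Q. ?e a" and s: "star_sym M" and a: "a : arcs G" for a
 proof (cases "a : arcs Q")
  case True
  then show ?thesis using bspec[OF Qa True] by (simp only: orient(3,4))
 next
  case False
  note sa = orient(5)[OF a False]
  have "equipped_relation (\<phi> (star a)) (\<phi> a) (espace M (tail Q (star a))) (espace M (head Q (star a))) (erel M (star a))"
  using bspec[OF Qa sa] by (simp only: eg.star_star[OF a])
  from equipped_relation_converse[OF this] show ?thesis
  unfolding star_ends[OF a sa] star_sym_erel[OF s a, symmetric] .
 qed
 moreover have "?e a" if "ALL a:arcs G. equipped_relation (\<phi> a) (\<phi> (star a)) (espace M (tail G a)) (espace M (head G a)) (erel M a)"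
  "a : arcs Q" for a
  using bspec[OF that(1) orient(2)[OF that(2)]] by (simp only: orient(3,4)[OF that(2)])
 ultimately have "equipped_rep G star \<phi> M \<longleftrightarrow> (ALL i:verts Q. fin_dim_space (espace M i)) & (ALL a:arcs Q. ?e a) & star_sym M"
  unfolding equipped_rep_def star_sym_def[symmetric] orient(1) by blast
 also have "... \<longleftrightarrow> rel_rep Q M & has_type Q \<phi> (%a. \<phi> (star a)) M & star_sym M"
  unfolding equipped_relation_def rel_rep_def has_type_def ball_conj_distrib by (simp only: conj_assoc conj_left_commute conj_commute)
 finally show ?thesis .
qed

lemma equipped_hom_iff:
 assumes M: "star_sym M" and N: "star_sym N"
 shows "equipped_hom G M N tht \<longleftrightarrow> rhom M N tht"
proof
 assume h: "equipped_hom G M N tht"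
 show "rhom M N tht" unfolding equipped_hom_def
 proof (intro conjI ballI)
  show "linear_map_on (espace M i) (espace N i) (tht i)" if "i : verts Q" for i
  using h that unfolding equipped_hom_def orient(1) by blast
  fix a p assume a: "a : arcs Q" and p: "p : erel M a"
  have "ALL p:erel M a. case p of (x, y) => (tht (tail G a) x, tht (head G a) y) : erel N a"
  using h orient(2)[OF a] unfolding equipped_hom_def by blast
  from bspec[OF this p] show "case p of (x, y) => (tht (tail Q a) x, tht (head Q a) y) : erel N a"
  unfolding orient(3,4)[OF a] .
 qed
next
 assume h: "rhom M N tht"
 show "equipped_hom G M N tht" unfolding equipped_hom_def orient(1)
 proof (intro conjI ballI)
  show "linear_map_on (espace M i) (espace N i) (tht i)" if "i : verts Q" for i by (rule homD(1)[OF h that])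
  fix a p assume a: "a : arcs G" and p: "p : erel M a"
  obtain x y where xy: "p = (x, y)" by (cases p)
  show "case p of (x, y) => (tht (tail G a) x, tht (head G a) y) : erel N a"
  proof (cases "a : arcs Q")
  case True
  then show ?thesis using homD(2)[OF h True p[unfolded xy]] by (simp add: xy orient(3,4))
  next
  case False
  note sa = orient(5)[OF a False]
  have "(y, x) : erel M (star a)" using p unfolding xy star_sym_erel[OF M a] by simp
  from homD(2)[OF h sa this] have "(tht (tail G a) x, tht (head G a) y) : (erel N (star a))\<inverse>"
  unfolding star_ends[OF a sa] by simp
  then show ?thesis unfolding xy star_sym_erel[OF N a, symmetric] by simp
  qed
 qed
qed

lemma equipped_iso_iff: "star_sym M ==> star_sym N ==> equipped_iso G M N \<longleftrightarrow> riso M N"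
 unfolding equipped_iso_def orient(1) by (simp only: equipped_hom_iff)

lemma star_sym_sum: "star_sym M ==> star_sym N ==> star_sym (equipped_sum M N)"
 by (auto simp: star_sym_def equipped_sum_def sum_rel_def)

text \<open>The missing arrows are filled in with converses; the orientation contains exactly one
  arrow of each opposite pair, so there is no conflict.\<close>

lemma equipped_dense:
 fixes A :: "('v, 'e, nat, 'f::field) erep"
 assumes A: "rel_rep Q A" and T: "has_type Q \<phi> (%a. \<phi> (star a)) A"
 shows "EX M :: ('v, 'e, nat, 'f) erep. equipped_rep G star \<phi> M & riso M A"
proof -
 define M where "M = \<lparr>espace = espace A, erel = %a. if a : arcs Q then erel A a else (erel A (star a))\<inverse>\<rparr>"
 have e: "espace M i = espace A i" "a : arcs Q ==> erel M a = erel A a" for i a by (simp_all add: M_def)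
 have s: "rel_rep Q M" "riso M A" by (rule rel_iso_same[OF A e]; assumption)+
 have "star_sym M" unfolding star_sym_def
 proof
  fix a assume a: "a : arcs G"
  show "erel M (star a) = (erel M a)\<inverse>"
  using orient(5)[OF a] orient(6)[of a] eg.star_star[OF a] by (cases "a : arcs Q") (simp_all add: M_def)
 qed
 moreover have "has_type Q \<phi> (%a. \<phi> (star a)) M" by (rule iso_type[OF A s(1) iso_sym[OF s(2)] T])
 ultimately show ?thesis using s unfolding equipped_rep_iff by blast
qed

lemma equipped_indecomposable_iff:
 fixes M :: "('v, 'e, nat, 'f::field) erep"
 assumes M: "equipped_rep G star \<phi> M"
 shows "equipped_indecomposable G star \<phi> M \<longleftrightarrow> indecomposable_rel M"
proof -
 have M': "rel_rep Q M" "has_type Q \<phi> (%a. \<phi> (star a)) M" "star_sym M" using M unfolding equipped_rep_iff by blast+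
 have s: "equipped_iso G M (equipped_sum N L) \<longleftrightarrow> bip Q M N L"
  if "equipped_rep G star \<phi> N" "equipped_rep G star \<phi> L" for N L :: "('v, 'e, nat, 'f) erep"
 proof -
  have N: "rel_rep Q N" "star_sym N" and L: "rel_rep Q L" "star_sym L" using that unfolding equipped_rep_iff by blast+
  show ?thesis unfolding equipped_iso_iff[OF M'(3) star_sym_sum[OF N(2) L(2)]] by (rule iso_sum_iff_bip[OF M'(1) N(1) L(1)])
 qed
 have r: "rel_rep Q N" if "equipped_rep G star \<phi> N" for N :: "('v, 'e, nat, 'f) erep"
  using that unfolding equipped_rep_iff by blast
 have nz: "equipped_nonzero G N \<longleftrightarrow> equipped_nonzero Q N" for N :: "('v, 'e, nat, 'f) erep"
  by (simp add: equipped_nonzero_def orient(1))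
 have "(EX (N :: ('v, 'e, nat, 'f) erep) (L :: ('v, 'e, nat, 'f) erep).
  equipped_rep G star \<phi> N & equipped_nonzero G N & equipped_rep G star \<phi> L & equipped_nonzero G L \<and>
  equipped_iso G M (equipped_sum N L)) \<longleftrightarrow>
  (EX (N :: ('v, 'e, nat, 'f) erep) (L :: ('v, 'e, nat, 'f) erep). equipped_rep G star \<phi> N & equipped_nonzero Q N & equipped_rep G star \<phi> L & equipped_nonzero Q L & bip Q M N L)"
  unfolding nz using s by blast
 also have "... \<longleftrightarrow> (EX (A :: ('v, 'e, nat, 'f) erep) (B :: ('v, 'e, nat, 'f) erep).
  rel_rep Q A & equipped_nonzero Q A & rel_rep Q B & equipped_nonzero Q B & bip Q M A B)"
  by (rule decomposition_iff[OF M'(1,2), where g = "%N. N" and Rk = "equipped_rep G star \<phi>"])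
  (rule r equipped_dense; assumption)+
 finally show ?thesis
  unfolding equipped_indecomposable_def indecomposable_rel_def nz[of M] using M M'(1) by simp
qed

lemma equipped_abs_indecomposable_iff:
 fixes M :: "('v, 'e, nat, 'k) erep"
 assumes M: "equipped_rep G star \<phi> M"
 shows "equipped_abs_indecomposable G star \<phi> M \<longleftrightarrow> indecomposable_rel (equipped_ext M)"
proof -
 have M': "rel_rep Q M" "has_type Q \<phi> (%a. \<phi> (star a)) M" "star_sym M" using M unfolding equipped_rep_iff by blast+
 have "star_sym (equipped_ext M)" using M'(3) by (simp add: star_sym_def ext_rel_converse)
 then have E: "equipped_rep G star \<phi> (equipped_ext M)"
  unfolding equipped_rep_iff using ext_rep[OF M'(1)] ext_type[OF M'(1)] M'(2) by blast
 show ?thesis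
  unfolding equipped_abs_indecomposable_def equipped_indecomposable_iff[OF M] equipped_indecomposable_iff[OF E]
  using indecomposable_rel_ext[OF M'(1)] by blast
qed

theorem equipped_A_eq: "equipped_A TYPE('k) G star \<phi> \<alpha> = card (fixed_indec 1 \<alpha> \<phi> (%a. \<phi> (star a)))"
proof -
 have "card ({M :: ('v, 'e, nat, 'k) erep. equipped_rep G star \<phi> M & (ALL i:verts Q. fv.dim (espace M i) = \<alpha> i) & equipped_abs_indecomposable G star \<phi> M} //
  {(M, N). equipped_rep G star \<phi> M & equipped_rep G star \<phi> N & equipped_iso G M N}) = card (fixed_indec 1 \<alpha> \<phi> (%a. \<phi> (star a)))"
 proof (rule card_quotient_eq[of _ "%M. M"])
  show "rel_rep Q M & has_type Q \<phi> (%a. \<phi> (star a)) M" if "equipped_rep G star \<phi> M" for M :: "('v, 'e, nat, 'k) erep"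
  using that unfolding equipped_rep_iff by blast
  show "equipped_iso G M N \<longleftrightarrow> riso M N" if "equipped_rep G star \<phi> M" "equipped_rep G star \<phi> N" for M N :: "('v, 'e, nat, 'k) erep"
  using that equipped_iso_iff[of M N] unfolding equipped_rep_iff by blast
  show "EX M :: ('v, 'e, nat, 'k) erep. equipped_rep G star \<phi> M & riso M A" if "rel_rep Q A" "has_type Q \<phi> (%a. \<phi> (star a)) A" for A :: "('v, 'e, nat, 'k) erep"
  by (rule equipped_dense[OF that])
  show "equipped_abs_indecomposable G star \<phi> M \<longleftrightarrow> indecomposable_rel (equipped_ext M)" if "equipped_rep G star \<phi> M" for M :: "('v, 'e, nat, 'k) erep"
  by (rule equipped_abs_indecomposable_iff[OF that])
 qed
 then show ?thesis unfolding equipped_A_def equipped_iso_classes_def orient(1) .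
qed

end

theorem theorem3p1:
 fixes G Q :: "('v, 'e) pre_digraph"
  and star :: "'e => 'e" and \<phi> :: "'e => nat"
  and \<alpha> :: "'v => nat" and q :: nat
 assumes "equipped_graph G star \<phi>"
  and "primepow q"
  and "card (UNIV :: 'k::field set) = q"
  and "fin_digraph Q"
  and "has_underlying_graph Q G star"
 shows "equipped_A TYPE('k) G star \<phi> \<alpha> = quiver_A TYPE('k) Q \<alpha>"
proof -
 interpret oriented_graph G star \<phi> Q "TYPE('k)" q
  by (intro oriented_graph.intro ext_quiver.intro quiver.intro ext_quiver_axioms.intro oriented_graph_axioms.intro assms)
 \<comment> \<open>The two assignments of types to be compared: the one given by the equipment on
   the arrows of \<open>Q\<close> and their opposites, and the constant type (1,0) of linear
   maps.\<close>
 have t: "\<phi> : arcs Q \<rightarrow> {0, 1}" "(%a. \<phi> (star a)) : arcs Q \<rightarrow> {0, 1}"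
  "(%_. 1) : arcs Q \<rightarrow> {0, 1 :: nat}" "(%_. 0) : arcs Q \<rightarrow> {0, 1 :: nat}"
  using eg.phi_range eg.star_closed orient(2) by (auto simp: Pi_iff)
 show ?thesis unfolding equipped_A_eq quiver_A_eq by (rule card_fixed_indec[OF _ t]) simp
qed

end
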